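(* Let $s>1$, $\theta>\tfrac12$, and let $k\ge1$ be an integer. If $\phi$ is such that $\Lambda^k\phi\in\mathcal H^{s,\theta}$, then $A_0=A_0(\phi)$ satisfies, for all spatial multi-indices $\alpha$ with $|\alpha|\le k$, $\|\partial_x^\alpha A_0\|_{L^\infty_t(\dot H^1)}\le\gamma_k(\|\phi\|_{\mathcal H^{s,\theta}})\,\|\Lambda^k\phi\|_{\mathcal H^{s,\theta}}+\eta_k(\|\Lambda^{k-1}\phi\|_{\mathcal H^{s,\theta}})$, where $\gamma_k,\eta_k$ are continuous functions.
   Context: $\Lambda^\alpha$ and $\Lambda_-^\alpha$ are the Fourier multipliers on $\mathbb{R}^{1+4}$ with symbols $(1+|\xi|^2)^{\alpha/2}$ and $\bigl(1+\frac{(\tau^2-|\xi|^2)^2}{1+\tau^2+|\xi|^2}\bigr)^{\alpha/2}$; $\|u\|_{H^{s,\theta}}=\|\Lambda^s\Lambda_-^\theta u\|_{L^2(\mathbb{R}^{1+4})}$, $\|u\|_{\mathcal H^{s,\theta}}=\|u\|_{H^{s,\theta}}+\|\partial_tu\|_{H^{s-1,\theta}}$. For $\theta>1/2$, $\mathcal H^{s,\theta}\hookrightarrow C_b(\mathbb{R},H^s)\cap C^1_b(\mathbb{R},H^{s-1})$. $\dot H^1=\mathcal F^{-1}[L^2(|\xi|^2d\xi)]$ on $\mathbb{R}^4$. For such $\phi$, $A_0(\phi)(t)$ is, for each $t\in\mathbb{R}$, the unique $\dot H^1(\mathbb{R}^4)$ solution of $\Delta A_0-|\phi(t)|^2A_0=-\operatorname{Im}(\phi(t)\overline{\partial_t\phi(t)})$;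 $L^\infty_t(\dot H^1)$ denotes the supremum over $t$ of the $\dot H^1$ norm. *)

theory Defs
  imports "HOL-Analysis.Analysis"
begin

definition fourier :: "('a::euclidean_space \<Rightarrow> complex) \<Rightarrow> 'a \<Rightarrow> complex" where
  "fourier f \<xi> = complex_of_real ((2 * pi) powr (- real DIM('a) / 2)) *
      (\<integral>x. exp (- \<i> * complex_of_real (x \<bullet> \<xi>)) * f x \<partial>lborel)"

definition sq_int :: "('a::euclidean_space \<Rightarrow> 'b::real_normed_vector) \<Rightarrow> bool" where
  "sq_int f \<longleftrightarrow> f \<in> borel_measurable lborel \<and> integrable lborel (\<lambda>x. (norm (f x))\<^sup>2)"

definition L2norm :: "('a::euclidean_space \<Rightarrow> 'b::real_normed_vector) \<Rightarrow> real" where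
  "L2norm f = sqrt (\<integral>x. (norm (f x))\<^sup>2 \<partial>lborel)"

text \<open>F is the (Plancherel) Fourier transform of f, characterised by the duality
  identity  int f psi^ = int F psi  for all psi in L1 cap L2.\<close>
definition is_FT :: "('a::euclidean_space \<Rightarrow> complex) \<Rightarrow> ('a \<Rightarrow> complex) \<Rightarrow> bool" where
  "is_FT f F \<longleftrightarrow> f \<in> borel_measurable lborel \<and> sq_int F \<and>
     (\<forall>\<psi>. integrable lborel \<psi> \<and> sq_int \<psi> \<longrightarrow>
        integrable lborel (\<lambda>x. f x * fourier \<psi> x) \<and>
        (\<integral>x. f x * fourier \<psi> x \<partial>lborel) = (\<integral>\<xi>. F \<xi> * \<psi> \<xi> \<partial>lborel))"

definition symL :: "real \<Rightarrow> real ^ 4 \<Rightarrow> real" where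
  "symL a \<xi> = (1 + (norm \<xi>)\<^sup>2) powr (a / 2)"

definition symLm :: "real \<Rightarrow> real \<Rightarrow> real ^ 4 \<Rightarrow> real" where
  "symLm a \<tau> \<xi> = (1 + (\<tau>\<^sup>2 - (norm \<xi>)\<^sup>2)\<^sup>2 / (1 + \<tau>\<^sup>2 + (norm \<xi>)\<^sup>2)) powr (a / 2)"

text \<open>Weighted function whose L2 norm is the H^{s,theta} norm of u, given U = FT u.\<close>
definition Hw :: "real \<Rightarrow> real \<Rightarrow> (real \<times> (real ^ 4) \<Rightarrow> complex) \<Rightarrow> real \<times> (real ^ 4) \<Rightarrow> complex" where
  "Hw s \<theta> U = (\<lambda>(\<tau>, \<xi>). complex_of_real (symL s \<xi> * symLm \<theta> \<tau> \<xi>) * U (\<tau>, \<xi>))"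

text \<open>Fourier transform of d/dt u, given U = FT u.\<close>
definition dtFT :: "(real \<times> (real ^ 4) \<Rightarrow> complex) \<Rightarrow> real \<times> (real ^ 4) \<Rightarrow> complex" where
  "dtFT U = (\<lambda>(\<tau>, \<xi>). \<i> * complex_of_real \<tau> * U (\<tau>, \<xi>))"

text \<open>Fourier transform of Lambda^a u, given U = FT u.\<close>
definition LamFT :: "real \<Rightarrow> (real \<times> (real ^ 4) \<Rightarrow> complex) \<Rightarrow> real \<times> (real ^ 4) \<Rightarrow> complex" where
  "LamFT a U = (\<lambda>(\<tau>, \<xi>). complex_of_real (symL a \<xi>) * U (\<tau>, \<xi>))"

definition calH_mem :: "real \<Rightarrow> real \<Rightarrow> (real \<times> (real ^ 4) \<Rightarrow> complex) \<Rightarrow> bool" where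
  "calH_mem s \<theta> U \<longleftrightarrow> sq_int (Hw s \<theta> U) \<and> sq_int (Hw (s - 1) \<theta> (dtFT U))"

definition calH_norm :: "real \<Rightarrow> real \<Rightarrow> (real \<times> (real ^ 4) \<Rightarrow> complex) \<Rightarrow> real" where
  "calH_norm s \<theta> U = L2norm (Hw s \<theta> U) + L2norm (Hw (s - 1) \<theta> (dtFT U))"

definition test_freq :: "(real ^ 4 \<Rightarrow> complex) \<Rightarrow> bool" where
  "test_freq \<psi> \<longleftrightarrow> \<psi> \<in> borel_measurable lborel \<and> bounded (range \<psi>) \<and>
     (\<exists>K. compact K \<and> (\<forall>\<xi>. \<xi> \<notin> K \<longrightarrow> \<psi> \<xi> = 0)) \<and> integrable lborel (fourier \<psi>)"

text \<open>A lies in dot-H^1(R^4) and G is its Fourier transform.\<close>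
definition Hdot1 :: "(real ^ 4 \<Rightarrow> real) \<Rightarrow> (real ^ 4 \<Rightarrow> complex) \<Rightarrow> bool" where
  "Hdot1 A G \<longleftrightarrow> A \<in> borel_measurable lborel \<and>
     sq_int (\<lambda>\<xi>. complex_of_real (norm \<xi>) * G \<xi>) \<and> G \<in> borel_measurable lborel \<and>
     (\<forall>\<psi>. test_freq \<psi> \<longrightarrow>
        integrable lborel (\<lambda>x. complex_of_real (A x) * fourier \<psi> x) \<and>
        (\<integral>x. complex_of_real (A x) * fourier \<psi> x \<partial>lborel) = (\<integral>\<xi>. G \<xi> * \<psi> \<xi> \<partial>lborel))"

definition pd :: "4 \<Rightarrow> (real ^ 4 \<Rightarrow> real) \<Rightarrow> real ^ 4 \<Rightarrow> real" where
  "pd i f x = deriv (\<lambda>h. f (x + h *\<^sub>R axis i 1)) 0"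

definition lap :: "(real ^ 4 \<Rightarrow> real) \<Rightarrow> real ^ 4 \<Rightarrow> real" where
  "lap f x = (\<Sum>i\<in>UNIV. pd i (pd i f) x)"

definition C2c :: "(real ^ 4 \<Rightarrow> real) \<Rightarrow> bool" where
  "C2c \<psi> \<longleftrightarrow> (\<exists>K. compact K \<and> (\<forall>x. x \<notin> K \<longrightarrow> \<psi> x = 0)) \<and>
     (\<forall>i x. (\<lambda>h. \<psi> (x + h *\<^sub>R axis i 1)) differentiable (at 0)) \<and>
     (\<forall>i j x. (\<lambda>h. pd i \<psi> (x + h *\<^sub>R axis j 1)) differentiable (at 0)) \<and>
     (\<forall>i j. continuous_on UNIV (pd j (pd i \<psi>)))"

text \<open>A solves  Delta A - |phi|^2 A = - Im(phi conj(dphi))  in the sense of distributions.\<close>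
definition weak_A0_eq :: "(real ^ 4 \<Rightarrow> real) \<Rightarrow> (real ^ 4 \<Rightarrow> complex) \<Rightarrow> (real ^ 4 \<Rightarrow> complex) \<Rightarrow> bool" where
  "weak_A0_eq A p dp \<longleftrightarrow> (\<forall>\<psi>. C2c \<psi> \<longrightarrow>
     (\<integral>x. A x * lap \<psi> x \<partial>lborel) - (\<integral>x. (cmod (p x))\<^sup>2 * A x * \<psi> x \<partial>lborel)
       = - (\<integral>x. Im (p x * cnj (dp x)) * \<psi> x \<partial>lborel))"

definition L2_time_deriv :: "(real \<Rightarrow> real ^ 4 \<Rightarrow> complex) \<Rightarrow> (real \<Rightarrow> real ^ 4 \<Rightarrow> complex) \<Rightarrow> bool" where
  "L2_time_deriv \<phi> d\<phi> \<longleftrightarrow> (\<forall>t. sq_int (\<phi> t) \<and> sq_int (d\<phi> t) \<and>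
     ((\<lambda>h. L2norm (\<lambda>x. (\<phi> (t + h) x - \<phi> t x) / complex_of_real h - d\<phi> t x)) \<longlongrightarrow> 0) (at 0))"

definition mi_abs :: "(4 \<Rightarrow> nat) \<Rightarrow> nat" where
  "mi_abs \<alpha> = (\<Sum>i\<in>UNIV. \<alpha> i)"

definition mi_pow :: "real ^ 4 \<Rightarrow> (4 \<Rightarrow> nat) \<Rightarrow> real" where
  "mi_pow \<xi> \<alpha> = (\<Prod>i\<in>UNIV. (\<xi> $ i) ^ \<alpha> i)"

text \<open>FT of the derivative d^alpha A, given G = FT A.\<close>
definition dxFT :: "(4 \<Rightarrow> nat) \<Rightarrow> (real ^ 4 \<Rightarrow> complex) \<Rightarrow> real ^ 4 \<Rightarrow> complex" where
  "dxFT \<alpha> G = (\<lambda>\<xi>. \<i> ^ mi_abs \<alpha> * complex_of_real (mi_pow \<xi> \<alpha>) * G \<xi>)"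

text \<open>dot-H^1 weighted function: its L2 norm is the dot-H^1 norm.\<close>
definition Hdot1w :: "(real ^ 4 \<Rightarrow> complex) \<Rightarrow> real ^ 4 \<Rightarrow> complex" where
  "Hdot1w G = (\<lambda>\<xi>. complex_of_real (norm \<xi>) * G \<xi>)"

end

theory Submission
  imports Defs "HOL-Probability.Characteristic_Functions"
begin

text \<open>
  Everything is done on the Fourier side, at a fixed time. Let P, Q, G be the spatial Fourier
  transforms of the solution, of its time derivative and of A0, and write ' for the transform of the
  complex conjugate. Since \<^term>\<open>k \<ge> (1::nat)\<close>, P is integrable, and the elliptic equation becomes
  the pointwise identity |xi|^2 G = c (P * Q' - P' * Q) / (2 i) - c^2 P' * (P * G).

  Pairing it with the conjugate of G, the last term contributes - c^2 times the integral of
  |P * G|^2, which has the good sign; hence the energy bound for |xi| G, without smallness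
  assumption. Multiplying the identity by |xi|^(k-1), distributing this weight over the factors of
  the convolutions and using elementary weighted Young inequalities (only Cauchy-Schwarz is needed,
  because s > 1 is not an endpoint) controls |xi|^(k+1) G by lower order quantities; only the term in
  which all derivatives fall on Q, or for k = 1 the integrability of P, involves the top norm, and
  it does so linearly.
\<close>

section \<open>Lebesgue integrals on Euclidean spaces\<close>

text \<open>The two descriptions of \<open>A0\<close> use incompatible test functions:
  \<open>Hdot1\<close> is tested with Fourier transforms of functions of bounded support, the weak
  equation with \<open>C2c\<close> functions, and only 0 is of both kinds. The equation is therefore
  extended to the first class by spatial cutoffs; the terms with derivatives of the cutoff disappear
  in the limit because \<open>A0\<close> is integrable against such a transform and its derivatives.
  Since \<open>is_FT\<close> specifies a transform by duality, products, conjugates and time slices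
  are treated by moving the operation onto the test function; the L2 theory required is then only
  the Bessel inequality. Of \<open>G\<close> only |\<xi>| G is known to be square integrable. In
  dimension 4 the weight 1/|\<xi>|^2 is locally integrable, which makes \<open>G\<close> locally
  integrable and puts the product of \<phi> and \<open>A0\<close> into L2. The energy is finite by
  hypothesis, so one power of it can be cancelled from an inequality between squares. The shift by
  one derivative gives s + 1 > 2, the threshold above which H^s functions on a space of dimension 4
  have integrable transforms.\<close>

lemma nn_integral_lborel_affine:
  fixes t :: "'a::euclidean_space"
  assumes [measurable]: "f \<in> borel_measurable borel" and c: "c \<noteq> 0"
  shows "(\<integral>\<^sup>+x. f x \<partial>lborel) = ennreal (\<bar>c\<bar> ^ DIM('a)) * (\<integral>\<^sup>+x. f (t + c *\<^sub>R x) \<partial>lborel)"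
  by (subst lborel_affine[OF c, of t])
     (simp add: nn_integral_density nn_integral_distr nn_integral_cmult)

lemma integrable_lborel_affine:
  fixes f :: "'a::euclidean_space \<Rightarrow> 'b :: {banach, second_countable_topology}"
  assumes f: "integrable lborel f" and c: "c \<noteq> 0"
  shows "integrable lborel (\<lambda>x. f (t + c *\<^sub>R x))"
proof -
  have [measurable]: "f \<in> borel_measurable borel" using f by auto
  have "(\<integral>\<^sup>+x. norm (f x) \<partial>lborel) < \<infinity>" using f unfolding integrable_iff_bounded by auto
  then show ?thesis
    by (subst (asm) nn_integral_lborel_affine[where c=c and t=t])
      (auto simp: integrable_iff_bounded ennreal_mult_less_top c)
qed

lemma integrable_lborel_affine_iff:
  fixes f :: "'a::euclidean_space \<Rightarrow> 'b :: {banach, second_countable_topology}"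
  assumes c: "c \<noteq> 0"
  shows "integrable lborel (\<lambda>x. f (t + c *\<^sub>R x)) \<longleftrightarrow> integrable lborel f"
  using integrable_lborel_affine[of f c t]
    integrable_lborel_affine[of "\<lambda>x. f (t + c *\<^sub>R x)" "1/c" "-t /\<^sub>R c"] c
  by (auto simp: scaleR_diff_right)

lemma integral_lborel_affine:
  fixes f :: "'a::euclidean_space \<Rightarrow> 'b :: {banach, second_countable_topology}"
  assumes c: "c \<noteq> 0"
  shows "(\<integral>x. f x \<partial>lborel) = \<bar>c\<bar> ^ DIM('a) *\<^sub>R (\<integral>x. f (t + c *\<^sub>R x) \<partial>lborel)"
proof cases
  assume f: "integrable lborel f"
  then have [measurable]: "f \<in> borel_measurable borel" by auto
  have [measurable]: "(\<lambda>x::'a. t + c *\<^sub>R x) \<in> borel_measurable borel" by measurable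
  have "(\<integral>x. f x \<partial>lborel) = (\<integral>x. f x \<partial>density (distr lborel borel (\<lambda>x. t + c *\<^sub>R x)) (\<lambda>_. \<bar>c\<bar>^DIM('a)))"
    using lborel_affine[OF c, of t] by simp
  also have "\<dots> = \<bar>c\<bar> ^ DIM('a) *\<^sub>R (\<integral>x. f (t + c *\<^sub>R x) \<partial>lborel)"
    by (subst integral_density) (auto simp: integral_distr)
  finally show ?thesis .
next
  assume "\<not> integrable lborel f" with c show ?thesis
    by (simp add: integrable_lborel_affine_iff not_integrable_integral_eq)
qed

lemma integral_lborel_shift:
  fixes f :: "'a::euclidean_space \<Rightarrow> 'b :: {banach, second_countable_topology}"
  shows "(\<integral>x. f (t + x) \<partial>lborel) = (\<integral>x. f x \<partial>lborel)" "(\<integral>x. f (x + t) \<partial>lborel) = (\<integral>x. f x \<partial>lborel)"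
    "(\<integral>x. f (x - t) \<partial>lborel) = (\<integral>x. f x \<partial>lborel)"
  using integral_lborel_affine[of 1 f t] integral_lborel_affine[of 1 f "-t"] by (auto simp: add.commute)

lemma integral_lborel_reflect:
  fixes f :: "'a::euclidean_space \<Rightarrow> 'b :: {banach, second_countable_topology}"
  shows "(\<integral>x. f (t - x) \<partial>lborel) = (\<integral>x. f x \<partial>lborel)" "(\<integral>x. f (- x) \<partial>lborel) = (\<integral>x. f x \<partial>lborel)"
  using integral_lborel_affine[of "-1" f t] integral_lborel_affine[of "-1" f 0] by auto

lemma integrable_lborel_shift:
  fixes f :: "'a::euclidean_space \<Rightarrow> 'b :: {banach, second_countable_topology}"
  shows "integrable lborel (\<lambda>x. f (t + x)) \<longleftrightarrow> integrable lborel f" "integrable lborel (\<lambda>x. f (x + t)) \<longleftrightarrow> integrable lborel f"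
   "integrable lborel (\<lambda>x. f (x - t)) \<longleftrightarrow> integrable lborel f"
  using integrable_lborel_affine_iff[of 1 f t] integrable_lborel_affine_iff[of 1 f "-t"] by (auto simp: add.commute)

lemma integrable_lborel_reflect:
  fixes f :: "'a::euclidean_space \<Rightarrow> 'b :: {banach, second_countable_topology}"
  shows "integrable lborel (\<lambda>x. f (t - x)) \<longleftrightarrow> integrable lborel f" "integrable lborel (\<lambda>x. f (- x)) \<longleftrightarrow> integrable lborel f"
  using integrable_lborel_affine_iff[of "-1" f t] integrable_lborel_affine_iff[of "-1" f 0] by auto

lemma nn_integral_lborel_shift:
  fixes f :: "'a::euclidean_space \<Rightarrow> ennreal"
  assumes [measurable]: "f \<in> borel_measurable borel"
  shows "(\<integral>\<^sup>+x. f (t + x) \<partial>lborel) = (\<integral>\<^sup>+x. f x \<partial>lborel)" "(\<integral>\<^sup>+x. f (x + t) \<partial>lborel) = (\<integral>\<^sup>+x. f x \<partial>lborel)"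
   "(\<integral>\<^sup>+x. f (x - t) \<partial>lborel) = (\<integral>\<^sup>+x. f x \<partial>lborel)"
  using nn_integral_lborel_affine[of f 1 t] nn_integral_lborel_affine[of f 1 "-t"] by (auto simp: add.commute)

lemma nn_integral_lborel_reflect:
  fixes f :: "'a::euclidean_space \<Rightarrow> ennreal"
  assumes [measurable]: "f \<in> borel_measurable borel"
  shows "(\<integral>\<^sup>+x. f (t - x) \<partial>lborel) = (\<integral>\<^sup>+x. f x \<partial>lborel)" "(\<integral>\<^sup>+x. f (- x) \<partial>lborel) = (\<integral>\<^sup>+x. f x \<partial>lborel)"
  using nn_integral_lborel_affine[of f "-1" t] nn_integral_lborel_affine[of f "-1" 0] by auto

text \<open>Boxes generate the Borel sets and are stable under intersection, so it suffices that the
  sets over which \<open>h\<close> integrates to 0 form a Dynkin system. Closure under complements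
  needs the integral over the whole space, which is a limit of integrals over growing boxes.\<close>

lemma AE_zero_if_box_integrals_zero:
  fixes h :: "'a::euclidean_space \<Rightarrow> 'b::{banach, second_countable_topology}"
  assumes h: "integrable lborel h"
    and box: "\<And>a b. (\<integral>x. indicator (box a b) x *\<^sub>R h x \<partial>lborel) = 0"
  shows "AE x in lborel. h x = 0"
proof (rule sigma_finite_measure.density_zero[OF sigma_finite_lborel h])
  have [measurable]: "h \<in> borel_measurable borel" using h by auto
  let ?A = "\<lambda>n::nat. box (- (real n *\<^sub>R One)) (real n *\<^sub>R One) :: 'a set"
  have total: "(\<integral>x. h x \<partial>lborel) = 0"
  proof -
    have "(\<lambda>n. \<integral>x. indicator (?A n) x *\<^sub>R h x \<partial>lborel) \<longlonglongrightarrow> (\<integral>x. h x \<partial>lborel)"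
    proof (rule integral_dominated_convergence[where w="\<lambda>x. norm (h x)"])
      show "AE x in lborel. (\<lambda>n. indicator (?A n) x *\<^sub>R h x) \<longlonglongrightarrow> h x"
      proof (intro AE_I2 tendsto_eventually)
        fix x :: 'a
        have "x \<in> (\<Union>n. ?A n)" using UN_box_eq_UNIV by auto
        then obtain N where N: "x \<in> ?A N" by auto
        have "x \<in> ?A n" if "n \<ge> N" for n
        proof -
          have "real N \<le> real n" using that by simp
          with N show ?thesis unfolding mem_box by auto
        qed
        then show "\<forall>\<^sub>F n in sequentially. indicator (?A n) x *\<^sub>R h x = h x"
          by (auto simp: eventually_sequentially intro!: exI[of _ N])
      qed
    qed (use h in \<open>auto split: split_indicator\<close>)
    then show ?thesis using box LIMSEQ_unique[OF _ tendsto_const] by fastforce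
  qed
  fix A :: "'a set" assume "A \<in> sets lborel"
  then have A: "A \<in> sigma_sets UNIV (range (\<lambda>(a, b). box a b :: 'a set))"
    by (simp add: borel_eq_box)
  have sub: "range (\<lambda>(a, b). box a b :: 'a set) \<subseteq> Pow UNIV" by auto
  have Is: "Int_stable (range (\<lambda>(a, b). box a b :: 'a set))"
    by (auto simp: Int_stable_def box_Int_box)
  have S: "B \<in> sets borel" if "B \<in> sigma_sets UNIV (range (\<lambda>(a, b). box a b :: 'a set))" for B
    using that by (simp add: borel_eq_box)
  from Is sub A show "set_lebesgue_integral lborel A h = 0"
  proof (induction rule: sigma_sets_induct_disjoint)
    case (basic A) then show ?case using box by (auto simp: set_lebesgue_integral_def)
  next
    case empty show ?case by (simp add: set_lebesgue_integral_def)
  next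
    case (compl A)
    have [measurable]: "A \<in> sets borel" using compl S by auto
    have "set_lebesgue_integral lborel (UNIV - A) h = (\<integral>x. h x - indicator A x *\<^sub>R h x \<partial>lborel)"
      unfolding set_lebesgue_integral_def by (intro Bochner_Integration.integral_cong) (auto split: split_indicator)
    also have "\<dots> = 0"
      using compl total h by (subst Bochner_Integration.integral_diff) (auto simp: set_lebesgue_integral_def intro: integrable_mult_indicator)
    finally show ?case .
  next
    case (union A)
    have [measurable]: "A i \<in> sets borel" for i using union S by auto
    have "(\<lambda>i. set_lebesgue_integral lborel (A i) h) sums set_lebesgue_integral lborel (\<Union>i. A i) h"
    proof -
      have "set_integrable lborel (\<Union>i. A i) h" unfolding set_integrable_def
        by (intro integrable_mult_indicator h) auto
      then have "set_lebesgue_integral lborel (\<Union>i. A i) h = (\<Sum>i. set_lebesgue_integral lborel (A i) h)"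
        using union by (intro lebesgue_integral_countable_add) (auto simp: disjoint_family_on_def)
      then show ?thesis using union by (simp add: sums_iff)
    qed
    then show ?case using union by (simp add: sums_iff)
  qed
qed

text \<open>Off the boundary of the box, a null set, the indicator is locally constant, so the claim
  is dominated convergence. The kernel is left arbitrary: Gaussians serve for uniqueness of the
  Fourier transform, the indicator of a unit box for test functions of bounded support.\<close>

lemma mollified_indicator_tendsto:
  fixes k :: "'a::euclidean_space \<Rightarrow> real"
  assumes k: "integrable lborel k"
  shows "AE x in lborel. (\<lambda>n. \<integral>y. indicator (box a b) (x - y /\<^sub>R real (Suc n)) * k y \<partial>lborel)
           \<longlonglongrightarrow> indicator (box a b) x * (\<integral>y. k y \<partial>lborel)"
proof -
  have "negligible (cbox a b - box a b)" by (rule negligible_frontier_interval)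
  then have "AE x in lebesgue. x \<notin> cbox a b - box a b"
    by (intro AE_not_in) (simp add: negligible_iff_null_sets)
  then have "AE x in lborel. x \<notin> cbox a b - box a b"
    by (subst (asm) AE_completion_iff) auto
  then show ?thesis
  proof eventually_elim
    case (elim x)
    have [measurable]: "k \<in> borel_measurable borel" using k by auto
    have ev: "\<forall>\<^sub>F z in nhds x. (indicator (box a b) z :: real) = indicator (box a b) x"
    proof (cases "x \<in> box a b")
      case True
      then have "\<forall>\<^sub>F z in nhds x. z \<in> box a b" by (intro eventually_nhds_in_open) auto
      then show ?thesis by eventually_elim (use True in auto)
    next
      case False
      then have "x \<in> - cbox a b" using elim by auto
      then have "\<forall>\<^sub>F z in nhds x. z \<in> - cbox a b" by (intro eventually_nhds_in_open) auto
      then show ?thesis by eventually_elim (use False box_subset_cbox in \<open>auto simp: indicator_def\<close>)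
    qed
    have "(\<lambda>n. \<integral>y. indicator (box a b) (x - y /\<^sub>R real (Suc n)) * k y \<partial>lborel)
           \<longlonglongrightarrow> (\<integral>y. indicator (box a b) x * k y \<partial>lborel)"
    proof (rule integral_dominated_convergence[where w="\<lambda>x. norm (k x)"])
      show "AE y in lborel. (\<lambda>n. indicator (box a b) (x - y /\<^sub>R real (Suc n)) * k y) \<longlonglongrightarrow> indicator (box a b) x * k y"
      proof (intro AE_I2 tendsto_mult_right)
        fix y :: 'a
        have "(\<lambda>n. x - inverse (real (Suc n)) *\<^sub>R y) \<longlonglongrightarrow> x - 0 *\<^sub>R y"
          by (intro tendsto_intros LIMSEQ_inverse_real_of_nat)
        then have "filterlim (\<lambda>n. x - y /\<^sub>R real (Suc n)) (nhds x) sequentially" by simp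
        with ev have "\<forall>\<^sub>F n in sequentially. (indicator (box a b) (x - y /\<^sub>R real (Suc n)) :: real) = indicator (box a b) x"
          unfolding filterlim_iff by blast
        then show "(\<lambda>n. indicator (box a b) (x - y /\<^sub>R real (Suc n)) :: real) \<longlonglongrightarrow> indicator (box a b) x"
          by (rule tendsto_eventually)
      qed
    qed (use k in \<open>auto split: split_indicator\<close>)
    then show ?case by simp
  qed
qed

text \<open>Mollified indicators are what the families of test functions below can produce; this
  converts vanishing against them into vanishing of box integrals. They are bounded by the L1 norm
  of \<open>k\<close>, which gives the dominating function, and the mass of \<open>k\<close> is
  divided out at the end.\<close>

lemma box_integral_zero_by_mollification:
  fixes h :: "'a::euclidean_space \<Rightarrow> complex"
  assumes h: "integrable lborel h" and k: "integrable lborel k" "(\<integral>y. k y \<partial>lborel) \<noteq> 0"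
    and zero: "\<And>n. (\<integral>x. complex_of_real (\<integral>y. indicator (box a b) (x - y /\<^sub>R real (Suc n)) * k y \<partial>lborel) * h x \<partial>lborel) = 0"
  shows "(\<integral>x. indicator (box a b) x *\<^sub>R h x \<partial>lborel) = 0"
proof -
  have [measurable]: "h \<in> borel_measurable borel" "k \<in> borel_measurable borel" using h k by auto
  let ?m = "\<lambda>n x. (\<integral>y. indicator (box a b) (x - y /\<^sub>R real (Suc n)) * k y \<partial>lborel)"
  let ?N = "\<integral>y. norm (k y) \<partial>lborel"
  have bd: "norm (?m n x) \<le> ?N" for n x
  proof (rule Bochner_Integration.integral_norm_bound_integral)
    show "integrable lborel (\<lambda>y. indicator (box a b) (x - y /\<^sub>R real (Suc n)) * k y)"
      by (rule Bochner_Integration.integrable_bound[OF k(1)]) (auto split: split_indicator)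
  qed (use k in \<open>auto split: split_indicator\<close>)
  have [measurable]: "?m n \<in> borel_measurable borel" for n
    by (rule lborel.borel_measurable_lebesgue_integral) measurable
  have "(\<lambda>n. \<integral>x. complex_of_real (?m n x) * h x \<partial>lborel)
      \<longlonglongrightarrow> (\<integral>x. complex_of_real (indicator (box a b) x * (\<integral>y. k y \<partial>lborel)) * h x \<partial>lborel)"
  proof (rule integral_dominated_convergence[where w="\<lambda>x. ?N * norm (h x)"])
    show "AE x in lborel. (\<lambda>n. complex_of_real (?m n x) * h x) \<longlonglongrightarrow> complex_of_real (indicator (box a b) x * (\<integral>y. k y \<partial>lborel)) * h x"
      using mollified_indicator_tendsto[OF k(1), of a b] by eventually_elim (intro tendsto_intros)
    show "AE x in lborel. norm (complex_of_real (?m n x) * h x) \<le> ?N * norm (h x)" for n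
      using bd by (auto simp: norm_mult intro!: mult_right_mono AE_I2)
  qed (use h in auto)
  then have "(\<integral>x. complex_of_real (indicator (box a b) x * (\<integral>y. k y \<partial>lborel)) * h x \<partial>lborel) = 0"
    using zero by (simp add: LIMSEQ_const_iff)
  then have "complex_of_real (\<integral>y. k y \<partial>lborel) * (\<integral>x. indicator (box a b) x *\<^sub>R h x \<partial>lborel) = 0"
    by (subst integral_mult_right_zero[symmetric]) (simp add: scaleR_conv_of_real mult_ac)
  with k show ?thesis by simp
qed

section \<open>The Fourier transform of integrable functions\<close>

lemma pair_integrableI:
  fixes f :: "'a::euclidean_space \<Rightarrow> 'b::euclidean_space \<Rightarrow> 'c::{banach, second_countable_topology}"
  assumes [measurable]: "case_prod f \<in> borel_measurable (lborel \<Otimes>\<^sub>M lborel)"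
    and "(\<integral>\<^sup>+x. \<integral>\<^sup>+y. ennreal (norm (f x y)) \<partial>lborel \<partial>lborel) < \<infinity>"
  shows "integrable (lborel \<Otimes>\<^sub>M lborel) (case_prod f)"
  using assms(2) by (subst integrable_iff_bounded)
    (simp add: lborel.nn_integral_fst[symmetric] split_beta')

lemma nn_integral_norm_finite:
  fixes f :: "'a \<Rightarrow> 'b::{banach, second_countable_topology}"
  shows "integrable M f \<Longrightarrow> (\<integral>\<^sup>+x. ennreal (norm (f x)) \<partial>M) < \<infinity>"
  by (simp add: integrable_iff_bounded)

lemma pair_integrable_mult:
  fixes f :: "'a::euclidean_space \<Rightarrow> complex" and g :: "'b::euclidean_space \<Rightarrow> complex"
  assumes f: "integrable lborel f" and g: "integrable lborel g"
  shows "integrable (lborel \<Otimes>\<^sub>M lborel) (\<lambda>(x,y). f x * g y)"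
proof (rule pair_integrableI)
  have [measurable]: "f \<in> borel_measurable borel" "g \<in> borel_measurable borel" using f g by auto
  show "(\<lambda>(x,y). f x * g y) \<in> borel_measurable (lborel \<Otimes>\<^sub>M lborel)" by measurable
  have "(\<integral>\<^sup>+x. \<integral>\<^sup>+y. ennreal (norm (f x * g y)) \<partial>lborel \<partial>lborel)
    = (\<integral>\<^sup>+x. ennreal (norm (f x)) \<partial>lborel) * (\<integral>\<^sup>+y. ennreal (norm (g y)) \<partial>lborel)"
    by (simp add: norm_mult ennreal_mult nn_integral_cmult nn_integral_multc)
  then show "(\<integral>\<^sup>+x. \<integral>\<^sup>+y. ennreal (norm (f x * g y)) \<partial>lborel \<partial>lborel) < \<infinity>"
    using nn_integral_norm_finite[OF f] nn_integral_norm_finite[OF g] by (simp add: ennreal_mult_less_top)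
qed

lemma pair_integrable_bound:
  fixes f :: "'a::euclidean_space \<Rightarrow> complex" and g :: "'b::euclidean_space \<Rightarrow> complex"
    and h :: "'a \<Rightarrow> 'b \<Rightarrow> complex"
  assumes f: "integrable lborel f" and g: "integrable lborel g"
    and [measurable]: "case_prod h \<in> borel_measurable (lborel \<Otimes>\<^sub>M lborel)"
    and "\<And>x y. norm (h x y) \<le> C * (norm (f x) * norm (g y))"
  shows "integrable (lborel \<Otimes>\<^sub>M lborel) (case_prod h)"
proof (rule Bochner_Integration.integrable_bound)
  show "integrable (lborel \<Otimes>\<^sub>M lborel) (\<lambda>x. complex_of_real C * (case x of (x,y) \<Rightarrow> f x * g y))"
    using pair_integrable_mult[OF f g] by simp
  show "AE x in lborel \<Otimes>\<^sub>M lborel. norm (case_prod h x) \<le> norm (complex_of_real C * (case x of (x,y) \<Rightarrow> f x * g y))"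
    using assms(4) by (intro AE_I2) (auto simp: norm_mult split: prod.split intro: order_trans[OF _ mult_right_mono[OF abs_ge_self]])
qed simp

definition ek :: "'a::euclidean_space \<Rightarrow> 'a \<Rightarrow> complex" where
  "ek x \<xi> = exp (- \<i> * complex_of_real (x \<bullet> \<xi>))"

definition fconst :: "'a::euclidean_space itself \<Rightarrow> real" where
  "fconst _ = (2 * pi) powr (- real DIM('a) / 2)"

definition ifourier :: "('a::euclidean_space \<Rightarrow> complex) \<Rightarrow> 'a \<Rightarrow> complex" where
  "ifourier f x = fourier f (- x)"

lemma fconst_pos [simp]: "fconst TYPE('a::euclidean_space) > 0"
  by (simp add: fconst_def)

lemma fconst_ge0 [simp]: "fconst TYPE('a::euclidean_space) \<ge> 0"
  using fconst_pos less_imp_le by blast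

lemma fourier_ek: "fourier f \<xi> = complex_of_real (fconst TYPE('a)) * (\<integral>x. ek x \<xi> * f x \<partial>lborel)"
  for f :: "'a::euclidean_space \<Rightarrow> complex"
  by (simp add: fourier_def fconst_def ek_def)

lemma norm_ek [simp]: "norm (ek x \<xi>) = 1"
  unfolding ek_def by (simp add: norm_exp_eq_Re)

lemma ek_sym: "ek x \<xi> = ek \<xi> x" by (simp add: ek_def inner_commute)
lemma ek_add_right: "ek x (\<xi> + \<eta>) = ek x \<xi> * ek x \<eta>"
  by (simp add: ek_def inner_add_right ring_distribs exp_add[symmetric])
lemma ek_add_left: "ek (x + y) \<xi> = ek x \<xi> * ek y \<xi>"
  by (simp add: ek_def inner_add_left ring_distribs exp_add[symmetric])
lemma ek_uminus_right: "ek x (- \<xi>) = cnj (ek x \<xi>)"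
  by (simp add: ek_def exp_cnj)
lemma ek_uminus_left: "ek (- x) \<xi> = cnj (ek x \<xi>)"
  by (simp add: ek_def exp_cnj)
lemma ek_diff_right: "ek x (\<xi> - \<eta>) = ek x \<xi> * cnj (ek x \<eta>)"
  using ek_add_right[of x \<xi> "-\<eta>"] by (simp add: ek_uminus_right)
lemma ek_scale: "ek (r *\<^sub>R x) \<xi> = ek x (r *\<^sub>R \<xi>)"
  by (simp add: ek_def)
lemma ek_zero [simp]: "ek x 0 = 1" "ek 0 x = 1" by (auto simp: ek_def)
lemma measurable_ek [measurable (raw)]:
  assumes [measurable]: "f \<in> borel_measurable M" "g \<in> borel_measurable M"
  shows "(\<lambda>x. ek (f x) (g x)) \<in> borel_measurable M"
  unfolding ek_def by measurable

lemma measurable_cnj [measurable (raw)]: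
  assumes "f \<in> borel_measurable M" shows "(\<lambda>x. cnj (f x)) \<in> borel_measurable M"
  using borel_measurable_continuous_onI[OF continuous_on_cnj[OF continuous_on_id]] assms
  by (auto intro: measurable_compose)

lemma integrable_ek:
  assumes f: "integrable lborel f" shows "integrable lborel (\<lambda>x. ek x \<xi> * f x)" "integrable lborel (\<lambda>x. ek \<xi> x * f x)"
    "integrable lborel (\<lambda>x. cnj (ek x \<xi>) * f x)"
  by (auto intro!: Bochner_Integration.integrable_bound[OF f] borel_measurable_integrable[OF f]
      borel_measurable_times measurable_ek measurable_cnj simp: norm_mult)

lemma measurable_fourier [measurable]:
  fixes f :: "'a::euclidean_space \<Rightarrow> complex"
  assumes [measurable]: "f \<in> borel_measurable borel"
  shows "fourier f \<in> borel_measurable borel"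
proof -
  have "(\<lambda>\<xi>. \<integral>x. ek x \<xi> * f x \<partial>lborel) \<in> borel_measurable borel"
    by (rule lborel.borel_measurable_lebesgue_integral) measurable
  then show ?thesis unfolding fourier_ek[abs_def] by measurable
qed

lemma measurable_ifourier [measurable]:
  assumes [measurable]: "f \<in> borel_measurable borel"
  shows "ifourier f \<in> borel_measurable borel"
  unfolding ifourier_def by measurable

lemma norm_fourier_le:
  fixes f :: "'a::euclidean_space \<Rightarrow> complex"
  shows "norm (fourier f \<xi>) \<le> fconst TYPE('a) * (\<integral>x. norm (f x) \<partial>lborel)"
proof -
  have "norm (\<integral>x. ek x \<xi> * f x \<partial>lborel) \<le> (\<integral>x. norm (ek x \<xi> * f x) \<partial>lborel)"
    by (rule integral_norm_bound)
  then show ?thesis by (simp add: fourier_ek norm_mult mult_left_mono)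
qed

lemma norm_ifourier_le:
  fixes f :: "'a::euclidean_space \<Rightarrow> complex"
  shows "norm (ifourier f \<xi>) \<le> fconst TYPE('a) * (\<integral>x. norm (f x) \<partial>lborel)"
  unfolding ifourier_def by (rule norm_fourier_le)

lemma fourier_cmult: "fourier (\<lambda>x. c * f x) \<xi> = c * fourier f \<xi>"
  unfolding fourier_ek by (simp add: mult.left_commute[of _ c])

lemma fourier_add:
  "integrable lborel f \<Longrightarrow> integrable lborel g \<Longrightarrow> fourier (\<lambda>x. f x + g x) \<xi> = fourier f \<xi> + fourier g \<xi>"
  unfolding fourier_ek by (simp add: ring_distribs integrable_ek)

lemma continuous_fourier:
  fixes f :: "'a::euclidean_space \<Rightarrow> complex"
  assumes f: "integrable lborel f"
  shows "continuous_on UNIV (fourier f)"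
proof -
  have [measurable]: "f \<in> borel_measurable borel" using f by auto
  have "(\<lambda>n. \<integral>x. ek x (X n) * f x \<partial>lborel) \<longlonglongrightarrow> (\<integral>x. ek x \<xi> * f x \<partial>lborel)" if X: "X \<longlonglongrightarrow> \<xi>" for X \<xi>
  proof (rule integral_dominated_convergence[where w="\<lambda>x. norm (f x)"])
    show "AE x in lborel. (\<lambda>n. ek x (X n) * f x) \<longlonglongrightarrow> ek x \<xi> * f x"
      unfolding ek_def by (intro AE_I2 tendsto_intros X)
  qed (use f in \<open>auto simp: norm_mult\<close>)
  then show ?thesis
    unfolding continuous_on_sequentially fourier_ek[abs_def] by (auto simp: o_def intro!: tendsto_intros)
qed

text \<open>Fubini for a kernel symmetric in its two arguments. This is the duality identity that
  \<open>is_FT\<close> takes as the definition of the transform in L2.\<close>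

lemma fourier_mult_formula:
  fixes f g :: "'a::euclidean_space \<Rightarrow> complex"
  assumes f: "integrable lborel f" and g: "integrable lborel g"
  shows "(\<integral>x. fourier f x * g x \<partial>lborel) = (\<integral>x. f x * fourier g x \<partial>lborel)"
proof -
  have [measurable]: "f \<in> borel_measurable borel" "g \<in> borel_measurable borel" using f g by auto
  have int: "integrable (lborel \<Otimes>\<^sub>M lborel) (\<lambda>(x,y). ek x y * f x * g y)"
    by (rule pair_integrable_bound[OF f g, where C=1]) (auto simp: norm_mult)
  have "(\<integral>y. (\<integral>x. ek x y * f x * g y \<partial>lborel) \<partial>lborel) = (\<integral>x. (\<integral>y. ek x y * f x * g y \<partial>lborel) \<partial>lborel)"
    using lborel_pair.Fubini_integral[OF int] by simp
  also have "(\<integral>y. (\<integral>x. ek x y * f x * g y \<partial>lborel) \<partial>lborel) = (\<integral>y. (\<integral>x. ek x y * f x \<partial>lborel) * g y \<partial>lborel)"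
    by simp
  also have "(\<integral>x. (\<integral>y. ek x y * f x * g y \<partial>lborel) \<partial>lborel) = (\<integral>x. f x * (\<integral>y. ek y x * g y \<partial>lborel) \<partial>lborel)"
    by (subst integral_mult_right_zero[symmetric]) (simp add: mult_ac ek_sym)
  finally show ?thesis
    by (simp add: fourier_ek mult.assoc mult.left_commute[of _ "complex_of_real (fconst TYPE('a))"])
qed

lemma fourier_shift: "fourier (\<lambda>\<xi>. f (\<xi> - y)) x = ek x y * fourier f x"
proof -
  have "(\<integral>\<xi>. ek \<xi> x * f (\<xi> - y) \<partial>lborel) = (\<integral>\<xi>. ek (\<xi> + y) x * f \<xi> \<partial>lborel)"
    using integral_lborel_shift(3)[of "\<lambda>\<xi>. ek (\<xi> + y) x * f \<xi>" y] by simp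
  also have "\<dots> = (\<integral>\<xi>. ek x y * (ek \<xi> x * f \<xi>) \<partial>lborel)" by (simp add: ek_add_left ek_sym[of y] mult_ac)
  finally show ?thesis by (simp add: fourier_ek)
qed

lemma fourier_modulate: "fourier (\<lambda>\<xi>. cnj (ek \<xi> z) * f \<xi>) x = fourier f (x - z)"
  by (simp add: fourier_ek ek_diff_right mult_ac)

lemma fourier_reflect: "fourier (\<lambda>x. f (- x)) \<xi> = fourier f (- \<xi>)"
proof -
  have "(\<integral>x. ek x \<xi> * f (- x) \<partial>lborel) = (\<integral>x. ek x (- \<xi>) * f x \<partial>lborel)"
    using integral_lborel_reflect(2)[of "\<lambda>x. ek x (- \<xi>) * f x"] by (simp add: ek_uminus_left ek_uminus_right)
  then show ?thesis by (simp add: fourier_ek)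
qed

lemma fourier_cnj_reflect: "fourier (\<lambda>x. cnj (f (- x))) \<xi> = cnj (fourier f \<xi>)"
proof -
  have "(\<integral>x. ek x \<xi> * cnj (f (- x)) \<partial>lborel) = (\<integral>x. ek (-x) \<xi> * cnj (f x) \<partial>lborel)"
    using integral_lborel_reflect(2)[of "\<lambda>x. ek (-x) \<xi> * cnj (f x)"] by simp
  also have "\<dots> = (\<integral>x. cnj (ek x \<xi> * f x) \<partial>lborel)" by (simp add: ek_uminus_left)
  also have "\<dots> = cnj (\<integral>x. ek x \<xi> * f x \<partial>lborel)" by (rule Bochner_Integration.integral_cnj)
  finally show ?thesis by (simp add: fourier_ek)
qed

lemma fourier_dilate:
  fixes f :: "'a::euclidean_space \<Rightarrow> complex"
  assumes r: "r > 0"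
  shows "fourier (\<lambda>\<xi>. f (\<xi> /\<^sub>R r)) x = complex_of_real (r ^ DIM('a)) * fourier f (r *\<^sub>R x)"
proof -
  have "(\<integral>\<xi>. ek \<xi> x * f (\<xi> /\<^sub>R r) \<partial>lborel) = r ^ DIM('a) *\<^sub>R (\<integral>\<xi>. ek (r *\<^sub>R \<xi>) x * f \<xi> \<partial>lborel)"
    using integral_lborel_affine[of r "\<lambda>\<xi>. ek \<xi> x * f (\<xi> /\<^sub>R r)" 0] r by simp
  then show ?thesis by (simp add: fourier_ek ek_scale scaleR_conv_of_real)
qed

text \<open>Fubini in coordinates; it reduces Gaussian integrals to dimension one.\<close>

lemma integral_lborel_prod_basis:
  fixes f :: "'a::euclidean_space \<Rightarrow> real \<Rightarrow> complex"
  assumes f: "\<And>b. b \<in> Basis \<Longrightarrow> integrable lborel (f b)"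
  shows "integrable lborel (\<lambda>x::'a. \<Prod>b\<in>Basis. f b (x \<bullet> b))"
    "(\<integral>x. (\<Prod>b\<in>(Basis::'a set). f b (x \<bullet> b)) \<partial>lborel) = (\<Prod>b\<in>Basis. \<integral>x. f b x \<partial>lborel)"
proof -
  interpret product_sigma_finite "\<lambda>_::'a. lborel :: real measure" ..
  have [measurable]: "b \<in> Basis \<Longrightarrow> f b \<in> borel_measurable borel" for b using f by (auto dest: borel_measurable_integrable)
  have m: "(\<lambda>x::'a. \<Prod>b\<in>Basis. f b (x \<bullet> b)) \<in> borel_measurable borel"
    by (intro borel_measurable_prod) measurable
  have m2: "(\<lambda>f. \<Sum>b\<in>Basis. f b *\<^sub>R b) \<in> (\<Pi>\<^sub>M b\<in>Basis. lborel) \<rightarrow>\<^sub>M (borel :: 'a measure)"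
    by measurable
  have eq: "(\<Sum>b\<in>Basis. g b *\<^sub>R b) \<bullet> c = g c" if "c \<in> Basis" for g and c :: 'a using that by simp
  show "integrable lborel (\<lambda>x::'a. \<Prod>b\<in>Basis. f b (x \<bullet> b))"
    using product_integrable_prod[OF finite_Basis, of f] f
    by (subst lborel_eq) (simp add: integrable_distr_eq[OF m2 m])
  show "(\<integral>x. (\<Prod>b\<in>(Basis::'a set). f b (x \<bullet> b)) \<partial>lborel) = (\<Prod>b\<in>Basis. \<integral>x. f b x \<partial>lborel)"
    using product_integral_prod[OF finite_Basis, of f] f
    by (subst lborel_eq) (simp add: integral_distr[OF m2 m])
qed

section \<open>The Gaussian as a fixed point of the Fourier transform\<close>

definition gauss :: "'a::euclidean_space \<Rightarrow> real" where
  "gauss x = exp (- (norm x)\<^sup>2 / 2)"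

lemma gauss_pos: "gauss x > 0" and gauss_le1: "gauss x \<le> 1" and gauss_minus: "gauss (- x) = gauss x"
  and gauss_0: "gauss 0 = 1"
  by (auto simp: gauss_def)

lemma continuous_gauss: "continuous_on A gauss"
  unfolding gauss_def by (intro continuous_intros) auto

lemma measurable_gauss [measurable]: "gauss \<in> borel_measurable borel"
  using continuous_gauss by (rule borel_measurable_continuous_onI)

lemma gauss_basis: "gauss (x::'a::euclidean_space) = (\<Prod>b\<in>Basis. exp (- (x \<bullet> b)\<^sup>2 / 2))"
proof -
  have "(norm x)\<^sup>2 = (\<Sum>b\<in>Basis. (x \<bullet> b)\<^sup>2)"
    unfolding power2_norm_eq_inner by (subst euclidean_inner) (simp only: power2_eq_square)
  then have "- (norm x)\<^sup>2 / 2 = (\<Sum>b\<in>Basis. - (x \<bullet> b)\<^sup>2 / 2)"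
    by (simp add: sum_negf sum_divide_distrib)
  then show ?thesis unfolding gauss_def by (simp only: exp_sum[OF finite_Basis])
qed

lemma integrable_gauss1: "integrable lborel (\<lambda>x::real. exp (- x\<^sup>2 / 2))"
proof -
  have "integrable lborel (\<lambda>x. sqrt (2 * pi) * std_normal_density x)"
    using integrable_normal_density[of 1 0] by auto
  then show ?thesis by (simp add: std_normal_density_def)
qed

text \<open>This is the characteristic function of the standard normal distribution, evaluated at
  \<open>- t\<close> to match the sign convention of \<open>ek\<close>.\<close>

lemma fourier_gauss1: "(\<integral>x. exp (- \<i> * complex_of_real (x * t)) * complex_of_real (exp (- x\<^sup>2 / 2)) \<partial>lborel)
   = complex_of_real (sqrt (2 * pi) * exp (- t\<^sup>2 / 2))"
proof -
  have "complex_of_real (exp (- t\<^sup>2 / 2)) = char std_normal_distribution (- t)"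
    by (simp add: char_std_normal_distribution)
  also have "\<dots> = (\<integral>x. std_normal_density x *\<^sub>R iexp (- t * x) \<partial>lborel)"
    unfolding char_def by (subst integral_density) auto
  also have "\<dots> = (\<integral>x. complex_of_real (1 / sqrt (2 * pi)) * (exp (- \<i> * complex_of_real (x * t)) * complex_of_real (exp (- x\<^sup>2 / 2))) \<partial>lborel)"
    by (simp add: std_normal_density_def scaleR_conv_of_real mult_ac)
  also have "\<dots> = complex_of_real (1 / sqrt (2 * pi)) * (\<integral>x. (exp (- \<i> * complex_of_real (x * t)) * complex_of_real (exp (- x\<^sup>2 / 2))) \<partial>lborel)"
    by (rule integral_mult_right_zero)
  finally show ?thesis by (simp add: field_simps)
qed

lemma integrable_gauss [simp]: "integrable lborel (\<lambda>x::'a::euclidean_space. complex_of_real (gauss x))"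
  unfolding gauss_basis of_real_prod using integrable_gauss1
  by (intro integral_lborel_prod_basis(1)) auto

lemma integrable_gauss_real [simp]: "integrable lborel (gauss :: 'a::euclidean_space \<Rightarrow> real)"
  using integrable_Re[OF integrable_gauss] by simp

lemma fourier_gauss: "fourier (\<lambda>x. complex_of_real (gauss x)) \<xi> = complex_of_real (gauss (\<xi>::'a::euclidean_space))"
proof -
  have ekp: "ek x \<xi> = (\<Prod>b\<in>Basis. exp (- \<i> * complex_of_real ((x \<bullet> b) * (\<xi> \<bullet> b))))" for x
  proof -
    have "- \<i> * complex_of_real (x \<bullet> \<xi>) = (\<Sum>b\<in>Basis. - \<i> * complex_of_real ((x \<bullet> b) * (\<xi> \<bullet> b)))"
      by (subst euclidean_inner) (simp add: sum_distrib_left sum_negf)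
    then show ?thesis unfolding ek_def by (simp only: exp_sum[OF finite_Basis])
  qed
  have "(\<integral>x. ek x \<xi> * complex_of_real (gauss x) \<partial>lborel)
    = (\<integral>x. (\<Prod>b\<in>Basis. (\<lambda>b y. exp (- \<i> * complex_of_real (y * (\<xi> \<bullet> b))) * complex_of_real (exp (- y\<^sup>2 / 2))) b (x \<bullet> b)) \<partial>lborel)"
    by (simp add: ekp gauss_basis prod.distrib)
  also have "\<dots> = (\<Prod>b\<in>Basis. (\<integral>y. exp (- \<i> * complex_of_real (y * (\<xi> \<bullet> b))) * complex_of_real (exp (- y\<^sup>2 / 2)) \<partial>lborel))"
  proof (rule integral_lborel_prod_basis(2))
    fix b :: 'a
    have "integrable lborel (\<lambda>y::real. complex_of_real (exp (- y\<^sup>2 / 2)))" using integrable_gauss1 by (simp only: integrable_of_real)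
    from integrable_ek(1)[OF this, of "\<xi> \<bullet> b"]
    show "integrable lborel (\<lambda>y::real. exp (- \<i> * complex_of_real (y * (\<xi> \<bullet> b))) * complex_of_real (exp (- y\<^sup>2 / 2)))"
      by (simp add: ek_def)
  qed
  also have "\<dots> = (\<Prod>b\<in>(Basis::'a set). complex_of_real (sqrt (2 * pi) * exp (- (\<xi> \<bullet> b)\<^sup>2 / 2)))"
    by (simp only: fourier_gauss1)
  also have "\<dots> = complex_of_real (sqrt (2 * pi) ^ DIM('a) * gauss \<xi>)"
    by (simp add: gauss_basis prod.distrib)
  finally have "fourier (\<lambda>x. complex_of_real (gauss x)) \<xi> = complex_of_real (fconst TYPE('a) * sqrt (2 * pi) ^ DIM('a) * gauss \<xi>)"
    by (simp add: fourier_ek)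
  moreover have "fconst TYPE('a) * sqrt (2 * pi) ^ DIM('a) = 1"
    unfolding fconst_def by (simp add: powr_half_sqrt[symmetric] powr_realpow[symmetric] powr_powr powr_add[symmetric])
  ultimately show ?thesis by simp
qed

text \<open>The mass is read off from the transform at frequency 0, where \<open>gauss\<close>
  equals 1.\<close>

lemma integral_gauss: "fconst TYPE('a::euclidean_space) * (\<integral>x. gauss (x::'a) \<partial>lborel) = 1"
proof -
  have "complex_of_real (fconst TYPE('a) * (\<integral>x. gauss (x::'a) \<partial>lborel)) = 1"
    using fourier_gauss[of "0::'a"] by (simp add: fourier_ek gauss_0)
  then show ?thesis using of_real_eq_1_iff by blast
qed

section \<open>Uniqueness, the Bessel inequality and inversion\<close>

lemma gauss_nonneg [simp]: "0 \<le> gauss x"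
  using gauss_pos less_imp_le by blast

lemma integrable_bounded_mult:
  fixes f g :: "'a \<Rightarrow> complex"
  assumes f: "integrable M f" and g[measurable]: "g \<in> borel_measurable M" and bd: "\<And>x. norm (g x) \<le> C"
  shows "integrable M (\<lambda>x. g x * f x)"
proof (rule Bochner_Integration.integrable_bound)
  show "integrable M (\<lambda>x. complex_of_real C * f x)" using f by simp
  show "AE x in M. norm (g x * f x) \<le> norm (complex_of_real C * f x)"
    by (intro AE_I2) (auto simp: norm_mult intro!: mult_right_mono order_trans[OF bd abs_ge_self])
qed (use f in measurable)

text \<open>Dilated and translated Gaussians are transforms of integrable functions, so they can be
  moved across \<open>fourier_mult_formula\<close>. As \<open>r\<close> grows they concentrate at
  \<open>z\<close>.\<close>

lemma gauss_translate_fourier: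
  assumes r: "r > 0"
  shows "complex_of_real (r ^ DIM('a) * gauss (r *\<^sub>R (x - z))) =
     fourier (\<lambda>\<xi>. cnj (ek \<xi> z) * complex_of_real (gauss (\<xi> /\<^sub>R r))) (x::'a::euclidean_space)"
  using fourier_dilate[OF r, of "\<lambda>x. complex_of_real (gauss x)" "x - z"]
  by (simp add: fourier_modulate fourier_gauss)

lemma integrable_gauss_dilate:
  "r > 0 \<Longrightarrow> integrable lborel (\<lambda>\<xi>::'a::euclidean_space. complex_of_real (gauss (\<xi> /\<^sub>R r)))"
  using integrable_lborel_affine[OF integrable_gauss, of "inverse r" 0] by simp

text \<open>By the multiplication formula \<open>h\<close> annihilates every transform of an
  integrable function, hence all translated Gaussians, hence their superpositions over a box; and
  these are the mollified indicators of that box.\<close>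

lemma fourier_L1_inj:
  fixes h :: "'a::euclidean_space \<Rightarrow> complex"
  assumes h: "integrable lborel h" and zero: "\<And>\<xi>. fourier h \<xi> = 0"
  shows "AE x in lborel. h x = 0"
proof (rule AE_zero_if_box_integrals_zero[OF h], rule box_integral_zero_by_mollification[OF h integrable_gauss_real])
  have [measurable]: "h \<in> borel_measurable borel" using h by auto
  show "(\<integral>y. gauss (y::'a) \<partial>lborel) \<noteq> 0" using integral_gauss[where 'a='a] by auto
  fix a b :: 'a and n
  define r where "r = real (Suc n)"
  have r: "r > 0" by (simp add: r_def)
  let ?B = "box a b"
  let ?g = "\<lambda>z \<xi>. cnj (ek \<xi> z) * complex_of_real (gauss (\<xi> /\<^sub>R r))"
  have g: "integrable lborel (?g z)" for z
    by (intro integrable_ek integrable_gauss_dilate r)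
  have iB: "integrable lborel (\<lambda>z. indicator ?B z :: complex)"
  proof -
    have "integrable lborel (\<lambda>z. complex_of_real (indicator ?B z))"
      by (intro integrable_of_real integrable_real_indicator) (auto simp: emeasure_lborel_box_eq)
    then show ?thesis by (simp add: of_real_indicator)
  qed
  \<comment> \<open>The substitution z = x - y/r turns the mollification into a superposition of
    Gaussians centred at the points of the box.\<close>
  have eq: "complex_of_real (\<integral>y. indicator ?B (x - y /\<^sub>R r) * gauss y \<partial>lborel)
     = (\<integral>z. indicator ?B z * complex_of_real (r ^ DIM('a) * gauss (r *\<^sub>R (x - z))) \<partial>lborel)" for x
  proof -
    have "(\<integral>y. indicator ?B (x - y /\<^sub>R r) * gauss y \<partial>lborel) = r ^ DIM('a) * (\<integral>z. indicator ?B z * gauss (r *\<^sub>R (x - z)) \<partial>lborel)"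
      using integral_lborel_affine[of "-r" "\<lambda>y. indicator ?B (x - y /\<^sub>R r) * gauss y" "r *\<^sub>R x"] r
      by (simp add: algebra_simps)
    also have "\<dots> = (\<integral>z. indicator ?B z * (r ^ DIM('a) * gauss (r *\<^sub>R (x - z))) \<partial>lborel)"
      by (subst integral_mult_right_zero[symmetric]) (simp add: mult_ac)
    finally have "complex_of_real (\<integral>y. indicator ?B (x - y /\<^sub>R r) * gauss y \<partial>lborel) = (\<integral>z. complex_of_real (indicator ?B z * (r ^ DIM('a) * gauss (r *\<^sub>R (x - z)))) \<partial>lborel)"
      by (simp only: integral_complex_of_real)
    then show ?thesis by (simp add: of_real_indicator)
  qed
  have int: "integrable (lborel \<Otimes>\<^sub>M lborel) (\<lambda>(x,z). h x * (indicator ?B z * complex_of_real (r ^ DIM('a) * gauss (r *\<^sub>R (x - z)))))"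
  proof (rule pair_integrable_bound[OF h iB, where C="r ^ DIM('a)"])
    show "(\<lambda>(x, z). h x * (indicator ?B z * complex_of_real (r ^ DIM('a) * gauss (r *\<^sub>R (x - z))))) \<in> borel_measurable (lborel \<Otimes>\<^sub>M lborel)"
      by measurable
    fix x y
    show "norm (h x * (indicator ?B y * complex_of_real (r ^ DIM('a) * gauss (r *\<^sub>R (x - y))))) \<le> r ^ DIM('a) * (norm (h x) * norm (indicator ?B y :: complex))"
      using r gauss_le1[of "r *\<^sub>R (x - y)"] gauss_pos[of "r *\<^sub>R (x - y)"]
      by (auto simp: norm_mult norm_power mult_ac split: split_indicator intro!: mult_left_mono mult_left_le_one_le)
  qed
  have "(\<integral>x. complex_of_real (\<integral>y. indicator ?B (x - y /\<^sub>R r) * gauss y \<partial>lborel) * h x \<partial>lborel)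
     = (\<integral>x. (\<integral>z. h x * (indicator ?B z * complex_of_real (r ^ DIM('a) * gauss (r *\<^sub>R (x - z)))) \<partial>lborel) \<partial>lborel)"
    by (simp only: eq integral_mult_right_zero mult.commute[of _ "h _"])
  also have "\<dots> = (\<integral>z. (\<integral>x. h x * (indicator ?B z * complex_of_real (r ^ DIM('a) * gauss (r *\<^sub>R (x - z)))) \<partial>lborel) \<partial>lborel)"
    using lborel_pair.Fubini_integral[OF int] by simp
  also have "\<dots> = (\<integral>z. indicator ?B z * (\<integral>x. h x * fourier (?g z) x \<partial>lborel) \<partial>lborel)"
    unfolding gauss_translate_fourier[OF r] mult.left_commute[of "h _" "indicator ?B _"] integral_mult_right_zero ..
  also have "\<dots> = 0"
    using zero by (simp add: fourier_mult_formula[OF h g, symmetric])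
  finally show "(\<integral>x. complex_of_real (\<integral>y. indicator ?B (x - y /\<^sub>R real (Suc n)) * gauss y \<partial>lborel) * h x \<partial>lborel) = 0"
    by (simp add: r_def)
qed

lemma sq_int_measurable: "sq_int f \<Longrightarrow> f \<in> borel_measurable borel"
  by (simp add: sq_int_def)

lemma nn_mult_le_squares: "ennreal (norm (u::complex)) * ennreal (norm (v::complex)) \<le> ennreal ((norm u)\<^sup>2 / 2) + ennreal ((norm v)\<^sup>2 / 2)"
proof -
  have "norm u * norm v \<le> (norm u)\<^sup>2 / 2 + (norm v)\<^sup>2 / 2"
    using sum_squares_bound[of "norm u" "norm v"] by (simp add: field_simps)
  then show ?thesis by (simp add: ennreal_mult[symmetric] ennreal_plus[symmetric] ennreal_leI del: ennreal_plus)
qed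

text \<open>Half of Plancherel's theorem. With a Gaussian factor inserted, the transform can be
  moved from \<open>b\<close> to the other factor, which becomes a Gaussian average of translates of
  the conjugate of \<open>b\<close>. Each correlation of \<open>b\<close> with a translate is at
  most the integral of |b|^2, and the Gaussian weights have total mass 1. Fatou's lemma removes the
  inserted factor.\<close>

lemma fourier_bessel:
  fixes b :: "'a::euclidean_space \<Rightarrow> complex"
  assumes b: "integrable lborel b" and b2: "sq_int b"
  shows "(\<integral>\<^sup>+x. ennreal ((norm (fourier b x))\<^sup>2) \<partial>lborel) \<le> (\<integral>\<^sup>+x. ennreal ((norm (b x))\<^sup>2) \<partial>lborel)"
proof -
  have [measurable]: "b \<in> borel_measurable borel" using b by auto
  let ?I = "\<integral>\<^sup>+x. ennreal ((norm (b x))\<^sup>2) \<partial>lborel"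
  have step: "(\<integral>\<^sup>+x. ennreal ((norm (fourier b x))\<^sup>2 * gauss (x /\<^sub>R r)) \<partial>lborel) \<le> ?I" if r: "r > 0" for r
  proof -
    let ?gr = "\<lambda>\<xi>::'a. complex_of_real (gauss (\<xi> /\<^sub>R r))"
    have gr: "integrable lborel ?gr" by (rule integrable_gauss_dilate[OF r])
    let ?w = "\<lambda>\<xi>. cnj (fourier b \<xi>) * ?gr \<xi>"
    have w: "integrable lborel ?w"
      by (rule integrable_bounded_mult[OF gr, of _ "fconst TYPE('a) * (\<integral>x. norm (b x) \<partial>lborel)"])
        (auto simp: norm_fourier_le)
    have real: "(\<integral>\<^sup>+x. ennreal ((norm (fourier b x))\<^sup>2 * gauss (x /\<^sub>R r)) \<partial>lborel) = ennreal (norm (\<integral>x. fourier b x * ?w x \<partial>lborel))"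
    proof -
      have e: "fourier b x * ?w x = complex_of_real ((norm (fourier b x))\<^sup>2 * gauss (x /\<^sub>R r))" for x
        by (simp only: of_real_mult complex_norm_square mult_ac)
      have i: "integrable lborel (\<lambda>x. (norm (fourier b x))\<^sup>2 * gauss (x /\<^sub>R r))"
      proof -
        have "integrable lborel (\<lambda>x. fourier b x * ?w x)"
          by (rule integrable_bounded_mult[OF w]) (auto intro!: norm_fourier_le)
        then show ?thesis using integrable_Re unfolding e by fastforce
      qed
      have "0 \<le> (\<integral>x. (norm (fourier b x))\<^sup>2 * gauss (x /\<^sub>R r) \<partial>lborel)" by simp
      then show ?thesis unfolding e integral_complex_of_real
        using i by (subst nn_integral_eq_integral) (simp_all only: norm_of_real abs_of_nonneg, auto)
    qed
    \<comment> \<open>After Fubini the integral over the frequency is evaluated by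
      \<open>gauss_translate_fourier\<close>; what remains is an average of translates of
      \<open>cnj b\<close> at scale 1/r.\<close>
    have Fw: "fourier ?w x = complex_of_real (fconst TYPE('a)) * (\<integral>z. cnj (b (x - z /\<^sub>R r)) * complex_of_real (gauss z) \<partial>lborel)" for x
    proof -
      have int: "integrable (lborel \<Otimes>\<^sub>M lborel) (\<lambda>(\<xi>,y). ek \<xi> x * ?gr \<xi> * cnj (ek y \<xi> * b y))"
        by (rule pair_integrable_bound[OF gr b, where C=1]) (auto simp: norm_mult)
      have "(\<integral>\<xi>. ek \<xi> x * ?w \<xi> \<partial>lborel) = complex_of_real (fconst TYPE('a)) * (\<integral>\<xi>. (\<integral>y. ek \<xi> x * ?gr \<xi> * cnj (ek y \<xi> * b y) \<partial>lborel) \<partial>lborel)"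
      proof -
        have "(\<integral>y. ek \<xi> x * ?gr \<xi> * cnj (ek y \<xi> * b y) \<partial>lborel) = ek \<xi> x * ?gr \<xi> * cnj (\<integral>y. ek y \<xi> * b y \<partial>lborel)" for \<xi>
          by (simp only: integral_mult_right_zero Bochner_Integration.integral_cnj)
        then have "ek \<xi> x * ?w \<xi> = complex_of_real (fconst TYPE('a)) * (\<integral>y. ek \<xi> x * ?gr \<xi> * cnj (ek y \<xi> * b y) \<partial>lborel)" for \<xi>
          unfolding fourier_ek complex_cnj_mult[of "complex_of_real _"] complex_cnj_complex_of_real by (simp only: mult_ac)
        then show ?thesis by (simp only: integral_mult_right_zero)
      qed
      also have "(\<integral>\<xi>. (\<integral>y. ek \<xi> x * ?gr \<xi> * cnj (ek y \<xi> * b y) \<partial>lborel) \<partial>lborel) = (\<integral>y. (\<integral>\<xi>. ek \<xi> x * ?gr \<xi> * cnj (ek y \<xi> * b y) \<partial>lborel) \<partial>lborel)"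
        using lborel_pair.Fubini_integral[OF int] by simp
      also have "\<dots> = (\<integral>y. cnj (b y) * (\<integral>\<xi>. ek \<xi> x * (cnj (ek \<xi> y) * ?gr \<xi>) \<partial>lborel) \<partial>lborel)"
      proof -
        have "ek \<xi> x * ?gr \<xi> * cnj (ek y \<xi> * b y) = cnj (b y) * (ek \<xi> x * (cnj (ek \<xi> y) * ?gr \<xi>))" for y \<xi>
          by (simp add: ek_sym[of y \<xi>])
        then show ?thesis by (simp only: integral_mult_right_zero)
      qed
      also have "complex_of_real (fconst TYPE('a)) * \<dots> = (\<integral>y. cnj (b y) * fourier (\<lambda>\<xi>. cnj (ek \<xi> y) * ?gr \<xi>) x \<partial>lborel)"
      proof -
        have "cnj (b y) * fourier (\<lambda>\<xi>. cnj (ek \<xi> y) * ?gr \<xi>) x = complex_of_real (fconst TYPE('a)) *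
            (cnj (b y) * (\<integral>\<xi>. ek \<xi> x * (cnj (ek \<xi> y) * ?gr \<xi>) \<partial>lborel))" for y
          unfolding fourier_ek by (rule mult.left_commute)
        then show ?thesis by (simp only: integral_mult_right_zero)
      qed
      finally have "fourier ?w x = complex_of_real (fconst TYPE('a)) * (\<integral>y. cnj (b y) * fourier (\<lambda>\<xi>. cnj (ek \<xi> y) * ?gr \<xi>) x \<partial>lborel)"
        by (subst fourier_ek) simp
      also have "(\<integral>y. cnj (b y) * fourier (\<lambda>\<xi>. cnj (ek \<xi> y) * ?gr \<xi>) x \<partial>lborel)
           = (\<integral>y. cnj (b y) * complex_of_real (r ^ DIM('a) * gauss (r *\<^sub>R (x - y))) \<partial>lborel)"
        by (simp only: gauss_translate_fourier[OF r])
      also have "\<dots> = (\<integral>z. cnj (b (x - z /\<^sub>R r)) * complex_of_real (gauss z) \<partial>lborel)"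
      proof -
        have "(\<integral>z. cnj (b (x - z /\<^sub>R r)) * complex_of_real (gauss z) \<partial>lborel)
          = r ^ DIM('a) *\<^sub>R (\<integral>y. cnj (b y) * complex_of_real (gauss (r *\<^sub>R (x - y))) \<partial>lborel)"
          using integral_lborel_affine[of "-r" "\<lambda>z. cnj (b (x - z /\<^sub>R r)) * complex_of_real (gauss z)" "r *\<^sub>R x"] r
          by (simp add: algebra_simps)
        then show ?thesis by (simp add: scaleR_conv_of_real mult.left_commute[of _ "complex_of_real r ^ _"])
      qed
      finally show ?thesis .
    qed
    have "ennreal (norm (\<integral>x. fourier b x * ?w x \<partial>lborel)) = ennreal (norm (\<integral>x. b x * fourier ?w x \<partial>lborel))"
      by (simp add: fourier_mult_formula[OF b w])
    also have "\<dots> \<le> (\<integral>\<^sup>+x. ennreal (norm (b x * fourier ?w x)) \<partial>lborel)"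
    proof (cases "integrable lborel (\<lambda>x. b x * fourier ?w x)")
      case True then show ?thesis by (rule integral_norm_bound_ennreal)
    qed (simp add: not_integrable_integral_eq)
    also have "\<dots> \<le> (\<integral>\<^sup>+x. \<integral>\<^sup>+z. ennreal (fconst TYPE('a)) * ennreal (gauss z) * (ennreal (norm (b x)) * ennreal (norm (b (x - z /\<^sub>R r)))) \<partial>lborel \<partial>lborel)"
    proof (rule nn_integral_mono)
      fix x
      have "ennreal (norm (\<integral>z. cnj (b (x - z /\<^sub>R r)) * complex_of_real (gauss z) \<partial>lborel)) \<le> (\<integral>\<^sup>+z. ennreal (norm (cnj (b (x - z /\<^sub>R r)) * complex_of_real (gauss z))) \<partial>lborel)"
      proof (cases "integrable lborel (\<lambda>z. cnj (b (x - z /\<^sub>R r)) * complex_of_real (gauss z))")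
        case True then show ?thesis by (rule integral_norm_bound_ennreal)
      qed (simp add: not_integrable_integral_eq)
      then have "ennreal (norm (b x * fourier ?w x)) \<le> ennreal (norm (b x)) * (ennreal (fconst TYPE('a)) * (\<integral>\<^sup>+z. ennreal (norm (cnj (b (x - z /\<^sub>R r)) * complex_of_real (gauss z))) \<partial>lborel))"
        unfolding Fw by (simp add: norm_mult ennreal_mult mult_left_mono)
      also have "\<dots> = (\<integral>\<^sup>+z. ennreal (fconst TYPE('a)) * ennreal (gauss z) * (ennreal (norm (b x)) * ennreal (norm (b (x - z /\<^sub>R r)))) \<partial>lborel)"
      proof -
        have e: "ennreal (norm (cnj (b (x - z /\<^sub>R r)) * complex_of_real (gauss z))) = ennreal (gauss z) * ennreal (norm (b (x - z /\<^sub>R r)))" for z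
          by (simp add: norm_mult ennreal_mult mult.commute)
        have "ennreal (norm (b x)) * (ennreal (fconst TYPE('a)) * (\<integral>\<^sup>+z. ennreal (norm (cnj (b (x - z /\<^sub>R r)) * complex_of_real (gauss z))) \<partial>lborel))
          = (\<integral>\<^sup>+z. (ennreal (norm (b x)) * ennreal (fconst TYPE('a))) * (ennreal (gauss z) * ennreal (norm (b (x - z /\<^sub>R r)))) \<partial>lborel)"
          unfolding e by (subst nn_integral_cmult) (auto simp: mult.assoc)
        then show ?thesis by (simp only: mult_ac)
      qed
      finally show "ennreal (norm (b x * fourier ?w x)) \<le> (\<integral>\<^sup>+z. ennreal (fconst TYPE('a)) * ennreal (gauss z) * (ennreal (norm (b x)) * ennreal (norm (b (x - z /\<^sub>R r)))) \<partial>lborel)" .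
    qed
    also have "\<dots> = (\<integral>\<^sup>+z. \<integral>\<^sup>+x. ennreal (fconst TYPE('a)) * ennreal (gauss z) * (ennreal (norm (b x)) * ennreal (norm (b (x - z /\<^sub>R r)))) \<partial>lborel \<partial>lborel)"
      by (rule lborel_pair.Fubini'[symmetric]) measurable
    also have "\<dots> \<le> (\<integral>\<^sup>+z. ennreal (fconst TYPE('a)) * ennreal (gauss (z::'a)) * ?I \<partial>lborel)"
    proof (rule nn_integral_mono)
      fix z :: 'a
      have half: "(\<integral>\<^sup>+x. ennreal ((norm (b x))\<^sup>2 / 2) \<partial>lborel) + (\<integral>\<^sup>+x. ennreal ((norm (b x))\<^sup>2 / 2) \<partial>lborel) = ?I"
        by (subst nn_integral_add[symmetric]) (auto simp: ennreal_plus[symmetric] simp del: ennreal_plus intro!: nn_integral_cong)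
      have "(\<integral>\<^sup>+x. ennreal (norm (b x)) * ennreal (norm (b (x - z /\<^sub>R r))) \<partial>lborel)
         \<le> (\<integral>\<^sup>+x. ennreal ((norm (b x))\<^sup>2 / 2) + ennreal ((norm (b (x - z /\<^sub>R r)))\<^sup>2 / 2) \<partial>lborel)"
        by (intro nn_integral_mono nn_mult_le_squares)
      also have "\<dots> = (\<integral>\<^sup>+x. ennreal ((norm (b x))\<^sup>2 / 2) \<partial>lborel) + (\<integral>\<^sup>+x. ennreal ((norm (b (x - z /\<^sub>R r)))\<^sup>2 / 2) \<partial>lborel)"
        by (rule nn_integral_add) auto
      also have "(\<integral>\<^sup>+x. ennreal ((norm (b (x - z /\<^sub>R r)))\<^sup>2 / 2) \<partial>lborel) = (\<integral>\<^sup>+x. ennreal ((norm (b x))\<^sup>2 / 2) \<partial>lborel)"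
        by (rule nn_integral_lborel_shift(3)[of "\<lambda>x. ennreal ((norm (b x))\<^sup>2 / 2)"]) simp
      finally have "(\<integral>\<^sup>+x. ennreal (norm (b x)) * ennreal (norm (b (x - z /\<^sub>R r))) \<partial>lborel) \<le> ?I" unfolding half .
      then show "(\<integral>\<^sup>+x. ennreal (fconst TYPE('a)) * ennreal (gauss z) * (ennreal (norm (b x)) * ennreal (norm (b (x - z /\<^sub>R r)))) \<partial>lborel)
           \<le> ennreal (fconst TYPE('a)) * ennreal (gauss z) * ?I"
        by (subst nn_integral_cmult) (auto intro!: mult_left_mono)
    qed
    also have "\<dots> = ennreal (fconst TYPE('a)) * ennreal (\<integral>z. gauss (z::'a) \<partial>lborel) * ?I"
      by (simp add: nn_integral_multc nn_integral_cmult nn_integral_eq_integral gauss_pos less_imp_le)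
    also have "\<dots> = ?I"
      by (subst ennreal_mult[symmetric]) (auto simp: integral_gauss gauss_pos less_imp_le)
    finally show ?thesis unfolding real .
  qed
  have lim: "(\<lambda>n. (norm (fourier b x))\<^sup>2 * gauss (x /\<^sub>R real (Suc n))) \<longlonglongrightarrow> (norm (fourier b x))\<^sup>2" for x :: 'a
  proof -
    have "(\<lambda>n. inverse (real (Suc n)) *\<^sub>R x) \<longlonglongrightarrow> 0 *\<^sub>R x"
      by (intro tendsto_intros LIMSEQ_inverse_real_of_nat)
    moreover have "isCont gauss (0::'a)" using continuous_gauss[of "UNIV :: 'a set"] by (simp add: continuous_on_eq_continuous_at)
    ultimately have "(\<lambda>n. gauss (x /\<^sub>R real (Suc n))) \<longlonglongrightarrow> gauss (0::'a)"
      by (intro isCont_tendsto_compose[where g=gauss]) auto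
    then have "(\<lambda>n. (norm (fourier b x))\<^sup>2 * gauss (x /\<^sub>R real (Suc n))) \<longlonglongrightarrow> (norm (fourier b x))\<^sup>2 * gauss (0::'a)"
      by (intro tendsto_intros)
    then show ?thesis by (simp add: gauss_0)
  qed
  have "(\<integral>\<^sup>+x. ennreal ((norm (fourier b x))\<^sup>2) \<partial>lborel) = (\<integral>\<^sup>+x. liminf (\<lambda>n. ennreal ((norm (fourier b x))\<^sup>2 * gauss (x /\<^sub>R real (Suc n)))) \<partial>lborel)"
    by (intro nn_integral_cong lim_imp_Liminf[symmetric] tendsto_ennrealI lim) simp
  also have "\<dots> \<le> liminf (\<lambda>n. \<integral>\<^sup>+x. ennreal ((norm (fourier b x))\<^sup>2 * gauss (x /\<^sub>R real (Suc n))) \<partial>lborel)"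
    by (rule nn_integral_liminf) measurable
  also have "\<dots> \<le> ?I"
    by (rule Liminf_le) (auto intro!: always_eventually step)
  finally show ?thesis .
qed

lemma sq_int_iff_nn: "sq_int f \<longleftrightarrow> f \<in> borel_measurable borel \<and> (\<integral>\<^sup>+x. ennreal ((norm (f x))\<^sup>2) \<partial>lborel) < \<infinity>"
  for f :: "'a::euclidean_space \<Rightarrow> complex"
  unfolding sq_int_def integrable_iff_bounded by (auto)

lemma sq_int_fourier: "integrable lborel b \<Longrightarrow> sq_int b \<Longrightarrow> sq_int (fourier b)"
  using fourier_bessel[of b] by (auto simp: sq_int_iff_nn less_top[symmetric] top_unique)

lemma sq_int_gauss_shift: "sq_int (\<lambda>\<xi>::'a::euclidean_space. complex_of_real (gauss (\<xi> - y)))"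
proof -
  have "integrable lborel (\<lambda>\<xi>::'a. gauss (\<xi> - y))"
    using integrable_gauss_real integrable_lborel_shift(3)[of gauss y] by blast
  then have "integrable lborel (\<lambda>\<xi>. (gauss (\<xi> - y))\<^sup>2)"
    by (rule Bochner_Integration.integrable_bound) (auto simp: power2_eq_square gauss_le1 intro!: mult_left_le)
  then show ?thesis by (auto simp: sq_int_def)
qed

text \<open>The merely measurable \<open>f\<close> becomes integrable after multiplication by a
  Gaussian. Testing with translated Gaussians, whose transforms are modulated Gaussians, shows that
  \<open>f\<close> and \<open>ifourier F\<close>, each multiplied by the Gaussian, have the same
  transform. Uniqueness in L1 applies, and the positive factor cancels.\<close>

lemma fourier_inversion_AE:
  fixes f F :: "'a::euclidean_space \<Rightarrow> complex"
  assumes f[measurable]: "f \<in> borel_measurable borel" and F: "integrable lborel F"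
    and FT: "\<And>\<psi>. integrable lborel \<psi> \<Longrightarrow> sq_int \<psi> \<Longrightarrow> integrable lborel (\<lambda>x. f x * fourier \<psi> x) \<and>
        (\<integral>x. f x * fourier \<psi> x \<partial>lborel) = (\<integral>\<xi>. F \<xi> * \<psi> \<xi> \<partial>lborel)"
  shows "AE x in lborel. f x = ifourier F x"
proof -
  have [measurable]: "F \<in> borel_measurable borel" using F by auto
  let ?g = "\<lambda>x::'a. complex_of_real (gauss x)"
  let ?s = "\<lambda>y \<xi>::'a. ?g (\<xi> - y)"
  have s: "integrable lborel (?s y)" for y
    using integrable_gauss integrable_lborel_shift(3)[of ?g y] by blast
  have Fs: "fourier (?s y) x = ek x y * ?g x" for x y
    using fourier_shift[of ?g y x] by (simp add: fourier_gauss)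
  have fg: "integrable lborel (\<lambda>x. f x * (ek x y * ?g x))" "(\<integral>x. f x * (ek x y * ?g x) \<partial>lborel) = (\<integral>\<xi>. F \<xi> * ?s y \<xi> \<partial>lborel)" for y
    using FT[OF s sq_int_gauss_shift, of y] unfolding Fs by auto
  have iFg: "integrable lborel (\<lambda>x. ifourier F x * (ek x y * ?g x))" for y
    by (rule integrable_bounded_mult[OF integrable_ek(1)[OF integrable_gauss]]) (auto intro!: norm_ifourier_le)
  have iF: "(\<integral>x. ifourier F x * (ek x y * ?g x) \<partial>lborel) = (\<integral>\<xi>. F \<xi> * ?s y \<xi> \<partial>lborel)" for y
  proof -
    have "(\<integral>x. ifourier F x * (ek x y * ?g x) \<partial>lborel) = (\<integral>x. fourier F x * (cnj (ek x y) * ?g x) \<partial>lborel)"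
      using integral_lborel_reflect(2)[of "\<lambda>x. ifourier F x * (ek x y * ?g x)"]
      by (simp add: ifourier_def ek_uminus_left gauss_minus)
    also have "\<dots> = (\<integral>x. F x * fourier (\<lambda>x. cnj (ek x y) * ?g x) x \<partial>lborel)"
      by (intro fourier_mult_formula F integrable_ek integrable_gauss)
    also have "\<dots> = (\<integral>\<xi>. F \<xi> * ?s y \<xi> \<partial>lborel)"
      by (simp add: fourier_modulate fourier_gauss)
    finally show ?thesis .
  qed
  let ?h = "\<lambda>x. f x * ?g x - ifourier F x * ?g x"
  have "AE x in lborel. ?h x = 0"
  proof (rule fourier_L1_inj)
    show "integrable lborel ?h" using fg(1)[of 0] iFg[of 0] by simp
    fix y :: 'a
    have "(\<integral>x. ek x y * ?h x \<partial>lborel) = (\<integral>x. f x * (ek x y * ?g x) - ifourier F x * (ek x y * ?g x) \<partial>lborel)"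
      by (simp add: algebra_simps)
    also have "\<dots> = 0" by (subst Bochner_Integration.integral_diff) (use fg iFg iF in auto)
    finally show "fourier ?h y = 0" by (simp add: fourier_ek)
  qed
  then show ?thesis
  proof eventually_elim
    case (elim x)
    then have "(f x - ifourier F x) * ?g x = 0" by (simp add: algebra_simps)
    then show ?case using gauss_pos[of x] by simp
  qed
qed

section \<open>Differentiation of Fourier transforms\<close>

lemma norm_iexp_bounds:
  "cmod (exp (- \<i> * complex_of_real t) - 1) \<le> \<bar>t\<bar>"
  "cmod (exp (- \<i> * complex_of_real t) - 1 + \<i> * complex_of_real t) \<le> t\<^sup>2 / 2"
  using iexp_approx1[of "- t" 0] iexp_approx1[of "- t" 1] by (auto simp: numeral_2_eq_2 power2_eq_square diff_diff_eq2 add_diff_eq diff_add_eq)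

text \<open>Differentiation under the integral sign: the first-order bound on the exponential
  dominates the difference quotients by |\<xi> \<bullet> e| |b|, and the second-order bound gives
  their pointwise limit.\<close>

lemma fourier_has_vector_derivative:
  fixes b :: "'a::euclidean_space \<Rightarrow> complex"
  assumes b: "integrable lborel b" and eb: "integrable lborel (\<lambda>\<xi>. complex_of_real (\<xi> \<bullet> e) * b \<xi>)"
  shows "((\<lambda>h. fourier b (x + h *\<^sub>R e)) has_vector_derivative fourier (\<lambda>\<xi>. - \<i> * complex_of_real (\<xi> \<bullet> e) * b \<xi>) x) (at 0)"
proof -
  have [measurable]: "b \<in> borel_measurable borel" using b by auto
  let ?D = "fourier (\<lambda>\<xi>. - \<i> * complex_of_real (\<xi> \<bullet> e) * b \<xi>) x"
  let ?q = "\<lambda>h. (fourier b (x + h *\<^sub>R e) - fourier b x) / complex_of_real h"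
  have "(?q \<longlongrightarrow> ?D) (at 0)"
    unfolding tendsto_at_iff_sequentially
  proof (intro allI impI)
    fix X :: "nat \<Rightarrow> real" assume "\<forall>i. X i \<in> UNIV - {0}" and X: "X \<longlonglongrightarrow> 0"
    then have nz: "X i \<noteq> 0" for i by auto
    let ?k = "\<lambda>h \<xi>. (ek \<xi> (h *\<^sub>R e) - 1) / complex_of_real h"
    have e: "ek \<xi> (h *\<^sub>R e) = exp (- \<i> * complex_of_real (h * (\<xi> \<bullet> e)))" for \<xi> h
      by (simp add: ek_def)
    have eq: "?q h = complex_of_real (fconst TYPE('a)) * (\<integral>\<xi>. ?k h \<xi> * (ek \<xi> x * b \<xi>) \<partial>lborel)" for h
    proof -
      have "(\<integral>\<xi>. ?k h \<xi> * (ek \<xi> x * b \<xi>) \<partial>lborel) = (\<integral>\<xi>. (ek \<xi> (x + h *\<^sub>R e) * b \<xi> - ek \<xi> x * b \<xi>) / complex_of_real h \<partial>lborel)"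
        by (intro Bochner_Integration.integral_cong) (auto simp: ek_add_right diff_divide_distrib algebra_simps)
      also have "\<dots> = ((\<integral>\<xi>. ek \<xi> (x + h *\<^sub>R e) * b \<xi> \<partial>lborel) - (\<integral>\<xi>. ek \<xi> x * b \<xi> \<partial>lborel)) / complex_of_real h"
        by (simp add: integrable_ek b)
      finally show ?thesis unfolding fourier_ek by (simp only: right_diff_distrib diff_divide_distrib times_divide_eq_right)
    qed
    have "(\<lambda>n. \<integral>\<xi>. ?k (X n) \<xi> * (ek \<xi> x * b \<xi>) \<partial>lborel) \<longlonglongrightarrow> (\<integral>\<xi>. (- \<i> * complex_of_real (\<xi> \<bullet> e)) * (ek \<xi> x * b \<xi>) \<partial>lborel)"
    proof (rule integral_dominated_convergence[where w="\<lambda>\<xi>. norm (complex_of_real (\<xi> \<bullet> e) * b \<xi>)"])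
      show "AE \<xi> in lborel. (\<lambda>n. ?k (X n) \<xi> * (ek \<xi> x * b \<xi>)) \<longlonglongrightarrow> (- \<i> * complex_of_real (\<xi> \<bullet> e)) * (ek \<xi> x * b \<xi>)"
      proof (intro AE_I2 tendsto_mult_right)
        fix \<xi> :: 'a
        let ?s = "\<xi> \<bullet> e"
        show "(\<lambda>n. ?k (X n) \<xi>) \<longlonglongrightarrow> - \<i> * complex_of_real ?s"
        proof (rule LIM_zero_cancel, rule Lim_null_comparison)
          show "\<forall>\<^sub>F n in sequentially. norm (?k (X n) \<xi> - - \<i> * complex_of_real ?s) \<le> \<bar>X n\<bar> * (?s\<^sup>2 / 2)"
          proof (intro always_eventually allI)
            fix n
            have "?k (X n) \<xi> - - \<i> * complex_of_real ?s = (exp (- \<i> * complex_of_real (X n * ?s)) - 1 + \<i> * complex_of_real (X n * ?s)) / complex_of_real (X n)"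
              using nz[of n] by (simp add: e divide_simps)
            then have "norm (?k (X n) \<xi> - - \<i> * complex_of_real ?s) \<le> (X n * ?s)\<^sup>2 / 2 / \<bar>X n\<bar>"
              using divide_right_mono[OF norm_iexp_bounds(2)[of "X n * ?s"], of "\<bar>X n\<bar>"] by (simp only: norm_divide norm_of_real abs_ge_zero)
            also have "\<dots> = \<bar>X n\<bar> * (?s\<^sup>2 / 2)"
            proof -
              have "(X n * ?s)\<^sup>2 = \<bar>X n\<bar> * (\<bar>X n\<bar> * ?s\<^sup>2)"
                by (simp add: power_mult_distrib power2_eq_square mult.assoc[symmetric])
              then show ?thesis using nz[of n] by simp
            qed
            finally show "norm (?k (X n) \<xi> - - \<i> * complex_of_real ?s) \<le> \<bar>X n\<bar> * (?s\<^sup>2 / 2)" .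
          qed
          have "(\<lambda>n. \<bar>X n\<bar> * (?s\<^sup>2 / 2)) \<longlonglongrightarrow> \<bar>0\<bar> * (?s\<^sup>2 / 2)" by (intro tendsto_intros X)
          then show "(\<lambda>n. \<bar>X n\<bar> * (?s\<^sup>2 / 2)) \<longlonglongrightarrow> 0" by simp
        qed
      qed
      show "AE \<xi> in lborel. norm (?k (X n) \<xi> * (ek \<xi> x * b \<xi>)) \<le> norm (complex_of_real (\<xi> \<bullet> e) * b \<xi>)" for n
      proof (intro AE_I2)
        fix \<xi> :: 'a
        have "norm (?k (X n) \<xi>) \<le> \<bar>X n * (\<xi> \<bullet> e)\<bar> / \<bar>X n\<bar>"
          using norm_iexp_bounds(1)[of "X n * (\<xi> \<bullet> e)"] by (simp add: e norm_divide divide_right_mono)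
        also have "\<dots> = \<bar>\<xi> \<bullet> e\<bar>" using nz[of n] by (simp add: abs_mult)
        finally show "norm (?k (X n) \<xi> * (ek \<xi> x * b \<xi>)) \<le> norm (complex_of_real (\<xi> \<bullet> e) * b \<xi>)"
          unfolding norm_mult norm_ek norm_of_real mult_1 by (rule mult_right_mono) simp
      qed
    qed (use eb in auto)
    then have "(\<lambda>n. ?q (X n)) \<longlonglongrightarrow> complex_of_real (fconst TYPE('a)) * (\<integral>\<xi>. (- \<i> * complex_of_real (\<xi> \<bullet> e)) * (ek \<xi> x * b \<xi>) \<partial>lborel)"
      unfolding eq by (intro tendsto_intros)
    also have "(\<integral>\<xi>. (- \<i> * complex_of_real (\<xi> \<bullet> e)) * (ek \<xi> x * b \<xi>) \<partial>lborel) = (\<integral>\<xi>. ek \<xi> x * (- \<i> * complex_of_real (\<xi> \<bullet> e) * b \<xi>) \<partial>lborel)"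
      by (intro Bochner_Integration.integral_cong) (auto simp: mult_ac)
    finally show "(?q \<circ> X) \<longlonglongrightarrow> ?D" unfolding fourier_ek o_def .
  qed
  then have "((\<lambda>h. norm (?q h - ?D)) \<longlongrightarrow> 0) (at 0)"
    by (intro tendsto_norm_zero LIM_zero)
  moreover have "\<forall>\<^sub>F h in at 0. norm (?q h - ?D) = norm (fourier b (x + (0 + h) *\<^sub>R e) - fourier b (x + 0 *\<^sub>R e) - h *\<^sub>R ?D) / norm h"
  proof (rule eventually_at_filter[THEN iffD2], intro always_eventually allI impI)
    fix h :: real assume h: "h \<noteq> 0"
    have "fourier b (x + (0 + h) *\<^sub>R e) - fourier b (x + 0 *\<^sub>R e) - h *\<^sub>R ?D = (?q h - ?D) * complex_of_real h"
      using h by (simp add: field_simps scaleR_conv_of_real)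
    then show "norm (?q h - ?D) = norm (fourier b (x + (0 + h) *\<^sub>R e) - fourier b (x + 0 *\<^sub>R e) - h *\<^sub>R ?D) / norm h"
      using h by (simp add: norm_mult)
  qed
  ultimately show ?thesis
    unfolding has_vector_derivative_def has_derivative_at
    by (auto intro!: bounded_linear_scaleR_left elim: Lim_transform_eventually)
qed

section \<open>Convolutions and products on the Fourier side\<close>

lemma norm_integral_le_nn:
  fixes f :: "'a \<Rightarrow> 'b::{banach, second_countable_topology}"
  shows "ennreal (norm (\<integral>x. f x \<partial>M)) \<le> (\<integral>\<^sup>+x. ennreal (norm (f x)) \<partial>M)"
proof (cases "integrable M f")
  case True then show ?thesis by (rule integral_norm_bound_ennreal)
qed (simp add: not_integrable_integral_eq)

text \<open>Size estimates are carried out for convolutions with values in [0,\<infinity>], where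
  Tonelli and Cauchy-Schwarz hold unconditionally. The complex \<open>cconv\<close> carries the
  identities, and \<open>nm_cconv_le\<close> connects the two.\<close>

definition nconv :: "('a::euclidean_space \<Rightarrow> ennreal) \<Rightarrow> ('a \<Rightarrow> ennreal) \<Rightarrow> 'a \<Rightarrow> ennreal" where
  "nconv f g \<xi> = (\<integral>\<^sup>+\<eta>. f \<eta> * g (\<xi> - \<eta>) \<partial>lborel)"

definition cconv :: "('a::euclidean_space \<Rightarrow> complex) \<Rightarrow> ('a \<Rightarrow> complex) \<Rightarrow> 'a \<Rightarrow> complex" where
  "cconv f g \<xi> = (\<integral>\<eta>. f \<eta> * g (\<xi> - \<eta>) \<partial>lborel)"

abbreviation nm :: "('a \<Rightarrow> complex) \<Rightarrow> 'a \<Rightarrow> ennreal" where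
  "nm f \<equiv> \<lambda>x. ennreal (norm (f x))"

lemma measurable_nconv [measurable]:
  assumes [measurable]: "f \<in> borel_measurable borel" "g \<in> borel_measurable borel"
  shows "nconv f g \<in> borel_measurable borel"
  unfolding nconv_def by (rule lborel.borel_measurable_nn_integral) measurable

lemma measurable_cconv [measurable]:
  assumes [measurable]: "f \<in> borel_measurable borel" "g \<in> borel_measurable borel"
  shows "cconv f g \<in> borel_measurable borel"
  unfolding cconv_def by (rule lborel.borel_measurable_lebesgue_integral) measurable

lemma nm_cconv_le: "nm (cconv f g) \<xi> \<le> nconv (nm f) (nm g) \<xi>"
  using norm_integral_le_nn[of lborel "\<lambda>\<eta>. f \<eta> * g (\<xi> - \<eta>)"]
  by (simp add: cconv_def nconv_def norm_mult ennreal_mult)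

lemma nn_integral_nconv:
  assumes [measurable]: "f \<in> borel_measurable borel" "g \<in> borel_measurable borel"
  shows "(\<integral>\<^sup>+\<xi>. nconv f g \<xi> \<partial>lborel) = (\<integral>\<^sup>+\<xi>. f \<xi> \<partial>lborel) * (\<integral>\<^sup>+\<xi>. g \<xi> \<partial>lborel)"
proof -
  have "(\<integral>\<^sup>+\<xi>. nconv f g \<xi> \<partial>lborel) = (\<integral>\<^sup>+\<eta>. \<integral>\<^sup>+\<xi>. f \<eta> * g (\<xi> - \<eta>) \<partial>lborel \<partial>lborel)"
    unfolding nconv_def by (rule lborel_pair.Fubini') measurable
  also have "\<dots> = (\<integral>\<^sup>+\<eta>. f \<eta> * (\<integral>\<^sup>+\<xi>. g \<xi> \<partial>lborel) \<partial>lborel)"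
    by (simp add: nn_integral_cmult nn_integral_lborel_shift)
  finally show ?thesis by (simp add: nn_integral_multc)
qed

lemma ennreal_mult_le_squares: "2 * (a * b) \<le> a\<^sup>2 + b\<^sup>2" for a b :: ennreal
proof (cases a; cases b)
  fix x y assume a: "a = ennreal x" "0 \<le> x" and b: "b = ennreal y" "0 \<le> y"
  have "2 * (x * y) \<le> x\<^sup>2 + y\<^sup>2" using sum_squares_bound[of x y] by simp
  then have "ennreal (2 * (x * y)) \<le> ennreal (x\<^sup>2 + y\<^sup>2)" by (rule ennreal_leI)
  then show ?thesis using a b by (simp add: ennreal_mult ennreal_power ennreal_plus)
qed (auto simp: power2_eq_square ennreal_top_mult ennreal_mult_top)

text \<open>Young's inequality for L1 and L2. Expanding the square yields an integral over two
  shifts of the correlation of \<open>g\<close> with itself, and each correlation is at most the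
  integral of g^2 because 2ab \<le> a^2 + b^2.\<close>

lemma young_L2:
  assumes [measurable]: "f \<in> borel_measurable borel" "g \<in> borel_measurable borel"
  shows "(\<integral>\<^sup>+\<xi>. (nconv f g \<xi>)\<^sup>2 \<partial>lborel) \<le> (\<integral>\<^sup>+\<xi>. f \<xi> \<partial>lborel)\<^sup>2 * (\<integral>\<^sup>+\<xi>. (g \<xi>)\<^sup>2 \<partial>lborel)"
proof -
  let ?G = "\<integral>\<^sup>+\<xi>. (g \<xi>)\<^sup>2 \<partial>lborel"
  have sq: "(nconv f g \<xi>)\<^sup>2 = (\<integral>\<^sup>+\<eta>. \<integral>\<^sup>+\<zeta>. f \<eta> * f \<zeta> * (g (\<xi> - \<eta>) * g (\<xi> - \<zeta>)) \<partial>lborel \<partial>lborel)" for \<xi>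
  proof -
    have "(\<integral>\<^sup>+\<zeta>. f \<eta> * f \<zeta> * (g (\<xi> - \<eta>) * g (\<xi> - \<zeta>)) \<partial>lborel) = f \<eta> * g (\<xi> - \<eta>) * nconv f g \<xi>" for \<eta>
      unfolding nconv_def by (subst nn_integral_cmult[symmetric]) (auto simp: mult_ac)
    then show ?thesis
      by (simp add: nn_integral_multc power2_eq_square) (simp add: nconv_def)
  qed
  have in1: "(\<integral>\<^sup>+\<xi>. g (\<xi> - \<eta>) * g (\<xi> - \<zeta>) \<partial>lborel) \<le> ?G" for \<eta> \<zeta>
  proof -
    have "2 * (\<integral>\<^sup>+\<xi>. g (\<xi> - \<eta>) * g (\<xi> - \<zeta>) \<partial>lborel) = (\<integral>\<^sup>+\<xi>. 2 * (g (\<xi> - \<eta>) * g (\<xi> - \<zeta>)) \<partial>lborel)"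
      by (rule nn_integral_cmult[symmetric]) measurable
    also have "\<dots> \<le> (\<integral>\<^sup>+\<xi>. (g (\<xi> - \<eta>))\<^sup>2 + (g (\<xi> - \<zeta>))\<^sup>2 \<partial>lborel)"
      by (intro nn_integral_mono ennreal_mult_le_squares)
    also have "\<dots> = 2 * ?G"
      by (subst nn_integral_add) (auto simp: nn_integral_lborel_shift(3)[of "\<lambda>x. (g x)\<^sup>2"] mult_2)
    finally show ?thesis by (simp add: ennreal_mult_le_mult_iff)
  qed
  have "(\<integral>\<^sup>+\<xi>. (nconv f g \<xi>)\<^sup>2 \<partial>lborel) = (\<integral>\<^sup>+\<eta>. \<integral>\<^sup>+\<xi>. \<integral>\<^sup>+\<zeta>. f \<eta> * f \<zeta> * (g (\<xi> - \<eta>) * g (\<xi> - \<zeta>)) \<partial>lborel \<partial>lborel \<partial>lborel)"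
    unfolding sq by (rule lborel_pair.Fubini') measurable
  also have "\<dots> = (\<integral>\<^sup>+\<eta>. \<integral>\<^sup>+\<zeta>. \<integral>\<^sup>+\<xi>. f \<eta> * f \<zeta> * (g (\<xi> - \<eta>) * g (\<xi> - \<zeta>)) \<partial>lborel \<partial>lborel \<partial>lborel)"
    by (rule nn_integral_cong, rule lborel_pair.Fubini') measurable
  also have "\<dots> \<le> (\<integral>\<^sup>+\<eta>. \<integral>\<^sup>+\<zeta>. f \<eta> * f \<zeta> * ?G \<partial>lborel \<partial>lborel)"
    by (intro nn_integral_mono) (auto simp: nn_integral_cmult intro!: mult_left_mono in1)
  also have "\<dots> = (\<integral>\<^sup>+\<xi>. f \<xi> \<partial>lborel)\<^sup>2 * ?G"
    by (simp add: nn_integral_cmult nn_integral_multc power2_eq_square)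
  finally show ?thesis .
qed

lemma integrable_nm_iff: "integrable lborel f \<longleftrightarrow> f \<in> borel_measurable borel \<and> (\<integral>\<^sup>+x. nm f x \<partial>lborel) < \<infinity>"
  for f :: "'a::euclidean_space \<Rightarrow> complex"
  by (simp add: integrable_iff_bounded)

lemma sq_int_nm_iff: "sq_int f \<longleftrightarrow> f \<in> borel_measurable borel \<and> (\<integral>\<^sup>+x. (nm f x)\<^sup>2 \<partial>lborel) < \<infinity>"
  for f :: "'a::euclidean_space \<Rightarrow> complex"
  by (simp add: sq_int_iff_nn ennreal_power)

lemma integrable_cconv:
  assumes f: "integrable lborel f" and g: "integrable lborel g"
  shows "integrable lborel (cconv f g)"
proof -
  have [measurable]: "f \<in> borel_measurable borel" "g \<in> borel_measurable borel" using f g by auto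
  have "(\<integral>\<^sup>+x. nm (cconv f g) x \<partial>lborel) \<le> (\<integral>\<^sup>+x. nconv (nm f) (nm g) x \<partial>lborel)"
    by (intro nn_integral_mono nm_cconv_le)
  also have "\<dots> < \<infinity>" using f g by (simp add: nn_integral_nconv integrable_nm_iff ennreal_mult_less_top)
  finally show ?thesis by (simp add: integrable_nm_iff)
qed

lemma sq_nconv_finite:
  assumes f: "integrable lborel f" and g: "sq_int g"
  shows "(\<integral>\<^sup>+x. (nconv (nm f) (nm g) x)\<^sup>2 \<partial>lborel) < \<infinity>"
proof -
  have [measurable]: "f \<in> borel_measurable borel" "g \<in> borel_measurable borel" using f g by (auto simp: sq_int_def)
  have "(\<integral>\<^sup>+x. (nconv (nm f) (nm g) x)\<^sup>2 \<partial>lborel) \<le> (\<integral>\<^sup>+\<xi>. nm f \<xi> \<partial>lborel)\<^sup>2 * (\<integral>\<^sup>+\<xi>. (nm g \<xi>)\<^sup>2 \<partial>lborel)"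
    by (rule young_L2) measurable
  also have "\<dots> < \<infinity>" using f g by (auto simp: sq_int_nm_iff integrable_nm_iff ennreal_mult_less_top power_less_top_ennreal)
  finally show ?thesis .
qed

lemma sq_int_cconv:
  assumes f: "integrable lborel f" and g: "sq_int g"
  shows "sq_int (cconv f g)"
proof -
  have [measurable]: "f \<in> borel_measurable borel" "g \<in> borel_measurable borel" using f g by (auto simp: sq_int_def)
  have "(\<integral>\<^sup>+x. (nm (cconv f g) x)\<^sup>2 \<partial>lborel) \<le> (\<integral>\<^sup>+x. (nconv (nm f) (nm g) x)\<^sup>2 \<partial>lborel)"
    by (intro nn_integral_mono power_mono nm_cconv_le) simp
  also have "\<dots> < \<infinity>" by (rule sq_nconv_finite[OF f g])
  finally show ?thesis by (simp add: sq_int_nm_iff)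
qed

lemma nn_L2_pairing_finite:
  assumes [measurable]: "f \<in> borel_measurable M" "g \<in> borel_measurable M"
    and "(\<integral>\<^sup>+x. (f x)\<^sup>2 \<partial>M) < \<infinity>" "(\<integral>\<^sup>+x. (g x)\<^sup>2 \<partial>M) < \<infinity>"
  shows "(\<integral>\<^sup>+x. f x * g x \<partial>M) < (\<infinity>::ennreal)"
proof -
  have "(\<integral>\<^sup>+x. f x * g x \<partial>M)\<^sup>2 \<le> (\<integral>\<^sup>+x. (f x)\<^sup>2 \<partial>M) * (\<integral>\<^sup>+x. (g x)\<^sup>2 \<partial>M)"
    by (rule Cauchy_Schwarz_nn_integral) measurable
  also have "\<dots> < \<infinity>" using assms by (simp add: ennreal_mult_less_top)
  finally show ?thesis by (simp add: power_less_top_ennreal)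
qed

lemma integrable_sq_int_mult:
  fixes f g :: "'a::euclidean_space \<Rightarrow> complex"
  assumes "sq_int f" "sq_int g" shows "integrable lborel (\<lambda>x. f x * g x)"
  using nn_L2_pairing_finite[of "nm f" lborel "nm g"] assms
  by (auto simp: sq_int_nm_iff integrable_nm_iff norm_mult ennreal_mult)

lemma fourier_cconv:
  fixes f g :: "'a::euclidean_space \<Rightarrow> complex"
  assumes f: "integrable lborel f" and g: "integrable lborel g"
  shows "complex_of_real (fconst TYPE('a)) * fourier (cconv f g) x = fourier f x * fourier g x"
proof -
  have [measurable]: "f \<in> borel_measurable borel" "g \<in> borel_measurable borel" using f g by auto
  have int: "integrable (lborel \<Otimes>\<^sub>M lborel) (\<lambda>(\<xi>,\<eta>). ek \<xi> x * (f \<eta> * g (\<xi> - \<eta>)))"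
  proof (rule pair_integrableI)
    have "(\<integral>\<^sup>+\<xi>. \<integral>\<^sup>+\<eta>. ennreal (norm (ek \<xi> x * (f \<eta> * g (\<xi> - \<eta>)))) \<partial>lborel \<partial>lborel) = (\<integral>\<^sup>+\<xi>. nconv (nm f) (nm g) \<xi> \<partial>lborel)"
      by (simp add: nconv_def norm_mult ennreal_mult)
    also have "\<dots> < \<infinity>" using f g by (simp add: nn_integral_nconv integrable_nm_iff ennreal_mult_less_top)
    finally show "(\<integral>\<^sup>+\<xi>. \<integral>\<^sup>+\<eta>. ennreal (norm (ek \<xi> x * (f \<eta> * g (\<xi> - \<eta>)))) \<partial>lborel \<partial>lborel) < \<infinity>" .
  qed measurable
  have "(\<integral>\<xi>. ek \<xi> x * cconv f g \<xi> \<partial>lborel) = (\<integral>\<xi>. (\<integral>\<eta>. ek \<xi> x * (f \<eta> * g (\<xi> - \<eta>)) \<partial>lborel) \<partial>lborel)"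
    by (simp only: cconv_def integral_mult_right_zero)
  also have "\<dots> = (\<integral>\<eta>. (\<integral>\<xi>. ek \<xi> x * (f \<eta> * g (\<xi> - \<eta>)) \<partial>lborel) \<partial>lborel)"
    using lborel_pair.Fubini_integral[OF int] by simp
  also have "\<dots> = (\<integral>\<eta>. ek \<eta> x * f \<eta> * (\<integral>\<xi>. ek \<xi> x * g \<xi> \<partial>lborel) \<partial>lborel)"
  proof -
    have "(\<integral>\<xi>. ek \<xi> x * (f \<eta> * g (\<xi> - \<eta>)) \<partial>lborel) = ek \<eta> x * f \<eta> * (\<integral>\<xi>. ek \<xi> x * g \<xi> \<partial>lborel)" for \<eta>
    proof -
      have "(\<integral>\<xi>. ek \<xi> x * (f \<eta> * g (\<xi> - \<eta>)) \<partial>lborel) = (\<integral>\<xi>. ek (\<xi> + \<eta>) x * (f \<eta> * g \<xi>) \<partial>lborel)"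
        using integral_lborel_shift(3)[of "\<lambda>\<xi>. ek (\<xi> + \<eta>) x * (f \<eta> * g \<xi>)" \<eta>] by simp
      also have "\<dots> = (\<integral>\<xi>. ek \<eta> x * f \<eta> * (ek \<xi> x * g \<xi>) \<partial>lborel)"
        by (intro Bochner_Integration.integral_cong) (auto simp: ek_add_left)
      finally show ?thesis by (simp only: integral_mult_right_zero)
    qed
    then show ?thesis by simp
  qed
  also have "\<dots> = (\<integral>\<eta>. ek \<eta> x * f \<eta> \<partial>lborel) * (\<integral>\<xi>. ek \<xi> x * g \<xi> \<partial>lborel)"
    by (rule integral_mult_left_zero)
  finally show ?thesis by (simp add: fourier_ek)
qed

text \<open>Fubini for the trilinear form in \<open>U\<close>, \<open>V\<close> and
  \<open>\<psi>\<close>, followed by the shift of \<xi> by \<eta>. The assumption is absolute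
  convergence of this form rather than membership in Lebesgue spaces, because \<open>V\<close> is in
  L2 in some applications and only locally integrable in others.\<close>

lemma cconv_adjoint:
  fixes U V \<psi> :: "'a::euclidean_space \<Rightarrow> complex"
  assumes [measurable]: "U \<in> borel_measurable borel" "V \<in> borel_measurable borel" "\<psi> \<in> borel_measurable borel"
    and fin: "(\<integral>\<^sup>+\<xi>. nconv (nm U) (nm V) \<xi> * nm \<psi> \<xi> \<partial>lborel) < \<infinity>"
  shows "integrable lborel (\<lambda>\<xi>. cconv U V \<xi> * \<psi> \<xi>)"
    "integrable lborel (\<lambda>\<xi>. V \<xi> * cconv (\<lambda>\<eta>. U (- \<eta>)) \<psi> \<xi>)"
    "(\<integral>\<xi>. V \<xi> * cconv (\<lambda>\<eta>. U (- \<eta>)) \<psi> \<xi> \<partial>lborel) = (\<integral>\<xi>. cconv U V \<xi> * \<psi> \<xi> \<partial>lborel)"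
proof -
  let ?J = "\<lambda>\<xi> \<eta>. U \<eta> * V (\<xi> - \<eta>) * \<psi> \<xi>"
  let ?K = "\<lambda>\<xi> \<eta>. U \<eta> * V \<xi> * \<psi> (\<xi> + \<eta>)"
  have nJ: "(\<integral>\<^sup>+\<xi>. \<integral>\<^sup>+\<eta>. ennreal (norm (?J \<xi> \<eta>)) \<partial>lborel \<partial>lborel) = (\<integral>\<^sup>+\<xi>. nconv (nm U) (nm V) \<xi> * nm \<psi> \<xi> \<partial>lborel)"
    by (simp add: nconv_def norm_mult ennreal_mult nn_integral_multc)
  have iJ: "integrable (lborel \<Otimes>\<^sub>M lborel) (\<lambda>(\<xi>,\<eta>). ?J \<xi> \<eta>)"
    by (rule pair_integrableI) (use fin nJ in auto)
  have nK: "(\<integral>\<^sup>+\<xi>. \<integral>\<^sup>+\<eta>. ennreal (norm (?K \<xi> \<eta>)) \<partial>lborel \<partial>lborel) = (\<integral>\<^sup>+\<xi>. \<integral>\<^sup>+\<eta>. ennreal (norm (?J \<xi> \<eta>)) \<partial>lborel \<partial>lborel)"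
  proof -
    have "(\<integral>\<^sup>+\<xi>. \<integral>\<^sup>+\<eta>. ennreal (norm (?K \<xi> \<eta>)) \<partial>lborel \<partial>lborel) = (\<integral>\<^sup>+\<eta>. \<integral>\<^sup>+\<xi>. ennreal (norm (?K \<xi> \<eta>)) \<partial>lborel \<partial>lborel)"
      by (rule lborel_pair.Fubini') measurable
    also have "\<dots> = (\<integral>\<^sup>+\<eta>. \<integral>\<^sup>+\<xi>. ennreal (norm (?J \<xi> \<eta>)) \<partial>lborel \<partial>lborel)"
    proof (rule nn_integral_cong)
      fix \<eta>
      show "(\<integral>\<^sup>+\<xi>. ennreal (norm (?K \<xi> \<eta>)) \<partial>lborel) = (\<integral>\<^sup>+\<xi>. ennreal (norm (?J \<xi> \<eta>)) \<partial>lborel)"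
        using nn_integral_lborel_shift(2)[of "\<lambda>\<xi>. ennreal (norm (?J \<xi> \<eta>))" \<eta>] by simp
    qed
    also have "\<dots> = (\<integral>\<^sup>+\<xi>. \<integral>\<^sup>+\<eta>. ennreal (norm (?J \<xi> \<eta>)) \<partial>lborel \<partial>lborel)"
      by (rule lborel_pair.Fubini'[symmetric]) measurable
    finally show ?thesis .
  qed
  have iK: "integrable (lborel \<Otimes>\<^sub>M lborel) (\<lambda>(\<xi>,\<eta>). ?K \<xi> \<eta>)"
    by (rule pair_integrableI) (use fin nJ nK in auto)
  have cJ: "(\<integral>\<eta>. ?J \<xi> \<eta> \<partial>lborel) = cconv U V \<xi> * \<psi> \<xi>" for \<xi>
    by (simp add: cconv_def)
  have cK: "(\<integral>\<eta>. ?K \<xi> \<eta> \<partial>lborel) = V \<xi> * cconv (\<lambda>\<eta>. U (- \<eta>)) \<psi> \<xi>" for \<xi>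
  proof -
    have "cconv (\<lambda>\<eta>. U (- \<eta>)) \<psi> \<xi> = (\<integral>\<eta>. U \<eta> * \<psi> (\<xi> + \<eta>) \<partial>lborel)"
      using integral_lborel_reflect(2)[of "\<lambda>\<eta>. U \<eta> * \<psi> (\<xi> + \<eta>)"] by (simp add: cconv_def)
    then have "V \<xi> * cconv (\<lambda>\<eta>. U (- \<eta>)) \<psi> \<xi> = (\<integral>\<eta>. V \<xi> * (U \<eta> * \<psi> (\<xi> + \<eta>)) \<partial>lborel)" by simp
    also have "\<dots> = (\<integral>\<eta>. ?K \<xi> \<eta> \<partial>lborel)" by (intro Bochner_Integration.integral_cong) auto
    finally show ?thesis ..
  qed
  show "integrable lborel (\<lambda>\<xi>. cconv U V \<xi> * \<psi> \<xi>)"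
    using lborel_pair.integrable_fst'[OF iJ] unfolding prod.case cJ .
  show "integrable lborel (\<lambda>\<xi>. V \<xi> * cconv (\<lambda>\<eta>. U (- \<eta>)) \<psi> \<xi>)"
    using lborel_pair.integrable_fst'[OF iK] unfolding prod.case cK .
  have "(\<integral>\<xi>. (\<integral>\<eta>. ?K \<xi> \<eta> \<partial>lborel) \<partial>lborel) = (\<integral>\<eta>. (\<integral>\<xi>. ?K \<xi> \<eta> \<partial>lborel) \<partial>lborel)"
    using lborel_pair.Fubini_integral[OF iK] by simp
  also have "\<dots> = (\<integral>\<eta>. (\<integral>\<xi>. ?J \<xi> \<eta> \<partial>lborel) \<partial>lborel)"
  proof -
    have "(\<integral>\<xi>. ?K \<xi> \<eta> \<partial>lborel) = (\<integral>\<xi>. ?J \<xi> \<eta> \<partial>lborel)" for \<eta>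
      using integral_lborel_shift(2)[of "\<lambda>\<xi>. ?J \<xi> \<eta>" \<eta>] by simp
    then show ?thesis by simp
  qed
  also have "\<dots> = (\<integral>\<xi>. (\<integral>\<eta>. ?J \<xi> \<eta> \<partial>lborel) \<partial>lborel)"
    using lborel_pair.Fubini_integral[OF iJ] by simp
  finally show "(\<integral>\<xi>. V \<xi> * cconv (\<lambda>\<eta>. U (- \<eta>)) \<psi> \<xi> \<partial>lborel) = (\<integral>\<xi>. cconv U V \<xi> * \<psi> \<xi> \<partial>lborel)"
    unfolding cJ cK .
qed

text \<open>The convolution theorem; the reflection appears because \<open>ifourier\<close> is the
  transform at the opposite point.\<close>

lemma ifourier_mult_fourier:
  fixes U \<psi> :: "'a::euclidean_space \<Rightarrow> complex"
  assumes U: "integrable lborel U" and \<psi>: "integrable lborel \<psi>"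
  shows "ifourier U x * fourier \<psi> x = complex_of_real (fconst TYPE('a)) * fourier (cconv (\<lambda>\<eta>. U (- \<eta>)) \<psi>) x"
proof -
  have "integrable lborel (\<lambda>\<eta>. U (- \<eta>))" using U integrable_lborel_reflect(2) by blast
  from fourier_cconv[OF this \<psi>, of x] show ?thesis by (simp add: ifourier_def fourier_reflect)
qed

text \<open>By duality: on the test side the factor \<open>ifourier U\<close> turns
  \<open>\<psi>\<close> into a multiple of its convolution with the reflected \<open>U\<close>. This
  is again integrable and square integrable, hence an admissible test function for
  \<open>v\<close>.\<close>

lemma is_FT_mult:
  fixes v V U :: "'a::euclidean_space \<Rightarrow> complex"
  assumes FT: "is_FT v V" and U: "integrable lborel U"
  shows "is_FT (\<lambda>x. ifourier U x * v x) (\<lambda>\<xi>. complex_of_real (fconst TYPE('a)) * cconv U V \<xi>)"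
proof -
  have V: "sq_int V" and [measurable]: "v \<in> borel_measurable borel" using FT by (auto simp: is_FT_def)
  have [measurable]: "U \<in> borel_measurable borel" "V \<in> borel_measurable borel" using U V by (auto simp: sq_int_def)
  have U': "integrable lborel (\<lambda>\<eta>. U (- \<eta>))" using U integrable_lborel_reflect(2) by blast
  have "sq_int (\<lambda>\<xi>. complex_of_real (fconst TYPE('a)) * cconv U V \<xi>)"
    using sq_int_cconv[OF U V] by (auto simp: sq_int_def norm_mult power_mult_distrib)
  moreover have "integrable lborel (\<lambda>x. ifourier U x * v x * fourier \<psi> x) \<and>
    (\<integral>x. ifourier U x * v x * fourier \<psi> x \<partial>lborel) = (\<integral>\<xi>. complex_of_real (fconst TYPE('a)) * cconv U V \<xi> * \<psi> \<xi> \<partial>lborel)"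
    if \<psi>: "integrable lborel \<psi>" "sq_int \<psi>" for \<psi>
  proof -
    have [measurable]: "\<psi> \<in> borel_measurable borel" using \<psi> by auto
    let ?p = "cconv (\<lambda>\<eta>. U (- \<eta>)) \<psi>"
    have p: "integrable lborel ?p" "sq_int ?p" using integrable_cconv[OF U' \<psi>(1)] sq_int_cconv[OF U' \<psi>(2)] by auto
    have eq: "ifourier U x * v x * fourier \<psi> x = complex_of_real (fconst TYPE('a)) * (v x * fourier ?p x)" for x
      using ifourier_mult_fourier[OF U \<psi>(1), of x] by (simp add: mult_ac)
    have i: "integrable lborel (\<lambda>x. v x * fourier ?p x)" "(\<integral>x. v x * fourier ?p x \<partial>lborel) = (\<integral>\<xi>. V \<xi> * ?p \<xi> \<partial>lborel)"
      using FT p unfolding is_FT_def by auto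
    have "(\<integral>\<^sup>+\<xi>. nconv (nm U) (nm V) \<xi> * nm \<psi> \<xi> \<partial>lborel) < \<infinity>"
      using sq_nconv_finite[OF U V] \<psi>(2) by (intro nn_L2_pairing_finite) (auto simp: sq_int_nm_iff)
    note adj = cconv_adjoint[OF _ _ _ this]
    have "(\<integral>x. ifourier U x * v x * fourier \<psi> x \<partial>lborel) = complex_of_real (fconst TYPE('a)) * (\<integral>\<xi>. cconv U V \<xi> * \<psi> \<xi> \<partial>lborel)"
      unfolding eq integral_mult_right_zero i adj(3)[simplified] by simp
    also have "\<dots> = (\<integral>\<xi>. complex_of_real (fconst TYPE('a)) * cconv U V \<xi> * \<psi> \<xi> \<partial>lborel)"
      by (simp add: mult.assoc)
    finally show ?thesis using i unfolding eq by simp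
  qed
  ultimately show ?thesis unfolding is_FT_def by auto
qed

text \<open>Conjugation is moved onto the test function, which becomes its reflected
  conjugate.\<close>

lemma is_FT_cnj:
  fixes v V :: "'a::euclidean_space \<Rightarrow> complex"
  assumes FT: "is_FT v V"
  shows "is_FT (\<lambda>x. cnj (v x)) (\<lambda>\<xi>. cnj (V (- \<xi>)))"
proof -
  have V: "sq_int V" and [measurable]: "v \<in> borel_measurable borel" "V \<in> borel_measurable borel" using FT by (auto simp: is_FT_def sq_int_def)
  have "sq_int (\<lambda>\<xi>. cnj (V (- \<xi>)))"
    using V integrable_lborel_reflect(2)[of "\<lambda>x. (norm (V x))\<^sup>2"] by (auto simp: sq_int_def)
  moreover have "integrable lborel (\<lambda>x. cnj (v x) * fourier \<psi> x) \<and>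
    (\<integral>x. cnj (v x) * fourier \<psi> x \<partial>lborel) = (\<integral>\<xi>. cnj (V (- \<xi>)) * \<psi> \<xi> \<partial>lborel)"
    if \<psi>: "integrable lborel \<psi>" "sq_int \<psi>" for \<psi>
  proof -
    have [measurable]: "\<psi> \<in> borel_measurable borel" using \<psi> by auto
    let ?p = "\<lambda>x. cnj (\<psi> (- x))"
    have p: "integrable lborel ?p" "sq_int ?p"
      using \<psi> integrable_lborel_reflect(2)[of \<psi>] integrable_lborel_reflect(2)[of "\<lambda>x. (norm (\<psi> x))\<^sup>2"] by (auto simp: sq_int_def)
    have eq: "cnj (v x) * fourier \<psi> x = cnj (v x * fourier ?p x)" for x
      by (simp add: fourier_cnj_reflect)
    have i: "integrable lborel (\<lambda>x. v x * fourier ?p x)" "(\<integral>x. v x * fourier ?p x \<partial>lborel) = (\<integral>\<xi>. V \<xi> * ?p \<xi> \<partial>lborel)"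
      using FT p unfolding is_FT_def by auto
    have "(\<integral>x. cnj (v x) * fourier \<psi> x \<partial>lborel) = cnj (\<integral>\<xi>. V \<xi> * ?p \<xi> \<partial>lborel)"
      unfolding eq Bochner_Integration.integral_cnj i ..
    also have "\<dots> = (\<integral>\<xi>. cnj (V \<xi> * ?p \<xi>) \<partial>lborel)"
      by (rule Bochner_Integration.integral_cnj[symmetric])
    also have "\<dots> = (\<integral>\<xi>. cnj (V (- \<xi>)) * \<psi> \<xi> \<partial>lborel)"
      using integral_lborel_reflect(2)[of "\<lambda>\<xi>. cnj (V \<xi> * ?p \<xi>)"] by simp
    finally show ?thesis using integrable_cnj[OF i(1)] unfolding eq by simp
  qed
  ultimately show ?thesis unfolding is_FT_def by auto
qed

section \<open>Test functions\<close>

text \<open>The part of \<open>test_freq\<close> that concerns the function itself, with a radius in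
  place of a compact set. Integrability of the transform is kept apart, being the condition that
  needs an argument.\<close>

definition bounded_supp :: "('a::euclidean_space \<Rightarrow> complex) \<Rightarrow> bool" where
  "bounded_supp f \<longleftrightarrow> f \<in> borel_measurable borel \<and> (\<exists>C. \<forall>x. norm (f x) \<le> C) \<and> (\<exists>r. \<forall>x. r < norm x \<longrightarrow> f x = 0)"

lemma bounded_supp_mult_cont:
  fixes h :: "'a::euclidean_space \<Rightarrow> complex"
  assumes f: "bounded_supp f" and h: "continuous_on UNIV h"
  shows "bounded_supp (\<lambda>x. h x * f x)"
proof -
  from f obtain C r where C: "\<And>x. norm (f x) \<le> C" and r: "\<And>x. r < norm x \<Longrightarrow> f x = 0" by (auto simp: bounded_supp_def)
  have [measurable]: "f \<in> borel_measurable borel" "h \<in> borel_measurable borel"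
    using f h by (auto simp: bounded_supp_def borel_measurable_continuous_onI)
  have "compact (h ` cball 0 r)" by (intro compact_continuous_image continuous_on_subset[OF h]) auto
  then obtain B where B: "\<And>x. x \<in> cball 0 r \<Longrightarrow> norm (h x) \<le> B"
    by (metis bounded_iff compact_imp_bounded imageI)
  have "norm (h x * f x) \<le> \<bar>B\<bar> * C" for x
  proof (cases "r < norm x")
    case True
    have "0 \<le> C" using C[of x] norm_ge_zero order_trans by blast
    then show ?thesis using True r by simp
  next
    case False
    then have "norm (h x) \<le> \<bar>B\<bar>" using B[of x] by auto
    then show ?thesis using C[of x] by (simp add: norm_mult mult_mono)
  qed
  moreover have "\<And>x. r < norm x \<Longrightarrow> h x * f x = 0" using r by simp
  ultimately show ?thesis unfolding bounded_supp_def by (intro conjI exI[of _ "\<bar>B\<bar> * C"] exI[of _ r]) auto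
qed

lemma bounded_supp_integrable:
  fixes f :: "'a::euclidean_space \<Rightarrow> complex"
  assumes "bounded_supp f" shows "integrable lborel f" "sq_int f"
proof -
  have *: "integrable lborel f" if f: "bounded_supp f" for f :: "'a \<Rightarrow> complex"
  proof -
    from f obtain C r where C: "\<And>x. norm (f x) \<le> C" and r: "\<And>x. r < norm x \<Longrightarrow> f x = 0" by (auto simp: bounded_supp_def)
    have [measurable]: "f \<in> borel_measurable borel" using f by (auto simp: bounded_supp_def)
    have "integrable lborel (\<lambda>x. indicator (cball 0 r) x *\<^sub>R C)"
      by (intro integrable_real_indicator integrable_scaleR_left) (use emeasure_bounded_finite[of "cball 0 r"] in auto)
    then show ?thesis
    proof (rule Bochner_Integration.integrable_bound)
      show "AE x in lborel. norm (f x) \<le> norm (indicator (cball 0 r) x *\<^sub>R C)"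
        using C r by (intro AE_I2) (auto split: split_indicator intro: order_trans[OF C abs_ge_self])
    qed simp
  qed
  show "integrable lborel f" using * assms by blast
  have [measurable]: "f \<in> borel_measurable borel" using assms by (auto simp: bounded_supp_def)
  from assms obtain C where C: "\<And>x. norm (f x) \<le> C" by (auto simp: bounded_supp_def)
  have "integrable lborel (\<lambda>x. f x * f x)"
    by (rule integrable_bounded_mult[OF *[OF assms] _ C]) simp
  then have "integrable lborel (\<lambda>x. norm (f x * f x))" by (rule integrable_norm)
  then show "sq_int f" by (simp add: sq_int_def norm_mult power2_eq_square)
qed

lemma bounded_supp_cmult: "bounded_supp f \<Longrightarrow> bounded_supp (\<lambda>x. c * f x)"
  by (intro bounded_supp_mult_cont continuous_intros)

lemma bounded_supp_add:
  assumes "bounded_supp f" "bounded_supp g" shows "bounded_supp (\<lambda>x. f x + g x)"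
proof -
  from assms obtain C r D r' where "\<And>x. norm (f x) \<le> C" "\<And>x. r < norm x \<Longrightarrow> f x = 0"
    "\<And>x. norm (g x) \<le> D" "\<And>x. r' < norm x \<Longrightarrow> g x = 0" by (auto simp: bounded_supp_def)
  then show ?thesis using assms unfolding bounded_supp_def
    by (intro conjI exI[of _ "C + D"] exI[of _ "max r r'"] allI) (auto intro: norm_triangle_mono)
qed

lemma bounded_supp_cconv:
  fixes f g :: "'a::euclidean_space \<Rightarrow> complex"
  assumes f: "integrable lborel f" "\<And>x. r < norm x \<Longrightarrow> f x = 0" and g: "bounded_supp g"
  shows "bounded_supp (cconv f g)"
proof -
  from g obtain C r' where C: "\<And>x. norm (g x) \<le> C" and r': "\<And>x. r' < norm x \<Longrightarrow> g x = 0" by (auto simp: bounded_supp_def)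
  have [measurable]: "f \<in> borel_measurable borel" "g \<in> borel_measurable borel" using f g by (auto simp: bounded_supp_def)
  have "norm (cconv f g x) \<le> C * (\<integral>y. norm (f y) \<partial>lborel)" for x
  proof -
    have i: "integrable lborel (\<lambda>y. g (x - y) * f y)"
      by (rule integrable_bounded_mult[OF f(1)]) (auto intro: C)
    have "norm (cconv f g x) \<le> (\<integral>y. norm (f y * g (x - y)) \<partial>lborel)" unfolding cconv_def by (rule integral_norm_bound)
    also have "\<dots> \<le> (\<integral>y. C * norm (f y) \<partial>lborel)"
    proof (rule integral_mono)
      show "norm (f y * g (x - y)) \<le> C * norm (f y)" for y
        using mult_right_mono[OF C[of "x - y"], of "norm (f y)"] by (simp add: norm_mult mult.commute)
    qed (use integrable_norm[OF i] f in \<open>auto simp: mult.commute\<close>)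
    finally show ?thesis by simp
  qed
  moreover have "cconv f g x = 0" if "r + r' < norm x" for x
  proof -
    have *: "f y * g (x - y) = 0" for y
    proof (cases "r < norm y")
      case False
      then have "r' < norm (x - y)" using that norm_triangle_ineq2[of x y] by linarith
      then show ?thesis using r' by simp
    qed (use f in auto)
    show ?thesis unfolding cconv_def * by simp
  qed
  ultimately show ?thesis unfolding bounded_supp_def by (intro conjI exI[of _ "C * (\<integral>y. norm (f y) \<partial>lborel)"] exI[of _ "r + r'"]) auto
qed

lemma test_freq_iff: "test_freq \<psi> \<longleftrightarrow> bounded_supp \<psi> \<and> integrable lborel (fourier \<psi>)"
proof
  assume t: "test_freq \<psi>"
  then obtain K where K: "compact K" "\<And>x. x \<notin> K \<Longrightarrow> \<psi> x = 0" by (auto simp: test_freq_def)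
  then obtain r where "\<And>x. x \<in> K \<Longrightarrow> norm x \<le> r" using compact_imp_bounded bounded_iff by metis
  then have "\<forall>x. r < norm x \<longrightarrow> \<psi> x = 0" using K(2) by force
  then show "bounded_supp \<psi> \<and> integrable lborel (fourier \<psi>)" using t by (auto simp: test_freq_def bounded_supp_def bounded_iff)
next
  assume b: "bounded_supp \<psi> \<and> integrable lborel (fourier \<psi>)"
  then obtain r where "\<And>x. r < norm x \<Longrightarrow> \<psi> x = 0" by (auto simp: bounded_supp_def)
  then have "\<forall>\<xi>. \<xi> \<notin> cball 0 r \<longrightarrow> \<psi> \<xi> = 0" by auto
  then have K: "\<exists>K. compact K \<and> (\<forall>\<xi>. \<xi> \<notin> K \<longrightarrow> \<psi> \<xi> = 0)" by (intro exI[of _ "cball 0 r"] conjI compact_cball)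
  have B: "bounded (range \<psi>)" using b unfolding bounded_supp_def bounded_iff by blast
  have M: "\<psi> \<in> borel_measurable lborel" using b by (simp add: bounded_supp_def)
  show "test_freq \<psi>" unfolding test_freq_def by (intro conjI K B M conjunct2[OF b])
qed

text \<open>Gaussians are not admissible in \<^const>\<open>test_freq\<close>. Convolutions of two bounded compactly supported
  functions are, by the Bessel inequality, and their span is stable under multiplication by
  coordinates, so no smoothness in frequency is ever needed.\<close>
inductive test_span :: "(real ^ 4 \<Rightarrow> complex) \<Rightarrow> bool" where
  conv: "bounded_supp f \<Longrightarrow> bounded_supp g \<Longrightarrow> test_span (cconv f g)"
| add: "test_span a \<Longrightarrow> test_span b \<Longrightarrow> test_span (\<lambda>x. a x + b x)"
| cmult: "test_span a \<Longrightarrow> test_span (\<lambda>x. c * a x)"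

text \<open>The transform of a convolution is, up to a constant, the product of two transforms. Each
  is square integrable by the Bessel inequality, so the product is integrable.\<close>

lemma test_span_test_freq: "test_span b \<Longrightarrow> test_freq b"
proof (induction rule: test_span.induct)
  case (conv f g)
  obtain r where "\<And>x. r < norm x \<Longrightarrow> f x = 0" using conv(1) unfolding bounded_supp_def by blast
  then have *: "bounded_supp (cconv f g)" by (rule bounded_supp_cconv[OF bounded_supp_integrable(1)[OF conv(1)] _ conv(2)])
  have "sq_int (fourier f)" "sq_int (fourier g)" using conv bounded_supp_integrable sq_int_fourier by blast+
  then have "integrable lborel (\<lambda>x. fourier f x * fourier g x)" by (rule integrable_sq_int_mult)
  then have "integrable lborel (\<lambda>x. complex_of_real (fconst TYPE(real^4)) * fourier (cconv f g) x)"
    unfolding fourier_cconv[OF bounded_supp_integrable(1)[OF conv(1)] bounded_supp_integrable(1)[OF conv(2)]] .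
  then have "integrable lborel (\<lambda>x. inverse (complex_of_real (fconst TYPE(real^4))) * (complex_of_real (fconst TYPE(real^4)) * fourier (cconv f g) x))"
    by (rule integrable_mult_right)
  then have "integrable lborel (fourier (cconv f g))"
    by (simp add: mult.assoc[symmetric] less_imp_neq[OF fconst_pos, symmetric])
  with * show ?case by (simp add: test_freq_iff)
next
  case (add a b)
  then have "fourier (\<lambda>x. a x + b x) = (\<lambda>\<xi>. fourier a \<xi> + fourier b \<xi>)"
    by (intro ext fourier_add) (auto simp: test_freq_iff bounded_supp_integrable)
  then show ?case using add by (auto simp: test_freq_iff bounded_supp_add)
next
  case (cmult a c)
  have "fourier (\<lambda>x. c * a x) = (\<lambda>\<xi>. c * fourier a \<xi>)" by (intro ext fourier_cmult)
  then show ?case using cmult by (auto simp: test_freq_iff bounded_supp_cmult)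
qed

text \<open>The splitting of \<xi> into \<eta> and \<xi> - \<eta> distributes a coordinate over the
  two factors of a convolution, and each factor keeps bounded support. In physical space the class
  becomes stable under differentiation.\<close>

lemma test_span_coord: "test_span b \<Longrightarrow> test_span (\<lambda>\<xi>. complex_of_real (\<xi> \<bullet> e) * b \<xi>)"
proof (induction rule: test_span.induct)
  case (conv f g)
  let ?m = "\<lambda>f \<xi>. complex_of_real (\<xi> \<bullet> e) * f \<xi>"
  have m: "bounded_supp (?m f)" "bounded_supp (?m g)" using conv by (auto intro!: bounded_supp_mult_cont continuous_intros)
  have i: "integrable lborel (\<lambda>\<eta>. f \<eta> * g (\<xi> - \<eta>))" if fg: "bounded_supp f" "bounded_supp g" for f g :: "real^4 \<Rightarrow> complex" and \<xi>
  proof -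
    obtain C where C: "\<And>x. norm (g x) \<le> C" using fg(2) unfolding bounded_supp_def by blast
    have [measurable]: "g \<in> borel_measurable borel" using fg by (simp add: bounded_supp_def)
    have "integrable lborel (\<lambda>\<eta>. g (\<xi> - \<eta>) * f \<eta>)"
      by (rule integrable_bounded_mult[OF bounded_supp_integrable(1)[OF fg(1)]]) (auto intro: C)
    then show ?thesis by (simp add: mult.commute)
  qed
  have "?m (cconv f g) \<xi> = cconv (?m f) g \<xi> + cconv f (?m g) \<xi>" for \<xi>
  proof -
    have "cconv (?m f) g \<xi> + cconv f (?m g) \<xi> = (\<integral>\<eta>. ?m f \<eta> * g (\<xi> - \<eta>) + f \<eta> * ?m g (\<xi> - \<eta>) \<partial>lborel)"
      unfolding cconv_def using i[OF m(1) conv(2)] i[OF conv(1) m(2)]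
      by (subst Bochner_Integration.integral_add) auto
    also have "\<dots> = (\<integral>\<eta>. complex_of_real (\<xi> \<bullet> e) * (f \<eta> * g (\<xi> - \<eta>)) \<partial>lborel)"
      by (intro Bochner_Integration.integral_cong) (auto simp: inner_diff_left algebra_simps)
    finally show ?thesis by (simp add: cconv_def)
  qed
  then have *: "?m (cconv f g) = (\<lambda>\<xi>. cconv (?m f) g \<xi> + cconv f (?m g) \<xi>)" by (rule ext)
  show ?case unfolding * by (intro test_span.add test_span.conv m conv)
next
  case (add a b)
  then show ?case using test_span.add[OF add.IH] by (simp add: ring_distribs)
next
  case (cmult a c)
  then show ?case using test_span.cmult[OF cmult.IH, of c] by (simp add: mult.left_commute)
qed

section \<open>Twice differentiable functions and spatial cutoffs\<close>

definition has_partials2 :: "(real^4 \<Rightarrow> real) \<Rightarrow> (4 \<Rightarrow> real^4 \<Rightarrow> real) \<Rightarrow> (4 \<Rightarrow> 4 \<Rightarrow> real^4 \<Rightarrow> real) \<Rightarrow> bool" where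
  "has_partials2 f f1 f2 \<longleftrightarrow>
    (\<forall>i x. ((\<lambda>h. f (x + h *\<^sub>R axis i 1)) has_real_derivative f1 i x) (at 0)) \<and>
    (\<forall>i j x. ((\<lambda>h. f1 i (x + h *\<^sub>R axis j 1)) has_real_derivative f2 i j x) (at 0)) \<and>
    continuous_on UNIV f \<and> (\<forall>i. continuous_on UNIV (f1 i)) \<and> (\<forall>i j. continuous_on UNIV (f2 i j))"

lemma has_partials2_pd:
  assumes "has_partials2 f f1 f2" shows "pd i f = f1 i" "pd j (pd i f) = f2 i j"
proof -
  show *: "pd i f = f1 i" for i using assms unfolding has_partials2_def pd_def by (intro ext) (auto intro: DERIV_imp_deriv)
  show "pd j (pd i f) = f2 i j" using assms unfolding * unfolding has_partials2_def pd_def by (intro ext) (auto intro: DERIV_imp_deriv)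
qed

lemma has_partials2_lap: "has_partials2 f f1 f2 \<Longrightarrow> lap f x = (\<Sum>i\<in>UNIV. f2 i i x)"
  unfolding lap_def using has_partials2_pd(2) by metis

text \<open>\<open>C2c\<close> speaks of \<open>deriv\<close> and differentiability. Carrying the
  partial derivatives as explicit functions lets the product rule be iterated and the Laplacian be
  written out, and this lemma returns to the required form.\<close>

lemma has_partials2_C2c:
  assumes D: "has_partials2 f f1 f2" and K: "compact K" "\<And>x. x \<notin> K \<Longrightarrow> f x = 0"
  shows "C2c f"
  unfolding C2c_def
proof (intro conjI allI)
  show "\<exists>K. compact K \<and> (\<forall>x. x \<notin> K \<longrightarrow> f x = 0)" using K by auto
  show "(\<lambda>h. f (x + h *\<^sub>R axis i 1)) differentiable at 0" for i x
    using D unfolding has_partials2_def by (meson real_differentiable_def)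
  show "(\<lambda>h. pd i f (x + h *\<^sub>R axis j 1)) differentiable at 0" for i j x
    using D unfolding has_partials2_pd(1)[OF D] unfolding has_partials2_def by (meson real_differentiable_def)
  show "continuous_on UNIV (pd j (pd i f))" for i j
    using D unfolding has_partials2_pd(2)[OF D] unfolding has_partials2_def by blast
qed

lemma has_partials2_mult:
  assumes f: "has_partials2 f f1 f2" and g: "has_partials2 g g1 g2"
  shows "has_partials2 (\<lambda>x. f x * g x) (\<lambda>i x. f1 i x * g x + f x * g1 i x)
     (\<lambda>i j x. f2 i j x * g x + f1 i x * g1 j x + (f1 j x * g1 i x + f x * g2 i j x))"
proof -
  have d: "((\<lambda>h. F (x + h *\<^sub>R axis i 1) * G (x + h *\<^sub>R axis i 1)) has_real_derivative F' * G x + F x * G') (at 0)"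
    if "((\<lambda>h. F (x + h *\<^sub>R axis i 1)) has_real_derivative F') (at 0)" "((\<lambda>h. G (x + h *\<^sub>R axis i 1)) has_real_derivative G') (at 0)"
    for F G :: "real^4 \<Rightarrow> real" and x i F' G'
    using DERIV_mult[OF that] by (simp add: add.commute mult.commute)
  show ?thesis using assms unfolding has_partials2_def
    by (auto intro!: d DERIV_add continuous_on_add continuous_on_mult)
qed

text \<open>At the corner t = 0 the difference quotient is at most |h|^(n-1), which tends to 0
  because n \<ge> 2.\<close>

lemma DERIV_max_power:
  assumes "n \<ge> 2"
  shows "((\<lambda>t::real. max 0 t ^ n) has_real_derivative real n * max 0 t ^ (n - 1)) (at t)"
proof -
  consider "t > 0" | "t < 0" | "t = 0" by linarith
  then show ?thesis
  proof cases
    case 1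
    have "((\<lambda>t::real. t ^ n) has_real_derivative real n * t ^ (n - 1)) (at t)"
      using DERIV_pow[of n t] by simp
    moreover have "\<forall>\<^sub>F s in nhds t. max 0 s ^ n = s ^ n"
      using eventually_nhds_in_open[of "{0<..}" t] 1 by (auto elim!: eventually_mono)
    ultimately show ?thesis using 1 by (subst DERIV_cong_ev[OF refl _ refl]) auto
  next
    case 2
    have "\<forall>\<^sub>F s in nhds t. max 0 s ^ n = 0"
      using eventually_nhds_in_open[of "{..<0}" t] 2 assms by (auto elim!: eventually_mono)
    then show ?thesis using 2 assms by (subst DERIV_cong_ev[OF refl _ refl, where g="\<lambda>_. 0"]) (auto simp: power_0_left)
  next
    case 3
    have "((\<lambda>h::real. (max 0 (0 + h) ^ n - max 0 0 ^ n) / h) \<longlongrightarrow> 0) (at 0)"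
    proof (rule Lim_null_comparison)
      show "\<forall>\<^sub>F h in at 0. norm ((max 0 (0 + h) ^ n - max 0 0 ^ n) / h) \<le> \<bar>h\<bar> ^ (n - 1)"
      proof (rule eventually_at_filter[THEN iffD2], intro always_eventually allI impI)
        fix h :: real assume h: "h \<noteq> 0"
        have "max 0 h ^ n \<le> \<bar>h\<bar> ^ n" by (intro power_mono) auto
        then have "\<bar>max 0 h ^ n\<bar> \<le> \<bar>h\<bar> ^ n" by simp
        also have "\<dots> = \<bar>h\<bar> ^ (n - 1) * \<bar>h\<bar>" using assms by (metis One_nat_def Suc_1 Suc_le_D diff_Suc_1 power_Suc2)
        finally show "norm ((max 0 (0 + h) ^ n - max 0 0 ^ n) / h) \<le> \<bar>h\<bar> ^ (n - 1)"
          using h assms by (simp add: divide_simps power_0_left)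
      qed
      show "((\<lambda>h::real. \<bar>h\<bar> ^ (n - 1)) \<longlongrightarrow> 0) (at 0)"
        by (intro tendsto_null_power tendsto_rabs_zero tendsto_ident_at) (use assms in auto)
    qed
    then show ?thesis using 3 assms by (simp add: DERIV_def power_0_left)
  qed
qed

text \<open>Its cube is twice continuously differentiable and compactly supported.\<close>
definition cutoff_base :: "real \<Rightarrow> real^4 \<Rightarrow> real" where
  "cutoff_base R x = max 0 (1 - (norm x)\<^sup>2 / R\<^sup>2)"

lemma cutoff_base_bounds: "0 \<le> cutoff_base R x" "cutoff_base R x \<le> 1"
  by (auto simp: cutoff_base_def)

lemma cutoff_base_deriv:
  assumes "n \<ge> 2"
  shows "((\<lambda>h. cutoff_base R (x + h *\<^sub>R axis i 1) ^ n) has_real_derivative real n * cutoff_base R x ^ (n - 1) * (- 2 * (x $ i) / R\<^sup>2)) (at 0)"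
proof -
  have "(norm (x + h *\<^sub>R axis i 1))\<^sup>2 = (norm x)\<^sup>2 + 2 * h * (x $ i) + h\<^sup>2" for h
    unfolding power2_norm_eq_inner by (simp add: inner_add_left inner_add_right inner_axis inner_axis' power2_eq_square algebra_simps)
  then have *: "cutoff_base R (x + h *\<^sub>R axis i 1) = max 0 (1 - ((norm x)\<^sup>2 + 2 * h * (x $ i) + h\<^sup>2) / R\<^sup>2)" for h
    by (simp add: cutoff_base_def)
  have g: "((\<lambda>h. 1 - ((norm x)\<^sup>2 + 2 * h * (x $ i) + h\<^sup>2) / R\<^sup>2) has_real_derivative - 2 * (x $ i) / R\<^sup>2) (at 0)"
  proof -
    have "((\<lambda>h. (norm x)\<^sup>2 + 2 * h * (x $ i) + h\<^sup>2) has_real_derivative 2 * (x $ i)) (at 0)"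
      by (auto intro!: derivative_eq_intros)
    from DERIV_diff[OF DERIV_const[of 1] DERIV_cdivide[OF this, of "R\<^sup>2"]] show ?thesis by simp
  qed
  have "((\<lambda>h. max 0 (1 - ((norm x)\<^sup>2 + 2 * h * (x $ i) + h\<^sup>2) / R\<^sup>2) ^ n) has_real_derivative
      real n * max 0 (1 - ((norm x)\<^sup>2 + 2 * 0 * (x $ i) + 0\<^sup>2) / R\<^sup>2) ^ (n - 1) * (- 2 * (x $ i) / R\<^sup>2)) (at 0)"
    by (rule DERIV_chain2[OF DERIV_max_power[OF assms] g])
  then show ?thesis unfolding * by (simp add: cutoff_base_def)
qed

lemma has_partials2_cutoff:
  "has_partials2 (\<lambda>x. cutoff_base R x ^ 3) (\<lambda>i x. - 6 / R\<^sup>2 * (cutoff_base R x ^ 2 * (x $ i)))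
     (\<lambda>i j x. - 6 / R\<^sup>2 * (2 * cutoff_base R x * (- 2 * (x $ j) / R\<^sup>2) * (x $ i) + cutoff_base R x ^ 2 * (axis j 1 $ i)))"
  unfolding has_partials2_def
proof (intro conjI allI)
  show "((\<lambda>h. cutoff_base R (x + h *\<^sub>R axis i 1) ^ 3) has_real_derivative - 6 / R\<^sup>2 * (cutoff_base R x ^ 2 * (x $ i))) (at 0)" for i x
    using cutoff_base_deriv[of 3 R x i] by (simp add: field_simps)
  show "((\<lambda>h. - 6 / R\<^sup>2 * (cutoff_base R (x + h *\<^sub>R axis j 1) ^ 2 * ((x + h *\<^sub>R axis j 1) $ i))) has_real_derivative
     - 6 / R\<^sup>2 * (2 * cutoff_base R x * (- 2 * (x $ j) / R\<^sup>2) * (x $ i) + cutoff_base R x ^ 2 * (axis j 1 $ i))) (at 0)" for i j x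
  proof (rule DERIV_cmult)
    have "((\<lambda>h. (x + h *\<^sub>R axis j 1) $ i) has_real_derivative axis j 1 $ i) (at 0)"
      by (auto intro!: derivative_eq_intros)
    from DERIV_mult[OF cutoff_base_deriv[of 2 R x j] this]
    show "((\<lambda>h. cutoff_base R (x + h *\<^sub>R axis j 1) ^ 2 * ((x + h *\<^sub>R axis j 1) $ i)) has_real_derivative
     2 * cutoff_base R x * (- 2 * (x $ j) / R\<^sup>2) * (x $ i) + cutoff_base R x ^ 2 * (axis j 1 $ i)) (at 0)"
      by (simp add: algebra_simps)
  qed
qed (auto simp: cutoff_base_def divide_inverse intro!: continuous_intros)

text \<open>Where the cutoff does not vanish, every coordinate is at most \<open>R\<close> in
  absolute value, so differentiation gains powers of 1/R. The second derivatives even gain 1/R^2; R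
  \<ge> 1 brings both bounds to the same form.\<close>

lemma cutoff_bounds:
  assumes R: "R \<ge> 1"
  shows "\<bar>- 6 / R\<^sup>2 * (cutoff_base R x ^ 2 * (x $ i))\<bar> \<le> 6 / R"
    "\<bar>- 6 / R\<^sup>2 * (2 * cutoff_base R x * (- 2 * (x $ j) / R\<^sup>2) * (x $ i) + cutoff_base R x ^ 2 * (axis j 1 $ i))\<bar> \<le> 30 / R"
proof -
  have R0: "R > 0" using R by simp
  have six: "\<bar>- 6 / R\<^sup>2 * y\<bar> = 6 / R\<^sup>2 * \<bar>y\<bar>" for y by (simp add: abs_mult)
  have z: "cutoff_base R x = 0 \<or> \<bar>x $ i\<bar> \<le> R" for i
  proof (cases "norm x \<le> R")
    case True then show ?thesis using component_le_norm_cart[of x i] by linarith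
  next
    case False
    then have "R\<^sup>2 \<le> (norm x)\<^sup>2" using R0 by (intro power_mono) auto
    then have "1 - (norm x)\<^sup>2 / R\<^sup>2 \<le> 0" using R0 by simp
    then show ?thesis by (simp add: cutoff_base_def)
  qed
  have w2: "cutoff_base R x ^ 2 \<le> 1" using cutoff_base_bounds[of R x] by (simp add: power_le_one)
  have a1: "\<bar>cutoff_base R x ^ 2 * (x $ i)\<bar> \<le> R" for i
    using z[of i] w2 R0 mult_mono[OF w2, of "\<bar>x $ i\<bar>" R] by (auto simp: abs_mult)
  have a2: "\<bar>cutoff_base R x * (x $ j) * (x $ i)\<bar> \<le> R * R" for i j
    using z[of i] z[of j] cutoff_base_bounds[of R x] R0 mult_mono[of "\<bar>x $ j\<bar>" R "\<bar>x $ i\<bar>" R]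
     mult_mono[OF cutoff_base_bounds(2)[of R x], of "\<bar>x $ j\<bar> * \<bar>x $ i\<bar>" "R * R"] by (auto simp: abs_mult mult.assoc)
  have a3: "\<bar>cutoff_base R x ^ 2 * (axis j 1 $ i)\<bar> \<le> 1" for i j
    using w2 by (auto simp: abs_mult axis_def)
  have "\<bar>- 6 / R\<^sup>2 * (cutoff_base R x ^ 2 * (x $ i))\<bar> = 6 / R\<^sup>2 * \<bar>cutoff_base R x ^ 2 * (x $ i)\<bar>" by (rule six)
  also have "\<dots> \<le> 6 / R\<^sup>2 * R" by (intro mult_left_mono a1) auto
  also have "\<dots> = 6 / R" using R0 by (simp add: power2_eq_square)
  finally show "\<bar>- 6 / R\<^sup>2 * (cutoff_base R x ^ 2 * (x $ i))\<bar> \<le> 6 / R" .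
  have "2 * cutoff_base R x * (- 2 * (x $ j) / R\<^sup>2) * (x $ i) = - 4 / R\<^sup>2 * (cutoff_base R x * (x $ j) * (x $ i))" by (simp add: field_simps)
  then have "\<bar>2 * cutoff_base R x * (- 2 * (x $ j) / R\<^sup>2) * (x $ i)\<bar> = 4 / R\<^sup>2 * \<bar>cutoff_base R x * (x $ j) * (x $ i)\<bar>"
    by (simp only: abs_mult abs_divide) simp
  also have "\<dots> \<le> 4 / R\<^sup>2 * (R * R)" by (intro mult_left_mono a2) auto
  also have "\<dots> = 4" using R0 by (simp add: power2_eq_square)
  finally have b: "\<bar>2 * cutoff_base R x * (- 2 * (x $ j) / R\<^sup>2) * (x $ i) + cutoff_base R x ^ 2 * (axis j 1 $ i)\<bar> \<le> 5"
    using a3[of j i] by linarith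
  have "\<bar>- 6 / R\<^sup>2 * (2 * cutoff_base R x * (- 2 * (x $ j) / R\<^sup>2) * (x $ i) + cutoff_base R x ^ 2 * (axis j 1 $ i))\<bar>
     = 6 / R\<^sup>2 * \<bar>2 * cutoff_base R x * (- 2 * (x $ j) / R\<^sup>2) * (x $ i) + cutoff_base R x ^ 2 * (axis j 1 $ i)\<bar>" by (rule six)
  also have "\<dots> \<le> 6 / R\<^sup>2 * 5" by (intro mult_left_mono b) auto
  also have "\<dots> \<le> 30 / R" using R by (simp add: power2_eq_square divide_simps)
  finally show "\<bar>- 6 / R\<^sup>2 * (2 * cutoff_base R x * (- 2 * (x $ j) / R\<^sup>2) * (x $ i) + cutoff_base R x ^ 2 * (axis j 1 $ i))\<bar> \<le> 30 / R" .
qed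

text \<open>\<open>C2c\<close> concerns real functions, so the transform is handled through its real
  and imaginary parts. A partial derivative multiplies the frequency function by -i times a
  coordinate, under which \<open>test_span\<close> is closed.\<close>

lemma has_partials2_fourier:
  assumes b: "test_span b" and T: "T = Re \<or> T = Im"
  defines "m \<equiv> \<lambda>i (b::real^4 \<Rightarrow> complex) \<xi>. - \<i> * complex_of_real (\<xi> \<bullet> axis i 1) * b \<xi>"
  shows "has_partials2 (\<lambda>x. T (fourier b x)) (\<lambda>i x. T (fourier (m i b) x)) (\<lambda>i j x. T (fourier (m j (m i b)) x))"
proof -
  have m: "test_span (m i b)" if "test_span b" for i b
    using test_span.cmult[OF test_span_coord[OF that], of "- \<i>"] by (simp add: m_def mult.assoc)
  have int: "integrable lborel b" if "test_span b" for b using test_span_test_freq[OF that] by (simp add: test_freq_iff bounded_supp_integrable)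
  have bl: "bounded_linear T" using T bounded_linear_Re bounded_linear_Im by auto
  have d: "((\<lambda>h. T (fourier b (x + h *\<^sub>R axis i 1))) has_real_derivative T (fourier (m i b) x)) (at 0)" if "test_span b" for b i x
    unfolding has_real_derivative_iff_has_vector_derivative m_def
    using int[OF that] int[OF test_span_coord[OF that]]
    by (intro bounded_linear.has_vector_derivative[OF bl] fourier_has_vector_derivative)
  have c: "continuous_on UNIV (\<lambda>x. T (fourier b x))" if "test_span b" for b
    using continuous_fourier[OF int[OF that]] T by (auto intro: continuous_intros)
  show ?thesis unfolding has_partials2_def using b m d c by blast
qed

section \<open>Testing the weak equation\<close>

text \<open>The test function \<open>v\<close> is not compactly supported, so the weak equation is
  applied to \<open>v\<close> times a cutoff of growing radius. In the Leibniz rule for the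
  Laplacian the terms with derivatives of the cutoff vanish in the limit, and integrability of
  \<open>A\<close> against \<open>v\<close> and its derivatives supplies the domination.\<close>

lemma weak_limit_real:
  fixes A v :: "real^4 \<Rightarrow> real" and p q :: "real^4 \<Rightarrow> complex"
  assumes A[measurable]: "A \<in> borel_measurable borel"
    and p: "sq_int p" and q: "sq_int q" and pC: "AE x in lborel. norm (p x) \<le> C"
    and weak: "weak_A0_eq A p q" and D: "has_partials2 v v1 v2" and vB: "\<And>x. \<bar>v x\<bar> \<le> B"
    and i0: "integrable lborel (\<lambda>x. A x * v x)"
    and i1: "\<And>i. integrable lborel (\<lambda>x. A x * v1 i x)"
    and i2: "\<And>i. integrable lborel (\<lambda>x. A x * v2 i i x)"
  shows "(\<Sum>i\<in>UNIV. \<integral>x. A x * v2 i i x \<partial>lborel) - (\<integral>x. (cmod (p x))\<^sup>2 * A x * v x \<partial>lborel)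
     = - (\<integral>x. Im (p x * cnj (q x)) * v x \<partial>lborel)"
    and "integrable lborel (\<lambda>x. (cmod (p x))\<^sup>2 * A x * v x)"
    and "integrable lborel (\<lambda>x. Im (p x * cnj (q x)) * v x)"
proof -
  have [measurable]: "p \<in> borel_measurable borel" "q \<in> borel_measurable borel" using p q by (auto simp: sq_int_def)
  have mv[measurable]: "v \<in> borel_measurable borel" "\<And>i. v1 i \<in> borel_measurable borel" "\<And>i j. v2 i j \<in> borel_measurable borel"
    using D by (auto simp: has_partials2_def intro: borel_measurable_continuous_onI)
  define R where "R n = real (Suc n)" for n
  have R1: "R n \<ge> 1" for n by (simp add: R_def)
  have invR: "(\<lambda>n. inverse (R n)) \<longlonglongrightarrow> 0" unfolding R_def by (rule LIMSEQ_inverse_real_of_nat)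
  define X where "X n x = cutoff_base (R n) x ^ 3" for n x
  define X1 where "X1 n i x = - 6 / (R n)\<^sup>2 * (cutoff_base (R n) x ^ 2 * (x $ i))" for n i x
  define X2 where "X2 n i j x = - 6 / (R n)\<^sup>2 * (2 * cutoff_base (R n) x * (- 2 * (x $ j) / (R n)\<^sup>2) * (x $ i) + cutoff_base (R n) x ^ 2 * (axis j 1 $ i))" for n i j x
  have DX: "has_partials2 (X n) (X1 n) (X2 n)" for n
    using has_partials2_cutoff[of "R n"] unfolding X_def[abs_def] X1_def[abs_def] X2_def[abs_def] .
  have [measurable]: "X n \<in> borel_measurable borel" "X1 n i \<in> borel_measurable borel" "X2 n i j \<in> borel_measurable borel" for n i j
    using DX[of n] by (auto simp: has_partials2_def intro: borel_measurable_continuous_onI)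
  have Xb: "\<bar>X n x\<bar> \<le> 1" for n x using cutoff_base_bounds[of "R n" x] by (simp add: X_def power_le_one)
  have X1b: "\<bar>X1 n i x\<bar> \<le> 6 * inverse (R n)" for n i x
    using cutoff_bounds(1)[OF R1] unfolding X1_def by (simp add: divide_inverse)
  have X2b: "\<bar>X2 n i j x\<bar> \<le> 30 * inverse (R n)" for n i j x
    using cutoff_bounds(2)[OF R1] unfolding X2_def by (simp add: divide_inverse)
  have invle: "inverse (R n) \<le> 1" for n using R1[of n] by (simp add: inverse_le_1_iff)
  have Xl: "(\<lambda>n. X n x) \<longlonglongrightarrow> 1" for x
  proof -
    have "(\<lambda>n. max 0 (1 - (norm x)\<^sup>2 * (inverse (R n))\<^sup>2) ^ 3) \<longlonglongrightarrow> max 0 (1 - (norm x)\<^sup>2 * 0\<^sup>2) ^ 3"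
      by (intro tendsto_intros invR)
    then show ?thesis by (simp add: X_def cutoff_base_def divide_inverse power_inverse)
  qed
  have X1l: "(\<lambda>n. X1 n i x) \<longlonglongrightarrow> 0" for i x
    by (rule Lim_null_comparison[OF _ tendsto_mult_right_zero[OF invR, of 6]]) (use X1b in auto)
  have X2l: "(\<lambda>n. X2 n i j x) \<longlonglongrightarrow> 0" for i j x
    by (rule Lim_null_comparison[OF _ tendsto_mult_right_zero[OF invR, of 30]]) (use X2b in auto)
  let ?\<psi> = "\<lambda>n x. X n x * v x"
  let ?L = "\<lambda>n x. (\<Sum>i\<in>UNIV. X2 n i i x * v x + X1 n i x * v1 i x + (X1 n i x * v1 i x + X n x * v2 i i x))"
  have C2: "C2c (?\<psi> n)" for n
  proof (rule has_partials2_C2c[OF has_partials2_mult[OF DX D] compact_cball[of "0::real^4" "R n"]])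
    fix x :: "real^4" assume "x \<notin> cball 0 (R n)"
    then have "(R n)\<^sup>2 \<le> (norm x)\<^sup>2" using R1[of n] by (intro power_mono) auto
    then have "cutoff_base (R n) x = 0" using R1[of n] by (simp add: cutoff_base_def)
    then show "X n x * v x = 0" by (simp add: X_def)
  qed
  have lap: "lap (?\<psi> n) x = ?L n x" for n x
    by (rule has_partials2_lap[OF has_partials2_mult[OF DX D]])
  have eqn: "(\<integral>x. A x * ?L n x \<partial>lborel) - (\<integral>x. (cmod (p x))\<^sup>2 * A x * ?\<psi> n x \<partial>lborel)
       = - (\<integral>x. Im (p x * cnj (q x)) * ?\<psi> n x \<partial>lborel)" for n
    using weak[unfolded weak_A0_eq_def, rule_format, OF C2[of n]] unfolding lap .
  have C0: "AE x in lborel. (cmod (p x))\<^sup>2 \<le> C\<^sup>2"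
    using pC by eventually_elim (intro power_mono, auto)
  \<comment> \<open>The bound on \<open>p\<close> reduces the cubic term to the integrable product
    of \<open>A\<close> and \<open>v\<close>.\<close>
  show ip: "integrable lborel (\<lambda>x. (cmod (p x))\<^sup>2 * A x * v x)"
  proof (rule Bochner_Integration.integrable_bound)
    show "integrable lborel (\<lambda>x. C\<^sup>2 * (A x * v x))" using i0 by simp
    show "AE x in lborel. norm ((cmod (p x))\<^sup>2 * A x * v x) \<le> norm (C\<^sup>2 * (A x * v x))"
      using C0 by eventually_elim (auto simp: abs_mult mult.assoc intro!: mult_right_mono)
  qed measurable
  have pq: "integrable lborel (\<lambda>x. p x * cnj (q x))"
    using q by (intro integrable_sq_int_mult p) (auto simp: sq_int_def)
  have ipq: "integrable lborel (\<lambda>x. B * norm (p x * cnj (q x)))"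
    using integrable_norm[OF pq] by simp
  have B0: "0 \<le> B" using vB[of 0] by linarith
  have bq: "\<bar>Im (p x * cnj (q x)) * v x\<bar> \<le> B * norm (p x * cnj (q x))" for x
    using mult_mono[OF vB[of x] abs_Im_le_cmod[of "p x * cnj (q x)"]] B0 by (simp add: abs_mult mult.commute)
  show iq: "integrable lborel (\<lambda>x. Im (p x * cnj (q x)) * v x)"
    by (rule Bochner_Integration.integrable_bound[OF ipq]) (use bq B0 in \<open>auto simp: abs_mult\<close>)
  have l1: "(\<lambda>n. \<integral>x. A x * ?L n x \<partial>lborel) \<longlonglongrightarrow> (\<integral>x. A x * (\<Sum>i\<in>UNIV. v2 i i x) \<partial>lborel)"
  \<comment> \<open>30 and 12 = 2 * 6 are the constants of \<open>cutoff_bounds\<close> with 1/R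
    \<le> 1; a first derivative of the cutoff occurs twice in the Leibniz rule.\<close>
  proof (rule integral_dominated_convergence[where w="\<lambda>x. \<Sum>i\<in>(UNIV::4 set). 30 * \<bar>A x * v x\<bar> + 12 * \<bar>A x * v1 i x\<bar> + \<bar>A x * v2 i i x\<bar>"])
    show "integrable lborel (\<lambda>x. \<Sum>i\<in>(UNIV::4 set). 30 * \<bar>A x * v x\<bar> + 12 * \<bar>A x * v1 i x\<bar> + \<bar>A x * v2 i i x\<bar>)"
      using i0 i1 i2 by auto
    show "AE x in lborel. (\<lambda>n. A x * ?L n x) \<longlonglongrightarrow> A x * (\<Sum>i\<in>UNIV. v2 i i x)"
    proof (intro AE_I2)
      fix x
      have "(\<lambda>n. A x * ?L n x) \<longlonglongrightarrow> A x * (\<Sum>i\<in>UNIV. 0 * v x + 0 * v1 i x + (0 * v1 i x + 1 * v2 i i x))"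
        by (intro tendsto_intros Xl X1l X2l)
      then show "(\<lambda>n. A x * ?L n x) \<longlonglongrightarrow> A x * (\<Sum>i\<in>UNIV. v2 i i x)" by simp
    qed
    show "AE x in lborel. norm (A x * ?L n x) \<le> (\<Sum>i\<in>(UNIV::4 set). 30 * \<bar>A x * v x\<bar> + 12 * \<bar>A x * v1 i x\<bar> + \<bar>A x * v2 i i x\<bar>)" for n
    proof (intro AE_I2)
      fix x
      have t: "\<bar>A x * (X2 n i i x * v x + X1 n i x * v1 i x + (X1 n i x * v1 i x + X n x * v2 i i x))\<bar>
         \<le> 30 * \<bar>A x * v x\<bar> + 12 * \<bar>A x * v1 i x\<bar> + \<bar>A x * v2 i i x\<bar>" for i
      proof -
        have a: "\<bar>X2 n i i x * (A x * v x)\<bar> \<le> 30 * \<bar>A x * v x\<bar>"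
          unfolding abs_mult[of "X2 n i i x"] using X2b[of n i i x] invle[of n] by (intro mult_right_mono) auto
        have b: "\<bar>X1 n i x * (A x * v1 i x)\<bar> \<le> 6 * \<bar>A x * v1 i x\<bar>"
          unfolding abs_mult[of "X1 n i x"] using X1b[of n i x] invle[of n] by (intro mult_right_mono) auto
        have c: "\<bar>X n x * (A x * v2 i i x)\<bar> \<le> 1 * \<bar>A x * v2 i i x\<bar>"
          unfolding abs_mult[of "X n x"] using Xb[of n x] by (intro mult_right_mono) auto
        have "A x * (X2 n i i x * v x + X1 n i x * v1 i x + (X1 n i x * v1 i x + X n x * v2 i i x))
          = X2 n i i x * (A x * v x) + X1 n i x * (A x * v1 i x) + (X1 n i x * (A x * v1 i x) + X n x * (A x * v2 i i x))"
          by (simp add: algebra_simps)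
        then show ?thesis using a b c by linarith
      qed
      have "norm (A x * ?L n x) \<le> (\<Sum>i\<in>UNIV. \<bar>A x * (X2 n i i x * v x + X1 n i x * v1 i x + (X1 n i x * v1 i x + X n x * v2 i i x))\<bar>)"
        unfolding sum_distrib_left real_norm_def by (rule sum_abs)
      also have "\<dots> \<le> (\<Sum>i\<in>(UNIV::4 set). 30 * \<bar>A x * v x\<bar> + 12 * \<bar>A x * v1 i x\<bar> + \<bar>A x * v2 i i x\<bar>)"
        by (intro sum_mono t)
      finally show "norm (A x * ?L n x) \<le> (\<Sum>i\<in>(UNIV::4 set). 30 * \<bar>A x * v x\<bar> + 12 * \<bar>A x * v1 i x\<bar> + \<bar>A x * v2 i i x\<bar>)" .
    qed
  qed measurable
  have l2: "(\<lambda>n. \<integral>x. (cmod (p x))\<^sup>2 * A x * ?\<psi> n x \<partial>lborel) \<longlonglongrightarrow> (\<integral>x. (cmod (p x))\<^sup>2 * A x * v x \<partial>lborel)"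
  proof (rule integral_dominated_convergence[where w="\<lambda>x. norm ((cmod (p x))\<^sup>2 * A x * v x)"])
    show "AE x in lborel. (\<lambda>n. (cmod (p x))\<^sup>2 * A x * ?\<psi> n x) \<longlonglongrightarrow> (cmod (p x))\<^sup>2 * A x * v x"
    proof (intro AE_I2)
      fix x
      have "(\<lambda>n. (cmod (p x))\<^sup>2 * A x * ?\<psi> n x) \<longlonglongrightarrow> (cmod (p x))\<^sup>2 * A x * (1 * v x)"
        by (intro tendsto_intros Xl)
      then show "(\<lambda>n. (cmod (p x))\<^sup>2 * A x * ?\<psi> n x) \<longlonglongrightarrow> (cmod (p x))\<^sup>2 * A x * v x" by simp
    qed
    show "AE x in lborel. norm ((cmod (p x))\<^sup>2 * A x * ?\<psi> n x) \<le> norm ((cmod (p x))\<^sup>2 * A x * v x)" for n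
      using Xb[of n] by (intro AE_I2) (auto simp: abs_mult intro!: mult_left_mono mult_left_le_one_le)
  qed (use ip in auto)
  have l3: "(\<lambda>n. \<integral>x. Im (p x * cnj (q x)) * ?\<psi> n x \<partial>lborel) \<longlonglongrightarrow> (\<integral>x. Im (p x * cnj (q x)) * v x \<partial>lborel)"
  proof (rule integral_dominated_convergence[where w="\<lambda>x. norm (Im (p x * cnj (q x)) * v x)"])
    show "AE x in lborel. (\<lambda>n. Im (p x * cnj (q x)) * ?\<psi> n x) \<longlonglongrightarrow> Im (p x * cnj (q x)) * v x"
    proof (intro AE_I2)
      fix x
      have "(\<lambda>n. Im (p x * cnj (q x)) * ?\<psi> n x) \<longlonglongrightarrow> Im (p x * cnj (q x)) * (1 * v x)"
        by (intro tendsto_intros Xl)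
      then show "(\<lambda>n. Im (p x * cnj (q x)) * ?\<psi> n x) \<longlonglongrightarrow> Im (p x * cnj (q x)) * v x" by simp
    qed
    show "AE x in lborel. norm (Im (p x * cnj (q x)) * ?\<psi> n x) \<le> norm (Im (p x * cnj (q x)) * v x)" for n
    proof (intro AE_I2)
      fix x
      have "norm (Im (p x * cnj (q x)) * ?\<psi> n x) = \<bar>X n x\<bar> * norm (Im (p x * cnj (q x)) * v x)"
        by (simp only: real_norm_def abs_mult mult_ac)
      also have "\<dots> \<le> norm (Im (p x * cnj (q x)) * v x)" using Xb[of n x] by (intro mult_left_le_one_le) auto
      finally show "norm (Im (p x * cnj (q x)) * ?\<psi> n x) \<le> norm (Im (p x * cnj (q x)) * v x)" .
    qed
  qed (use iq in auto)
  have "(\<integral>x. A x * (\<Sum>i\<in>UNIV. v2 i i x) \<partial>lborel) - (\<integral>x. (cmod (p x))\<^sup>2 * A x * v x \<partial>lborel)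
     = - (\<integral>x. Im (p x * cnj (q x)) * v x \<partial>lborel)"
    using LIMSEQ_unique[OF tendsto_diff[OF l1 l2, unfolded eqn] tendsto_minus[OF l3]] .
  moreover have "(\<integral>x. A x * (\<Sum>i\<in>UNIV. v2 i i x) \<partial>lborel) = (\<Sum>i\<in>UNIV. \<integral>x. A x * v2 i i x \<partial>lborel)"
    unfolding sum_distrib_left using i2 by (intro Bochner_Integration.integral_sum) auto
  ultimately show "(\<Sum>i\<in>UNIV. \<integral>x. A x * v2 i i x \<partial>lborel) - (\<integral>x. (cmod (p x))\<^sup>2 * A x * v x \<partial>lborel)
     = - (\<integral>x. Im (p x * cnj (q x)) * v x \<partial>lborel)" by simp
qed

text \<open>The real and the imaginary part of a complex test function both satisfy the assumptions
  of \<open>weak_limit_real\<close>; combining them gives the complex form needed on the Fourier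
  side.\<close>

lemma weak_limit:
  fixes A :: "real^4 \<Rightarrow> real" and p q b :: "real^4 \<Rightarrow> complex"
  assumes A[measurable]: "A \<in> borel_measurable borel"
    and p: "sq_int p" and q: "sq_int q" and pC: "AE x in lborel. norm (p x) \<le> C"
    and weak: "weak_A0_eq A p q" and b: "test_span b"
    and AI: "\<And>b. test_span b \<Longrightarrow> integrable lborel (\<lambda>x. complex_of_real (A x) * fourier b x)"
  defines "m \<equiv> \<lambda>i (b::real^4 \<Rightarrow> complex) \<xi>. - \<i> * complex_of_real (\<xi> \<bullet> axis i 1) * b \<xi>"
  shows "(\<Sum>i\<in>UNIV. \<integral>x. complex_of_real (A x) * fourier (m i (m i b)) x \<partial>lborel)
       - (\<integral>x. complex_of_real ((cmod (p x))\<^sup>2 * A x) * fourier b x \<partial>lborel)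
     = - (\<integral>x. complex_of_real (Im (p x * cnj (q x))) * fourier b x \<partial>lborel)"
proof -
  have [measurable]: "p \<in> borel_measurable borel" "q \<in> borel_measurable borel" using p q by (auto simp: sq_int_def)
  have m: "test_span (m i b)" if "test_span b" for i b
    using test_span.cmult[OF test_span_coord[OF that], of "- \<i>"] by (simp add: m_def mult.assoc)
  have bi: "integrable lborel b" using test_span_test_freq[OF b] by (simp add: test_freq_iff bounded_supp_integrable)
  then have [measurable]: "b \<in> borel_measurable borel" by auto
  let ?B = "fconst TYPE(real^4) * (\<integral>x. norm (b x) \<partial>lborel)"
  have vB: "\<bar>Re (fourier b x)\<bar> \<le> ?B" "\<bar>Im (fourier b x)\<bar> \<le> ?B" for x
    using order_trans[OF abs_Re_le_cmod norm_fourier_le] order_trans[OF abs_Im_le_cmod norm_fourier_le] by auto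
  have IR: "integrable lborel (\<lambda>x. A x * Re (fourier b x))" "integrable lborel (\<lambda>x. A x * Im (fourier b x))" if "test_span b" for b
    using integrable_Re[OF AI[OF that]] integrable_Im[OF AI[OF that]] by simp_all
  have Dm: "has_partials2 (\<lambda>x. T (fourier b x)) (\<lambda>i x. T (fourier (m i b) x)) (\<lambda>i j x. T (fourier (m j (m i b)) x))" if "T = Re \<or> T = Im" for T
    unfolding m_def by (rule has_partials2_fourier[OF b that])
  note R = weak_limit_real[OF A p q pC weak Dm[OF disjI1[OF refl]] vB(1) IR(1)[OF b] IR(1)[OF m[OF b]] IR(1)[OF m[OF m[OF b]]]]
  note I = weak_limit_real[OF A p q pC weak Dm[OF disjI2[OF refl]] vB(2) IR(2)[OF b] IR(2)[OF m[OF b]] IR(2)[OF m[OF m[OF b]]]]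
  have cI: "integrable lborel f" if "integrable lborel (\<lambda>x. Re (f x))" "integrable lborel (\<lambda>x. Im (f x))" for f :: "real^4 \<Rightarrow> complex"
  proof -
    have "integrable lborel (\<lambda>x. complex_of_real (Re (f x)) + \<i> * complex_of_real (Im (f x)))"
      using that by (intro Bochner_Integration.integrable_add integrable_mult_right integrable_of_real)
    then show ?thesis by (simp only: complex_eq[symmetric])
  qed
  have i1: "integrable lborel (\<lambda>x. complex_of_real ((cmod (p x))\<^sup>2 * A x) * fourier b x)"
    by (rule cI) (use R(2) I(2) in \<open>simp_all add: m_def\<close>)
  have i2: "integrable lborel (\<lambda>x. complex_of_real (Im (p x * cnj (q x))) * fourier b x)"
    by (rule cI) (use R(3) I(3) in \<open>simp_all add: m_def\<close>)
  have i3: "integrable lborel (\<lambda>x. complex_of_real (A x) * fourier (m i (m i b)) x)" for i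
    using AI m b by blast
  have r: "Re (\<integral>x. f x \<partial>lborel) = (\<integral>x. Re (f x) \<partial>lborel)" "Im (\<integral>x. f x \<partial>lborel) = (\<integral>x. Im (f x) \<partial>lborel)"
    if "integrable lborel f" for f :: "real^4 \<Rightarrow> complex" using that by auto
  have rm: "Re (complex_of_real c * z) = c * Re z" "Im (complex_of_real c * z) = c * Im z" for c z by auto
  show ?thesis
    by (rule complex_eqI) (use R(1) I(1) in \<open>simp_all only: minus_complex.sel uminus_complex.sel Re_sum Im_sum r[OF i1] r[OF i2] r[OF i3] rm\<close>)
qed

section \<open>The equation on the Fourier side\<close>

lemma bounded_supp_indicator_box: "bounded_supp (\<lambda>x. c * indicator (box a b) x)" for a b :: "'a::euclidean_space"
proof -
  obtain r where r: "\<And>x. x \<in> box a b \<Longrightarrow> norm x \<le> r" using bounded_box[of a b] bounded_iff by metis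
  have "c * indicator (box a b) x = 0" if "r < norm x" for x
    using r[of x] that by (auto simp: indicator_def)
  then show ?thesis unfolding bounded_supp_def
    by (intro conjI exI[of _ "norm c"] exI[of _ r]) (auto simp: norm_mult indicator_def)
qed

text \<open>With the indicator of a unit box as kernel, the mollified indicator of a box is a
  convolution of two functions of bounded support, hence lies in \<open>test_span\<close>. As
  \<open>E\<close> is only locally integrable, it is first cut off to a ball containing the supports
  of these mollifications.\<close>

lemma AE_zero_if_test_span_pairing:
  fixes E :: "real^4 \<Rightarrow> complex"
  assumes [measurable]: "E \<in> borel_measurable borel"
    and loc: "\<And>b. bounded_supp b \<Longrightarrow> integrable lborel (\<lambda>\<xi>. E \<xi> * b \<xi>)"
    and zero: "\<And>b. test_span b \<Longrightarrow> (\<integral>\<xi>. E \<xi> * b \<xi> \<partial>lborel) = 0"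
  shows "AE \<xi> in lborel. E \<xi> = 0"
proof -
  define k :: "real^4 \<Rightarrow> real" where "k = indicator (box 0 One)"
  have k: "integrable lborel k" unfolding k_def
    by (intro integrable_real_indicator) (auto simp: emeasure_lborel_box_eq)
  have k1: "(\<integral>y. k y \<partial>lborel) \<noteq> 0" by (simp add: k_def measure_lborel_box_eq)
  have boxes: "(\<integral>x. indicator (box a b) x *\<^sub>R E x \<partial>lborel) = 0" for a b
  proof -
    obtain r where r: "\<And>x. x \<in> box a b \<Longrightarrow> norm x \<le> r" using bounded_box[of a b] bounded_iff by metis
    obtain s where s: "\<And>y::real^4. y \<in> box 0 One \<Longrightarrow> norm y \<le> s" using bounded_box[of "0::real^4" One] bounded_iff by metis
    \<comment> \<open>Points of the box have norm at most \<open>r\<close>, and the kernel at scale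
      1/N with N \<ge> 1 moves them by at most \<open>s\<close>, so every mollified indicator
      vanishes outside this ball.\<close>
    let ?K = "cball (0::real^4) (\<bar>r\<bar> + \<bar>s\<bar>)"
    define h where "h x = indicator ?K x * E x" for x
    have bK: "bounded_supp (\<lambda>x. indicator ?K x :: complex)"
    proof -
      have "\<forall>x. norm (indicator ?K x :: complex) \<le> 1" by (auto simp: indicator_def)
      moreover have "\<forall>x. \<bar>r\<bar> + \<bar>s\<bar> < norm x \<longrightarrow> (indicator ?K x :: complex) = 0" by (auto simp: indicator_def)
      moreover have "(\<lambda>x. indicator ?K x :: complex) \<in> borel_measurable borel" by (intro borel_measurable_indicator) auto
      ultimately show ?thesis unfolding bounded_supp_def by blast
    qed
    have hi: "integrable lborel h" using loc[OF bK] by (simp add: h_def[abs_def] mult.commute)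
    have "(\<integral>x. indicator (box a b) x *\<^sub>R h x \<partial>lborel) = 0"
    proof (rule box_integral_zero_by_mollification[OF hi k k1])
      fix n
      define N where "N = real (Suc n)"
      have N: "N \<ge> 1" by (simp add: N_def)
      let ?m = "\<lambda>x. complex_of_real (\<integral>y. indicator (box a b) (x - y /\<^sub>R N) * k y \<partial>lborel)"
      let ?kN = "\<lambda>z. complex_of_real (N ^ DIM(real^4)) * indicator (box 0 (One /\<^sub>R N)) z"
      have ind: "indicator (box 0 One) (N *\<^sub>R z) = (indicator (box 0 (One /\<^sub>R N)) z :: real)" for z :: "real^4"
      proof -
        have "(N *\<^sub>R z) \<bullet> i > 0 \<and> (N *\<^sub>R z) \<bullet> i < One \<bullet> i \<longleftrightarrow> z \<bullet> i > 0 \<and> z \<bullet> i < (One /\<^sub>R N) \<bullet> i" if "i \<in> Basis" for i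
          using N that by (auto simp: zero_less_mult_iff field_simps)
        then have "N *\<^sub>R z \<in> box 0 One \<longleftrightarrow> z \<in> box 0 (One /\<^sub>R N)" unfolding mem_box by simp
        then show ?thesis by (simp only: indicator_def)
      qed
      have meq: "?m x = cconv (\<lambda>x. 1 * indicator (box a b) x) ?kN x" for x
      proof -
        have "(\<integral>y. indicator (box a b) (x - y /\<^sub>R N) * k y \<partial>lborel) = N ^ DIM(real^4) * (\<integral>z. indicator (box a b) z * k (N *\<^sub>R (x - z)) \<partial>lborel)"
          using integral_lborel_affine[of "-N" "\<lambda>y. indicator (box a b) (x - y /\<^sub>R N) * k y" "N *\<^sub>R x"] N
          by (simp add: algebra_simps)
        also have "\<dots> = (\<integral>z. N ^ DIM(real^4) * (indicator (box a b) z * k (N *\<^sub>R (x - z))) \<partial>lborel)" by simp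
        finally have "?m x = (\<integral>z. complex_of_real (N ^ DIM(real^4) * (indicator (box a b) z * k (N *\<^sub>R (x - z)))) \<partial>lborel)"
          by (simp only: integral_complex_of_real)
        also have "\<dots> = cconv (\<lambda>x. 1 * indicator (box a b) x) ?kN x"
          unfolding cconv_def by (intro Bochner_Integration.integral_cong) (auto simp: k_def ind of_real_indicator mult_ac)
        finally show ?thesis .
      qed
      have t: "test_span ?m" unfolding meq by (intro test_span.conv bounded_supp_indicator_box)
      have supp: "?m x * h x = E x * ?m x" for x
      proof (cases "x \<in> ?K")
        case False
        have "indicator (box a b) (x - y /\<^sub>R N) * k y = 0" for y
        proof (rule ccontr)
          assume "indicator (box a b) (x - y /\<^sub>R N) * k y \<noteq> 0"
          then have "x - y /\<^sub>R N \<in> box a b" "y \<in> box 0 One" by (auto simp: k_def indicator_def split: if_splits)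
          then have 1: "norm (x - y /\<^sub>R N) \<le> r" "norm y \<le> s" using r s by auto
          have "norm (y /\<^sub>R N) = norm y / N" using N by (simp add: divide_inverse mult.commute)
          also have "\<dots> \<le> norm y" using N mult_left_mono[of 1 N "norm y"] by (simp add: divide_le_eq)
          finally have "norm (y /\<^sub>R N) \<le> s" using 1 by simp
          moreover have "norm x \<le> norm (x - y /\<^sub>R N) + norm (y /\<^sub>R N)" using norm_triangle_sub[of x "y /\<^sub>R N"] by simp
          ultimately show False using False 1 by auto
        qed
        then have "?m x = 0" by (simp only: integral_zero of_real_0)
        then show ?thesis by simp
      qed (auto simp: h_def)
      have "(\<integral>x. ?m x * h x \<partial>lborel) = 0" unfolding supp using zero[OF t] .
      then show "(\<integral>x. complex_of_real (\<integral>y. indicator (box a b) (x - y /\<^sub>R real (Suc n)) * k y \<partial>lborel) * h x \<partial>lborel) = 0"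
        by (simp only: N_def)
    qed
    moreover have "indicator (box a b) x *\<^sub>R h x = indicator (box a b) x *\<^sub>R E x" for x
      using r[of x] by (auto simp: h_def indicator_def)
    ultimately show ?thesis by simp
  qed
  \<comment> \<open>Growing boxes cover the space. The restriction of \<open>E\<close> to one of
    them is integrable with vanishing box integrals, since an intersection of boxes is a
    box.\<close>
  let ?A = "\<lambda>n::nat. box (- (real n *\<^sub>R One)) (real n *\<^sub>R One) :: (real^4) set"
  have "AE x in lborel. indicator (?A n) x *\<^sub>R E x = 0" for n
  proof (rule AE_zero_if_box_integrals_zero)
    show "integrable lborel (\<lambda>x. indicator (?A n) x *\<^sub>R E x)"
      using loc[OF bounded_supp_indicator_box[of 1 "- (real n *\<^sub>R One)" "real n *\<^sub>R One"]]
      by (simp add: scaleR_conv_of_real of_real_indicator mult.commute)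
    fix a b :: "real^4"
    obtain c d where cd: "box a b \<inter> ?A n = box c d" using box_Int_box by blast
    have "indicator (box a b) x *\<^sub>R indicator (?A n) x *\<^sub>R E x = indicator (box c d) x *\<^sub>R E x" for x
      unfolding cd[symmetric] by (simp add: indicator_def)
    then show "(\<integral>x. indicator (box a b) x *\<^sub>R indicator (?A n) x *\<^sub>R E x \<partial>lborel) = 0"
      by (simp only: boxes)
  qed
  then have "AE x in lborel. \<forall>n. indicator (?A n) x *\<^sub>R E x = 0" unfolding AE_all_countable by blast
  then show ?thesis
  proof eventually_elim
    case (elim x)
    have "x \<in> (\<Union>n. ?A n)" using UN_box_eq_UNIV by auto
    then obtain n where "x \<in> ?A n" by blast
    then show ?case using elim[rule_format, of n] by simp
  qed
qed

text \<open>The pairing in the definition of \<^const>\<open>Hdot1\<close>, for complex functions and without the weight.\<close>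
definition freq_pairing :: "(real^4 \<Rightarrow> complex) \<Rightarrow> (real^4 \<Rightarrow> complex) \<Rightarrow> bool" where
  "freq_pairing a V \<longleftrightarrow> a \<in> borel_measurable borel \<and> V \<in> borel_measurable borel \<and>
    (\<forall>b. test_freq b \<longrightarrow> integrable lborel (\<lambda>x. a x * fourier b x) \<and> integrable lborel (\<lambda>\<xi>. V \<xi> * b \<xi>) \<and>
       (\<integral>x. a x * fourier b x \<partial>lborel) = (\<integral>\<xi>. V \<xi> * b \<xi> \<partial>lborel))"

text \<open>The multiplier is absorbed into the test function as in \<open>is_FT_mult\<close>, but
  the result must again lie in \<open>test_freq\<close>. Bounded support of \<open>U\<close> gives
  bounded support of the convolution, and the transform of the convolution is the integrable
  \<open>fourier b\<close> times a bounded function.\<close>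

lemma freq_pairing_mult_compact:
  assumes HP: "freq_pairing a V" and U: "integrable lborel U" and supp: "\<And>x. r < norm x \<Longrightarrow> U x = 0" and b: "test_freq b"
    and fin: "(\<integral>\<^sup>+\<xi>. nconv (nm U) (nm V) \<xi> * nm b \<xi> \<partial>lborel) < \<infinity>"
  shows "(\<integral>x. ifourier U x * (a x * fourier b x) \<partial>lborel) = complex_of_real (fconst TYPE(real^4)) * (\<integral>\<xi>. cconv U V \<xi> * b \<xi> \<partial>lborel)"
proof -
  let ?c = "complex_of_real (fconst TYPE(real^4))"
  have bb: "bounded_supp b" "integrable lborel (fourier b)" using b by (auto simp: test_freq_iff)
  have [measurable]: "U \<in> borel_measurable borel" "b \<in> borel_measurable borel" "V \<in> borel_measurable borel"
    using U bb HP by (auto simp: bounded_supp_def freq_pairing_def)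
  have U': "integrable lborel (\<lambda>\<eta>. U (- \<eta>))" using U integrable_lborel_reflect(2) by blast
  let ?b = "cconv (\<lambda>\<eta>. U (- \<eta>)) b"
  have eq: "ifourier U x * fourier b x = ?c * fourier ?b x" for x
    by (rule ifourier_mult_fourier[OF U bounded_supp_integrable(1)[OF bb(1)]])
  have "integrable lborel (\<lambda>x. ifourier U x * fourier b x)"
    by (rule integrable_bounded_mult[OF bb(2)]) (auto intro!: norm_ifourier_le)
  then have "integrable lborel (\<lambda>x. inverse ?c * (?c * fourier ?b x))"
    unfolding eq by (rule integrable_mult_right)
  then have "integrable lborel (fourier ?b)"
    by (simp add: mult.assoc[symmetric] less_imp_neq[OF fconst_pos, symmetric])
  moreover have "bounded_supp ?b" by (rule bounded_supp_cconv[OF U' _ bb(1), of r]) (use supp in simp)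
  ultimately have "test_freq ?b" by (simp add: test_freq_iff)
  then have "(\<integral>x. a x * fourier ?b x \<partial>lborel) = (\<integral>\<xi>. V \<xi> * ?b \<xi> \<partial>lborel)" using HP by (simp add: freq_pairing_def)
  also have "\<dots> = (\<integral>\<xi>. cconv U V \<xi> * b \<xi> \<partial>lborel)" by (rule cconv_adjoint(3)[OF _ _ _ fin]) measurable
  finally have "?c * (\<integral>x. a x * fourier ?b x \<partial>lborel) = ?c * (\<integral>\<xi>. cconv U V \<xi> * b \<xi> \<partial>lborel)" by simp
  moreover have "ifourier U x * (a x * fourier b x) = ?c * (a x * fourier ?b x)" for x
    using eq[of x] by (simp add: mult.left_commute)
  ultimately show ?thesis by (simp only: integral_mult_right_zero)
qed

text \<open>Truncation of \<open>U\<close> to balls reduces to the case of bounded support. On the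
  physical side \<open>ifourier (W n)\<close> converges boundedly; on the frequency side the
  convolution of absolute values is a majorant, integrable against \<open>b\<close> by
  assumption.\<close>

lemma freq_pairing_mult:
  assumes HP: "freq_pairing a V" and U: "integrable lborel U"
    and fin: "\<And>b. bounded_supp b \<Longrightarrow> (\<integral>\<^sup>+\<xi>. nconv (nm U) (nm V) \<xi> * nm b \<xi> \<partial>lborel) < \<infinity>"
  shows "freq_pairing (\<lambda>x. ifourier U x * a x) (\<lambda>\<xi>. complex_of_real (fconst TYPE(real^4)) * cconv U V \<xi>)"
proof -
  let ?c = "complex_of_real (fconst TYPE(real^4))"
  have [measurable]: "U \<in> borel_measurable borel" "V \<in> borel_measurable borel" "a \<in> borel_measurable borel"
    using U HP by (auto simp: freq_pairing_def)
  have "integrable lborel (\<lambda>x. ifourier U x * a x * fourier b x) \<and> integrable lborel (\<lambda>\<xi>. ?c * cconv U V \<xi> * b \<xi>) \<and>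
       (\<integral>x. ifourier U x * a x * fourier b x \<partial>lborel) = (\<integral>\<xi>. ?c * cconv U V \<xi> * b \<xi> \<partial>lborel)" if b: "test_freq b" for b
  proof -
    have bb: "bounded_supp b" "integrable lborel (fourier b)" using b by (auto simp: test_freq_iff)
    have [measurable]: "b \<in> borel_measurable borel" using bb by (auto simp: bounded_supp_def)
    have af: "integrable lborel (\<lambda>x. a x * fourier b x)" using HP b by (simp add: freq_pairing_def)
    define W where "W n x = indicator (cball 0 (real n)) x * U x" for n x
    have Um[measurable]: "W n \<in> borel_measurable borel" for n unfolding W_def[abs_def]
      by (intro borel_measurable_times borel_measurable_indicator) auto
    have Ule: "norm (W n x) \<le> norm (U x)" for n x by (auto simp: W_def indicator_def)
    have Ui: "integrable lborel (W n)" for n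
      by (rule Bochner_Integration.integrable_bound[OF U]) (use Ule in auto)
    have Ul: "\<forall>\<^sub>F n in sequentially. W n x = U x" for x
    proof -
      obtain N :: nat where "norm x \<le> real N" using real_arch_simple by blast
      then show ?thesis by (auto simp: W_def eventually_sequentially indicator_def intro!: exI[of _ N])
    qed
    have ncle: "nconv (nm (W n)) (nm V) \<xi> \<le> nconv (nm U) (nm V) \<xi>" for n \<xi>
      unfolding nconv_def by (intro nn_integral_mono mult_right_mono ennreal_leI Ule) auto
    have finn: "(\<integral>\<^sup>+\<xi>. nconv (nm (W n)) (nm V) \<xi> * nm b \<xi> \<partial>lborel) < \<infinity>" for n
      by (rule le_less_trans[OF _ fin[OF bb(1)]]) (intro nn_integral_mono mult_right_mono ncle, simp)
    have eqn: "(\<integral>x. ifourier (W n) x * (a x * fourier b x) \<partial>lborel) = ?c * (\<integral>\<xi>. cconv (W n) V \<xi> * b \<xi> \<partial>lborel)" for n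
      by (rule freq_pairing_mult_compact[OF HP Ui _ b finn, of "real n"]) (auto simp: W_def)
    have ifl: "(\<lambda>n. ifourier (W n) x) \<longlonglongrightarrow> ifourier U x" for x
    proof -
      have "(\<lambda>n. \<integral>\<xi>. ek \<xi> (- x) * W n \<xi> \<partial>lborel) \<longlonglongrightarrow> (\<integral>\<xi>. ek \<xi> (- x) * U \<xi> \<partial>lborel)"
      proof (rule integral_dominated_convergence[where w="\<lambda>x. norm (U x)"])
        show "AE \<xi> in lborel. (\<lambda>n. ek \<xi> (- x) * W n \<xi>) \<longlonglongrightarrow> ek \<xi> (- x) * U \<xi>"
          using Ul by (intro AE_I2 tendsto_mult_left tendsto_eventually)
      qed (use U Ule in \<open>auto simp: norm_mult\<close>)
      then show ?thesis unfolding ifourier_def fourier_ek by (intro tendsto_intros)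
    qed
    let ?B = "fconst TYPE(real^4) * (\<integral>x. norm (U x) \<partial>lborel)"
    have ifb: "norm (ifourier (W n) x) \<le> ?B" for n x
    proof -
      have "(\<integral>x. norm (W n x) \<partial>lborel) \<le> (\<integral>x. norm (U x) \<partial>lborel)"
        using Ui U Ule by (intro integral_mono) auto
      then show ?thesis using order_trans[OF norm_ifourier_le mult_left_mono] by auto
    qed
    have B0: "0 \<le> ?B" using ifb[of 0 0] norm_ge_zero order_trans by blast
    have l1: "(\<lambda>n. \<integral>x. ifourier (W n) x * (a x * fourier b x) \<partial>lborel) \<longlonglongrightarrow> (\<integral>x. ifourier U x * (a x * fourier b x) \<partial>lborel)"
    proof (rule integral_dominated_convergence[where w="\<lambda>x. ?B * norm (a x * fourier b x)"])
      show "AE x in lborel. (\<lambda>n. ifourier (W n) x * (a x * fourier b x)) \<longlonglongrightarrow> ifourier U x * (a x * fourier b x)"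
        by (intro AE_I2 tendsto_mult_right ifl)
      show "AE x in lborel. norm (ifourier (W n) x * (a x * fourier b x)) \<le> ?B * norm (a x * fourier b x)" for n
        unfolding norm_mult[of "ifourier _ _"] by (intro AE_I2 mult_right_mono ifb) simp
    qed (use af in auto)
    \<comment> \<open>The majorant takes values in [0,\<infinity>]. Its finite integral makes it
      finite almost everywhere, so \<open>enn2real\<close> turns it into a real dominating
      function.\<close>
    let ?w = "\<lambda>\<xi>. nconv (nm U) (nm V) \<xi> * nm b \<xi>"
    have wAE: "AE \<xi> in lborel. ?w \<xi> \<noteq> \<infinity>"
      by (rule nn_integral_PInf_AE) (use fin[OF bb(1)] in auto)
    have wi: "integrable lborel (\<lambda>\<xi>. enn2real (?w \<xi>))"
    proof (rule integrableI_bounded)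
      have "(\<integral>\<^sup>+\<xi>. ennreal (norm (enn2real (?w \<xi>))) \<partial>lborel) \<le> (\<integral>\<^sup>+\<xi>. ?w \<xi> \<partial>lborel)"
        by (intro nn_integral_mono) (simp add: ennreal_enn2real_if)
      then show "(\<integral>\<^sup>+\<xi>. ennreal (norm (enn2real (?w \<xi>))) \<partial>lborel) < \<infinity>" using fin[OF bb(1)] by (rule le_less_trans)
    qed measurable
    have l2: "(\<lambda>n. \<integral>\<xi>. cconv (W n) V \<xi> * b \<xi> \<partial>lborel) \<longlonglongrightarrow> (\<integral>\<xi>. cconv U V \<xi> * b \<xi> \<partial>lborel)"
    proof (rule integral_dominated_convergence[OF _ _ wi])
      show "AE \<xi> in lborel. (\<lambda>n. cconv (W n) V \<xi> * b \<xi>) \<longlonglongrightarrow> cconv U V \<xi> * b \<xi>"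
        using wAE
      proof eventually_elim
        case (elim \<xi>)
        show ?case
        proof (cases "b \<xi> = 0")
          case False
          then have "nconv (nm U) (nm V) \<xi> < \<infinity>" using elim by (auto simp: ennreal_top_mult less_top[symmetric])
          then have i: "integrable lborel (\<lambda>\<eta>. U \<eta> * V (\<xi> - \<eta>))"
            by (simp add: integrable_nm_iff nconv_def norm_mult ennreal_mult)
          have "(\<lambda>n. cconv (W n) V \<xi>) \<longlonglongrightarrow> cconv U V \<xi>" unfolding cconv_def
          proof (rule integral_dominated_convergence[OF _ _ integrable_norm[OF i]])
            show "AE \<eta> in lborel. (\<lambda>n. W n \<eta> * V (\<xi> - \<eta>)) \<longlonglongrightarrow> U \<eta> * V (\<xi> - \<eta>)"
              using Ul by (intro AE_I2 tendsto_mult_right tendsto_eventually)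
            show "AE \<eta> in lborel. norm (W n \<eta> * V (\<xi> - \<eta>)) \<le> norm (U \<eta> * V (\<xi> - \<eta>))" for n
              using Ule by (auto simp: norm_mult intro!: mult_right_mono AE_I2)
          qed measurable
          then show ?thesis by (intro tendsto_intros)
        qed simp
      qed
      show "AE \<xi> in lborel. norm (cconv (W n) V \<xi> * b \<xi>) \<le> enn2real (?w \<xi>)" for n
        using wAE
      proof eventually_elim
        case (elim \<xi>)
        have "ennreal (norm (cconv (W n) V \<xi> * b \<xi>)) \<le> ?w \<xi>"
          using order_trans[OF nm_cconv_le[of "W n" V \<xi>] ncle[of n \<xi>]] by (simp add: norm_mult ennreal_mult mult_right_mono)
        then show ?case using elim
          by (metis enn2real_ennreal enn2real_mono ennreal_neq_top infinity_ennreal_def norm_ge_zero top.not_eq_extremum)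
      qed
    qed measurable
    have "(\<integral>x. ifourier U x * (a x * fourier b x) \<partial>lborel) = ?c * (\<integral>\<xi>. cconv U V \<xi> * b \<xi> \<partial>lborel)"
      using LIMSEQ_unique[OF l1[unfolded eqn] tendsto_mult_left[OF l2]] by simp
    moreover have "integrable lborel (\<lambda>\<xi>. cconv U V \<xi> * b \<xi>)"
      by (rule cconv_adjoint(1)[OF _ _ _ fin[OF bb(1)]]) measurable
    moreover have "integrable lborel (\<lambda>x. ifourier U x * (a x * fourier b x))"
      by (rule integrable_bounded_mult[OF af]) (auto intro!: norm_ifourier_le)
    ultimately show ?thesis by (simp add: mult.assoc)
  qed
  then show ?thesis unfolding freq_pairing_def by auto
qed

text \<open>The transform of the complex conjugate, written with a prime in the overview; see
  \<open>cnj_ifourier\<close>.\<close>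

definition refl_cnj :: "('a::euclidean_space \<Rightarrow> complex) \<Rightarrow> 'a \<Rightarrow> complex" where
  "refl_cnj P = (\<lambda>\<xi>. cnj (P (- \<xi>)))"

lemma cnj_ifourier: "cnj (ifourier P x) = ifourier (refl_cnj P) x"
  by (simp add: ifourier_def refl_cnj_def fourier_cnj_reflect)

lemma integrable_refl_cnj: "integrable lborel P \<Longrightarrow> integrable lborel (refl_cnj P)"
  using integrable_lborel_reflect(2)[of P] by (simp add: refl_cnj_def)

lemma measurable_refl_cnj [measurable]:
  assumes [measurable]: "P \<in> borel_measurable borel" shows "refl_cnj P \<in> borel_measurable borel"
  unfolding refl_cnj_def by measurable

text \<open>The two sides are compared through \<open>E\<close>, whose pairing with every element of
  \<open>test_span\<close> vanishes. The cubic term is built in two multiplications: \<phi> times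
  \<open>A0\<close> is placed in L2 by \<open>fin\<close>, and after that multiplication by the
  conjugate is a convolution of L1 with L2.\<close>

lemma elliptic_identity:
  fixes A :: "real^4 \<Rightarrow> real"
  assumes pP: "is_FT p P" and qQ: "is_FT q Q" and P: "integrable lborel P" and p: "sq_int p" and q: "sq_int q"
    and H: "Hdot1 A G" and weak: "weak_A0_eq A p q"
    and Gloc: "\<And>b. bounded_supp b \<Longrightarrow> integrable lborel (\<lambda>\<xi>. G \<xi> * b \<xi>)"
    and fin: "(\<integral>\<^sup>+\<xi>. (nconv (nm P) (nm G) \<xi>)\<^sup>2 \<partial>lborel) < \<infinity>"
  defines "c \<equiv> complex_of_real (fconst TYPE(real^4))"
  shows "AE \<xi> in lborel. complex_of_real ((norm \<xi>)\<^sup>2) * G \<xi> =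
     c * (cconv P (refl_cnj Q) \<xi> - cconv (refl_cnj P) Q \<xi>) / (2 * \<i>) - c * c * cconv (refl_cnj P) (cconv P G) \<xi>"
proof -
  let ?P' = "refl_cnj P" and ?Q' = "refl_cnj Q"
  have Gm[measurable]: "G \<in> borel_measurable borel" and Am[measurable]: "A \<in> borel_measurable borel" using H by (auto simp: Hdot1_def)
  have [measurable]: "P \<in> borel_measurable borel" "Q \<in> borel_measurable borel" "p \<in> borel_measurable borel" "q \<in> borel_measurable borel"
    using P qQ p q by (auto simp: is_FT_def sq_int_def)
  have P': "integrable lborel ?P'" by (rule integrable_refl_cnj[OF P])
  have pAE: "AE x in lborel. p x = ifourier P x"
    by (rule fourier_inversion_AE[OF _ P]) (use pP in \<open>auto simp: is_FT_def\<close>)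
  then have pC: "AE x in lborel. norm (p x) \<le> fconst TYPE(real^4) * (\<integral>x. norm (P x) \<partial>lborel)"
    by eventually_elim (simp add: norm_ifourier_le)
  have HPA: "freq_pairing (\<lambda>x. complex_of_real (A x)) G"
    using H Gloc unfolding freq_pairing_def Hdot1_def test_freq_iff by auto
  have bcs2: "(\<integral>\<^sup>+x. (nm b x)\<^sup>2 \<partial>lborel) < \<infinity>" if "bounded_supp b" for b :: "real^4 \<Rightarrow> complex"
    using bounded_supp_integrable(2)[OF that] by (simp add: sq_int_nm_iff)
  have HP1: "freq_pairing (\<lambda>x. ifourier P x * complex_of_real (A x)) (\<lambda>\<xi>. c * cconv P G \<xi>)"
    unfolding c_def
  proof (rule freq_pairing_mult[OF HPA P])
    fix b :: "real^4 \<Rightarrow> complex" assume b: "bounded_supp b"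
    have [measurable]: "b \<in> borel_measurable borel" using b by (auto simp: bounded_supp_def)
    show "(\<integral>\<^sup>+\<xi>. nconv (nm P) (nm G) \<xi> * nm b \<xi> \<partial>lborel) < \<infinity>"
      using fin bcs2[OF b] by (intro nn_L2_pairing_finite) auto
  qed
  have sq1: "sq_int (cconv P G)"
  proof -
    have "(\<integral>\<^sup>+x. (nm (cconv P G) x)\<^sup>2 \<partial>lborel) \<le> (\<integral>\<^sup>+\<xi>. (nconv (nm P) (nm G) \<xi>)\<^sup>2 \<partial>lborel)"
      by (intro nn_integral_mono power_mono nm_cconv_le) simp
    then show ?thesis using fin by (auto simp: sq_int_nm_iff intro: le_less_trans)
  qed
  have sq1c: "sq_int (\<lambda>\<xi>. c * cconv P G \<xi>)"
    using sq1 by (auto simp: sq_int_def norm_mult power_mult_distrib)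
  have HP2: "freq_pairing (\<lambda>x. ifourier ?P' x * (ifourier P x * complex_of_real (A x))) (\<lambda>\<xi>. c * cconv ?P' (\<lambda>\<xi>. c * cconv P G \<xi>) \<xi>)"
    unfolding c_def
  proof (rule freq_pairing_mult[OF HP1[unfolded c_def] P'])
    fix b :: "real^4 \<Rightarrow> complex" assume b: "bounded_supp b"
    have [measurable]: "b \<in> borel_measurable borel" using b by (auto simp: bounded_supp_def)
    show "(\<integral>\<^sup>+\<xi>. nconv (nm ?P') (nm (\<lambda>\<xi>. complex_of_real (fconst TYPE(real^4)) * cconv P G \<xi>)) \<xi> * nm b \<xi> \<partial>lborel) < \<infinity>"
      using sq_nconv_finite[OF P' sq1c] bcs2[OF b] unfolding c_def by (intro nn_L2_pairing_finite) auto
  qed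
  have cc: "cconv ?P' (\<lambda>\<xi>. c * cconv P G \<xi>) \<xi> = c * cconv ?P' (cconv P G) \<xi>" for \<xi>
    unfolding cconv_def[of ?P'] by (subst integral_mult_right_zero[symmetric]) (simp only: mult.left_commute)
  have F1: "is_FT (\<lambda>x. ifourier P x * cnj (q x)) (\<lambda>\<xi>. c * cconv P ?Q' \<xi>)"
    using is_FT_mult[OF is_FT_cnj[OF qQ] P] unfolding refl_cnj_def c_def .
  have F2: "is_FT (\<lambda>x. ifourier ?P' x * q x) (\<lambda>\<xi>. c * cconv ?P' Q \<xi>)"
    using is_FT_mult[OF qQ P'] unfolding c_def .
  define M where "M \<xi> = c * c * cconv ?P' (cconv P G) \<xi>" for \<xi>
  define R1 where "R1 \<xi> = c * cconv P ?Q' \<xi>" for \<xi>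
  define R2 where "R2 \<xi> = c * cconv ?P' Q \<xi>" for \<xi>
  have [measurable]: "M \<in> borel_measurable borel" "R1 \<in> borel_measurable borel" "R2 \<in> borel_measurable borel"
    unfolding M_def R1_def R2_def by measurable
  have sqM: "sq_int M"
    using sq_int_cconv[OF P' sq1] unfolding M_def by (auto simp: sq_int_def norm_mult power_mult_distrib)
  have sqR: "sq_int R1" "sq_int R2" using F1 F2 by (auto simp: is_FT_def R1_def[abs_def] R2_def[abs_def])
  define E where "E \<xi> = complex_of_real ((norm \<xi>)\<^sup>2) * G \<xi> + M \<xi> - (R1 \<xi> - R2 \<xi>) / (2 * \<i>)" for \<xi>
  have [measurable]: "E \<in> borel_measurable borel" unfolding E_def by measurable
  have iG: "integrable lborel (\<lambda>\<xi>. complex_of_real ((norm \<xi>)\<^sup>2) * G \<xi> * b \<xi>)" if "bounded_supp b" for b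
  proof -
    have "bounded_supp (\<lambda>\<xi>. complex_of_real ((norm \<xi>)\<^sup>2) * b \<xi>)" by (intro bounded_supp_mult_cont that continuous_intros)
    from Gloc[OF this] show ?thesis by (simp add: mult_ac)
  qed
  have iMR: "integrable lborel (\<lambda>\<xi>. M \<xi> * b \<xi>)" "integrable lborel (\<lambda>\<xi>. R1 \<xi> * b \<xi>)" "integrable lborel (\<lambda>\<xi>. R2 \<xi> * b \<xi>)" if "bounded_supp b" for b
    using integrable_sq_int_mult bounded_supp_integrable(2)[OF that] sqM sqR by blast+
  have Eb: "E \<xi> * b \<xi> = complex_of_real ((norm \<xi>)\<^sup>2) * G \<xi> * b \<xi> + M \<xi> * b \<xi> - (R1 \<xi> * b \<xi> - R2 \<xi> * b \<xi>) / (2 * \<i>)" for b \<xi>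
    by (simp add: E_def ring_distribs diff_divide_distrib mult.assoc)
  have "AE \<xi> in lborel. E \<xi> = 0"
  proof (rule AE_zero_if_test_span_pairing)
    show "integrable lborel (\<lambda>\<xi>. E \<xi> * b \<xi>)" if "bounded_supp b" for b
      unfolding Eb using iG[OF that] iMR[OF that]
      by (intro Bochner_Integration.integrable_add Bochner_Integration.integrable_diff integrable_divide) auto
    fix b assume b: "test_span b"
    let ?m = "\<lambda>i (b::real^4 \<Rightarrow> complex) \<xi>. - \<i> * complex_of_real (\<xi> \<bullet> axis i 1) * b \<xi>"
    have tb: "test_freq b" "bounded_supp b" using test_span_test_freq[OF b] by (auto simp: test_freq_iff)
    have mt: "test_span (?m i b)" if "test_span b" for i b
      using test_span.cmult[OF test_span_coord[OF that], of "- \<i>"] by (simp add: mult.assoc)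
    have HA: "integrable lborel (\<lambda>x. complex_of_real (A x) * fourier b x)" "(\<integral>x. complex_of_real (A x) * fourier b x \<partial>lborel) = (\<integral>\<xi>. G \<xi> * b \<xi> \<partial>lborel)"
      if "test_span b" for b using HPA test_span_test_freq[OF that] by (auto simp: freq_pairing_def)
    have W: "(\<Sum>i\<in>UNIV. \<integral>x. complex_of_real (A x) * fourier (?m i (?m i b)) x \<partial>lborel)
       - (\<integral>x. complex_of_real ((cmod (p x))\<^sup>2 * A x) * fourier b x \<partial>lborel)
       = - (\<integral>x. complex_of_real (Im (p x * cnj (q x))) * fourier b x \<partial>lborel)"
      by (rule weak_limit[OF Am p q pC weak b HA(1)])
    \<comment> \<open>Differentiating twice in direction \<open>i\<close> multiplies by the square
      of -i times a coordinate; the sum over the directions is -|\<xi>|^2.\<close>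
    have T1: "(\<Sum>i\<in>UNIV. \<integral>x. complex_of_real (A x) * fourier (?m i (?m i b)) x \<partial>lborel) = - (\<integral>\<xi>. complex_of_real ((norm \<xi>)\<^sup>2) * G \<xi> * b \<xi> \<partial>lborel)"
    proof -
      have "(\<Sum>i\<in>UNIV. \<integral>x. complex_of_real (A x) * fourier (?m i (?m i b)) x \<partial>lborel) = (\<Sum>i\<in>UNIV. \<integral>\<xi>. G \<xi> * ?m i (?m i b) \<xi> \<partial>lborel)"
        using HA(2)[OF mt[OF mt[OF b]]] by simp
      also have "\<dots> = (\<integral>\<xi>. (\<Sum>i\<in>UNIV. G \<xi> * ?m i (?m i b) \<xi>) \<partial>lborel)"
      proof (rule Bochner_Integration.integral_sum[symmetric])
        fix i :: 4
        have "bounded_supp (?m i (?m i b))" using test_span_test_freq[OF mt[OF mt[OF b]], of i i] by (simp add: test_freq_iff)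
        then show "integrable lborel (\<lambda>\<xi>. G \<xi> * ?m i (?m i b) \<xi>)" by (rule Gloc)
      qed
      also have "\<dots> = (\<integral>\<xi>. - (complex_of_real ((norm \<xi>)\<^sup>2) * G \<xi> * b \<xi>) \<partial>lborel)"
      proof (rule Bochner_Integration.integral_cong[OF refl])
        fix \<xi> :: "real^4"
        have n2: "(norm \<xi>)\<^sup>2 = (\<Sum>i\<in>UNIV. (\<xi> $ i) * (\<xi> $ i))"
          by (simp add: power2_norm_eq_inner inner_vec_def)
        have "(\<Sum>i\<in>UNIV. G \<xi> * ?m i (?m i b) \<xi>) = (\<Sum>i\<in>UNIV. - (G \<xi> * b \<xi>) * complex_of_real ((\<xi> $ i) * (\<xi> $ i)))"
          by (intro sum.cong) (auto simp: inner_axis algebra_simps)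
        also have "\<dots> = - (complex_of_real ((norm \<xi>)\<^sup>2) * G \<xi> * b \<xi>)"
          unfolding sum_distrib_left[symmetric] of_real_sum[symmetric] n2[symmetric] by simp
        finally show "(\<Sum>i\<in>UNIV. G \<xi> * ?m i (?m i b) \<xi>) = - (complex_of_real ((norm \<xi>)\<^sup>2) * G \<xi> * b \<xi>)" .
      qed
      finally show ?thesis by simp
    qed
    have T2: "(\<integral>x. complex_of_real ((cmod (p x))\<^sup>2 * A x) * fourier b x \<partial>lborel) = (\<integral>\<xi>. M \<xi> * b \<xi> \<partial>lborel)"
    proof -
      have "(\<integral>x. complex_of_real ((cmod (p x))\<^sup>2 * A x) * fourier b x \<partial>lborel) = (\<integral>x. ifourier ?P' x * (ifourier P x * complex_of_real (A x)) * fourier b x \<partial>lborel)"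
      proof (rule integral_cong_AE)
        show "AE x in lborel. complex_of_real ((cmod (p x))\<^sup>2 * A x) * fourier b x = ifourier ?P' x * (ifourier P x * complex_of_real (A x)) * fourier b x"
          using pAE
        proof eventually_elim
          case (elim x)
          have "complex_of_real ((cmod (p x))\<^sup>2) = p x * cnj (p x)" by (rule complex_norm_square)
          then show ?case by (simp add: elim cnj_ifourier mult_ac)
        qed
        have [measurable]: "b \<in> borel_measurable borel" using tb by (simp add: bounded_supp_def)
        show "(\<lambda>x. complex_of_real ((cmod (p x))\<^sup>2 * A x) * fourier b x) \<in> borel_measurable lborel"
           "(\<lambda>x. ifourier ?P' x * (ifourier P x * complex_of_real (A x)) * fourier b x) \<in> borel_measurable lborel"
          by measurable
      qed
      also have "\<dots> = (\<integral>\<xi>. M \<xi> * b \<xi> \<partial>lborel)" using HP2 tb(1) unfolding freq_pairing_def cc M_def by (simp add: mult.assoc)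
      finally show ?thesis .
    qed
    have bL: "integrable lborel b" "sq_int b" using bounded_supp_integrable tb by auto
    have T3: "(\<integral>x. complex_of_real (Im (p x * cnj (q x))) * fourier b x \<partial>lborel) = (\<integral>\<xi>. (R1 \<xi> * b \<xi> - R2 \<xi> * b \<xi>) / (2 * \<i>) \<partial>lborel)"
    proof -
      have i1: "integrable lborel (\<lambda>x. ifourier P x * cnj (q x) * fourier b x)" "(\<integral>x. ifourier P x * cnj (q x) * fourier b x \<partial>lborel) = (\<integral>\<xi>. R1 \<xi> * b \<xi> \<partial>lborel)"
        using F1 bL unfolding is_FT_def R1_def by auto
      have i2: "integrable lborel (\<lambda>x. ifourier ?P' x * q x * fourier b x)" "(\<integral>x. ifourier ?P' x * q x * fourier b x \<partial>lborel) = (\<integral>\<xi>. R2 \<xi> * b \<xi> \<partial>lborel)"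
        using F2 bL unfolding is_FT_def R2_def by auto
      have "(\<integral>x. complex_of_real (Im (p x * cnj (q x))) * fourier b x \<partial>lborel)
         = (\<integral>x. (ifourier P x * cnj (q x) * fourier b x - ifourier ?P' x * q x * fourier b x) / (2 * \<i>) \<partial>lborel)"
      proof (rule integral_cong_AE)
        show "AE x in lborel. complex_of_real (Im (p x * cnj (q x))) * fourier b x = (ifourier P x * cnj (q x) * fourier b x - ifourier ?P' x * q x * fourier b x) / (2 * \<i>)"
          using pAE
        proof eventually_elim
          case (elim x)
          have "complex_of_real (Im z) = (z - cnj z) / (2 * \<i>)" for z by (simp add: complex_eq_iff)
          then have "complex_of_real (Im (p x * cnj (q x))) = (p x * cnj (q x) - cnj (p x * cnj (q x))) / (2 * \<i>)" .
          moreover have "cnj (p x * cnj (q x)) = ifourier ?P' x * q x" by (simp add: elim cnj_ifourier)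
          ultimately have e: "complex_of_real (Im (p x * cnj (q x))) = (ifourier P x * cnj (q x) - ifourier ?P' x * q x) / (2 * \<i>)"
            by (simp only: elim)
          show ?case unfolding e by (simp only: times_divide_eq_left left_diff_distrib)
        qed
        have [measurable]: "b \<in> borel_measurable borel" using tb by (simp add: bounded_supp_def)
        show "(\<lambda>x. complex_of_real (Im (p x * cnj (q x))) * fourier b x) \<in> borel_measurable lborel"
          "(\<lambda>x. (ifourier P x * cnj (q x) * fourier b x - ifourier ?P' x * q x * fourier b x) / (2 * \<i>)) \<in> borel_measurable lborel"
          by measurable
      qed
      also have "\<dots> = ((\<integral>\<xi>. R1 \<xi> * b \<xi> \<partial>lborel) - (\<integral>\<xi>. R2 \<xi> * b \<xi> \<partial>lborel)) / (2 * \<i>)"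
        using i1 i2 by simp
      also have "\<dots> = (\<integral>\<xi>. (R1 \<xi> * b \<xi> - R2 \<xi> * b \<xi>) / (2 * \<i>) \<partial>lborel)"
        using iMR(2,3)[OF tb(2)] by simp
      finally show ?thesis .
    qed
    have "(\<integral>\<xi>. E \<xi> * b \<xi> \<partial>lborel) = (\<integral>\<xi>. complex_of_real ((norm \<xi>)\<^sup>2) * G \<xi> * b \<xi> \<partial>lborel) + (\<integral>\<xi>. M \<xi> * b \<xi> \<partial>lborel) - (\<integral>\<xi>. (R1 \<xi> * b \<xi> - R2 \<xi> * b \<xi>) / (2 * \<i>) \<partial>lborel)"
      unfolding Eb using iG[OF tb(2)] iMR[OF tb(2)] by simp
    also have "\<dots> = 0" using W unfolding T1 T2 T3 by (simp add: algebra_simps)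
    finally show "(\<integral>\<xi>. E \<xi> * b \<xi> \<partial>lborel) = 0" .
  qed measurable
  then show ?thesis
  proof eventually_elim
    case (elim \<xi>)
    then have "complex_of_real ((norm \<xi>)\<^sup>2) * G \<xi> = (R1 \<xi> - R2 \<xi>) / (2 * \<i>) - M \<xi>"
      by (simp add: E_def algebra_simps)
    then show ?case by (simp add: R1_def R2_def M_def right_diff_distrib)
  qed
qed

section \<open>Weighted convolution estimates\<close>

lemma nn_integral_even_real:
  fixes f :: "real \<Rightarrow> ennreal"
  assumes [measurable]: "f \<in> borel_measurable borel" and even: "\<And>x. f (- x) = f x"
  shows "(\<integral>\<^sup>+x. f x \<partial>lborel) \<le> 2 * (\<integral>\<^sup>+x. f x * indicator {0..} x \<partial>lborel)"
proof -
  have "(\<integral>\<^sup>+x. f x \<partial>lborel) \<le> (\<integral>\<^sup>+x. f x * indicator {0..} x + f (- x) * indicator {0..} (- x) \<partial>lborel)"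
    by (intro nn_integral_mono) (auto simp: even indicator_def)
  also have "\<dots> = (\<integral>\<^sup>+x. f x * indicator {0..} x \<partial>lborel) + (\<integral>\<^sup>+x. f (- x) * indicator {0..} (- x) \<partial>lborel)"
    by (rule nn_integral_add) measurable
  also have "(\<integral>\<^sup>+x. f (- x) * indicator {0..} (- x) \<partial>lborel) = (\<integral>\<^sup>+x. f x * indicator {0..} x \<partial>lborel)"
    by (rule nn_integral_lborel_reflect(2)[of "\<lambda>x. f x * indicator {0..} x"]) measurable
  finally show ?thesis by (simp add: mult_2)
qed

text \<open>For x \<ge> 1 the integrand is below x^(-2r), and 2r > 1.\<close>

lemma nn_integral_bracket_real:
  assumes r: "r > 1 / 2"
  shows "(\<integral>\<^sup>+x. ennreal ((1 + x\<^sup>2) powr (- r)) \<partial>lborel) < \<infinity>"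
proof -
  have "((\<lambda>x::real. x powr (- 2 * r)) has_integral - (1 powr (- 2 * r + 1)) / (- 2 * r + 1)) {1..}"
    using r by (intro has_integral_powr_to_inf) auto
  from nn_integral_has_integral_lebesgue'[OF _ this]
  have I: "(\<integral>\<^sup>+x. ennreal (x powr (- 2 * r)) * indicator {1..} x \<partial>lborel) < \<infinity>" by simp
  have "(\<integral>\<^sup>+x. ennreal ((1 + x\<^sup>2) powr (- r)) * indicator {0..} x \<partial>lborel)
     \<le> (\<integral>\<^sup>+x. indicator {0..1} x + ennreal (x powr (- 2 * r)) * indicator {1..} x \<partial>lborel)"
  proof (intro nn_integral_mono)
    fix x :: real
    have 1: "(1 + x\<^sup>2) powr (- r) \<le> 1"
      using powr_mono[of "-r" 0 "1 + x\<^sup>2"] r by (simp add: powr_zero_eq_one[of "1 + x\<^sup>2"] add_nonneg_eq_0_iff)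
    have 2: "(1 + x\<^sup>2) powr (- r) \<le> x powr (- 2 * r)" if "x \<ge> 1"
    proof -
      have "(1 + x\<^sup>2) powr (- r) \<le> (x\<^sup>2) powr (- r)" using that r by (intro powr_mono2') auto
      also have "(x\<^sup>2) powr (- r) = x powr (- 2 * r)"
      proof -
        have "x\<^sup>2 = x powr 2" using that by simp
        then show ?thesis unfolding powr_powr by (simp only: powr_powr) simp
      qed
      finally show ?thesis .
    qed
    show "ennreal ((1 + x\<^sup>2) powr (- r)) * indicator {0..} x \<le> indicator {0..1} x + ennreal (x powr (- 2 * r)) * indicator {1..} x"
    proof -
      consider "x < 0" | "0 \<le> x" "x \<le> 1" | "x > 1" by linarith
      then show ?thesis
      proof cases
        case 2
        then have "ennreal ((1 + x\<^sup>2) powr (- r)) * indicator {0..} x \<le> indicator {0..1} x" using 1 by simp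
        then show ?thesis by (rule order_trans) simp
      qed (use 2 in \<open>auto intro!: ennreal_leI\<close>)
    qed
  qed
  also have "\<dots> = (\<integral>\<^sup>+x. indicator {0..1::real} x \<partial>lborel) + (\<integral>\<^sup>+x. ennreal (x powr (- 2 * r)) * indicator {1..} x \<partial>lborel)"
    by (subst nn_integral_add) auto
  also have "\<dots> < \<infinity>" using I by simp
  finally have "2 * (\<integral>\<^sup>+x. ennreal ((1 + x\<^sup>2) powr (- r)) * indicator {0..} x \<partial>lborel) < \<infinity>"
    by (simp add: ennreal_mult_less_top)
  then show ?thesis by (rule le_less_trans[OF nn_integral_even_real, rotated 2]) auto
qed

text \<open>One coordinate factor of the singularity 1/|\<xi>|^2 in dimension 4.\<close>

lemma nn_integral_sqrt_singular_real:
  "(\<integral>\<^sup>+x. ennreal (\<bar>x::real\<bar> powr (- 1/2)) * indicator {-1..1} x \<partial>lborel) < \<infinity>"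
proof -
  have "((\<lambda>x::real. x powr (- 1/2)) has_integral (1 powr (- 1/2 + 1)) / (- 1/2 + 1)) {0..1}"
    by (intro has_integral_powr_from_0) auto
  from nn_integral_has_integral_lebesgue'[OF _ this]
  have "(\<integral>\<^sup>+x. ennreal (x powr (- 1/2)) * indicator {0..1} x \<partial>lborel) < \<infinity>" by simp
  also have "(\<integral>\<^sup>+x. ennreal (x powr (- 1/2)) * indicator {0..1} x \<partial>lborel) =
     (\<integral>\<^sup>+x. ennreal (\<bar>x::real\<bar> powr (- 1/2)) * indicator {-1..1} x * indicator {0..} x \<partial>lborel)"
    by (intro nn_integral_cong) (auto simp: indicator_def)
  finally have "2 * (\<integral>\<^sup>+x. ennreal (\<bar>x::real\<bar> powr (- 1/2)) * indicator {-1..1} x * indicator {0..} x \<partial>lborel) < \<infinity>"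
    by (simp add: ennreal_mult_less_top)
  then show ?thesis by (rule le_less_trans[OF nn_integral_even_real, rotated 2]) (auto simp: indicator_def)
qed

lemma symL_pos [simp]: "symL a \<xi> > 0"
proof -
  have "1 + (norm \<xi>)\<^sup>2 \<noteq> 0" by (simp add: add_nonneg_eq_0_iff)
  then show ?thesis by (simp add: symL_def)
qed
lemma symL_nz [simp]: "symL a \<xi> \<noteq> 0" by (rule less_imp_neq[OF symL_pos, symmetric])
lemma symL_nonneg [simp]: "symL a \<xi> \<ge> 0" by (simp add: less_imp_le)
lemma symL_add: "symL (a + b) \<xi> = symL a \<xi> * symL b \<xi>"
  by (simp add: symL_def powr_add add_divide_distrib)
lemma symL_0 [simp]: "symL 0 \<xi> = 1"
proof -
  have "1 + (norm \<xi>)\<^sup>2 \<noteq> 0" by (simp add: add_nonneg_eq_0_iff)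
  then show ?thesis by (simp add: symL_def)
qed
lemma symL_minus: "symL (- a) \<xi> = 1 / symL a \<xi>"
  by (simp add: symL_def powr_minus inverse_eq_divide)
lemma symL_mono: "a \<le> b \<Longrightarrow> symL a \<xi> \<le> symL b \<xi>"
  unfolding symL_def by (intro powr_mono) auto
lemma symL_uminus [simp]: "symL a (- \<xi>) = symL a \<xi>" by (simp add: symL_def)
lemma symL_square: "(symL a \<xi>)\<^sup>2 = symL (2 * a) \<xi>"
  using symL_add[of a a \<xi>] by (simp add: power2_eq_square)
lemma measurable_symL [measurable]: "symL a \<in> borel_measurable borel"
  unfolding symL_def by measurable
lemma symL_norm_anti: "a \<le> 0 \<Longrightarrow> norm \<eta> \<le> norm \<xi> \<Longrightarrow> symL a \<xi> \<le> symL a \<eta>"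
  unfolding symL_def by (intro powr_mono2') (auto simp: add_pos_nonneg)
lemma norm_pow_le_symL: "(norm \<xi>) ^ m \<le> symL (real m) \<xi>"
proof -
  have p: "1 + (norm \<xi>)\<^sup>2 > 0" by (simp add: add_pos_nonneg)
  have "norm \<xi> = ((norm \<xi>)\<^sup>2) powr (1/2)" by (simp add: powr_half_sqrt)
  also have "\<dots> \<le> symL 1 \<xi>" unfolding symL_def by (intro powr_mono2) auto
  finally have "(norm \<xi>) ^ m \<le> (symL 1 \<xi>) ^ m" by (intro power_mono) auto
  also have "\<dots> = symL (real m) \<xi>"
    using p unfolding symL_def by (simp add: powr_realpow[symmetric] powr_powr)
  finally show ?thesis .
qed

text \<open>The decay is shared among the four coordinates: (1 + |\<xi>|^2)^(-a/2) is the fourth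
  power of (1 + |\<xi>|^2)^(-a/8), hence at most a product of one-dimensional factors. The condition
  a > 4 is exactly a/8 > 1/2.\<close>

lemma nn_integral_symL:
  assumes a: "a > 4"
  shows "(\<integral>\<^sup>+\<xi>. ennreal (symL (- a) \<xi>) \<partial>lborel) < \<infinity>"
proof -
  have "(\<integral>\<^sup>+\<xi>. ennreal (symL (- a) \<xi>) \<partial>lborel) \<le> (\<integral>\<^sup>+\<xi>. (\<Prod>b\<in>(Basis::(real^4) set). ennreal ((1 + (\<xi> \<bullet> b)\<^sup>2) powr (- (a / 8)))) \<partial>lborel)"
  proof (rule nn_integral_mono)
    fix \<xi> :: "real^4"
    have p: "1 + (norm \<xi>)\<^sup>2 > 0" by (simp add: add_pos_nonneg)
    have "symL (- a) \<xi> = ((1 + (norm \<xi>)\<^sup>2) powr (- (a / 8))) ^ 4"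
      using p unfolding symL_def by (simp add: powr_realpow[symmetric] powr_powr)
    also have "\<dots> = (\<Prod>b\<in>(Basis::(real^4) set). (1 + (norm \<xi>)\<^sup>2) powr (- (a / 8)))" by simp
    also have "\<dots> \<le> (\<Prod>b\<in>(Basis::(real^4) set). (1 + (\<xi> \<bullet> b)\<^sup>2) powr (- (a / 8)))"
    proof (intro prod_mono conjI)
      fix b :: "real^4" assume "b \<in> Basis"
      then have "(\<xi> \<bullet> b)\<^sup>2 \<le> (norm \<xi>)\<^sup>2" using Basis_le_norm[of b \<xi>] by (metis abs_ge_zero power2_abs power_mono)
      then show "(1 + (norm \<xi>)\<^sup>2) powr (- (a / 8)) \<le> (1 + (\<xi> \<bullet> b)\<^sup>2) powr (- (a / 8))"
        using a by (intro powr_mono2') (auto simp: add_pos_nonneg)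
    qed simp
    finally show "ennreal (symL (- a) \<xi>) \<le> (\<Prod>b\<in>(Basis::(real^4) set). ennreal ((1 + (\<xi> \<bullet> b)\<^sup>2) powr (- (a / 8))))"
      by (subst prod_ennreal) (auto intro!: ennreal_leI)
  qed
  also have "\<dots> = (\<Prod>b\<in>(Basis::(real^4) set). (\<integral>\<^sup>+x. ennreal ((1 + x\<^sup>2) powr (- (a / 8))) \<partial>lborel))"
    by (rule nn_integral_lborel_prod) auto
  also have "\<dots> < \<infinity>"
    using nn_integral_bracket_real[of "a/8"] a by (simp add: power_less_top_ennreal)
  finally show ?thesis .
qed

text \<open>In dimension 4, |\<xi>|^(-2) is the fourth power of |\<xi>|^(-1/2), and each of the four
  factors is at most the same power of one coordinate, which is integrable near 0.\<close>

lemma nn_integral_inverse_square_ball: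
  "(\<integral>\<^sup>+\<xi>. ennreal (1 / (norm (\<xi>::real^4))\<^sup>2) * indicator (cball 0 1) \<xi> \<partial>lborel) < \<infinity>"
proof -
  have "(\<integral>\<^sup>+\<xi>. ennreal (1 / (norm (\<xi>::real^4))\<^sup>2) * indicator (cball 0 1) \<xi> \<partial>lborel)
     \<le> (\<integral>\<^sup>+\<xi>. (\<Prod>b\<in>(Basis::(real^4) set). ennreal (\<bar>\<xi> \<bullet> b\<bar> powr (- 1/2)) * indicator {-1..1} (\<xi> \<bullet> b)) \<partial>lborel)"
  proof (rule nn_integral_mono_AE)
    \<comment> \<open>Since \<open>0 powr (- 1/2)\<close> is 0, the product bound breaks down on the
      coordinate hyperplanes; these are removed as null sets.\<close>
    have "AE \<xi> in lborel. \<forall>b\<in>(Basis::(real^4) set). \<xi> \<bullet> b \<noteq> 0"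
    proof (rule AE_finite_allI[OF finite_Basis])
      fix b :: "real^4" assume "b \<in> Basis"
      then have "negligible {x. b \<bullet> x = 0}" by (intro negligible_hyperplane) auto
      then have "AE x in lebesgue. x \<notin> {x. b \<bullet> x = 0}" by (intro AE_not_in) (simp add: negligible_iff_null_sets)
      then have "AE x in lborel. x \<notin> {x. b \<bullet> x = 0}" by (subst (asm) AE_completion_iff) auto
      then show "AE x in lborel. x \<bullet> b \<noteq> 0" by eventually_elim (simp add: inner_commute)
    qed
    then show "AE \<xi> in lborel. ennreal (1 / (norm (\<xi>::real^4))\<^sup>2) * indicator (cball 0 1) \<xi>
      \<le> (\<Prod>b\<in>(Basis::(real^4) set). ennreal (\<bar>\<xi> \<bullet> b\<bar> powr (- 1/2)) * indicator {-1..1} (\<xi> \<bullet> b))"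
    proof eventually_elim
      case (elim \<xi>)
      show ?case
      proof (cases "\<xi> \<in> cball 0 1")
        case True
        have ind: "\<xi> \<bullet> b \<in> {-1..1}" if "b \<in> Basis" for b
          using Basis_le_norm[OF that, of \<xi>] True by (auto simp: abs_le_iff)
        have nz: "norm \<xi> > 0"
          using bspec[OF elim SOME_Basis] by auto
        have "1 / (norm \<xi>)\<^sup>2 = (norm \<xi> powr (- 1/2)) ^ 4"
        proof -
          have "(norm \<xi> powr (- 1/2)) ^ 4 = norm \<xi> powr (- 2)" by (subst powr_power) (use nz in auto)
          then show ?thesis using nz by (simp add: powr_minus_divide)
        qed
        also have "\<dots> = (\<Prod>b\<in>(Basis::(real^4) set). norm \<xi> powr (- 1/2))" by simp
        also have "\<dots> \<le> (\<Prod>b\<in>(Basis::(real^4) set). \<bar>\<xi> \<bullet> b\<bar> powr (- 1/2))"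
          using elim Basis_le_norm by (intro prod_mono conjI powr_mono2') auto
        finally have "ennreal (1 / (norm \<xi>)\<^sup>2) \<le> (\<Prod>b\<in>(Basis::(real^4) set). ennreal (\<bar>\<xi> \<bullet> b\<bar> powr (- 1/2)))"
          by (subst prod_ennreal) (auto intro!: ennreal_leI)
        also have "\<dots> = (\<Prod>b\<in>(Basis::(real^4) set). ennreal (\<bar>\<xi> \<bullet> b\<bar> powr (- 1/2)) * indicator {-1..1} (\<xi> \<bullet> b))"
          using ind by (intro prod.cong) auto
        finally show ?thesis using True by simp
      qed simp
    qed
  qed
  also have "\<dots> = (\<Prod>b\<in>(Basis::(real^4) set). (\<integral>\<^sup>+x. ennreal (\<bar>x\<bar> powr (- 1/2)) * indicator {-1..1} x \<partial>lborel))"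
    by (rule nn_integral_lborel_prod) auto
  also have "\<dots> < \<infinity>"
    using nn_integral_sqrt_singular_real by (simp add: power_less_top_ennreal)
  finally show ?thesis .
qed

section \<open>Bilinear bounds for weighted L2 norms\<close>

definition nn2 :: "('a::euclidean_space \<Rightarrow> ennreal) \<Rightarrow> ennreal" where
  "nn2 f = (\<integral>\<^sup>+x. (f x)\<^sup>2 \<partial>lborel)"

text \<open>Cauchy-Schwarz in \<eta> with the weights inserted and divided out. The remaining factor
  is a convolution of squares, whose integral is a product. The bilinear bounds below are thereby
  reduced to a bound, uniform in \<xi>, for one kernel integral.\<close>

lemma nconv_weight:
  fixes u v :: "'a::euclidean_space \<Rightarrow> real"
  assumes [measurable]: "u \<in> borel_measurable borel" "v \<in> borel_measurable borel" "f \<in> borel_measurable borel" "g \<in> borel_measurable borel"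
    and pos: "\<And>x. u x > 0" "\<And>x. v x > 0"
    and K: "\<And>\<xi>. (\<integral>\<^sup>+\<eta>. ennreal (1 / (u \<eta> * v (\<xi> - \<eta>))\<^sup>2) \<partial>lborel) \<le> K"
  shows "nn2 (nconv f g) \<le> K * (nn2 (\<lambda>x. ennreal (u x) * f x) * nn2 (\<lambda>x. ennreal (v x) * g x))"
proof -
  let ?F = "\<lambda>x. ennreal (u x) * f x" and ?G = "\<lambda>x. ennreal (v x) * g x"
  have "(nconv f g \<xi>)\<^sup>2 \<le> K * nconv (\<lambda>x. (?F x)\<^sup>2) (\<lambda>x. (?G x)\<^sup>2) \<xi>" for \<xi>
  proof -
    have e: "f \<eta> * g (\<xi> - \<eta>) = ennreal (1 / (u \<eta> * v (\<xi> - \<eta>))) * (?F \<eta> * ?G (\<xi> - \<eta>))" for \<eta>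
    proof -
      have "ennreal (1 / (u \<eta> * v (\<xi> - \<eta>))) * (ennreal (u \<eta>) * ennreal (v (\<xi> - \<eta>))) = 1"
        using pos[of \<eta>] pos[of "\<xi> - \<eta>"] by (simp add: ennreal_mult[symmetric] less_imp_le)
      then have "ennreal (1 / (u \<eta> * v (\<xi> - \<eta>))) * (ennreal (u \<eta>) * ennreal (v (\<xi> - \<eta>))) * (f \<eta> * g (\<xi> - \<eta>)) = f \<eta> * g (\<xi> - \<eta>)" by simp
      then show ?thesis by (simp add: mult_ac)
    qed
    have "(nconv f g \<xi>)\<^sup>2 = (\<integral>\<^sup>+\<eta>. ennreal (1 / (u \<eta> * v (\<xi> - \<eta>))) * (?F \<eta> * ?G (\<xi> - \<eta>)) \<partial>lborel)\<^sup>2"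
      unfolding nconv_def by (simp only: e)
    also have "\<dots> \<le> (\<integral>\<^sup>+\<eta>. (ennreal (1 / (u \<eta> * v (\<xi> - \<eta>))))\<^sup>2 \<partial>lborel) * (\<integral>\<^sup>+\<eta>. (?F \<eta> * ?G (\<xi> - \<eta>))\<^sup>2 \<partial>lborel)"
      by (rule Cauchy_Schwarz_nn_integral) measurable
    also have "(\<integral>\<^sup>+\<eta>. (ennreal (1 / (u \<eta> * v (\<xi> - \<eta>))))\<^sup>2 \<partial>lborel) \<le> K"
      using K[of \<xi>] pos by (simp add: ennreal_power less_imp_le power_divide)
    also have "(\<integral>\<^sup>+\<eta>. (?F \<eta> * ?G (\<xi> - \<eta>))\<^sup>2 \<partial>lborel) = nconv (\<lambda>x. (?F x)\<^sup>2) (\<lambda>x. (?G x)\<^sup>2) \<xi>"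
      by (simp add: nconv_def power_mult_distrib)
    finally show ?thesis by (simp add: mult_right_mono)
  qed
  then have "nn2 (nconv f g) \<le> (\<integral>\<^sup>+\<xi>. K * nconv (\<lambda>x. (?F x)\<^sup>2) (\<lambda>x. (?G x)\<^sup>2) \<xi> \<partial>lborel)"
    unfolding nn2_def by (intro nn_integral_mono)
  also have "\<dots> = K * (nn2 ?F * nn2 ?G)"
    by (simp add: nn_integral_cmult nn_integral_nconv nn2_def)
  finally show ?thesis .
qed

text \<open>The decaying weight at the larger frequency is at most the same weight at the smaller
  one, so the total decay can be put on a single variable.\<close>

lemma symL_kernel_le:
  assumes "a \<ge> 0" "b \<ge> 0"
  shows "1 / (symL a \<eta> * symL b \<zeta>)\<^sup>2 \<le> symL (- (2 * (a + b))) \<eta> + symL (- (2 * (a + b))) \<zeta>"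
proof -
  have e: "1 / (symL a \<eta> * symL b \<zeta>)\<^sup>2 = symL (- (2 * a)) \<eta> * symL (- (2 * b)) \<zeta>"
    by (simp add: power_mult_distrib symL_square symL_minus)
  show ?thesis
  proof (cases "norm \<eta> \<le> norm \<zeta>")
    case True
    have "symL (- (2 * a)) \<eta> * symL (- (2 * b)) \<zeta> \<le> symL (- (2 * a)) \<eta> * symL (- (2 * b)) \<eta>"
      using assms True by (intro mult_left_mono symL_norm_anti) auto
    also have "\<dots> = symL (- (2 * (a + b))) \<eta>" by (simp add: symL_add[symmetric])
    finally show ?thesis unfolding e by (simp add: add_increasing2)
  next
    case False
    have "symL (- (2 * a)) \<eta> * symL (- (2 * b)) \<zeta> \<le> symL (- (2 * a)) \<zeta> * symL (- (2 * b)) \<zeta>"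
      using assms False by (intro mult_right_mono symL_norm_anti) auto
    also have "\<dots> = symL (- (2 * (a + b))) \<zeta>" by (simp add: symL_add[symmetric])
    finally show ?thesis unfolding e by (simp add: add_increasing)
  qed
qed

lemma nn_symL_sum:
  "(\<integral>\<^sup>+\<eta>. ennreal (symL c \<eta> + symL c (\<xi> - \<eta>)) \<partial>lborel) = 2 * (\<integral>\<^sup>+\<eta>. ennreal (symL c \<eta>) \<partial>lborel)"
proof -
  have "(\<integral>\<^sup>+\<eta>. ennreal (symL c \<eta> + symL c (\<xi> - \<eta>)) \<partial>lborel) = (\<integral>\<^sup>+\<eta>. ennreal (symL c \<eta>) \<partial>lborel) + (\<integral>\<^sup>+\<eta>. ennreal (symL c (\<xi> - \<eta>)) \<partial>lborel)"
    by (simp add: nn_integral_add)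
  also have "(\<integral>\<^sup>+\<eta>. ennreal (symL c (\<xi> - \<eta>)) \<partial>lborel) = (\<integral>\<^sup>+\<eta>. ennreal (symL c \<eta>) \<partial>lborel)"
    by (rule nn_integral_lborel_reflect(1)[of "\<lambda>\<eta>. ennreal (symL c \<eta>)"]) simp
  finally show ?thesis by (simp only: mult_2)
qed

text \<open>The square of the H^a norm on the Fourier side. The quantities \<open>nn2\<close>,
  \<open>wn\<close> and \<open>hn\<close> are all squared norms, which avoids roots in
  [0,\<infinity>].\<close>

definition wn :: "real \<Rightarrow> (real^4 \<Rightarrow> ennreal) \<Rightarrow> ennreal" where
  "wn a f = nn2 (\<lambda>\<xi>. ennreal (symL a \<xi>) * f \<xi>)"

definition hn :: "(real^4 \<Rightarrow> ennreal) \<Rightarrow> ennreal" where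
  "hn f = nn2 (\<lambda>\<xi>. ennreal (norm \<xi>) * f \<xi>)"

text \<open>The Sobolev product of two H^s functions in L2 in dimension 4: the kernel decays with
  exponent 4s, and s > 1 puts this strictly above 4.\<close>

lemma nconv_bilinear_ss:
  assumes s: "s > 1"
  obtains K where "K < \<infinity>" "\<And>f g. f \<in> borel_measurable borel \<Longrightarrow> g \<in> borel_measurable borel \<Longrightarrow> nn2 (nconv f g) \<le> K * (wn s f * wn s g)"
proof -
  define K where "K = 2 * (\<integral>\<^sup>+\<eta>. ennreal (symL (- (2 * (s + s))) \<eta>) \<partial>lborel)"
  have "K < \<infinity>" unfolding K_def using nn_integral_symL[of "2 * (s + s)"] s by (simp add: ennreal_mult_less_top)
  moreover have "nn2 (nconv f g) \<le> K * (wn s f * wn s g)" if [measurable]: "f \<in> borel_measurable borel" "g \<in> borel_measurable borel" for f g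
    unfolding wn_def
  proof (rule nconv_weight)
    show "(\<integral>\<^sup>+\<eta>. ennreal (1 / (symL s \<eta> * symL s (\<xi> - \<eta>))\<^sup>2) \<partial>lborel) \<le> K" for \<xi>
    proof -
      have "(\<integral>\<^sup>+\<eta>. ennreal (1 / (symL s \<eta> * symL s (\<xi> - \<eta>))\<^sup>2) \<partial>lborel) \<le> (\<integral>\<^sup>+\<eta>. ennreal (symL (- (2 * (s + s))) \<eta> + symL (- (2 * (s + s))) (\<xi> - \<eta>)) \<partial>lborel)"
        using s by (intro nn_integral_mono ennreal_leI symL_kernel_le) auto
      also have "\<dots> = K" unfolding K_def by (rule nn_symL_sum)
      finally show ?thesis .
    qed
  qed auto
  ultimately show ?thesis by (rule that)
qed

text \<open>The second weight |\<xi>| vanishes at the origin, but its kernel 1/|\<xi>|^2 is locally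
  integrable in dimension 4. Outside the unit ball it is comparable to the inhomogeneous weight, and
  the resulting exponent 2(s + 1) exceeds 4.\<close>

lemma nconv_bilinear_sh:
  assumes s: "s > 1"
  obtains K where "K < \<infinity>" "\<And>f g. f \<in> borel_measurable borel \<Longrightarrow> g \<in> borel_measurable borel \<Longrightarrow> nn2 (nconv f g) \<le> K * (wn s f * hn g)"
proof -
  define I where "I = (\<integral>\<^sup>+\<xi>. ennreal (1 / (norm (\<xi>::real^4))\<^sup>2) * indicator (cball 0 1) \<xi> \<partial>lborel)"
  define J where "J = (\<integral>\<^sup>+\<eta>. ennreal (symL (- (2 * (s + 1))) \<eta>) \<partial>lborel)"
  have I: "I < \<infinity>" unfolding I_def by (rule nn_integral_inverse_square_ball)
  have J: "J < \<infinity>" unfolding J_def using nn_integral_symL[of "2 * (s + 1)"] s by simp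
  \<comment> \<open>\<open>nconv_weight\<close> asks for strictly positive weights; the value 1 at
    the origin alters the weight only on a null set.\<close>
  define v :: "real^4 \<Rightarrow> real" where "v x = (if x = 0 then 1 else norm x)" for x
  have vm[measurable]: "v \<in> borel_measurable borel" unfolding v_def by measurable
  have vp: "v x > 0" for x by (simp add: v_def)
  have AE0: "AE x in lborel. x \<noteq> (0::real^4)"
    using AE_lborel_singleton[of "0::real^4"] by simp
  have hv: "nn2 (\<lambda>x. ennreal (v x) * g x) = hn g" for g
    unfolding hn_def nn2_def by (rule nn_integral_cong_AE, rule eventually_mono[OF AE0]) (simp add: v_def)
  have I': "(\<integral>\<^sup>+\<zeta>. ennreal (1 / (v \<zeta>)\<^sup>2) * indicator (cball 0 1) \<zeta> \<partial>lborel) = I"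
    unfolding I_def by (rule nn_integral_cong_AE, rule eventually_mono[OF AE0]) (simp add: v_def)
  have kern: "(\<integral>\<^sup>+\<eta>. ennreal (1 / (symL s \<eta> * v (\<xi> - \<eta>))\<^sup>2) \<partial>lborel) \<le> I + 4 * J" for \<xi>
  proof -
    have "(\<integral>\<^sup>+\<eta>. ennreal (1 / (symL s \<eta> * v (\<xi> - \<eta>))\<^sup>2) \<partial>lborel)
       \<le> (\<integral>\<^sup>+\<eta>. ennreal (1 / (v (\<xi> - \<eta>))\<^sup>2) * indicator (cball 0 1) (\<xi> - \<eta>) + 2 * ennreal (symL (- (2 * (s + 1))) \<eta> + symL (- (2 * (s + 1))) (\<xi> - \<eta>)) \<partial>lborel)"
    proof (rule nn_integral_mono)
      fix \<eta>
      let ?z = "\<xi> - \<eta>"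
      have s1: "1 \<le> symL s \<eta>" using symL_mono[of 0 s \<eta>] s by simp
      show "ennreal (1 / (symL s \<eta> * v ?z)\<^sup>2) \<le> ennreal (1 / (v ?z)\<^sup>2) * indicator (cball 0 1) ?z + 2 * ennreal (symL (- (2 * (s + 1))) \<eta> + symL (- (2 * (s + 1))) ?z)"
      proof (cases "norm ?z \<le> 1")
        case True
        have "v ?z \<le> symL s \<eta> * v ?z" using s1 vp[of ?z] mult_right_mono[of 1 "symL s \<eta>" "v ?z"] by simp
        then have "(v ?z)\<^sup>2 \<le> (symL s \<eta> * v ?z)\<^sup>2" using vp[of ?z] by (intro power_mono) auto
        then have "1 / (symL s \<eta> * v ?z)\<^sup>2 \<le> 1 / (v ?z)\<^sup>2" using vp[of ?z] by (intro divide_left_mono) auto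
        then have "ennreal (1 / (symL s \<eta> * v ?z)\<^sup>2) \<le> ennreal (1 / (v ?z)\<^sup>2) * indicator (cball 0 1) ?z" using True by (simp add: ennreal_leI)
        then show ?thesis by (rule order_trans) simp
      next
        case False
        then have vz: "v ?z = norm ?z" by (auto simp: v_def)
        have "symL 1 ?z ^ 2 = 1 + (norm ?z)\<^sup>2" unfolding symL_square by (simp add: symL_def add_pos_nonneg)
        also have "\<dots> \<le> 2 * (norm ?z)\<^sup>2" using False by (smt (verit) one_le_power)
        finally have "(symL s \<eta>)\<^sup>2 * (symL 1 ?z)\<^sup>2 \<le> (symL s \<eta>)\<^sup>2 * (2 * (norm ?z)\<^sup>2)" by (rule mult_left_mono) simp
        then have "(symL s \<eta> * symL 1 ?z)\<^sup>2 \<le> 2 * (symL s \<eta> * v ?z)\<^sup>2"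
          by (simp add: power_mult_distrib vz mult.left_commute)
        then have "1 / (2 * (symL s \<eta> * v ?z)\<^sup>2) \<le> 1 / (symL s \<eta> * symL 1 ?z)\<^sup>2"
          using vp[of ?z] by (intro divide_left_mono) (auto intro!: mult_pos_pos)
        also have "\<dots> \<le> symL (- (2 * (s + 1))) \<eta> + symL (- (2 * (s + 1))) ?z" using s by (intro symL_kernel_le) auto
        finally have "1 / (symL s \<eta> * v ?z)\<^sup>2 \<le> 2 * (symL (- (2 * (s + 1))) \<eta> + symL (- (2 * (s + 1))) ?z)" by simp
        then have "ennreal (1 / (symL s \<eta> * v ?z)\<^sup>2) \<le> 2 * ennreal (symL (- (2 * (s + 1))) \<eta> + symL (- (2 * (s + 1))) ?z)"
          using ennreal_leI by (fastforce simp: ennreal_mult)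
        then show ?thesis by (rule order_trans) simp
      qed
    qed
    also have "\<dots> = (\<integral>\<^sup>+\<eta>. ennreal (1 / (v (\<xi> - \<eta>))\<^sup>2) * indicator (cball 0 1) (\<xi> - \<eta>) \<partial>lborel) + (\<integral>\<^sup>+\<eta>. 2 * ennreal (symL (- (2 * (s + 1))) \<eta> + symL (- (2 * (s + 1))) (\<xi> - \<eta>)) \<partial>lborel)"
    proof (rule nn_integral_add)
      have [measurable]: "cball (0::real^4) 1 \<in> sets borel" by auto
      show "(\<lambda>\<eta>. ennreal (1 / (v (\<xi> - \<eta>))\<^sup>2) * indicator (cball 0 1) (\<xi> - \<eta>)) \<in> borel_measurable lborel" by measurable
    qed measurable
    also have "(\<integral>\<^sup>+\<eta>. ennreal (1 / (v (\<xi> - \<eta>))\<^sup>2) * indicator (cball 0 1) (\<xi> - \<eta>) \<partial>lborel) = I"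
    proof -
      have [measurable]: "cball (0::real^4) 1 \<in> sets borel" by auto
      show ?thesis
        unfolding I'[symmetric] by (rule nn_integral_lborel_reflect(1)[of "\<lambda>\<zeta>. ennreal (1 / (v \<zeta>)\<^sup>2) * indicator (cball 0 1) \<zeta>"]) measurable
    qed
    also have "(\<integral>\<^sup>+\<eta>. 2 * ennreal (symL (- (2 * (s + 1))) \<eta> + symL (- (2 * (s + 1))) (\<xi> - \<eta>)) \<partial>lborel) = 2 * (2 * J)"
      unfolding J_def nn_symL_sum[symmetric, of _ \<xi>] by (rule nn_integral_cmult) measurable
    finally show ?thesis by (simp add: mult.assoc[symmetric])
  qed
  have "I + 4 * J < \<infinity>" using I J by (simp add: ennreal_mult_less_top)
  moreover have "nn2 (nconv f g) \<le> (I + 4 * J) * (wn s f * hn g)" if [measurable]: "f \<in> borel_measurable borel" "g \<in> borel_measurable borel" for f g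
    unfolding wn_def hv[symmetric] by (rule nconv_weight) (use kern vp in auto)
  ultimately show ?thesis by (rule that)
qed

text \<open>Cauchy-Schwarz against the inverse weight, which is square integrable in dimension 4 for
  s > 2. It is applied with s + 1 in place of \<open>s\<close>, and that is where one additional
  derivative of \<phi> is spent.\<close>

lemma L1_bound:
  assumes s: "s > 2"
  obtains K where "K < \<infinity>" "\<And>f. f \<in> borel_measurable borel \<Longrightarrow> (\<integral>\<^sup>+\<xi>. f \<xi> \<partial>lborel)\<^sup>2 \<le> K * wn s f"
proof -
  define K where "K = (\<integral>\<^sup>+\<eta>. ennreal (symL (- (2 * s)) \<eta>) \<partial>lborel)"
  have "K < \<infinity>" unfolding K_def using nn_integral_symL[of "2 * s"] s by simp
  moreover have "(\<integral>\<^sup>+\<xi>. f \<xi> \<partial>lborel)\<^sup>2 \<le> K * wn s f" if [measurable]: "f \<in> borel_measurable borel" for f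
  proof -
    have e: "ennreal (symL (- s) \<xi>) * (ennreal (symL s \<xi>) * f \<xi>) = f \<xi>" for \<xi>
    proof -
      have "ennreal (symL (- s) \<xi>) * ennreal (symL s \<xi>) = 1" by (simp add: ennreal_mult[symmetric] symL_add[symmetric])
      then show ?thesis by (simp add: mult.assoc[symmetric])
    qed
    have "(\<integral>\<^sup>+\<xi>. ennreal (symL (- s) \<xi>) * (ennreal (symL s \<xi>) * f \<xi>) \<partial>lborel)\<^sup>2
      \<le> (\<integral>\<^sup>+\<xi>. (ennreal (symL (- s) \<xi>))\<^sup>2 \<partial>lborel) * (\<integral>\<^sup>+\<xi>. (ennreal (symL s \<xi>) * f \<xi>)\<^sup>2 \<partial>lborel)"
      by (rule Cauchy_Schwarz_nn_integral) measurable
    then show ?thesis unfolding e by (simp add: K_def wn_def nn2_def ennreal_power symL_square)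
  qed
  ultimately show ?thesis by (rule that)
qed

text \<open>The product is split as |\<xi>| G times b/|\<xi>|. The second factor is square
  integrable too, because 1/|\<xi>|^2 is integrable near 0 and \<open>b\<close> is bounded and
  square integrable.\<close>

lemma local_L1_bound:
  assumes [measurable]: "G \<in> borel_measurable borel" and h: "hn (nm G) < \<infinity>" and b: "bounded_supp b"
  shows "integrable lborel (\<lambda>\<xi>. G \<xi> * b \<xi>)"
proof -
  from b obtain C r where C: "\<And>x. norm (b x) \<le> C" and r: "\<And>x. r < norm x \<Longrightarrow> b x = 0" by (auto simp: bounded_supp_def)
  have bm[measurable]: "b \<in> borel_measurable borel" using b by (simp add: bounded_supp_def)
  have C0: "0 \<le> C" using C[of 0] norm_ge_zero order_trans by blast
  have [measurable]: "cball (0::real^4) 1 \<in> sets borel" by auto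
  have B: "nn2 (\<lambda>x. ennreal (1 / norm x) * nm b x) < \<infinity>"
  proof -
    have "nn2 (\<lambda>x. ennreal (1 / norm x) * nm b x) \<le> (\<integral>\<^sup>+\<xi>. ennreal (C\<^sup>2) * (ennreal (1 / (norm \<xi>)\<^sup>2) * indicator (cball 0 1) \<xi>) + (nm b \<xi>)\<^sup>2 \<partial>lborel)"
      unfolding nn2_def
    proof (rule nn_integral_mono)
      fix \<xi> :: "real^4"
      have e: "(ennreal (1 / norm \<xi>) * nm b \<xi>)\<^sup>2 = ennreal ((1 / (norm \<xi>)\<^sup>2) * (norm (b \<xi>))\<^sup>2)"
        by (simp add: ennreal_mult[symmetric] ennreal_power power_divide power_mult_distrib)
      have b2: "(norm (b \<xi>))\<^sup>2 \<le> C\<^sup>2" using C by (intro power_mono) auto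
      show "(ennreal (1 / norm \<xi>) * nm b \<xi>)\<^sup>2 \<le> ennreal (C\<^sup>2) * (ennreal (1 / (norm \<xi>)\<^sup>2) * indicator (cball 0 1) \<xi>) + (nm b \<xi>)\<^sup>2"
      proof (cases "norm \<xi> \<le> 1")
        case True
        have "(1 / (norm \<xi>)\<^sup>2) * (norm (b \<xi>))\<^sup>2 \<le> C\<^sup>2 * (1 / (norm \<xi>)\<^sup>2)" using mult_right_mono[OF b2, of "1 / (norm \<xi>)\<^sup>2"] by (simp add: mult.commute)
        then have "(ennreal (1 / norm \<xi>) * nm b \<xi>)\<^sup>2 \<le> ennreal (C\<^sup>2) * (ennreal (1 / (norm \<xi>)\<^sup>2) * indicator (cball 0 1) \<xi>)"
          unfolding e using True C0 by (simp add: ennreal_mult[symmetric] ennreal_leI)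
        then show ?thesis by (rule order_trans) simp
      next
        case False
        then have "1 \<le> (norm \<xi>)\<^sup>2" by (simp add: one_le_power)
        then have "1 / (norm \<xi>)\<^sup>2 \<le> 1 / 1" by (intro divide_left_mono) auto
        then have "1 / (norm \<xi>)\<^sup>2 \<le> 1" by simp
        then have "(1 / (norm \<xi>)\<^sup>2) * (norm (b \<xi>))\<^sup>2 \<le> (norm (b \<xi>))\<^sup>2" by (intro mult_left_le_one_le) auto
        then have "ennreal ((1 / (norm \<xi>)\<^sup>2) * (norm (b \<xi>))\<^sup>2) \<le> (nm b \<xi>)\<^sup>2" by (simp add: ennreal_power ennreal_leI)
        then show ?thesis unfolding e by (rule order_trans) simp
      qed
    qed
    also have "\<dots> = ennreal (C\<^sup>2) * (\<integral>\<^sup>+\<xi>. (ennreal (1 / (norm (\<xi>::real^4))\<^sup>2) * indicator (cball 0 1) \<xi>) \<partial>lborel) + (\<integral>\<^sup>+\<xi>. (nm b \<xi>)\<^sup>2 \<partial>lborel)"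
      by (subst nn_integral_add) (auto simp: nn_integral_cmult)
    also have "\<dots> < \<infinity>"
      using nn_integral_inverse_square_ball bounded_supp_integrable(2)[OF b] by (simp add: sq_int_nm_iff ennreal_mult_less_top)
    finally show ?thesis .
  qed
  have "(\<integral>\<^sup>+x. (ennreal (norm x) * nm G x) * (ennreal (1 / norm x) * nm b x) \<partial>lborel) < \<infinity>"
    using h B unfolding hn_def nn2_def by (intro nn_L2_pairing_finite) auto
  also have "(\<integral>\<^sup>+x. (ennreal (norm x) * nm G x) * (ennreal (1 / norm x) * nm b x) \<partial>lborel) = (\<integral>\<^sup>+x. nm (\<lambda>\<xi>. G \<xi> * b \<xi>) x \<partial>lborel)"
  proof (rule nn_integral_cong_AE)
    show "AE x in lborel. (ennreal (norm x) * nm G x) * (ennreal (1 / norm x) * nm b x) = nm (\<lambda>\<xi>. G \<xi> * b \<xi>) x"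
      using AE_lborel_singleton[of "0::real^4"]
    proof eventually_elim
      case (elim x)
      then have "ennreal (norm x) * ennreal (1 / norm x) = 1" by (simp add: ennreal_mult[symmetric])
      then have "(ennreal (norm x) * ennreal (1 / norm x)) * (nm G x * nm b x) = nm G x * nm b x" by simp
      then show ?case by (simp add: norm_mult ennreal_mult mult_ac)
    qed
  qed
  finally show ?thesis by (simp add: integrable_nm_iff)
qed

section \<open>Energy and higher-order estimates\<close>

lemma nconv_adjoint:
  assumes [measurable]: "f \<in> borel_measurable borel" "g \<in> borel_measurable borel" "h \<in> borel_measurable borel"
  shows "(\<integral>\<^sup>+\<xi>. nconv f g \<xi> * h \<xi> \<partial>lborel) = (\<integral>\<^sup>+\<xi>. g \<xi> * nconv (\<lambda>\<eta>. f (- \<eta>)) h \<xi> \<partial>lborel)"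
proof -
  have "(\<integral>\<^sup>+\<xi>. nconv f g \<xi> * h \<xi> \<partial>lborel) = (\<integral>\<^sup>+\<xi>. \<integral>\<^sup>+\<eta>. f \<eta> * g (\<xi> - \<eta>) * h \<xi> \<partial>lborel \<partial>lborel)"
    by (simp add: nconv_def nn_integral_multc)
  also have "\<dots> = (\<integral>\<^sup>+\<eta>. \<integral>\<^sup>+\<xi>. f \<eta> * g (\<xi> - \<eta>) * h \<xi> \<partial>lborel \<partial>lborel)"
    by (rule lborel_pair.Fubini') measurable
  also have "\<dots> = (\<integral>\<^sup>+\<eta>. \<integral>\<^sup>+\<xi>. f \<eta> * g \<xi> * h (\<xi> + \<eta>) \<partial>lborel \<partial>lborel)"
  proof (rule nn_integral_cong)
    fix \<eta>
    show "(\<integral>\<^sup>+\<xi>. f \<eta> * g (\<xi> - \<eta>) * h \<xi> \<partial>lborel) = (\<integral>\<^sup>+\<xi>. f \<eta> * g \<xi> * h (\<xi> + \<eta>) \<partial>lborel)"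
      using nn_integral_lborel_shift(2)[of "\<lambda>\<xi>. f \<eta> * g (\<xi> - \<eta>) * h \<xi>" \<eta>] by simp
  qed
  also have "\<dots> = (\<integral>\<^sup>+\<xi>. \<integral>\<^sup>+\<eta>. f \<eta> * g \<xi> * h (\<xi> + \<eta>) \<partial>lborel \<partial>lborel)"
    by (rule lborel_pair.Fubini') measurable
  also have "\<dots> = (\<integral>\<^sup>+\<xi>. g \<xi> * nconv (\<lambda>\<eta>. f (- \<eta>)) h \<xi> \<partial>lborel)"
  proof (rule nn_integral_cong)
    fix \<xi>
    have "nconv (\<lambda>\<eta>. f (- \<eta>)) h \<xi> = (\<integral>\<^sup>+\<eta>. f \<eta> * h (\<xi> + \<eta>) \<partial>lborel)"
      using nn_integral_lborel_reflect(2)[of "\<lambda>\<eta>. f \<eta> * h (\<xi> + \<eta>)"] by (simp add: nconv_def)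
    then have "g \<xi> * nconv (\<lambda>\<eta>. f (- \<eta>)) h \<xi> = (\<integral>\<^sup>+\<eta>. g \<xi> * (f \<eta> * h (\<xi> + \<eta>)) \<partial>lborel)"
      by (simp add: nn_integral_cmult)
    then show "(\<integral>\<^sup>+\<eta>. f \<eta> * g \<xi> * h (\<xi> + \<eta>) \<partial>lborel) = g \<xi> * nconv (\<lambda>\<eta>. f (- \<eta>)) h \<xi>" by (simp add: mult_ac)
  qed
  finally show ?thesis .
qed

text \<open>Tonelli and commutativity. In the cubic term it lets the two factors coming from
  \<open>P\<close> be interchanged.\<close>

lemma nconv_left_commute:
  assumes [measurable]: "f \<in> borel_measurable borel" "g \<in> borel_measurable borel" "h \<in> borel_measurable borel"
  shows "nconv f (nconv g h) = nconv g (nconv f h)"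
proof
  fix \<xi>
  have "nconv f (nconv g h) \<xi> = (\<integral>\<^sup>+\<eta>. \<integral>\<^sup>+\<zeta>. f \<eta> * (g \<zeta> * h (\<xi> - \<eta> - \<zeta>)) \<partial>lborel \<partial>lborel)"
    by (simp add: nconv_def nn_integral_cmult)
  also have "\<dots> = (\<integral>\<^sup>+\<zeta>. \<integral>\<^sup>+\<eta>. f \<eta> * (g \<zeta> * h (\<xi> - \<eta> - \<zeta>)) \<partial>lborel \<partial>lborel)"
    by (rule lborel_pair.Fubini') measurable
  also have "\<dots> = (\<integral>\<^sup>+\<zeta>. g \<zeta> * (\<integral>\<^sup>+\<eta>. f \<eta> * h (\<xi> - \<zeta> - \<eta>) \<partial>lborel) \<partial>lborel)"
  proof (rule nn_integral_cong)
    fix \<zeta>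
    have "f \<eta> * (g \<zeta> * h (\<xi> - \<eta> - \<zeta>)) = g \<zeta> * (f \<eta> * h (\<xi> - \<zeta> - \<eta>))" for \<eta>
      unfolding cancel_ab_semigroup_add_class.diff_right_commute[of \<xi> \<zeta> \<eta>] by (rule mult.left_commute)
    then show "(\<integral>\<^sup>+\<eta>. f \<eta> * (g \<zeta> * h (\<xi> - \<eta> - \<zeta>)) \<partial>lborel) = g \<zeta> * (\<integral>\<^sup>+\<eta>. f \<eta> * h (\<xi> - \<zeta> - \<eta>) \<partial>lborel)"
      by (simp add: nn_integral_cmult)
  qed
  finally show "nconv f (nconv g h) \<xi> = nconv g (nconv f h) \<xi>" by (simp add: nconv_def)
qed

lemma wn_reflect: "f \<in> borel_measurable borel \<Longrightarrow> wn a (\<lambda>\<xi>. f (- \<xi>)) = wn a f"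
  using nn_integral_lborel_reflect(2)[of "\<lambda>\<xi>. (ennreal (symL a \<xi>) * f \<xi>)\<^sup>2"] by (simp add: wn_def nn2_def)

lemma nm_refl_cnj: "nm (refl_cnj P) = (\<lambda>\<xi>. nm P (- \<xi>))" by (simp add: refl_cnj_def)

text \<open>The absorption step of the energy estimate; without finiteness of \<open>a\<close> the
  first inequality could read \<infinity> \<le> \<infinity>.\<close>

lemma ennreal_cancel_square:
  fixes a b :: ennreal
  assumes "a * a \<le> b * a" "a < \<infinity>" shows "a \<le> b"
proof (cases "a = 0")
  case False
  have "a * a \<le> a * b" using assms(1) by (simp only: mult.commute[of b a])
  then show ?thesis using False assms(2) ennreal_mult_le_mult_iff[of a a b] by auto
qed simp

lemma sum_sq_le: "(a + b)\<^sup>2 \<le> 2 * (a\<^sup>2 + b\<^sup>2)" for a b :: ennreal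
proof -
  have "(a + b)\<^sup>2 = a\<^sup>2 + b\<^sup>2 + 2 * (a * b)" by (simp add: power2_eq_square distrib_left distrib_right mult_2 mult.commute[of b a] add_ac)
  also have "\<dots> \<le> a\<^sup>2 + b\<^sup>2 + (a\<^sup>2 + b\<^sup>2)" by (intro add_left_mono ennreal_mult_le_squares)
  finally show ?thesis by (simp only: mult_2)
qed

text \<open>The transform of the equation for A0, where P, Q, G are the transforms of the solution, of its
  time derivative and of A0.\<close>
definition elliptic_rel :: "(real^4 \<Rightarrow> complex) \<Rightarrow> (real^4 \<Rightarrow> complex) \<Rightarrow> (real^4 \<Rightarrow> complex) \<Rightarrow> bool" where
  "elliptic_rel P Q G \<longleftrightarrow> (AE \<xi> in lborel. complex_of_real ((norm \<xi>)\<^sup>2) * G \<xi> =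
     complex_of_real (fconst TYPE(real^4)) * (cconv P (refl_cnj Q) \<xi> - cconv (refl_cnj P) Q \<xi>) / (2 * \<i>)
     - complex_of_real (fconst TYPE(real^4)) * complex_of_real (fconst TYPE(real^4)) * cconv (refl_cnj P) (cconv P G) \<xi>)"

text \<open>In the two source terms the convolution with \<open>P\<close> is moved onto
  \<open>G\<close>, so that only the L2 norm of \<open>Q\<close> and the product bound for
  \<open>P\<close> and \<open>G\<close> are used. Squaring leaves the energy once on the right-hand
  side, where its finiteness permits cancellation.\<close>

lemma energy_estimate:
  assumes s: "s > 1"
  obtains K where "K < \<infinity>" "\<And>P Q G. integrable lborel P \<Longrightarrow> sq_int Q \<Longrightarrow> G \<in> borel_measurable borel \<Longrightarrow>
     wn s (nm P) < \<infinity> \<Longrightarrow> hn (nm G) < \<infinity> \<Longrightarrow> elliptic_rel P Q G \<Longrightarrow>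
     hn (nm G) \<le> K * (nn2 (nm Q) * wn s (nm P))"
proof -
  obtain K where K: "K < \<infinity>" "\<And>f g. f \<in> borel_measurable borel \<Longrightarrow> g \<in> borel_measurable borel \<Longrightarrow> nn2 (nconv f g) \<le> K * (wn s f * hn g)"
    using nconv_bilinear_sh[OF s] by blast
  let ?fc = "fconst TYPE(real^4)"
  let ?c = "complex_of_real ?fc"
  have main: "hn (nm G) \<le> (ennreal (?fc\<^sup>2) * K) * (nn2 (nm Q) * wn s (nm P))"
    if P: "integrable lborel P" and Q: "sq_int Q" and [measurable]: "G \<in> borel_measurable borel"
      and w: "wn s (nm P) < \<infinity>" and h: "hn (nm G) < \<infinity>" and rel: "elliptic_rel P Q G" for P Q G
  proof -
    have [measurable]: "P \<in> borel_measurable borel" "Q \<in> borel_measurable borel" using P Q by (auto simp: sq_int_def)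
    let ?P' = "refl_cnj P" and ?Q' = "refl_cnj Q" and ?H = "cconv P G"
    have P'n: "(\<lambda>\<eta>. nm ?P' (- \<eta>)) = nm P" by (simp add: refl_cnj_def)
    have wP': "wn s (nm ?P') = wn s (nm P)" unfolding nm_refl_cnj using wn_reflect[of "nm P" s] by simp
    have Q2: "nn2 (nm Q) < \<infinity>" using Q by (simp add: sq_int_nm_iff nn2_def)
    have nQ': "nn2 (nm ?Q') = nn2 (nm Q)" unfolding nm_refl_cnj nn2_def
      using nn_integral_lborel_reflect(2)[of "\<lambda>x. (nm Q x)\<^sup>2"] by simp
    define e where "e = hn (nm G)"
    let ?B = "nn2 (nm Q) * (K * (wn s (nm P) * e))"
    define t1 where "t1 = (\<integral>\<^sup>+\<xi>. nconv (nm P) (nm ?Q') \<xi> * nm G \<xi> \<partial>lborel)"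
    define t2 where "t2 = (\<integral>\<^sup>+\<xi>. nconv (nm ?P') (nm Q) \<xi> * nm G \<xi> \<partial>lborel)"
    have t1: "t1\<^sup>2 \<le> ?B"
    proof -
      have "t1 = (\<integral>\<^sup>+\<xi>. nm ?Q' \<xi> * nconv (nm ?P') (nm G) \<xi> \<partial>lborel)"
        unfolding t1_def by (subst nconv_adjoint) (auto simp: nm_refl_cnj)
      then have "t1\<^sup>2 \<le> nn2 (nm ?Q') * nn2 (nconv (nm ?P') (nm G))"
        unfolding nn2_def by (simp only:) (rule Cauchy_Schwarz_nn_integral, auto)
      also have "\<dots> \<le> nn2 (nm Q) * (K * (wn s (nm ?P') * hn (nm G)))"
        unfolding nQ' by (intro mult_left_mono K(2)) auto
      finally show ?thesis by (simp add: wP' e_def)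
    qed
    have t2: "t2\<^sup>2 \<le> ?B"
    proof -
      have "t2 = (\<integral>\<^sup>+\<xi>. nm Q \<xi> * nconv (nm P) (nm G) \<xi> \<partial>lborel)"
        unfolding t2_def by (subst nconv_adjoint) (auto simp: P'n)
      then have "t2\<^sup>2 \<le> nn2 (nm Q) * nn2 (nconv (nm P) (nm G))"
        unfolding nn2_def by (simp only:) (rule Cauchy_Schwarz_nn_integral, auto)
      also have "\<dots> \<le> nn2 (nm Q) * (K * (wn s (nm P) * hn (nm G)))"
        by (intro mult_left_mono K(2)) auto
      finally show ?thesis by (simp add: e_def)
    qed
    have Bf: "?B < \<infinity>" using K(1) Q2 w h by (simp add: ennreal_mult_less_top e_def)
    have tf: "t1 < \<infinity>" "t2 < \<infinity>" using le_less_trans[OF t1 Bf] le_less_trans[OF t2 Bf] by (auto simp: power_less_top_ennreal)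
    have nH: "nn2 (nconv (nm P) (nm G)) < \<infinity>"
      using K(2)[of "nm P" "nm G"] K(1) w h by (auto simp: ennreal_mult_less_top intro: le_less_trans)
    have H2: "nn2 (nm ?H) < \<infinity>"
      by (rule le_less_trans[OF _ nH]) (auto simp: nn2_def intro!: nn_integral_mono power_mono nm_cconv_le)
    have adj: "(\<integral>\<^sup>+\<xi>. nconv (nm ?P') (nm ?H) \<xi> * nm (\<lambda>\<xi>. cnj (G \<xi>)) \<xi> \<partial>lborel) < \<infinity>"
    proof -
      have "(\<integral>\<^sup>+\<xi>. nconv (nm ?P') (nm ?H) \<xi> * nm (\<lambda>\<xi>. cnj (G \<xi>)) \<xi> \<partial>lborel) = (\<integral>\<^sup>+\<xi>. nm ?H \<xi> * nconv (nm P) (nm G) \<xi> \<partial>lborel)"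
        by (subst nconv_adjoint) (auto simp: P'n)
      also have "\<dots> < \<infinity>" using H2 nH unfolding nn2_def by (intro nn_L2_pairing_finite) auto
      finally show ?thesis .
    qed
    \<comment> \<open>The adjoint of convolution with \<open>?P'\<close>, applied to the conjugate
      of \<open>G\<close>, is the conjugate of \<open>?H\<close>; this is what makes the cubic
      pairing a square.\<close>
    have cc: "cconv (\<lambda>\<eta>. ?P' (- \<eta>)) (\<lambda>\<xi>. cnj (G \<xi>)) \<xi> = cnj (?H \<xi>)" for \<xi>
    proof -
      have "cconv (\<lambda>\<eta>. ?P' (- \<eta>)) (\<lambda>\<xi>. cnj (G \<xi>)) \<xi> = (\<integral>\<eta>. cnj (P \<eta> * G (\<xi> - \<eta>)) \<partial>lborel)"
        by (simp add: cconv_def refl_cnj_def)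
      then show ?thesis unfolding cconv_def by (simp only: Bochner_Integration.integral_cnj)
    qed
    have iM: "integrable lborel (\<lambda>\<xi>. cconv ?P' ?H \<xi> * cnj (G \<xi>))"
      and eM: "(\<integral>\<xi>. cconv ?P' ?H \<xi> * cnj (G \<xi>) \<partial>lborel) = (\<integral>\<xi>. ?H \<xi> * cnj (?H \<xi>) \<partial>lborel)"
      using cconv_adjoint(1)[of ?P' ?H "\<lambda>\<xi>. cnj (G \<xi>)", OF _ _ _ adj] cconv_adjoint(3)[of ?P' ?H "\<lambda>\<xi>. cnj (G \<xi>)", OF _ _ _ adj]
      unfolding cc by auto
    \<comment> \<open>This is the integral of |phi|^2 A0^2 in physical space.\<close>
    have Mpos: "Re (\<integral>\<xi>. cconv ?P' ?H \<xi> * cnj (G \<xi>) \<partial>lborel) \<ge> 0"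
    proof -
      have "?H \<xi> * cnj (?H \<xi>) = complex_of_real ((norm (?H \<xi>))\<^sup>2)" for \<xi> by (rule complex_norm_square[symmetric])
      then have "(\<integral>\<xi>. ?H \<xi> * cnj (?H \<xi>) \<partial>lborel) = complex_of_real (\<integral>\<xi>. (norm (?H \<xi>))\<^sup>2 \<partial>lborel)"
        by (simp only: integral_complex_of_real)
      then show ?thesis unfolding eM by simp
    qed
    have i1: "integrable lborel (\<lambda>\<xi>. cconv P ?Q' \<xi> * cnj (G \<xi>))" and b1: "ennreal (norm (\<integral>\<xi>. cconv P ?Q' \<xi> * cnj (G \<xi>) \<partial>lborel)) \<le> t1"
    proof -
      have le: "(\<integral>\<^sup>+\<xi>. nm (\<lambda>\<xi>. cconv P ?Q' \<xi> * cnj (G \<xi>)) \<xi> \<partial>lborel) \<le> t1"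
        unfolding t1_def by (intro nn_integral_mono) (simp add: norm_mult ennreal_mult mult_right_mono nm_cconv_le)
      then show "integrable lborel (\<lambda>\<xi>. cconv P ?Q' \<xi> * cnj (G \<xi>))" using tf by (simp add: integrable_nm_iff le_less_trans)
      show "ennreal (norm (\<integral>\<xi>. cconv P ?Q' \<xi> * cnj (G \<xi>) \<partial>lborel)) \<le> t1" using norm_integral_le_nn le by (rule order_trans)
    qed
    have i2: "integrable lborel (\<lambda>\<xi>. cconv ?P' Q \<xi> * cnj (G \<xi>))" and b2: "ennreal (norm (\<integral>\<xi>. cconv ?P' Q \<xi> * cnj (G \<xi>) \<partial>lborel)) \<le> t2"
    proof -
      have le: "(\<integral>\<^sup>+\<xi>. nm (\<lambda>\<xi>. cconv ?P' Q \<xi> * cnj (G \<xi>)) \<xi> \<partial>lborel) \<le> t2"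
        unfolding t2_def by (intro nn_integral_mono) (simp add: norm_mult ennreal_mult mult_right_mono nm_cconv_le)
      then show "integrable lborel (\<lambda>\<xi>. cconv ?P' Q \<xi> * cnj (G \<xi>))" using tf by (simp add: integrable_nm_iff le_less_trans)
      show "ennreal (norm (\<integral>\<xi>. cconv ?P' Q \<xi> * cnj (G \<xi>) \<partial>lborel)) \<le> t2" using norm_integral_le_nn le by (rule order_trans)
    qed
    let ?I1 = "\<integral>\<xi>. cconv P ?Q' \<xi> * cnj (G \<xi>) \<partial>lborel" and ?I2 = "\<integral>\<xi>. cconv ?P' Q \<xi> * cnj (G \<xi>) \<partial>lborel"
      and ?I3 = "\<integral>\<xi>. cconv ?P' ?H \<xi> * cnj (G \<xi>) \<partial>lborel"
    have "(\<integral>\<xi>. complex_of_real ((norm \<xi> * norm (G \<xi>))\<^sup>2) \<partial>lborel)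
      = (\<integral>\<xi>. ?c / (2 * \<i>) * (cconv P ?Q' \<xi> * cnj (G \<xi>) - cconv ?P' Q \<xi> * cnj (G \<xi>)) - ?c * ?c * (cconv ?P' ?H \<xi> * cnj (G \<xi>)) \<partial>lborel)"
    proof (rule integral_cong_AE)
      show "AE \<xi> in lborel. complex_of_real ((norm \<xi> * norm (G \<xi>))\<^sup>2) = ?c / (2 * \<i>) * (cconv P ?Q' \<xi> * cnj (G \<xi>) - cconv ?P' Q \<xi> * cnj (G \<xi>)) - ?c * ?c * (cconv ?P' ?H \<xi> * cnj (G \<xi>))"
        using rel unfolding elliptic_rel_def
      proof eventually_elim
        case (elim \<xi>)
        have "complex_of_real ((norm \<xi> * norm (G \<xi>))\<^sup>2) = complex_of_real ((norm \<xi>)\<^sup>2) * G \<xi> * cnj (G \<xi>)"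
          using complex_norm_square[of "G \<xi>"] by (simp add: power_mult_distrib mult.assoc)
        then show ?case unfolding elim by (simp add: algebra_simps diff_divide_distrib)
      qed
    qed measurable
    also have "\<dots> = ?c / (2 * \<i>) * (?I1 - ?I2) - ?c * ?c * ?I3"
      using i1 i2 iM by simp
    finally have eq: "complex_of_real (\<integral>\<xi>. (norm \<xi> * norm (G \<xi>))\<^sup>2 \<partial>lborel) = ?c / (2 * \<i>) * (?I1 - ?I2) - ?c * ?c * ?I3"
      by (simp only: integral_complex_of_real)
    have "(\<integral>\<xi>. (norm \<xi> * norm (G \<xi>))\<^sup>2 \<partial>lborel) = Re (?c / (2 * \<i>) * (?I1 - ?I2)) - ?fc * ?fc * Re ?I3"
      using arg_cong[OF eq, of Re] by (simp del: Re_divide_numeral)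
    also have "\<dots> \<le> norm (?c / (2 * \<i>) * (?I1 - ?I2))"
    proof -
      have "0 \<le> ?fc * ?fc * Re ?I3" using Mpos by (intro mult_nonneg_nonneg) auto
      then show ?thesis using complex_Re_le_cmod[of "?c / (2 * \<i>) * (?I1 - ?I2)"] by linarith
    qed
    also have "\<dots> \<le> ?fc / 2 * (norm ?I1 + norm ?I2)"
      using norm_triangle_ineq4[of ?I1 ?I2] by (simp add: norm_mult norm_divide mult_left_mono)
    finally have rl: "(\<integral>\<xi>. (norm \<xi> * norm (G \<xi>))\<^sup>2 \<partial>lborel) \<le> ?fc / 2 * (norm ?I1 + norm ?I2)" .
    have e_eq: "e = ennreal (\<integral>\<xi>. (norm \<xi> * norm (G \<xi>))\<^sup>2 \<partial>lborel)"
    proof -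
      have e1: "e = (\<integral>\<^sup>+\<xi>. ennreal ((norm \<xi> * norm (G \<xi>))\<^sup>2) \<partial>lborel)"
        unfolding e_def hn_def nn2_def by (simp add: ennreal_mult[symmetric] ennreal_power)
      then have "integrable lborel (\<lambda>\<xi>. (norm \<xi> * norm (G \<xi>))\<^sup>2)"
        using h unfolding e_def[symmetric] by (intro integrableI_nonneg) auto
      then show ?thesis unfolding e1 by (intro nn_integral_eq_integral) auto
    qed
    have "e \<le> ennreal (?fc / 2) * (t1 + t2)"
    proof -
      have "e \<le> ennreal (?fc / 2 * (norm ?I1 + norm ?I2))" unfolding e_eq by (intro ennreal_leI rl)
      also have "\<dots> = ennreal (?fc / 2) * (ennreal (norm ?I1) + ennreal (norm ?I2))"
        by (subst ennreal_mult) auto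
      also have "\<dots> \<le> ennreal (?fc / 2) * (t1 + t2)" by (intro mult_left_mono add_mono b1 b2) simp
      finally show ?thesis .
    qed
    \<comment> \<open>The bounds on \<open>t1\<close> and \<open>t2\<close> concern their squares,
      so the inequality is squared. \<open>?B\<close> contains exactly one factor
      \<open>e\<close>.\<close>
    then have "e * e \<le> (ennreal (?fc / 2) * (t1 + t2))\<^sup>2" unfolding power2_eq_square by (intro mult_mono) auto
    also have "\<dots> = ennreal (?fc\<^sup>2 / 4) * (t1 + t2)\<^sup>2"
      by (simp add: power_mult_distrib ennreal_power power_divide)
    also have "\<dots> \<le> ennreal (?fc\<^sup>2 / 4) * (2 * (t1\<^sup>2 + t2\<^sup>2))" by (intro mult_left_mono sum_sq_le) simp
    also have "\<dots> \<le> ennreal (?fc\<^sup>2 / 4) * (2 * (?B + ?B))" by (intro mult_left_mono add_mono t1 t2) auto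
    also have "\<dots> = ennreal (?fc\<^sup>2) * ?B"
    proof -
      have "ennreal (?fc\<^sup>2 / 4) * 4 = ennreal (?fc\<^sup>2)"
        using ennreal_mult[of "?fc\<^sup>2 / 4" 4] by simp
      moreover have "2 * (?B + ?B) = 4 * ?B" by (simp add: mult_2[symmetric] mult.assoc[symmetric])
      ultimately show ?thesis by (simp add: mult.assoc[symmetric])
    qed
    finally have "e * e \<le> (ennreal (?fc\<^sup>2) * K * (nn2 (nm Q) * wn s (nm P))) * e" by (simp add: mult_ac)
    then have "e \<le> ennreal (?fc\<^sup>2) * K * (nn2 (nm Q) * wn s (nm P))"
      by (rule ennreal_cancel_square) (use h in \<open>simp add: e_def\<close>)
    then show ?thesis by (simp add: e_def)
  qed
  have "ennreal (?fc\<^sup>2) * K < \<infinity>" using K(1) by (simp add: ennreal_mult_less_top)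
  then show ?thesis using main by (rule that)
qed

section \<open>Powers of the frequency and higher-order estimates\<close>

definition pw :: "nat \<Rightarrow> (real^4 \<Rightarrow> ennreal) \<Rightarrow> real^4 \<Rightarrow> ennreal" where
  "pw m f = (\<lambda>\<xi>. ennreal (norm \<xi> ^ m) * f \<xi>)"

lemma measurable_pw [measurable]: "f \<in> borel_measurable borel \<Longrightarrow> pw m f \<in> borel_measurable borel"
  unfolding pw_def by measurable

lemma pow_add_le: "(x + y) ^ m \<le> 2 ^ m * (x ^ m + y ^ m)" if "0 \<le> x" "0 \<le> y" for x y :: real
proof -
  have "(x + y) ^ m \<le> (2 * max x y) ^ m" using that by (intro power_mono) auto
  also have "\<dots> = 2 ^ m * (max x y) ^ m" by (rule power_mult_distrib)
  also have "\<dots> \<le> 2 ^ m * (x ^ m + y ^ m)" using that by (intro mult_left_mono) (auto simp: max_def)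
  finally show ?thesis .
qed

text \<open>The triangle inequality for the frequencies replaces the Leibniz rule: intermediate
  distributions of the weight are dominated by the two extreme ones, in which a single factor
  carries all of it.\<close>

lemma pw_nconv_le:
  assumes [measurable]: "f \<in> borel_measurable borel" "g \<in> borel_measurable borel"
  shows "pw m (nconv f g) \<xi> \<le> ennreal (2 ^ m) * (nconv (pw m f) g \<xi> + nconv f (pw m g) \<xi>)"
proof -
  have "pw m (nconv f g) \<xi> = (\<integral>\<^sup>+\<eta>. ennreal (norm \<xi> ^ m) * (f \<eta> * g (\<xi> - \<eta>)) \<partial>lborel)"
    unfolding pw_def nconv_def by (rule nn_integral_cmult[symmetric]) measurable
  also have "\<dots> \<le> (\<integral>\<^sup>+\<eta>. ennreal (2 ^ m) * (pw m f \<eta> * g (\<xi> - \<eta>) + f \<eta> * pw m g (\<xi> - \<eta>)) \<partial>lborel)"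
  proof (rule nn_integral_mono)
    fix \<eta>
    have "norm \<xi> ^ m \<le> (norm \<eta> + norm (\<xi> - \<eta>)) ^ m" using norm_triangle_ineq[of \<eta> "\<xi> - \<eta>"] by (intro power_mono) auto
    also have "\<dots> \<le> 2 ^ m * (norm \<eta> ^ m + norm (\<xi> - \<eta>) ^ m)" by (rule pow_add_le) auto
    finally have "ennreal (norm \<xi> ^ m) \<le> ennreal (2 ^ m) * (ennreal (norm \<eta> ^ m) + ennreal (norm (\<xi> - \<eta>) ^ m))"
      using ennreal_leI by (fastforce simp: ennreal_mult)
    from mult_right_mono[OF this, of "f \<eta> * g (\<xi> - \<eta>)"]
    show "ennreal (norm \<xi> ^ m) * (f \<eta> * g (\<xi> - \<eta>)) \<le> ennreal (2 ^ m) * (pw m f \<eta> * g (\<xi> - \<eta>) + f \<eta> * pw m g (\<xi> - \<eta>))"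
      by (simp add: pw_def algebra_simps)
  qed
  also have "\<dots> = ennreal (2 ^ m) * (nconv (pw m f) g \<xi> + nconv f (pw m g) \<xi>)"
    unfolding nconv_def by (subst nn_integral_cmult) (auto simp: nn_integral_add)
  finally show ?thesis .
qed

lemma wn_pw_le: "wn a (pw m f) \<le> wn (a + real m) f"
  unfolding wn_def nn2_def
proof (intro nn_integral_mono power_mono)
  fix \<xi>
  have "ennreal (symL a \<xi> * norm \<xi> ^ m) \<le> ennreal (symL (a + real m) \<xi>)"
    unfolding symL_add by (intro ennreal_leI mult_left_mono norm_pow_le_symL) auto
  from mult_right_mono[OF this, of "f \<xi>"]
  show "ennreal (symL a \<xi>) * pw m f \<xi> \<le> ennreal (symL (a + real m) \<xi>) * f \<xi>"
    by (simp add: pw_def ennreal_mult mult_ac)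
qed auto

lemma nn2_add_le:
  assumes [measurable]: "f \<in> borel_measurable borel" "g \<in> borel_measurable borel"
  shows "nn2 (\<lambda>x. f x + g x) \<le> 2 * (nn2 f + nn2 g)"
proof -
  have "nn2 (\<lambda>x. f x + g x) \<le> (\<integral>\<^sup>+x. 2 * ((f x)\<^sup>2 + (g x)\<^sup>2) \<partial>lborel)"
    unfolding nn2_def by (intro nn_integral_mono sum_sq_le)
  also have "\<dots> = 2 * (nn2 f + nn2 g)" by (simp add: nn_integral_cmult nn_integral_add nn2_def)
  finally show ?thesis .
qed

lemma nn2_cmult: "f \<in> borel_measurable borel \<Longrightarrow> nn2 (\<lambda>x. c * f x) = c\<^sup>2 * nn2 f"
  by (simp add: nn2_def power_mult_distrib nn_integral_cmult)

lemma nn2_pw_nconv_le: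
  assumes [measurable]: "f \<in> borel_measurable borel" "g \<in> borel_measurable borel"
  shows "nn2 (pw m (nconv f g)) \<le> ennreal (2 * 4 ^ m) * (nn2 (nconv (pw m f) g) + nn2 (nconv f (pw m g)))"
proof -
  have "nn2 (pw m (nconv f g)) \<le> nn2 (\<lambda>\<xi>. ennreal (2 ^ m) * (nconv (pw m f) g \<xi> + nconv f (pw m g) \<xi>))"
    unfolding nn2_def by (intro nn_integral_mono power_mono pw_nconv_le) auto
  also have "\<dots> = (ennreal (2 ^ m))\<^sup>2 * nn2 (\<lambda>\<xi>. nconv (pw m f) g \<xi> + nconv f (pw m g) \<xi>)"
    by (rule nn2_cmult) measurable
  also have "\<dots> \<le> (ennreal (2 ^ m))\<^sup>2 * (2 * (nn2 (nconv (pw m f) g) + nn2 (nconv f (pw m g))))"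
    by (intro mult_left_mono nn2_add_le) auto
  also have "(ennreal (2 ^ m))\<^sup>2 = ennreal (4 ^ m)"
    by (simp only: ennreal_power zero_le_power zero_le_numeral power_mult[symmetric] mult.commute[of m]) (simp add: power_mult)
  also have "ennreal (4 ^ m) * (2 * (nn2 (nconv (pw m f) g) + nn2 (nconv f (pw m g)))) = ennreal (2 * 4 ^ m) * (nn2 (nconv (pw m f) g) + nn2 (nconv f (pw m g)))"
    by (subst ennreal_mult) (auto simp: distrib_left mult_ac)
  finally show ?thesis .
qed

lemma nn2_young:
  assumes "f \<in> borel_measurable borel" "g \<in> borel_measurable borel"
  shows "nn2 (nconv f g) \<le> (\<integral>\<^sup>+\<xi>. f \<xi> \<partial>lborel)\<^sup>2 * nn2 g"
  unfolding nn2_def by (rule young_L2[OF assms])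

lemma pw_0 [simp]: "pw 0 f = f" by (simp add: pw_def)

lemma pw_reflect: "pw m (\<lambda>\<xi>. f (- \<xi>)) = (\<lambda>\<xi>. pw m f (- \<xi>))" by (simp add: pw_def)

text \<open>The weight |\<xi>|^m is distributed over the equation for |\<xi>|^2 G. The source terms
  use the product bound at regularity \<open>s\<close>. For the cubic term Young's inequality
  detaches one factor \<open>P\<close>, and the remaining convolution is treated by the product
  bound or again by Young, depending on the factor that carries the weight.\<close>

lemma higher_estimate:
  fixes m :: nat
  assumes s: "s > 1"
  obtains K where "K < \<infinity>" "\<And>P Q G. P \<in> borel_measurable borel \<Longrightarrow> Q \<in> borel_measurable borel \<Longrightarrow> G \<in> borel_measurable borel \<Longrightarrow>
     elliptic_rel P Q G \<Longrightarrow>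
     nn2 (pw (m + 2) (nm G)) \<le> K * (wn (s + real m) (nm P) * wn s (nm Q) + wn s (nm P) * wn (s + real m) (nm Q)
        + wn (s + 1) (nm P) * (wn (s + real m) (nm P) * hn (nm G))
        + wn (s + 1) (nm P) * (if m = 0 then 0 else wn (s + 1) (nm P) * nn2 (pw m (nm G))))"
proof -
  obtain K1 where K1: "K1 < \<infinity>" "\<And>f g. f \<in> borel_measurable borel \<Longrightarrow> g \<in> borel_measurable borel \<Longrightarrow> nn2 (nconv f g) \<le> K1 * (wn s f * wn s g)"
    using nconv_bilinear_ss[OF s] by blast
  obtain K2 where K2: "K2 < \<infinity>" "\<And>f g. f \<in> borel_measurable borel \<Longrightarrow> g \<in> borel_measurable borel \<Longrightarrow> nn2 (nconv f g) \<le> K2 * (wn s f * hn g)"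
    using nconv_bilinear_sh[OF s] by blast
  have "s + 1 > 2" using s by simp
  then obtain K3 where K3: "K3 < \<infinity>" "\<And>f. f \<in> borel_measurable borel \<Longrightarrow> (\<integral>\<^sup>+\<xi>. f \<xi> \<partial>lborel)\<^sup>2 \<le> K3 * wn (s + 1) f"
    using L1_bound by blast
  let ?fc = "fconst TYPE(real^4)"
  let ?c = "complex_of_real ?fc"
  define D where "D = ennreal (?fc + ?fc * ?fc)"
  define q where "q = ennreal (2 * 4 ^ m)"
  define k1 where "k1 = q * K1"
  define k3 where "k3 = q * (K3 * K2 + K3 * (q * (K2 + (K2 + K3))))"
  \<comment> \<open>\<open>D\<close> bounds the numerical coefficients of the equation,
    \<open>k1\<close> belongs to each of the two source terms and \<open>k3\<close> to the cubic
    one. The nested factors 2 come from two uses of \<open>nn2_add_le\<close>.\<close>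
  define K where "K = D\<^sup>2 * (2 * (2 * (k1 + k1) + k3))"
  have fin: "K < \<infinity>"
    using K1(1) K2(1) K3(1) by (simp add: K_def k1_def k3_def D_def q_def ennreal_mult_less_top power_less_top_ennreal)
  have main: "nn2 (pw (m + 2) (nm G)) \<le> K * (wn (s + real m) (nm P) * wn s (nm Q) + wn s (nm P) * wn (s + real m) (nm Q)
        + wn (s + 1) (nm P) * (wn (s + real m) (nm P) * hn (nm G))
        + wn (s + 1) (nm P) * (if m = 0 then 0 else wn (s + 1) (nm P) * nn2 (pw m (nm G))))"
    if [measurable]: "P \<in> borel_measurable borel" "Q \<in> borel_measurable borel" "G \<in> borel_measurable borel"
      and rel: "elliptic_rel P Q G" for P Q G
  proof -
    let ?P' = "refl_cnj P" and ?Q' = "refl_cnj Q"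
    define a0 where "a0 = wn s (nm P)"
    define a1 where "a1 = wn (s + 1) (nm P)"
    define am where "am = wn (s + real m) (nm P)"
    define d1 where "d1 = wn s (nm Q)"
    define dm where "dm = wn (s + real m) (nm Q)"
    define e where "e = hn (nm G)"
    define T where "T = (if m = 0 then 0 else a1 * nn2 (pw m (nm G)))"
    define B where "B = am * d1 + a0 * dm + a1 * (am * e) + a1 * T"
    have wr: "wn a (pw j (nm ?P')) = wn a (pw j (nm P))" "wn a (pw j (nm ?Q')) = wn a (pw j (nm Q))" for a j
      unfolding nm_refl_cnj pw_reflect[of j "nm P"] pw_reflect[of j "nm Q"] using wn_reflect[of "pw j (nm P)" a] wn_reflect[of "pw j (nm Q)" a] by auto
    have wr0: "wn a (nm ?P') = wn a (nm P)" "wn a (nm ?Q') = wn a (nm Q)" for a using wr[of a 0] by auto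
    have wm: "wn s (pw m (nm P)) \<le> am" "wn s (pw m (nm Q)) \<le> dm" unfolding am_def dm_def by (rule wn_pw_le)+
    have B1: "am * d1 + a0 * dm \<le> B" "a1 * (am * e) \<le> B" "a1 * T \<le> B"
      unfolding B_def by (auto simp: add.assoc add_increasing add_increasing2)
    have S12: "nn2 (pw m (nconv f g)) \<le> k1 * B"
      if [measurable]: "f \<in> borel_measurable borel" "g \<in> borel_measurable borel"
        and b: "wn s (pw m f) \<le> am" "wn s g \<le> d1" "wn s f \<le> a0" "wn s (pw m g) \<le> dm" for f g
    proof -
      have "nn2 (nconv (pw m f) g) \<le> K1 * (am * d1)"
        by (rule order_trans[OF K1(2)]) (auto intro!: mult_left_mono mult_mono b)
      moreover have "nn2 (nconv f (pw m g)) \<le> K1 * (a0 * dm)"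
        by (rule order_trans[OF K1(2)]) (auto intro!: mult_left_mono mult_mono b)
      ultimately have "nn2 (nconv (pw m f) g) + nn2 (nconv f (pw m g)) \<le> K1 * (am * d1 + a0 * dm)"
        unfolding distrib_left by (rule add_mono)
      also have "\<dots> \<le> K1 * B" by (intro mult_left_mono B1) simp
      finally have "q * (nn2 (nconv (pw m f) g) + nn2 (nconv f (pw m g))) \<le> q * (K1 * B)" by (rule mult_left_mono) simp
      then show ?thesis using nn2_pw_nconv_le[of f g m] unfolding q_def[symmetric] k1_def mult.assoc by (auto intro: order_trans)
    qed
    have S1: "nn2 (pw m (nconv (nm P) (nm ?Q'))) \<le> k1 * B"
      by (rule S12) (auto simp: wr wr0 wm a0_def d1_def)
    have S2: "nn2 (pw m (nconv (nm ?P') (nm Q))) \<le> k1 * B"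
      by (rule S12) (auto simp: wr wr0 wm a0_def d1_def)
    have LX: "(\<integral>\<^sup>+\<xi>. nm P \<xi> \<partial>lborel)\<^sup>2 \<le> K3 * a1" "(\<integral>\<^sup>+\<xi>. nm ?P' \<xi> \<partial>lborel)\<^sup>2 \<le> K3 * a1"
      using K3(2)[of "nm P"] K3(2)[of "nm ?P'"] by (auto simp: wr0 a1_def)
    have pZ: "nn2 (nconv (pw m h) (nm G)) \<le> K2 * (am * e)" if [measurable]: "h \<in> borel_measurable borel" and "wn s (pw m h) \<le> am" for h
      by (rule order_trans[OF K2(2)]) (use that in \<open>auto intro!: mult_left_mono mult_mono simp: e_def\<close>)
    \<comment> \<open>Putting one factor P into L1 costs a single derivative of phi; the other two factors are
      estimated with the regularity of the energy bound.\<close>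
    have U1: "nn2 (nconv (pw m (nm ?P')) (nconv (nm P) (nm G))) \<le> K3 * K2 * B"
    proof -
      \<comment> \<open>The weighted factor is moved next to \<open>G\<close>, where the product
        bound applies, and the unweighted \<open>P\<close> goes outside, where Young
        applies.\<close>
      have "nn2 (nconv (pw m (nm ?P')) (nconv (nm P) (nm G))) = nn2 (nconv (nm P) (nconv (pw m (nm ?P')) (nm G)))"
        by (subst nconv_left_commute) auto
      also have "\<dots> \<le> (\<integral>\<^sup>+\<xi>. nm P \<xi> \<partial>lborel)\<^sup>2 * nn2 (nconv (pw m (nm ?P')) (nm G))" by (rule nn2_young) auto
      also have "\<dots> \<le> (K3 * a1) * (K2 * (am * e))" by (intro mult_mono LX pZ) (auto simp: wr wm)
      also have "\<dots> = K3 * K2 * (a1 * (am * e))" by (simp only: mult_ac)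
      also have "\<dots> \<le> K3 * K2 * B" by (intro mult_left_mono B1) simp
      finally show ?thesis .
    qed
    \<comment> \<open>For m = 0 Young would involve the L2 norm of \<open>G\<close> itself, which
      the energy does not control at low frequencies; the product bound with the homogeneous weight
      is used instead. For m > 0 Young leads to the lower-order quantity in
      \<open>T\<close>.\<close>
    have U2: "a1 * nn2 (nconv (nm P) (pw m (nm G))) \<le> (K2 + K3) * B"
    proof (cases "m = 0")
      case True
      have "a1 * nn2 (nconv (nm P) (pw m (nm G))) \<le> a1 * (K2 * (am * e))"
        using pZ[of "nm P"] wm True by (intro mult_left_mono) auto
      also have "\<dots> = K2 * (a1 * (am * e))" by (simp only: mult_ac)
      also have "\<dots> \<le> (K2 + K3) * B" by (intro mult_mono B1) auto
      finally show ?thesis .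
    next
      case False
      have "nn2 (nconv (nm P) (pw m (nm G))) \<le> (\<integral>\<^sup>+\<xi>. nm P \<xi> \<partial>lborel)\<^sup>2 * nn2 (pw m (nm G))" by (rule nn2_young) auto
      also have "\<dots> \<le> K3 * a1 * nn2 (pw m (nm G))" by (intro mult_right_mono LX) auto
      finally have "a1 * nn2 (nconv (nm P) (pw m (nm G))) \<le> a1 * (K3 * a1 * nn2 (pw m (nm G)))" by (rule mult_left_mono) simp
      also have "\<dots> = K3 * (a1 * T)" using False by (simp add: T_def mult_ac)
      also have "\<dots> \<le> (K2 + K3) * B" by (intro mult_mono B1) auto
      finally show ?thesis .
    qed
    have U3: "nn2 (nconv (nm ?P') (pw m (nconv (nm P) (nm G)))) \<le> K3 * (q * (K2 + (K2 + K3))) * B"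
    proof -
      have "nn2 (nconv (nm ?P') (pw m (nconv (nm P) (nm G)))) \<le> (\<integral>\<^sup>+\<xi>. nm ?P' \<xi> \<partial>lborel)\<^sup>2 * nn2 (pw m (nconv (nm P) (nm G)))"
        by (rule nn2_young) auto
      also have "\<dots> \<le> (K3 * a1) * (q * (nn2 (nconv (pw m (nm P)) (nm G)) + nn2 (nconv (nm P) (pw m (nm G)))))"
        unfolding q_def by (intro mult_mono LX nn2_pw_nconv_le) auto
      also have "\<dots> = K3 * (q * (a1 * nn2 (nconv (pw m (nm P)) (nm G)) + a1 * nn2 (nconv (nm P) (pw m (nm G)))))"
        by (simp only: distrib_left mult_ac)
      also have "\<dots> \<le> K3 * (q * (K2 * B + (K2 + K3) * B))"
      proof (intro mult_left_mono add_mono U2)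
        have "a1 * nn2 (nconv (pw m (nm P)) (nm G)) \<le> a1 * (K2 * (am * e))" by (intro mult_left_mono pZ wm) auto
        also have "\<dots> = K2 * (a1 * (am * e))" by (simp only: mult_ac)
        also have "\<dots> \<le> K2 * B" by (intro mult_left_mono B1) simp
        finally show "a1 * nn2 (nconv (pw m (nm P)) (nm G)) \<le> K2 * B" .
      qed auto
      also have "\<dots> = K3 * (q * (K2 + (K2 + K3))) * B" by (simp only: distrib_left distrib_right mult_ac)
      finally show ?thesis .
    qed
    have S3: "nn2 (pw m (nconv (nm ?P') (nconv (nm P) (nm G)))) \<le> k3 * B"
    proof -
      have "nn2 (pw m (nconv (nm ?P') (nconv (nm P) (nm G)))) \<le> q * (nn2 (nconv (pw m (nm ?P')) (nconv (nm P) (nm G))) + nn2 (nconv (nm ?P') (pw m (nconv (nm P) (nm G)))))"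
        unfolding q_def by (rule nn2_pw_nconv_le) auto
      also have "\<dots> \<le> q * (K3 * K2 * B + K3 * (q * (K2 + (K2 + K3))) * B)" by (intro mult_left_mono add_mono U1 U3) auto
      also have "\<dots> = k3 * B" unfolding k3_def by (simp only: distrib_right mult.assoc distrib_left)
      finally show ?thesis .
    qed
    let ?S = "\<lambda>\<xi>. pw m (nconv (nm P) (nm ?Q')) \<xi> + pw m (nconv (nm ?P') (nm Q)) \<xi> + pw m (nconv (nm ?P') (nconv (nm P) (nm G))) \<xi>"
    have "nn2 (pw (m + 2) (nm G)) \<le> nn2 (\<lambda>\<xi>. D * ?S \<xi>)"
      unfolding nn2_def
    proof (rule nn_integral_mono_AE)
      show "AE \<xi> in lborel. (pw (m + 2) (nm G) \<xi>)\<^sup>2 \<le> (D * ?S \<xi>)\<^sup>2"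
        using rel unfolding elliptic_rel_def
      proof eventually_elim
        case (elim \<xi>)
        let ?a = "cconv P ?Q' \<xi>" and ?b = "cconv ?P' Q \<xi>" and ?d = "cconv ?P' (cconv P G) \<xi>"
        let ?E = "?fc + ?fc * ?fc"
        have "norm (complex_of_real ((norm \<xi>)\<^sup>2) * G \<xi>) \<le> norm (?c * (?a - ?b) / (2 * \<i>)) + norm (?c * ?c * ?d)"
          unfolding elim by (rule norm_triangle_ineq4)
        also have "\<dots> = ?fc / 2 * norm (?a - ?b) + ?fc * ?fc * norm ?d"
          by (simp add: norm_mult norm_divide)
        also have "\<dots> \<le> ?E * (norm ?a + norm ?b) + ?E * norm ?d"
        proof (intro add_mono mult_mono)
          show "?fc / 2 \<le> ?E" "?fc * ?fc \<le> ?E" using fconst_pos[where 'a="real^4"] by (auto simp: add_increasing2)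
          show "norm (?a - ?b) \<le> norm ?a + norm ?b" by (rule norm_triangle_ineq4)
        qed auto
        finally have "(norm \<xi>)\<^sup>2 * norm (G \<xi>) \<le> ?E * (norm ?a + norm ?b + norm ?d)" by (simp add: norm_mult norm_power distrib_left)
        then have "ennreal ((norm \<xi>)\<^sup>2 * norm (G \<xi>)) \<le> ennreal (?E * (norm ?a + norm ?b + norm ?d))" by (rule ennreal_leI)
        also have "\<dots> = D * (ennreal (norm ?a) + ennreal (norm ?b) + ennreal (norm ?d))"
          unfolding D_def by (subst ennreal_mult) auto
        also have "\<dots> \<le> D * (nconv (nm P) (nm ?Q') \<xi> + nconv (nm ?P') (nm Q) \<xi> + nconv (nm ?P') (nconv (nm P) (nm G)) \<xi>)"
        proof (intro mult_left_mono add_mono nm_cconv_le)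
          have "nm (cconv ?P' (cconv P G)) \<xi> \<le> nconv (nm ?P') (nm (cconv P G)) \<xi>" by (rule nm_cconv_le)
          also have "\<dots> \<le> nconv (nm ?P') (nconv (nm P) (nm G)) \<xi>"
            unfolding nconv_def[of "nm ?P'"] by (intro nn_integral_mono mult_left_mono nm_cconv_le) auto
          finally show "ennreal (norm ?d) \<le> nconv (nm ?P') (nconv (nm P) (nm G)) \<xi>" .
        qed auto
        finally have "ennreal (norm \<xi> ^ m) * ennreal ((norm \<xi>)\<^sup>2 * norm (G \<xi>)) \<le> ennreal (norm \<xi> ^ m) * (D * (nconv (nm P) (nm ?Q') \<xi> + nconv (nm ?P') (nm Q) \<xi> + nconv (nm ?P') (nconv (nm P) (nm G)) \<xi>))"
          by (rule mult_left_mono) simp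
        also have "\<dots> = D * ?S \<xi>" unfolding pw_def by (simp only: distrib_left mult_ac)
        also have "ennreal (norm \<xi> ^ m) * ennreal ((norm \<xi>)\<^sup>2 * norm (G \<xi>)) = pw (m + 2) (nm G) \<xi>"
          unfolding pw_def power_add by (simp add: ennreal_mult mult.assoc)
        finally show ?case by (intro power_mono) auto
      qed
    qed
    also have "\<dots> = D\<^sup>2 * nn2 ?S" by (rule nn2_cmult) measurable
    also have "\<dots> \<le> D\<^sup>2 * (2 * (2 * (k1 * B + k1 * B) + k3 * B))"
    proof (intro mult_left_mono)
      have "nn2 ?S \<le> 2 * (nn2 (\<lambda>\<xi>. pw m (nconv (nm P) (nm ?Q')) \<xi> + pw m (nconv (nm ?P') (nm Q)) \<xi>) + nn2 (pw m (nconv (nm ?P') (nconv (nm P) (nm G)))))"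
        by (rule nn2_add_le) measurable
      also have "\<dots> \<le> 2 * (2 * (nn2 (pw m (nconv (nm P) (nm ?Q'))) + nn2 (pw m (nconv (nm ?P') (nm Q)))) + nn2 (pw m (nconv (nm ?P') (nconv (nm P) (nm G)))))"
        by (intro mult_left_mono add_mono nn2_add_le order_refl) auto
      also have "\<dots> \<le> 2 * (2 * (k1 * B + k1 * B) + k3 * B)" by (intro mult_left_mono add_mono S1 S2 S3) auto
      finally show "nn2 ?S \<le> 2 * (2 * (k1 * B + k1 * B) + k3 * B)" .
    qed simp
    also have "\<dots> = K * B" unfolding K_def by (simp only: distrib_left distrib_right mult.assoc)
    finally show ?thesis unfolding B_def T_def a0_def a1_def am_def d1_def dm_def e_def .
  qed
  show ?thesis using fin main by (rule that)
qed

section \<open>Passage to real-valued L2 norms\<close>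

lemma L2norm_nonneg [simp]: "L2norm f \<ge> 0"
  by (simp add: L2norm_def integral_nonneg_AE)

lemma nn2_L2norm:
  fixes f :: "'a::euclidean_space \<Rightarrow> complex"
  assumes "sq_int f" shows "nn2 (nm f) = ennreal ((L2norm f)\<^sup>2)"
proof -
  have "nn2 (nm f) = (\<integral>\<^sup>+x. ennreal ((norm (f x))\<^sup>2) \<partial>lborel)" by (simp add: nn2_def ennreal_power)
  also have "\<dots> = ennreal (\<integral>x. (norm (f x))\<^sup>2 \<partial>lborel)"
    using assms by (intro nn_integral_eq_integral) (auto simp: sq_int_def)
  also have "(\<integral>x. (norm (f x))\<^sup>2 \<partial>lborel) = (L2norm f)\<^sup>2"
    unfolding L2norm_def by (subst real_sqrt_pow2) (auto intro: integral_nonneg_AE)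
  finally show ?thesis .
qed

lemma L2_Cauchy_Schwarz:
  fixes f g :: "'a::euclidean_space \<Rightarrow> complex"
  assumes f: "sq_int f" and g: "sq_int g"
  shows "norm (\<integral>x. f x * g x \<partial>lborel) \<le> L2norm f * L2norm g"
proof -
  have [measurable]: "f \<in> borel_measurable borel" "g \<in> borel_measurable borel" using f g by (auto simp: sq_int_def)
  have "ennreal (norm (\<integral>x. f x * g x \<partial>lborel)) \<le> (\<integral>\<^sup>+x. nm f x * nm g x \<partial>lborel)"
    using norm_integral_le_nn[of lborel "\<lambda>x. f x * g x"] by (simp add: norm_mult ennreal_mult)
  then have "(ennreal (norm (\<integral>x. f x * g x \<partial>lborel)))\<^sup>2 \<le> (\<integral>\<^sup>+x. nm f x * nm g x \<partial>lborel)\<^sup>2"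
    by (intro power_mono) auto
  also have "\<dots> \<le> nn2 (nm f) * nn2 (nm g)" unfolding nn2_def by (rule Cauchy_Schwarz_nn_integral) measurable
  also have "\<dots> = ennreal ((L2norm f * L2norm g)\<^sup>2)"
    by (simp add: nn2_L2norm f g ennreal_mult power_mult_distrib)
  finally have "(norm (\<integral>x. f x * g x \<partial>lborel))\<^sup>2 \<le> (L2norm f * L2norm g)\<^sup>2"
    by (simp add: ennreal_power ennreal_le_iff)
  then show ?thesis by (rule power2_le_imp_le) simp
qed

lemma sq_int_diff:
  fixes f g :: "'a::euclidean_space \<Rightarrow> complex"
  assumes "sq_int f" "sq_int g" shows "sq_int (\<lambda>x. f x - g x)"
proof -
  have [measurable]: "f \<in> borel_measurable borel" "g \<in> borel_measurable borel" using assms by (auto simp: sq_int_def)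
  have "nn2 (nm (\<lambda>x. f x - g x)) \<le> nn2 (\<lambda>x. nm f x + nm g x)"
    unfolding nn2_def
    by (intro nn_integral_mono power_mono) (auto simp: ennreal_plus[symmetric] simp del: ennreal_plus intro!: ennreal_leI norm_triangle_ineq4)
  also have "\<dots> \<le> (\<integral>\<^sup>+x. 2 * ((nm f x)\<^sup>2 + (nm g x)\<^sup>2) \<partial>lborel)"
    unfolding nn2_def by (intro nn_integral_mono sum_sq_le)
  also have "\<dots> = 2 * (nn2 (nm f) + nn2 (nm g))" by (simp add: nn_integral_cmult nn_integral_add nn2_def)
  also have "\<dots> < \<infinity>" using assms by (simp add: nn2_def sq_int_nm_iff ennreal_mult_less_top)
  finally show ?thesis by (simp add: nn2_def sq_int_nm_iff)
qed

lemma sq_int_cmult: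
  fixes f :: "'a::euclidean_space \<Rightarrow> complex"
  shows "sq_int f \<Longrightarrow> sq_int (\<lambda>x. c * f x)"
  by (auto simp: sq_int_def norm_mult power_mult_distrib)

section \<open>Restriction to a fixed time\<close>

lemma fconst_prod: "fconst TYPE('a::euclidean_space \<times> 'b::euclidean_space) = fconst TYPE('a) * fconst TYPE('b)"
  by (simp add: fconst_def powr_add[symmetric] diff_divide_distrib)

lemma ek_Pair: "ek (a, b) (c, d) = ek a c * ek b d"
  by (simp add: ek_def ring_distribs exp_add[symmetric])

lemma fourier_tensor:
  fixes a :: "'a::euclidean_space \<Rightarrow> complex" and b :: "'b::euclidean_space \<Rightarrow> complex"
  assumes a: "integrable lborel a" and b: "integrable lborel b"
  shows "integrable lborel (\<lambda>(\<tau>, \<xi>). a \<tau> * b \<xi>)"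
    "fourier (\<lambda>(\<tau>, \<xi>). a \<tau> * b \<xi>) (t, x) = fourier a t * fourier b x"
proof -
  show "integrable lborel (\<lambda>(\<tau>, \<xi>). a \<tau> * b \<xi>)"
    using pair_integrable_mult[OF a b] by (simp add: lborel_prod)
  have i: "integrable (lborel \<Otimes>\<^sub>M lborel) (\<lambda>(\<tau>, \<xi>). (ek \<tau> t * a \<tau>) * (ek \<xi> x * b \<xi>))"
    by (rule pair_integrable_mult[OF integrable_ek(1)[OF a] integrable_ek(1)[OF b]])
  have "(\<integral>z. ek z (t, x) * (case z of (\<tau>, \<xi>) \<Rightarrow> a \<tau> * b \<xi>) \<partial>lborel)
     = (\<integral>z. (case z of (\<tau>, \<xi>) \<Rightarrow> (ek \<tau> t * a \<tau>) * (ek \<xi> x * b \<xi>)) \<partial>(lborel \<Otimes>\<^sub>M lborel))"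
    unfolding lborel_prod by (intro Bochner_Integration.integral_cong) (auto simp: ek_Pair)
  also have "\<dots> = (\<integral>\<tau>. (\<integral>\<xi>. (ek \<tau> t * a \<tau>) * (ek \<xi> x * b \<xi>) \<partial>lborel) \<partial>lborel)"
    using lborel_pair.integral_fst'[OF i] by simp
  also have "\<dots> = (\<integral>\<tau>. ek \<tau> t * a \<tau> \<partial>lborel) * (\<integral>\<xi>. ek \<xi> x * b \<xi> \<partial>lborel)"
    by (simp only: integral_mult_right_zero integral_mult_left_zero)
  finally show "fourier (\<lambda>(\<tau>, \<xi>). a \<tau> * b \<xi>) (t, x) = fourier a t * fourier b x"
    by (simp add: fourier_ek fconst_prod)
qed

lemma sq_int_tensor:
  fixes a :: "'a::euclidean_space \<Rightarrow> complex" and b :: "'b::euclidean_space \<Rightarrow> complex"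
  assumes a: "sq_int a" and b: "sq_int b"
  shows "sq_int (\<lambda>(\<tau>, \<xi>). a \<tau> * b \<xi>)"
proof -
  have [measurable]: "a \<in> borel_measurable borel" "b \<in> borel_measurable borel" using assms by (auto simp: sq_int_def)
  have "(\<lambda>(\<tau>, \<xi>). a \<tau> * b \<xi>) \<in> borel_measurable (lborel \<Otimes>\<^sub>M lborel)" by measurable
  then have m: "(\<lambda>(\<tau>, \<xi>). a \<tau> * b \<xi>) \<in> borel_measurable lborel" by (simp only: lborel_prod)
  have "(\<integral>\<^sup>+z. (nm (\<lambda>(\<tau>, \<xi>). a \<tau> * b \<xi>) z)\<^sup>2 \<partial>(lborel \<Otimes>\<^sub>M lborel)) = (\<integral>\<^sup>+\<tau>. \<integral>\<^sup>+\<xi>. (nm a \<tau>)\<^sup>2 * (nm b \<xi>)\<^sup>2 \<partial>lborel \<partial>lborel)"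
    by (subst lborel.nn_integral_fst[symmetric]) (auto simp: norm_mult ennreal_mult power_mult_distrib split_beta')
  also have "\<dots> = (\<integral>\<^sup>+\<tau>. (nm a \<tau>)\<^sup>2 \<partial>lborel) * (\<integral>\<^sup>+\<xi>. (nm b \<xi>)\<^sup>2 \<partial>lborel)"
    by (simp add: nn_integral_cmult nn_integral_multc)
  also have "\<dots> < \<infinity>" using assms by (simp add: sq_int_nm_iff ennreal_mult_less_top)
  finally show ?thesis using m unfolding lborel_prod by (simp add: sq_int_nm_iff)
qed

text \<open>The set where \<open>g\<close> does not vanish is open and null, hence empty.\<close>

lemma continuous_AE_zero:
  fixes g :: "real \<Rightarrow> complex"
  assumes "continuous_on UNIV g" and AE: "AE t in lborel. g t = 0"
  shows "g t = 0"
proof (rule ccontr)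
  assume t: "g t \<noteq> 0"
  have "open (g -` (- {0}))" using assms(1) by (intro open_vimage) auto
  moreover have "g -` (- {0}) \<noteq> {}" using t by auto
  ultimately have "\<not> negligible (g -` (- {0}))" by (rule open_not_negligible)
  moreover have "negligible (g -` (- {0}))"
  proof -
    have "{t. g t \<noteq> 0} = g -` (- {0})" by auto
    then have "{t. g t \<noteq> 0} \<in> sets borel" using \<open>open (g -` (- {0}))\<close> by simp
    then have "{t. g t \<noteq> 0} \<in> null_sets lborel" using AE by (subst (asm) AE_iff_null) auto
    then have "{t. \<not> g t = 0} \<in> null_sets lebesgue" by (rule null_sets_completionI)
    then show ?thesis by (simp add: negligible_iff_null_sets vimage_def)
  qed
  ultimately show False by simp
qed

text \<open>After integration of |\<Psi>| in \<tau> the result is square integrable in \<xi>, so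
  pairing with \<open>b\<close> in L2 makes all double integrals absolutely convergent. The spatial
  pairing then commutes with the inverse transform in time.\<close>

lemma partial_ifourier_pairing:
  fixes \<Psi> :: "real \<times> (real^4) \<Rightarrow> complex"
  assumes [measurable]: "\<Psi> \<in> borel_measurable (lborel \<Otimes>\<^sub>M lborel)"
    and fin: "(\<integral>\<^sup>+\<xi>. (\<integral>\<^sup>+\<tau>. nm \<Psi> (\<tau>, \<xi>) \<partial>lborel)\<^sup>2 \<partial>lborel) < \<infinity>" and b: "sq_int b"
  shows "integrable (lborel \<Otimes>\<^sub>M lborel) (\<lambda>(\<tau>, \<xi>). \<Psi> (\<tau>, \<xi>) * b \<xi>)"
    "integrable lborel (\<lambda>\<tau>. \<integral>\<xi>. \<Psi> (\<tau>, \<xi>) * b \<xi> \<partial>lborel)"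
    "ifourier (\<lambda>\<tau>. \<integral>\<xi>. \<Psi> (\<tau>, \<xi>) * b \<xi> \<partial>lborel) t = (\<integral>\<xi>. ifourier (\<lambda>\<tau>. \<Psi> (\<tau>, \<xi>)) t * b \<xi> \<partial>lborel)"
proof -
  have [measurable]: "b \<in> borel_measurable borel" using b by (simp add: sq_int_def)
  have nn: "(\<integral>\<^sup>+\<tau>. \<integral>\<^sup>+\<xi>. nm \<Psi> (\<tau>, \<xi>) * nm b \<xi> \<partial>lborel \<partial>lborel) < \<infinity>"
  proof -
    have "(\<integral>\<^sup>+\<tau>. \<integral>\<^sup>+\<xi>. nm \<Psi> (\<tau>, \<xi>) * nm b \<xi> \<partial>lborel \<partial>lborel) = (\<integral>\<^sup>+\<xi>. \<integral>\<^sup>+\<tau>. nm \<Psi> (\<tau>, \<xi>) * nm b \<xi> \<partial>lborel \<partial>lborel)"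
      by (rule lborel_pair.Fubini') measurable
    also have "\<dots> = (\<integral>\<^sup>+\<xi>. (\<integral>\<^sup>+\<tau>. nm \<Psi> (\<tau>, \<xi>) \<partial>lborel) * nm b \<xi> \<partial>lborel)"
      by (intro nn_integral_cong nn_integral_multc) measurable
    also have "\<dots> < \<infinity>" using fin b by (intro nn_L2_pairing_finite) (auto simp: sq_int_nm_iff)
    finally show ?thesis .
  qed
  show i: "integrable (lborel \<Otimes>\<^sub>M lborel) (\<lambda>(\<tau>, \<xi>). \<Psi> (\<tau>, \<xi>) * b \<xi>)"
    by (rule pair_integrableI) (use nn in \<open>auto simp: norm_mult ennreal_mult\<close>)
  show "integrable lborel (\<lambda>\<tau>. \<integral>\<xi>. \<Psi> (\<tau>, \<xi>) * b \<xi> \<partial>lborel)"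
    using lborel_pair.integrable_fst'[OF i] by simp
  have i2: "integrable (lborel \<Otimes>\<^sub>M lborel) (\<lambda>(\<tau>, \<xi>). ek \<tau> (- t) * (\<Psi> (\<tau>, \<xi>) * b \<xi>))"
    by (rule pair_integrableI) (use nn in \<open>auto simp: norm_mult ennreal_mult\<close>)
  have "(\<integral>\<tau>. ek \<tau> (- t) * (\<integral>\<xi>. \<Psi> (\<tau>, \<xi>) * b \<xi> \<partial>lborel) \<partial>lborel) = (\<integral>\<tau>. (\<integral>\<xi>. ek \<tau> (- t) * (\<Psi> (\<tau>, \<xi>) * b \<xi>) \<partial>lborel) \<partial>lborel)"
    by (simp only: integral_mult_right_zero)
  also have "\<dots> = (\<integral>\<xi>. (\<integral>\<tau>. ek \<tau> (- t) * (\<Psi> (\<tau>, \<xi>) * b \<xi>) \<partial>lborel) \<partial>lborel)"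
    using lborel_pair.Fubini_integral[OF i2] by simp
  also have "\<dots> = (\<integral>\<xi>. (\<integral>\<tau>. ek \<tau> (- t) * \<Psi> (\<tau>, \<xi>) \<partial>lborel) * b \<xi> \<partial>lborel)"
    by (simp only: mult.assoc[symmetric] integral_mult_left_zero)
  finally have "ifourier (\<lambda>\<tau>. \<integral>\<xi>. \<Psi> (\<tau>, \<xi>) * b \<xi> \<partial>lborel) t = complex_of_real (fconst TYPE(real)) * (\<integral>\<xi>. (\<integral>\<tau>. ek \<tau> (- t) * \<Psi> (\<tau>, \<xi>) \<partial>lborel) * b \<xi> \<partial>lborel)"
    by (simp only: ifourier_def fourier_ek)
  also have "\<dots> = (\<integral>\<xi>. ifourier (\<lambda>\<tau>. \<Psi> (\<tau>, \<xi>)) t * b \<xi> \<partial>lborel)"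
    by (simp only: ifourier_def fourier_ek mult.assoc integral_mult_right_zero)
  finally show "ifourier (\<lambda>\<tau>. \<integral>\<xi>. \<Psi> (\<tau>, \<xi>) * b \<xi> \<partial>lborel) t = (\<integral>\<xi>. ifourier (\<lambda>\<tau>. \<Psi> (\<tau>, \<xi>)) t * b \<xi> \<partial>lborel)" .
qed

lemma nm_partial_ifourier_le:
  "nm (\<lambda>\<xi>. ifourier (\<lambda>\<tau>. \<Psi> (\<tau>, \<xi>)) t) \<xi> \<le> ennreal (fconst TYPE(real)) * (\<integral>\<^sup>+\<tau>. nm \<Psi> (\<tau>, \<xi>) \<partial>lborel)"
  for \<Psi> :: "real \<times> 'a \<Rightarrow> complex"
proof -
  have "ennreal (norm (\<integral>\<tau>. ek \<tau> (- t) * \<Psi> (\<tau>, \<xi>) \<partial>lborel)) \<le> (\<integral>\<^sup>+\<tau>. ennreal (norm (ek \<tau> (- t) * \<Psi> (\<tau>, \<xi>))) \<partial>lborel)"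
    by (rule norm_integral_le_nn)
  then show ?thesis by (simp add: ifourier_def fourier_ek norm_mult ennreal_mult mult_left_mono)
qed

lemma measurable_partial_ifourier:
  fixes \<Psi> :: "real \<times> 'a::euclidean_space \<Rightarrow> complex"
  assumes [measurable]: "\<Psi> \<in> borel_measurable (lborel \<Otimes>\<^sub>M lborel)"
  shows "(\<lambda>\<xi>. ifourier (\<lambda>\<tau>. \<Psi> (\<tau>, \<xi>)) t) \<in> borel_measurable borel"
proof -
  have "(\<lambda>\<xi>. \<integral>\<tau>. ek \<tau> (- t) * \<Psi> (\<tau>, \<xi>) \<partial>lborel) \<in> borel_measurable lborel"
    by (rule lborel.borel_measurable_lebesgue_integral) measurable
  then show ?thesis unfolding ifourier_def fourier_ek by measurable
qed

lemma sq_int_partial_ifourier: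
  fixes \<Psi> :: "real \<times> 'a::euclidean_space \<Rightarrow> complex"
  assumes [measurable]: "\<Psi> \<in> borel_measurable (lborel \<Otimes>\<^sub>M lborel)"
    and fin: "(\<integral>\<^sup>+\<xi>. (\<integral>\<^sup>+\<tau>. nm \<Psi> (\<tau>, \<xi>) \<partial>lborel)\<^sup>2 \<partial>lborel) < \<infinity>"
  shows "sq_int (\<lambda>\<xi>. ifourier (\<lambda>\<tau>. \<Psi> (\<tau>, \<xi>)) t)"
proof -
  have "(\<integral>\<^sup>+\<xi>. (nm (\<lambda>\<xi>. ifourier (\<lambda>\<tau>. \<Psi> (\<tau>, \<xi>)) t) \<xi>)\<^sup>2 \<partial>lborel) \<le> (\<integral>\<^sup>+\<xi>. (ennreal (fconst TYPE(real)) * (\<integral>\<^sup>+\<tau>. nm \<Psi> (\<tau>, \<xi>) \<partial>lborel))\<^sup>2 \<partial>lborel)"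
    by (intro nn_integral_mono power_mono nm_partial_ifourier_le) simp
  also have "\<dots> = (ennreal (fconst TYPE(real)))\<^sup>2 * (\<integral>\<^sup>+\<xi>. (\<integral>\<^sup>+\<tau>. nm \<Psi> (\<tau>, \<xi>) \<partial>lborel)\<^sup>2 \<partial>lborel)"
    unfolding power_mult_distrib by (rule nn_integral_cmult) measurable
  also have "\<dots> < \<infinity>" using fin by (simp add: ennreal_mult_less_top power_less_top_ennreal)
  finally show ?thesis using measurable_partial_ifourier[of \<Psi> t] by (simp add: sq_int_nm_iff)
qed

text \<open>Pairing with a fixed L2 function is a bounded functional, so differentiability in the L2
  norm passes to the scalar function by Cauchy-Schwarz.\<close>

lemma L2_deriv_pairing:
  assumes D: "L2_time_deriv \<phi> d\<phi>" and g: "sq_int g"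
  shows "((\<lambda>t. \<integral>x. \<phi> t x * g x \<partial>lborel) has_vector_derivative (\<integral>x. d\<phi> t x * g x \<partial>lborel)) (at t)"
proof -
  have sq: "sq_int (\<phi> t)" "sq_int (d\<phi> t)" for t using D by (auto simp: L2_time_deriv_def)
  let ?h = "\<lambda>t. \<integral>x. \<phi> t x * g x \<partial>lborel"
  let ?D = "\<integral>x. d\<phi> t x * g x \<partial>lborel"
  let ?r = "\<lambda>h x. (\<phi> (t + h) x - \<phi> t x) / complex_of_real h - d\<phi> t x"
  have rs: "sq_int (?r h)" for h
  proof -
    have "sq_int (\<lambda>x. inverse (complex_of_real h) * (\<phi> (t + h) x - \<phi> t x) - d\<phi> t x)"
      by (intro sq_int_diff sq_int_cmult sq)
    then show ?thesis by (simp add: divide_inverse mult.commute)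
  qed
  have lim: "((\<lambda>h. L2norm (?r h)) \<longlongrightarrow> 0) (at 0)" using D by (simp add: L2_time_deriv_def)
  have i: "integrable lborel (\<lambda>x. \<phi> t x * g x)" "integrable lborel (\<lambda>x. d\<phi> t x * g x)" for t
    by (intro integrable_sq_int_mult sq g)+
  have "((\<lambda>h. norm (?h (t + h) - ?h t - h *\<^sub>R ?D) / norm h) \<longlongrightarrow> 0) (at 0)"
  proof (rule Lim_null_comparison)
    show "((\<lambda>h. L2norm (?r h) * L2norm g) \<longlongrightarrow> 0) (at 0)" using tendsto_mult_left_zero[OF lim] by simp
    show "\<forall>\<^sub>F h in at 0. norm (norm (?h (t + h) - ?h t - h *\<^sub>R ?D) / norm h) \<le> L2norm (?r h) * L2norm g"
    proof (rule eventually_at_filter[THEN iffD2], intro always_eventually allI impI)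
      fix h :: real assume h: "h \<noteq> 0"
      have "(\<integral>x. ?r h x * g x \<partial>lborel) = (\<integral>x. (\<phi> (t + h) x * g x - \<phi> t x * g x) / complex_of_real h - d\<phi> t x * g x \<partial>lborel)"
        by (intro Bochner_Integration.integral_cong) (auto simp: left_diff_distrib)
      also have "\<dots> = (?h (t + h) - ?h t) / complex_of_real h - ?D"
        using i by simp
      finally have "?h (t + h) - ?h t - h *\<^sub>R ?D = complex_of_real h * (\<integral>x. ?r h x * g x \<partial>lborel)"
        using h by (simp add: scaleR_conv_of_real right_diff_distrib diff_divide_distrib)
      then have "norm (?h (t + h) - ?h t - h *\<^sub>R ?D) / norm h = norm (\<integral>x. ?r h x * g x \<partial>lborel)"
        using h by (simp add: norm_mult)
      then show "norm (norm (?h (t + h) - ?h t - h *\<^sub>R ?D) / norm h) \<le> L2norm (?r h) * L2norm g"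
        using L2_Cauchy_Schwarz[OF rs[of h] g] by simp
    qed
  qed
  then show ?thesis
    unfolding has_vector_derivative_def has_derivative_at by (auto intro!: bounded_linear_scaleR_left)
qed

text \<open>For a fixed spatial test function the pairing is a scalar function of time. Testing
  \<open>is_FT\<close> with tensor products identifies it as the inverse transform of
  \<open>mm\<close>. Differentiating this formula and comparing with the derivative in the L2 sense
  identifies the transform of \<open>d\<phi> t\<close>.\<close>

lemma time_slice:
  fixes \<phi> d\<phi> :: "real \<Rightarrow> real^4 \<Rightarrow> complex"
  assumes FT: "is_FT (\<lambda>(t, x). \<phi> t x) \<Phi>" and D: "L2_time_deriv \<phi> d\<phi>"
    and f0: "(\<integral>\<^sup>+\<xi>. (\<integral>\<^sup>+\<tau>. nm \<Phi> (\<tau>, \<xi>) \<partial>lborel)\<^sup>2 \<partial>lborel) < \<infinity>"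
    and f1: "(\<integral>\<^sup>+\<xi>. (\<integral>\<^sup>+\<tau>. nm (dtFT \<Phi>) (\<tau>, \<xi>) \<partial>lborel)\<^sup>2 \<partial>lborel) < \<infinity>"
  shows "is_FT (\<phi> t) (\<lambda>\<xi>. ifourier (\<lambda>\<tau>. \<Phi> (\<tau>, \<xi>)) t)" "is_FT (d\<phi> t) (\<lambda>\<xi>. ifourier (\<lambda>\<tau>. dtFT \<Phi> (\<tau>, \<xi>)) t)"
proof -
  have \<Phi>m[measurable]: "\<Phi> \<in> borel_measurable (lborel \<Otimes>\<^sub>M lborel)" using FT by (auto simp: is_FT_def sq_int_def lborel_prod)
  have \<phi>m[measurable]: "(\<lambda>(t, x). \<phi> t x) \<in> borel_measurable (lborel \<Otimes>\<^sub>M lborel)" using FT by (auto simp: is_FT_def lborel_prod)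
  have dm[measurable]: "dtFT \<Phi> \<in> borel_measurable (lborel \<Otimes>\<^sub>M lborel)" unfolding dtFT_def by measurable
  have sq: "sq_int (\<phi> t)" "sq_int (d\<phi> t)" for t using D by (auto simp: L2_time_deriv_def)
  have key: "(\<integral>x. \<phi> t x * fourier b x \<partial>lborel) = (\<integral>\<xi>. ifourier (\<lambda>\<tau>. \<Phi> (\<tau>, \<xi>)) t * b \<xi> \<partial>lborel) \<and>
     (\<integral>x. d\<phi> t x * fourier b x \<partial>lborel) = (\<integral>\<xi>. ifourier (\<lambda>\<tau>. dtFT \<Phi> (\<tau>, \<xi>)) t * b \<xi> \<partial>lborel)"
    if b: "integrable lborel b" "sq_int b" for b t
  proof -
    have [measurable]: "b \<in> borel_measurable borel" using b by auto
    have Fb: "sq_int (fourier b)" by (rule sq_int_fourier[OF b])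
    define h where "h t = (\<integral>x. \<phi> t x * fourier b x \<partial>lborel)" for t
    define mm where "mm \<tau> = (\<integral>\<xi>. \<Phi> (\<tau>, \<xi>) * b \<xi> \<partial>lborel)" for \<tau>
    define m1 where "m1 \<tau> = (\<integral>\<xi>. dtFT \<Phi> (\<tau>, \<xi>) * b \<xi> \<partial>lborel)" for \<tau>
    note pp = partial_ifourier_pairing[OF \<Phi>m f0 b(2)]
    note pp1 = partial_ifourier_pairing[OF dm f1 b(2)]
    have mi: "integrable lborel mm" "integrable lborel m1" using pp(2) pp1(2) by (simp_all add: mm_def[abs_def] m1_def[abs_def])
    have m1_eq: "m1 \<tau> = \<i> * complex_of_real \<tau> * mm \<tau>" for \<tau>
      unfolding m1_def mm_def dtFT_def by (simp only: prod.case mult.assoc integral_mult_right_zero)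
    have hd: "(h has_vector_derivative (\<integral>x. d\<phi> t x * fourier b x \<partial>lborel)) (at t)" for t
      unfolding h_def[abs_def] by (rule L2_deriv_pairing[OF D Fb])
    have hc: "continuous_on UNIV h"
      using has_vector_derivative_continuous[OF hd] by (simp add: continuous_on_eq_continuous_at)
    then have hm[measurable]: "h \<in> borel_measurable borel" by (rule borel_measurable_continuous_onI)
    \<comment> \<open>is_FT determines phi only almost everywhere; continuity in time then fixes every slice.\<close>
    have "AE t in lborel. h t = ifourier mm t"
    proof (rule fourier_inversion_AE[OF hm mi(1)])
      fix a :: "real \<Rightarrow> complex" assume a: "integrable lborel a" "sq_int a"
      have [measurable]: "a \<in> borel_measurable borel" using a by auto
      let ?\<psi> = "\<lambda>(\<tau>, \<xi>). a \<tau> * b \<xi>"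
      have F\<psi>: "fourier ?\<psi> (t, x) = fourier a t * fourier b x" for t x by (rule fourier_tensor(2)[OF a(1) b(1)])
      have "integrable lborel (\<lambda>z. (case z of (t, x) \<Rightarrow> \<phi> t x) * fourier ?\<psi> z)"
        "(\<integral>z. (case z of (t, x) \<Rightarrow> \<phi> t x) * fourier ?\<psi> z \<partial>lborel) = (\<integral>z. \<Phi> z * ?\<psi> z \<partial>lborel)"
        using FT fourier_tensor(1)[OF a(1) b(1)] sq_int_tensor[OF a(2) b(2)] unfolding is_FT_def by auto
      moreover have "(\<lambda>z. (case z of (t, x) \<Rightarrow> \<phi> t x) * fourier ?\<psi> z) = (\<lambda>(t, x). \<phi> t x * fourier b x * fourier a t)"
        by (auto simp: F\<psi>)
      moreover have "(\<lambda>z. \<Phi> z * ?\<psi> z) = (\<lambda>(\<tau>, \<xi>). \<Phi> (\<tau>, \<xi>) * b \<xi> * a \<tau>)" by auto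
      ultimately have L: "integrable (lborel \<Otimes>\<^sub>M lborel) (\<lambda>(t, x). \<phi> t x * fourier b x * fourier a t)"
        and LR: "(\<integral>z. (case z of (t, x) \<Rightarrow> \<phi> t x * fourier b x * fourier a t) \<partial>(lborel \<Otimes>\<^sub>M lborel)) = (\<integral>z. (case z of (\<tau>, \<xi>) \<Rightarrow> \<Phi> (\<tau>, \<xi>) * b \<xi> * a \<tau>) \<partial>(lborel \<Otimes>\<^sub>M lborel))"
        unfolding lborel_prod by (simp_all only:)
      have iR: "integrable (lborel \<Otimes>\<^sub>M lborel) (\<lambda>(\<tau>, \<xi>). \<Phi> (\<tau>, \<xi>) * b \<xi> * a \<tau>)"
      proof -
        have s1: "sq_int \<Phi>" using FT by (simp add: is_FT_def)
        have "integrable lborel (\<lambda>z. \<Phi> z * ?\<psi> z)"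
          by (rule integrable_sq_int_mult[OF s1 sq_int_tensor[OF a(2) b(2)]])
        moreover have "(\<lambda>z. \<Phi> z * ?\<psi> z) = (\<lambda>(\<tau>, \<xi>). \<Phi> (\<tau>, \<xi>) * b \<xi> * a \<tau>)" by auto
        ultimately show ?thesis unfolding lborel_prod by (simp only:)
      qed
      have "integrable lborel (\<lambda>t. \<integral>x. \<phi> t x * fourier b x * fourier a t \<partial>lborel)"
        using lborel_pair.integrable_fst'[OF L] by simp
      then have A: "integrable lborel (\<lambda>t. h t * fourier a t)" unfolding h_def by simp
      have "(\<integral>t. h t * fourier a t \<partial>lborel) = (\<integral>t. (\<integral>x. \<phi> t x * fourier b x * fourier a t \<partial>lborel) \<partial>lborel)"
        unfolding h_def by simp
      also have "\<dots> = (\<integral>z. (case z of (t, x) \<Rightarrow> \<phi> t x * fourier b x * fourier a t) \<partial>(lborel \<Otimes>\<^sub>M lborel))"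
        using lborel_pair.integral_fst'[OF L] by simp
      also have "\<dots> = (\<integral>\<tau>. (\<integral>\<xi>. \<Phi> (\<tau>, \<xi>) * b \<xi> * a \<tau> \<partial>lborel) \<partial>lborel)"
        unfolding LR using lborel_pair.integral_fst'[OF iR] by simp
      also have "\<dots> = (\<integral>\<tau>. mm \<tau> * a \<tau> \<partial>lborel)" unfolding mm_def by simp
      finally show "integrable lborel (\<lambda>t. h t * fourier a t) \<and> (\<integral>t. h t * fourier a t \<partial>lborel) = (\<integral>\<tau>. mm \<tau> * a \<tau> \<partial>lborel)"
        using A by simp
    qed
    then have AE0: "AE t in lborel. h t - ifourier mm t = 0" by simp
    have "continuous_on UNIV (ifourier mm)" unfolding ifourier_def
      by (intro continuous_on_compose2[OF continuous_fourier[OF mi(1)]] continuous_intros) auto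
    then have eq: "h t = ifourier mm t" for t
      using continuous_AE_zero[OF _ AE0, of t] hc by (simp add: continuous_on_diff)
    \<comment> \<open>\<open>ifourier mm t\<close> is the transform at \<open>- t\<close>, so a
      forward step in time is a step in direction -1. The integrability of \<tau> times
      \<open>mm\<close> is that of \<open>m1\<close>, which rests on the assumption about
      \<open>dtFT \<Phi>\<close>.\<close>
    have "((\<lambda>s. fourier mm (- t + s *\<^sub>R (-1))) has_vector_derivative fourier (\<lambda>\<tau>. - \<i> * complex_of_real (\<tau> \<bullet> (-1)) * mm \<tau>) (- t)) (at 0)"
    proof (rule fourier_has_vector_derivative[OF mi(1)])
      have "integrable lborel (\<lambda>\<tau>. \<i> * m1 \<tau>)" using mi by simp
      then show "integrable lborel (\<lambda>\<tau>. complex_of_real (\<tau> \<bullet> (-1)) * mm \<tau>)" by (simp add: m1_eq mult.assoc[symmetric])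
    qed
    then have "((\<lambda>s. h (t + s)) has_vector_derivative ifourier m1 t) (at 0)"
      by (simp add: eq ifourier_def m1_eq[abs_def])
    moreover have "((\<lambda>s. h (t + s)) has_vector_derivative (\<integral>x. d\<phi> t x * fourier b x \<partial>lborel)) (at 0)"
      using hd[of t] unfolding has_vector_derivative_def has_derivative_at by simp
    ultimately have "(\<integral>x. d\<phi> t x * fourier b x \<partial>lborel) = ifourier m1 t"
      by (rule vector_derivative_unique_at[symmetric])
    then show ?thesis using eq[of t] pp(3)[of t] pp1(3)[of t] by (simp add: h_def mm_def[abs_def] m1_def[abs_def])
  qed
  have int: "integrable lborel (\<lambda>x. v x * fourier b x)" if "sq_int v" "integrable lborel b" "sq_int b" for v b :: "real^4 \<Rightarrow> complex"
    by (intro integrable_sq_int_mult sq_int_fourier that)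
  show "is_FT (\<phi> t) (\<lambda>\<xi>. ifourier (\<lambda>\<tau>. \<Phi> (\<tau>, \<xi>)) t)"
    unfolding is_FT_def using sq_int_partial_ifourier[OF \<Phi>m f0] key int sq sq_int_measurable[OF sq(1)] by auto
  show "is_FT (d\<phi> t) (\<lambda>\<xi>. ifourier (\<lambda>\<tau>. dtFT \<Phi> (\<tau>, \<xi>)) t)"
    unfolding is_FT_def using sq_int_partial_ifourier[OF dm f1] key int sq sq_int_measurable[OF sq(2)] by auto
qed

section \<open>Traces at a fixed time\<close>

lemma symLm_kernel_le:
  fixes \<tau> :: real and \<xi> :: "real^4"
  assumes \<theta>: "\<theta> > 1/2"
  shows "1 / (symLm \<theta> \<tau> \<xi>)\<^sup>2 \<le> 2 powr \<theta> * ((1 + (\<tau> - norm \<xi>)\<^sup>2) powr (- \<theta>) + (1 + (\<tau> + norm \<xi>)\<^sup>2) powr (- \<theta>))"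
proof -
  let ?r = "norm \<xi>"
  \<comment> \<open>\<open>w\<close> is the quotient in the symbol. Its numerator factors as
    \<open>d\<close> times \<open>S\<close>, where \<open>d\<close> is the squared distance of
    |\<tau>| from |\<xi>|, that is, from the light cone.\<close>
  define \<sigma> where "\<sigma> = \<tau>\<^sup>2 + ?r\<^sup>2"
  define d where "d = (\<bar>\<tau>\<bar> - ?r)\<^sup>2"
  define S where "S = (\<bar>\<tau>\<bar> + ?r)\<^sup>2"
  define w where "w = (\<tau>\<^sup>2 - ?r\<^sup>2)\<^sup>2 / (1 + \<tau>\<^sup>2 + ?r\<^sup>2)"
  have tr: "0 \<le> \<bar>\<tau>\<bar> * ?r" by simp
  have \<sigma>0: "0 \<le> \<sigma>" by (simp add: \<sigma>_def)
  have d0: "0 \<le> d" by (simp add: d_def)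
  have dS: "d \<le> \<sigma>" "\<sigma> \<le> S"
    using tr unfolding d_def S_def \<sigma>_def by (auto simp: power2_diff power2_sum)
  have w_eq: "w = d * S / (1 + \<sigma>)"
  proof -
    have "\<tau>\<^sup>2 - ?r\<^sup>2 = (\<bar>\<tau>\<bar> - ?r) * (\<bar>\<tau>\<bar> + ?r)" by (simp add: algebra_simps power2_eq_square)
    then show ?thesis unfolding w_def d_def S_def \<sigma>_def by (simp add: power_mult_distrib add.assoc)
  qed
  have w0: "0 \<le> w" unfolding w_eq using d0 \<sigma>0 dS by simp
  \<comment> \<open>Comparison of the symbol with the distance to the cone: for \<sigma> \<ge> 1 one
    has 1 + \<sigma> \<le> 2 S, hence d \<le> 2 w; for \<sigma> < 1 already d \<le> 1.\<close>
  have "d \<le> 1 + 2 * w"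
  proof (cases "\<sigma> \<ge> 1")
    case True
    have "d * (1 + \<sigma>) \<le> d * (2 * S)" using True dS d0 by (intro mult_left_mono) auto
    then have "d \<le> 2 * (d * S / (1 + \<sigma>))" using \<sigma>0 by (simp add: field_simps)
    then show ?thesis unfolding w_eq by simp
  next
    case False then show ?thesis using dS w0 by simp
  qed
  then have le: "(1 + d) / 2 \<le> 1 + w" by simp
  have "1 / (symLm \<theta> \<tau> \<xi>)\<^sup>2 = (1 + w) powr (- \<theta>)"
    using w0 unfolding symLm_def w_def[symmetric] by (simp add: power2_eq_square powr_add[symmetric] powr_minus_divide)
  also have "\<dots> \<le> ((1 + d) / 2) powr (- \<theta>)" using le d0 \<theta> by (intro powr_mono2') auto
  also have "\<dots> = 2 powr \<theta> * (1 + d) powr (- \<theta>)" using d0 by (simp add: powr_divide powr_minus_divide)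
  also have "\<dots> \<le> 2 powr \<theta> * ((1 + (\<tau> - ?r)\<^sup>2) powr (- \<theta>) + (1 + (\<tau> + ?r)\<^sup>2) powr (- \<theta>))"
  proof (intro mult_left_mono)
    \<comment> \<open>Which alternative holds depends on the sign of \<tau>. Summing both gives
      translates of one function of \<tau>, whose integrals do not depend on \<xi>.\<close>
    have "d = (\<tau> - ?r)\<^sup>2 \<or> d = (\<tau> + ?r)\<^sup>2"
      unfolding d_def by (cases "\<tau> \<ge> 0") (auto simp: power2_eq_square algebra_simps)
    then show "(1 + d) powr (- \<theta>) \<le> (1 + (\<tau> - ?r)\<^sup>2) powr (- \<theta>) + (1 + (\<tau> + ?r)\<^sup>2) powr (- \<theta>)" by auto
  qed simp
  finally show ?thesis .
qed

lemma symLm_pos [simp]: "symLm a \<tau> \<xi> > 0"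
proof -
  have "1 + (\<tau>\<^sup>2 - (norm \<xi>)\<^sup>2)\<^sup>2 / (1 + \<tau>\<^sup>2 + (norm \<xi>)\<^sup>2) > 0"
    by (intro add_pos_nonneg divide_nonneg_nonneg) auto
  then show ?thesis by (simp add: symLm_def)
qed

lemma measurable_symLm [measurable]: "(\<lambda>(\<tau>, \<xi>). symLm a \<tau> \<xi>) \<in> borel_measurable (borel \<Otimes>\<^sub>M borel)"
  unfolding symLm_def by measurable

text \<open>Translation invariance in \<tau> makes the bound uniform in \<xi>, and \<theta> > 1/2 is
  the threshold of integrability.\<close>

lemma symLm_kernel:
  assumes \<theta>: "\<theta> > 1/2"
  obtains K where "K < \<infinity>" "\<And>\<xi>. (\<integral>\<^sup>+\<tau>. ennreal (1 / (symLm \<theta> \<tau> \<xi>)\<^sup>2) \<partial>lborel) \<le> K"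
proof -
  define I where "I = (\<integral>\<^sup>+x. ennreal ((1 + x\<^sup>2) powr (- \<theta>)) \<partial>lborel)"
  define K where "K = ennreal (2 powr \<theta>) * (I + I)"
  have "I < \<infinity>" unfolding I_def by (rule nn_integral_bracket_real[OF \<theta>])
  then have "K < \<infinity>" unfolding K_def by (simp add: ennreal_mult_less_top)
  moreover have "(\<integral>\<^sup>+\<tau>. ennreal (1 / (symLm \<theta> \<tau> \<xi>)\<^sup>2) \<partial>lborel) \<le> K" for \<xi>
  proof -
    let ?f = "\<lambda>x. ennreal ((1 + x\<^sup>2) powr (- \<theta>))"
    have "(\<integral>\<^sup>+\<tau>. ennreal (1 / (symLm \<theta> \<tau> \<xi>)\<^sup>2) \<partial>lborel) \<le> (\<integral>\<^sup>+\<tau>. ennreal (2 powr \<theta>) * (?f (\<tau> - norm \<xi>) + ?f (\<tau> + norm \<xi>)) \<partial>lborel)"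
    proof (rule nn_integral_mono)
      fix \<tau>
      have "ennreal (1 / (symLm \<theta> \<tau> \<xi>)\<^sup>2) \<le> ennreal (2 powr \<theta> * ((1 + (\<tau> - norm \<xi>)\<^sup>2) powr (- \<theta>) + (1 + (\<tau> + norm \<xi>)\<^sup>2) powr (- \<theta>)))"
        by (intro ennreal_leI symLm_kernel_le \<theta>)
      also have "\<dots> = ennreal (2 powr \<theta>) * (?f (\<tau> - norm \<xi>) + ?f (\<tau> + norm \<xi>))"
        by (subst ennreal_mult) auto
      finally show "ennreal (1 / (symLm \<theta> \<tau> \<xi>)\<^sup>2) \<le> ennreal (2 powr \<theta>) * (?f (\<tau> - norm \<xi>) + ?f (\<tau> + norm \<xi>))" .
    qed
    also have "\<dots> = ennreal (2 powr \<theta>) * ((\<integral>\<^sup>+\<tau>. ?f (\<tau> - norm \<xi>) \<partial>lborel) + (\<integral>\<^sup>+\<tau>. ?f (\<tau> + norm \<xi>) \<partial>lborel))"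
      by (subst nn_integral_cmult) (auto simp: nn_integral_add)
    also have "(\<integral>\<^sup>+\<tau>. ?f (\<tau> - norm \<xi>) \<partial>lborel) = I" unfolding I_def by (rule nn_integral_lborel_shift(3)[of ?f]) measurable
    also have "(\<integral>\<^sup>+\<tau>. ?f (\<tau> + norm \<xi>) \<partial>lborel) = I" unfolding I_def by (rule nn_integral_lborel_shift(2)[of ?f]) measurable
    finally show ?thesis unfolding K_def .
  qed
  ultimately show ?thesis by (rule that)
qed

lemma measurable_Hw:
  assumes [measurable]: "U \<in> borel_measurable (lborel \<Otimes>\<^sub>M lborel)"
  shows "Hw a \<theta> U \<in> borel_measurable (lborel \<Otimes>\<^sub>M lborel)"
  unfolding Hw_def by measurable

text \<open>The estimate behind the embedding of H^{s,\<theta>} into continuous functions of time: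
  Cauchy-Schwarz in \<tau> against \<open>1 / symLm\<close>. It is stated for the integral of |U|
  over \<tau>, which dominates the spatial transform at all times simultaneously.\<close>

lemma slice_bound:
  assumes \<theta>: "\<theta> > 1/2"
  obtains K where "K < \<infinity>" "\<And>a U. U \<in> borel_measurable (lborel \<Otimes>\<^sub>M lborel) \<Longrightarrow>
     (\<integral>\<^sup>+\<xi>. (ennreal (symL a \<xi>) * (\<integral>\<^sup>+\<tau>. nm U (\<tau>, \<xi>) \<partial>lborel))\<^sup>2 \<partial>lborel) \<le> K * nn2 (nm (Hw a \<theta> U))"
proof -
  obtain K where K: "K < \<infinity>" "\<And>\<xi>. (\<integral>\<^sup>+\<tau>. ennreal (1 / (symLm \<theta> \<tau> \<xi>)\<^sup>2) \<partial>lborel) \<le> K" using symLm_kernel[OF \<theta>] by blast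
  have "(\<integral>\<^sup>+\<xi>. (ennreal (symL a \<xi>) * (\<integral>\<^sup>+\<tau>. nm U (\<tau>, \<xi>) \<partial>lborel))\<^sup>2 \<partial>lborel) \<le> K * nn2 (nm (Hw a \<theta> U))"
    if Um[measurable]: "U \<in> borel_measurable (lborel \<Otimes>\<^sub>M lborel)" for a and U :: "real \<times> (real^4) \<Rightarrow> complex"
  proof -
    have Hm[measurable]: "Hw a \<theta> U \<in> borel_measurable (lborel \<Otimes>\<^sub>M lborel)" by (rule measurable_Hw[OF Um])
    have pt: "(ennreal (symL a \<xi>) * (\<integral>\<^sup>+\<tau>. nm U (\<tau>, \<xi>) \<partial>lborel))\<^sup>2 \<le> K * (\<integral>\<^sup>+\<tau>. (nm (Hw a \<theta> U) (\<tau>, \<xi>))\<^sup>2 \<partial>lborel)" for \<xi>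
    proof -
      have e: "ennreal (symL a \<xi>) * nm U (\<tau>, \<xi>) = ennreal (1 / symLm \<theta> \<tau> \<xi>) * nm (Hw a \<theta> U) (\<tau>, \<xi>)" for \<tau>
      proof -
        have "symL a \<xi> * norm (U (\<tau>, \<xi>)) = 1 / symLm \<theta> \<tau> \<xi> * norm (Hw a \<theta> U (\<tau>, \<xi>))"
          unfolding Hw_def by (simp add: norm_mult abs_of_pos field_simps less_imp_neq[OF symLm_pos, symmetric])
        then have "ennreal (symL a \<xi> * norm (U (\<tau>, \<xi>))) = ennreal (1 / symLm \<theta> \<tau> \<xi> * norm (Hw a \<theta> U (\<tau>, \<xi>)))" by simp
        moreover have n: "0 \<le> 1 / symLm \<theta> \<tau> \<xi>" by (simp add: less_imp_le)
        ultimately show ?thesis by (simp only: ennreal_mult[OF symL_nonneg norm_ge_zero] ennreal_mult[OF n norm_ge_zero])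
      qed
      have "ennreal (symL a \<xi>) * (\<integral>\<^sup>+\<tau>. nm U (\<tau>, \<xi>) \<partial>lborel) = (\<integral>\<^sup>+\<tau>. ennreal (symL a \<xi>) * nm U (\<tau>, \<xi>) \<partial>lborel)"
        by (rule nn_integral_cmult[symmetric]) measurable
      then have "(ennreal (symL a \<xi>) * (\<integral>\<^sup>+\<tau>. nm U (\<tau>, \<xi>) \<partial>lborel))\<^sup>2 = (\<integral>\<^sup>+\<tau>. ennreal (1 / symLm \<theta> \<tau> \<xi>) * nm (Hw a \<theta> U) (\<tau>, \<xi>) \<partial>lborel)\<^sup>2"
        by (simp only: e)
      also have "\<dots> \<le> (\<integral>\<^sup>+\<tau>. (ennreal (1 / symLm \<theta> \<tau> \<xi>))\<^sup>2 \<partial>lborel) * (\<integral>\<^sup>+\<tau>. (nm (Hw a \<theta> U) (\<tau>, \<xi>))\<^sup>2 \<partial>lborel)"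
        by (rule Cauchy_Schwarz_nn_integral) measurable
      also have "\<dots> \<le> K * (\<integral>\<^sup>+\<tau>. (nm (Hw a \<theta> U) (\<tau>, \<xi>))\<^sup>2 \<partial>lborel)"
      proof (rule mult_right_mono)
        have "(ennreal (1 / symLm \<theta> \<tau> \<xi>))\<^sup>2 = ennreal (1 / (symLm \<theta> \<tau> \<xi>)\<^sup>2)" for \<tau>
          using symLm_pos[of \<theta> \<tau> \<xi>] by (simp add: ennreal_power less_imp_le power_divide)
        then show "(\<integral>\<^sup>+\<tau>. (ennreal (1 / symLm \<theta> \<tau> \<xi>))\<^sup>2 \<partial>lborel) \<le> K" using K(2) by simp
      qed simp
      finally show ?thesis .
    qed
    have "(\<integral>\<^sup>+\<xi>. (ennreal (symL a \<xi>) * (\<integral>\<^sup>+\<tau>. nm U (\<tau>, \<xi>) \<partial>lborel))\<^sup>2 \<partial>lborel) \<le> (\<integral>\<^sup>+\<xi>. K * (\<integral>\<^sup>+\<tau>. (nm (Hw a \<theta> U) (\<tau>, \<xi>))\<^sup>2 \<partial>lborel) \<partial>lborel)"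
      by (rule nn_integral_mono) (rule pt)
    also have "\<dots> = K * (\<integral>\<^sup>+\<xi>. (\<integral>\<^sup>+\<tau>. (nm (Hw a \<theta> U) (\<tau>, \<xi>))\<^sup>2 \<partial>lborel) \<partial>lborel)"
      by (rule nn_integral_cmult) measurable
    also have "(\<integral>\<^sup>+\<xi>. (\<integral>\<^sup>+\<tau>. (nm (Hw a \<theta> U) (\<tau>, \<xi>))\<^sup>2 \<partial>lborel) \<partial>lborel) = (\<integral>\<^sup>+\<tau>. (\<integral>\<^sup>+\<xi>. (nm (Hw a \<theta> U) (\<tau>, \<xi>))\<^sup>2 \<partial>lborel) \<partial>lborel)"
      by (rule lborel_pair.Fubini'[symmetric]) measurable
    also have "\<dots> = (\<integral>\<^sup>+z. (nm (Hw a \<theta> U) z)\<^sup>2 \<partial>(lborel \<Otimes>\<^sub>M lborel))"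
      by (rule lborel.nn_integral_fst) measurable
    also have "\<dots> = nn2 (nm (Hw a \<theta> U))" by (simp add: nn2_def lborel_prod)
    finally show ?thesis .
  qed
  with K(1) show ?thesis by (rule that)
qed

text \<open>The spatial weights multiply, so \<open>LamFT\<close> merely shifts the regularity
  index; norms of different order become weighted norms of the same \<Phi>.\<close>

lemma Hw_LamFT: "Hw a \<theta> (LamFT j U) = Hw (a + j) \<theta> U"
  by (rule ext) (auto simp: Hw_def LamFT_def symL_add)

lemma Hw_dtFT_LamFT: "Hw a \<theta> (dtFT (LamFT j U)) = Hw (a + j) \<theta> (dtFT U)"
  by (rule ext) (auto simp: Hw_def LamFT_def dtFT_def symL_add)

lemma nn2_Hw_mono:
  assumes "a \<le> b" shows "nn2 (nm (Hw a \<theta> U)) \<le> nn2 (nm (Hw b \<theta> U))"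
  unfolding nn2_def
proof (intro nn_integral_mono power_mono ennreal_leI)
  fix z :: "real \<times> (real^4)"
  obtain \<tau> \<xi> where z: "z = (\<tau>, \<xi>)" by (cases z)
  show "norm (Hw a \<theta> U z) \<le> norm (Hw b \<theta> U z)"
    using symL_mono[OF assms, of \<xi>] symLm_pos[of \<theta> \<tau> \<xi>]
    by (auto simp: z Hw_def norm_mult abs_of_pos intro!: mult_right_mono)
qed simp

section \<open>Counting derivatives and induction on the order\<close>

text \<open>N j stands for the norm of Lambda^j phi; only indices up to k are controlled.\<close>
definition admissible :: "real \<Rightarrow> real \<Rightarrow> nat \<Rightarrow> (real^4 \<Rightarrow> complex) \<Rightarrow> (real^4 \<Rightarrow> complex) \<Rightarrow> (real^4 \<Rightarrow> complex) \<Rightarrow> (nat \<Rightarrow> real) \<Rightarrow> bool" where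
  "admissible s \<kappa> k P Q G N \<longleftrightarrow> integrable lborel P \<and> sq_int Q \<and> G \<in> borel_measurable borel \<and> hn (nm G) < \<infinity> \<and>
     elliptic_rel P Q G \<and> (\<forall>j. 0 \<le> N j) \<and> (\<forall>i j. i \<le> j \<longrightarrow> j \<le> k \<longrightarrow> N i \<le> N j) \<and>
     (\<forall>j\<le>k. wn (s + real j) (nm P) \<le> ennreal (\<kappa> * (N j)\<^sup>2) \<and> wn (s - 1 + real j) (nm Q) \<le> ennreal (\<kappa> * (N j)\<^sup>2))"

lemma hn_pw: "hn f = nn2 (pw 1 f)" by (simp add: hn_def pw_def)

text \<open>Since s > 1, the weight of index s - 1 is at least 1, so the L2 norm of \<open>Q\<close>
  is covered. Both factors of the energy bound are at most \<kappa> times the square of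
  \<open>N 0\<close>, whence the fourth power.\<close>

lemma admissible_energy:
  assumes s: "s > 1" and \<kappa>: "\<kappa> \<ge> 0"
  obtains C where "C \<ge> 0" "\<And>k P Q G N. admissible s \<kappa> k P Q G N \<Longrightarrow> nn2 (pw 1 (nm G)) \<le> ennreal (C * N 0 ^ 4)"
proof -
  obtain K where K: "K < \<infinity>" "\<And>P Q G. integrable lborel P \<Longrightarrow> sq_int Q \<Longrightarrow> G \<in> borel_measurable borel \<Longrightarrow>
     wn s (nm P) < \<infinity> \<Longrightarrow> hn (nm G) < \<infinity> \<Longrightarrow> elliptic_rel P Q G \<Longrightarrow>
     hn (nm G) \<le> K * (nn2 (nm Q) * wn s (nm P))"
    using energy_estimate[OF s] by blast
  obtain K' where K': "K = ennreal K'" "K' \<ge> 0" using K(1) by (cases K) auto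
  have "nn2 (pw 1 (nm G)) \<le> ennreal (K' * (\<kappa> * \<kappa>) * N 0 ^ 4)" if a: "admissible s \<kappa> k P Q G N" for k P Q G N
  proof -
    have b: "wn s (nm P) \<le> ennreal (\<kappa> * (N 0)\<^sup>2)" "wn (s - 1) (nm Q) \<le> ennreal (\<kappa> * (N 0)\<^sup>2)"
      using a unfolding admissible_def by (force dest: spec[of _ 0])+
    have q: "nn2 (nm Q) \<le> wn (s - 1) (nm Q)" unfolding wn_def nn2_def
    proof (intro nn_integral_mono power_mono)
      fix \<xi>
      have "1 \<le> symL (s - 1) \<xi>" using symL_mono[of 0 "s - 1" \<xi>] s by simp
      then show "nm Q \<xi> \<le> ennreal (symL (s - 1) \<xi>) * nm Q \<xi>"
        using mult_right_mono[of 1 "ennreal (symL (s - 1) \<xi>)" "nm Q \<xi>"] by simp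
    qed simp
    have "hn (nm G) \<le> K * (nn2 (nm Q) * wn s (nm P))"
      using a le_less_trans[OF b(1)] by (intro K(2)) (auto simp: admissible_def)
    also have "\<dots> \<le> ennreal K' * (ennreal (\<kappa> * (N 0)\<^sup>2) * ennreal (\<kappa> * (N 0)\<^sup>2))"
      unfolding K' by (intro mult_left_mono mult_mono b order_trans[OF q]) auto
    also have "\<dots> = ennreal (K' * (\<kappa> * \<kappa>) * N 0 ^ 4)"
      using K' \<kappa> by (simp add: ennreal_mult'[symmetric] power2_eq_square power4_eq_xxxx mult_ac)
    finally show ?thesis by (simp add: hn_pw)
  qed
  moreover have "K' * (\<kappa> * \<kappa>) \<ge> 0" using K' \<kappa> by simp
  ultimately show ?thesis using that by blast
qed

text \<open>\<open>P\<close> at regularity s + j costs \<open>N j\<close>, whereas \<open>Q\<close>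
  at regularity s + j costs the norm of index j + 1, because \<open>Q\<close> starts one derivative
  lower. Apart from \<open>N 1\<close>, which coincides with it for m = 0, the norm
  \<open>N (Suc m)\<close> thus enters only through the term in which all weight falls on
  \<open>Q\<close>, with coefficient the square of \<open>N 0\<close>.\<close>

lemma admissible_step:
  assumes s: "s > 1" and \<kappa>: "\<kappa> \<ge> 0"
  obtains C where "C \<ge> 0" "\<And>k P Q G N. admissible s \<kappa> k P Q G N \<Longrightarrow> Suc m \<le> k \<Longrightarrow>
     nn2 (pw (m + 2) (nm G)) \<le> ennreal (C * ((N m)\<^sup>2 * (N 1)\<^sup>2 + (N 0)\<^sup>2 * (N (Suc m))\<^sup>2 + (N 1)\<^sup>2 * (N m)\<^sup>2 * N 0 ^ 4))
        + (if m = 0 then 0 else ennreal (C * N 1 ^ 4) * nn2 (pw m (nm G)))"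
proof -
  obtain K where K: "K < \<infinity>" "\<And>P Q G. P \<in> borel_measurable borel \<Longrightarrow> Q \<in> borel_measurable borel \<Longrightarrow> G \<in> borel_measurable borel \<Longrightarrow>
     elliptic_rel P Q G \<Longrightarrow>
     nn2 (pw (m + 2) (nm G)) \<le> K * (wn (s + real m) (nm P) * wn s (nm Q) + wn s (nm P) * wn (s + real m) (nm Q)
        + wn (s + 1) (nm P) * (wn (s + real m) (nm P) * hn (nm G))
        + wn (s + 1) (nm P) * (if m = 0 then 0 else wn (s + 1) (nm P) * nn2 (pw m (nm G))))"
    using higher_estimate[OF s, of m] by blast
  obtain K' where K': "K = ennreal K'" "K' \<ge> 0" using K(1) by (cases K) auto
  obtain C0 where C0: "C0 \<ge> 0" "\<And>k P Q G N. admissible s \<kappa> k P Q G N \<Longrightarrow> nn2 (pw 1 (nm G)) \<le> ennreal (C0 * N 0 ^ 4)"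
    using admissible_energy[OF s \<kappa>] by blast
  \<comment> \<open>The factor 1 + C0 absorbs the energy constant, which replaces \<open>hn\<close>
    of \<open>G\<close> in the cubic term, so that one \<open>C\<close> serves for all
    terms.\<close>
  define C where "C = K' * (\<kappa> * \<kappa>) * (1 + C0)"
  have C: "C \<ge> 0" using K' \<kappa> C0 by (simp add: C_def)
  have Kk: "K' * (\<kappa> * \<kappa>) \<ge> 0" using K' \<kappa> by simp
  have main: "nn2 (pw (m + 2) (nm G)) \<le> ennreal (C * ((N m)\<^sup>2 * (N 1)\<^sup>2 + (N 0)\<^sup>2 * (N (Suc m))\<^sup>2 + (N 1)\<^sup>2 * (N m)\<^sup>2 * N 0 ^ 4))
        + (if m = 0 then 0 else ennreal (C * N 1 ^ 4) * nn2 (pw m (nm G)))"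
    if a: "admissible s \<kappa> k P Q G N" and mk: "Suc m \<le> k" for k P Q G N
  proof -
    have ab: "wn (s + real j) (nm P) \<le> ennreal (\<kappa> * (N j)\<^sup>2)" "wn (s - 1 + real j) (nm Q) \<le> ennreal (\<kappa> * (N j)\<^sup>2)" if "j \<le> k" for j
      using a that unfolding admissible_def by blast+
    have b0: "wn s (nm P) \<le> ennreal (\<kappa> * (N 0)\<^sup>2)" using ab(1)[of 0] by simp
    have b1: "wn (s + 1) (nm P) \<le> ennreal (\<kappa> * (N 1)\<^sup>2)" using ab(1)[of 1] mk by simp
    have bm: "wn (s + real m) (nm P) \<le> ennreal (\<kappa> * (N m)\<^sup>2)" using ab(1)[of m] mk by simp
    have q1: "wn s (nm Q) \<le> ennreal (\<kappa> * (N 1)\<^sup>2)" using ab(2)[of 1] mk by simp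
    have qm: "wn (s + real m) (nm Q) \<le> ennreal (\<kappa> * (N (Suc m))\<^sup>2)" using ab(2)[of "Suc m"] mk by (simp add: algebra_simps)
    have e: "hn (nm G) \<le> ennreal (C0 * N 0 ^ 4)" using C0(2)[OF a] by (simp add: hn_pw)
    have N0: "N j \<ge> 0" for j using a by (simp add: admissible_def)
    let ?X = "(N m)\<^sup>2 * (N 1)\<^sup>2 + (N 0)\<^sup>2 * (N (Suc m))\<^sup>2 + (N 1)\<^sup>2 * (N m)\<^sup>2 * N 0 ^ 4"
    let ?T = "if m = 0 then 0 else nn2 (pw m (nm G))"
    have "nn2 (pw (m + 2) (nm G)) \<le> K * (wn (s + real m) (nm P) * wn s (nm Q) + wn s (nm P) * wn (s + real m) (nm Q)
        + wn (s + 1) (nm P) * (wn (s + real m) (nm P) * hn (nm G))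
        + wn (s + 1) (nm P) * (if m = 0 then 0 else wn (s + 1) (nm P) * nn2 (pw m (nm G))))"
      using a by (intro K(2)) (auto simp: admissible_def sq_int_def)
    also have "\<dots> \<le> ennreal K' * (ennreal (\<kappa> * (N m)\<^sup>2) * ennreal (\<kappa> * (N 1)\<^sup>2) + ennreal (\<kappa> * (N 0)\<^sup>2) * ennreal (\<kappa> * (N (Suc m))\<^sup>2)
        + ennreal (\<kappa> * (N 1)\<^sup>2) * (ennreal (\<kappa> * (N m)\<^sup>2) * ennreal (C0 * N 0 ^ 4))
        + ennreal (\<kappa> * (N 1)\<^sup>2) * (ennreal (\<kappa> * (N 1)\<^sup>2) * ?T))"
      unfolding K' by (intro mult_left_mono add_mono mult_mono bm q1 b0 qm b1 e) (use b1 in \<open>auto intro!: mult_mono\<close>)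
    also have "\<dots> = ennreal (K' * (\<kappa> * \<kappa>) * ((N m)\<^sup>2 * (N 1)\<^sup>2 + (N 0)\<^sup>2 * (N (Suc m))\<^sup>2 + (N 1)\<^sup>2 * (N m)\<^sup>2 * (C0 * N 0 ^ 4)))
        + ennreal (K' * (\<kappa> * \<kappa>) * N 1 ^ 4) * ?T"
    proof -
      have "ennreal K' * (ennreal (\<kappa> * (N m)\<^sup>2) * ennreal (\<kappa> * (N 1)\<^sup>2) + ennreal (\<kappa> * (N 0)\<^sup>2) * ennreal (\<kappa> * (N (Suc m))\<^sup>2)
        + ennreal (\<kappa> * (N 1)\<^sup>2) * (ennreal (\<kappa> * (N m)\<^sup>2) * ennreal (C0 * N 0 ^ 4)))
        = ennreal (K' * (\<kappa> * (N m)\<^sup>2 * (\<kappa> * (N 1)\<^sup>2) + \<kappa> * (N 0)\<^sup>2 * (\<kappa> * (N (Suc m))\<^sup>2) + \<kappa> * (N 1)\<^sup>2 * (\<kappa> * (N m)\<^sup>2 * (C0 * N 0 ^ 4))))"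
        using K' \<kappa> C0(1) N0 by (simp add: ennreal_mult ennreal_plus)
      moreover have "K' * (\<kappa> * (N m)\<^sup>2 * (\<kappa> * (N 1)\<^sup>2) + \<kappa> * (N 0)\<^sup>2 * (\<kappa> * (N (Suc m))\<^sup>2) + \<kappa> * (N 1)\<^sup>2 * (\<kappa> * (N m)\<^sup>2 * (C0 * N 0 ^ 4)))
        = K' * (\<kappa> * \<kappa>) * ((N m)\<^sup>2 * (N 1)\<^sup>2 + (N 0)\<^sup>2 * (N (Suc m))\<^sup>2 + (N 1)\<^sup>2 * (N m)\<^sup>2 * (C0 * N 0 ^ 4))"
        by (simp add: algebra_simps)
      moreover have "ennreal K' * (ennreal (\<kappa> * (N 1)\<^sup>2) * (ennreal (\<kappa> * (N 1)\<^sup>2) * ?T)) = ennreal (K' * (\<kappa> * \<kappa>) * N 1 ^ 4) * ?T"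
      proof -
        have "ennreal K' * (ennreal (\<kappa> * (N 1)\<^sup>2) * ennreal (\<kappa> * (N 1)\<^sup>2)) = ennreal (K' * (\<kappa> * \<kappa>) * N 1 ^ 4)"
          using K' \<kappa> by (simp add: ennreal_mult'[symmetric] power2_eq_square power4_eq_xxxx mult_ac)
        then show ?thesis by (simp only: mult.assoc[symmetric])
      qed
      ultimately show ?thesis by (simp only: distrib_left[of "ennreal K'" "_ + _ + _"])
    qed
    also have "\<dots> \<le> ennreal (C * ?X) + ennreal (C * N 1 ^ 4) * ?T"
    proof (intro add_mono mult_right_mono ennreal_leI)
      have p: "0 \<le> (N m)\<^sup>2 * (N 1)\<^sup>2" "0 \<le> (N 0)\<^sup>2 * (N (Suc m))\<^sup>2" "0 \<le> (N 1)\<^sup>2 * (N m)\<^sup>2 * N 0 ^ 4" by auto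
      have "(N m)\<^sup>2 * (N 1)\<^sup>2 + (N 0)\<^sup>2 * (N (Suc m))\<^sup>2 + (N 1)\<^sup>2 * (N m)\<^sup>2 * (C0 * N 0 ^ 4) \<le> (1 + C0) * ?X"
      proof -
        have "(1 + C0) * ?X = ((N m)\<^sup>2 * (N 1)\<^sup>2 + (N 0)\<^sup>2 * (N (Suc m))\<^sup>2 + (N 1)\<^sup>2 * (N m)\<^sup>2 * (C0 * N 0 ^ 4))
          + C0 * ((N m)\<^sup>2 * (N 1)\<^sup>2) + C0 * ((N 0)\<^sup>2 * (N (Suc m))\<^sup>2) + (N 1)\<^sup>2 * (N m)\<^sup>2 * N 0 ^ 4"
          by (simp add: algebra_simps)
        moreover have "0 \<le> C0 * ((N m)\<^sup>2 * (N 1)\<^sup>2)" "0 \<le> C0 * ((N 0)\<^sup>2 * (N (Suc m))\<^sup>2)" using C0(1) p by (intro mult_nonneg_nonneg; simp)+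
        ultimately show ?thesis using p by linarith
      qed
      from mult_left_mono[OF this Kk]
      show "K' * (\<kappa> * \<kappa>) * ((N m)\<^sup>2 * (N 1)\<^sup>2 + (N 0)\<^sup>2 * (N (Suc m))\<^sup>2 + (N 1)\<^sup>2 * (N m)\<^sup>2 * (C0 * N 0 ^ 4)) \<le> C * ?X"
        by (simp only: C_def mult.assoc)
      have "K' * (\<kappa> * \<kappa>) * 1 \<le> C" unfolding C_def using C0(1) by (intro mult_left_mono Kk) simp
      then show "K' * (\<kappa> * \<kappa>) \<le> C" by simp
    qed auto
    finally show ?thesis by (simp split: if_splits)
  qed
  show ?thesis using C main by (rule that)
qed

text \<open>The equation gains two powers of |\<xi>|, so order \<open>m + 2\<close> is reduced to
  order \<open>m\<close> and the induction moves in steps of two. A crude polynomial in the norm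
  suffices, because the bound is applied to orders whose norms are collected in \<eta>.\<close>

lemma admissible_poly_bound:
  assumes s: "s > 1" and \<kappa>: "\<kappa> \<ge> 0"
  shows "\<exists>C d. C \<ge> 0 \<and> (\<forall>k P Q G N. admissible s \<kappa> k P Q G N \<longrightarrow> j \<le> k \<longrightarrow> nn2 (pw (Suc j) (nm G)) \<le> ennreal (C * (1 + N j) ^ d))"
proof (induction j rule: less_induct)
  case (less j)
  show ?case
  proof (cases j)
    case 0
    obtain C0 where C0: "C0 \<ge> 0" "\<And>k P Q G N. admissible s \<kappa> k P Q G N \<Longrightarrow> nn2 (pw 1 (nm G)) \<le> ennreal (C0 * N 0 ^ 4)"
      using admissible_energy[OF s \<kappa>] by blast
    have "nn2 (pw (Suc j) (nm G)) \<le> ennreal (C0 * (1 + N j) ^ 4)" if a: "admissible s \<kappa> k P Q G N" for k P Q G N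
    proof -
      have "N 0 \<ge> 0" using a by (simp add: admissible_def)
      then have "C0 * N 0 ^ 4 \<le> C0 * (1 + N 0) ^ 4" using C0(1) by (intro mult_left_mono power_mono) auto
      then show ?thesis using C0(2)[OF a] 0 by (auto intro: order_trans ennreal_leI)
    qed
    then show ?thesis using C0(1) by blast
  next
    case (Suc m)
    obtain C where C: "C \<ge> 0" "\<And>k P Q G N. admissible s \<kappa> k P Q G N \<Longrightarrow> Suc m \<le> k \<Longrightarrow>
     nn2 (pw (m + 2) (nm G)) \<le> ennreal (C * ((N m)\<^sup>2 * (N 1)\<^sup>2 + (N 0)\<^sup>2 * (N (Suc m))\<^sup>2 + (N 1)\<^sup>2 * (N m)\<^sup>2 * N 0 ^ 4))
        + (if m = 0 then 0 else ennreal (C * N 1 ^ 4) * nn2 (pw m (nm G)))"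
      using admissible_step[OF s \<kappa>, of m] by blast
    \<comment> \<open>For m = 0 the term of order \<open>m\<close> is absent and m - 1 is truncated
      to 0; arbitrary constants serve, here 0.\<close>
    obtain C' d' where C': "C' \<ge> 0" "m > 0 \<Longrightarrow> \<forall>k P Q G N. admissible s \<kappa> k P Q G N \<longrightarrow> m - 1 \<le> k \<longrightarrow> nn2 (pw m (nm G)) \<le> ennreal (C' * (1 + N (m - 1)) ^ d')"
    proof (cases "m > 0")
      case True
      then have "m - 1 < j" "Suc (m - 1) = m" using Suc by auto
      with less.IH[of "m - 1"] show ?thesis using that by auto
    qed (use that[of 0 0] in auto)
    \<comment> \<open>8 = 2 + 2 + 4 is the degree of the cubic contribution, the largest of the
      three collected in \<open>3 * C\<close>; the remaining term has degree 4 + d'.\<close>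
    let ?C = "3 * C + C * C'" and ?d = "8 + d'"
    have "nn2 (pw (Suc j) (nm G)) \<le> ennreal (?C * (1 + N j) ^ ?d)" if a: "admissible s \<kappa> k P Q G N" and jk: "j \<le> k" for k P Q G N
    proof -
      define y where "y = 1 + N j"
      have N0: "N i \<ge> 0" for i using a by (simp add: admissible_def)
      have Ny: "N i \<le> y" if "i \<le> j" for i
      proof -
        have "N i \<le> N j" using a that jk unfolding admissible_def by blast
        then show ?thesis by (simp add: y_def)
      qed
      have y1: "y \<ge> 1" using N0 by (simp add: y_def)
      have pwr: "y ^ a \<le> y ^ ?d" if "a \<le> 8 + d'" for a using y1 that by (intro power_increasing) auto
      have 1: "(N m)\<^sup>2 * (N 1)\<^sup>2 \<le> y ^ ?d" 
      proof -
        have "(N m)\<^sup>2 * (N 1)\<^sup>2 \<le> y\<^sup>2 * y\<^sup>2" using Ny N0 Suc by (intro mult_mono power_mono) auto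
        also have "\<dots> = y ^ 4" by (simp flip: power_add)
        finally show ?thesis using pwr[of 4] by simp
      qed
      have 2: "(N 0)\<^sup>2 * (N (Suc m))\<^sup>2 \<le> y ^ ?d"
      proof -
        have "(N 0)\<^sup>2 * (N (Suc m))\<^sup>2 \<le> y\<^sup>2 * y\<^sup>2" using Ny N0 Suc by (intro mult_mono power_mono) auto
        also have "\<dots> = y ^ 4" by (simp flip: power_add)
        finally show ?thesis using pwr[of 4] by simp
      qed
      have 3: "(N 1)\<^sup>2 * (N m)\<^sup>2 * N 0 ^ 4 \<le> y ^ ?d"
      proof -
        have "(N 1)\<^sup>2 * (N m)\<^sup>2 * N 0 ^ 4 \<le> y\<^sup>2 * y\<^sup>2 * y ^ 4" using Ny N0 Suc by (intro mult_mono power_mono) auto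
        also have "\<dots> = y ^ 8" by (simp flip: power_add)
        finally show ?thesis using pwr[of 8] by simp
      qed
      have T: "(if m = 0 then 0 else ennreal (C * N 1 ^ 4) * nn2 (pw m (nm G))) \<le> ennreal (C * C' * y ^ ?d)"
      proof (cases "m = 0")
        case False
        have "nn2 (pw m (nm G)) \<le> ennreal (C' * (1 + N (m - 1)) ^ d')" using C'(2) False a jk Suc by auto
        then have "ennreal (C * N 1 ^ 4) * nn2 (pw m (nm G)) \<le> ennreal (C * N 1 ^ 4) * ennreal (C' * (1 + N (m - 1)) ^ d')" by (rule mult_left_mono) simp
        also have "\<dots> = ennreal (C * C' * (N 1 ^ 4 * (1 + N (m - 1)) ^ d'))" using C C' N0 by (simp add: ennreal_mult[symmetric] mult_ac)
        also have "\<dots> \<le> ennreal (C * C' * y ^ ?d)"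
        proof (intro ennreal_leI mult_left_mono)
          have "N (m - 1) \<le> N j" using a jk Suc unfolding admissible_def by auto
          then have "N 1 ^ 4 * (1 + N (m - 1)) ^ d' \<le> y ^ 4 * y ^ d'" using Ny[of 1] N0 Suc y1 by (intro mult_mono power_mono) (auto simp: y_def)
          also have "\<dots> = y ^ (4 + d')" by (simp add: power_add)
          finally show "N 1 ^ 4 * (1 + N (m - 1)) ^ d' \<le> y ^ ?d" using pwr[of "4 + d'"] by simp
        qed (use C C' in auto)
        finally show ?thesis using False by simp
      qed simp
      have "nn2 (pw (Suc j) (nm G)) \<le> ennreal (C * ((N m)\<^sup>2 * (N 1)\<^sup>2 + (N 0)\<^sup>2 * (N (Suc m))\<^sup>2 + (N 1)\<^sup>2 * (N m)\<^sup>2 * N 0 ^ 4))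
        + (if m = 0 then 0 else ennreal (C * N 1 ^ 4) * nn2 (pw m (nm G)))"
        using C(2)[OF a] Suc jk by simp
      also have "\<dots> \<le> ennreal (C * (3 * y ^ ?d)) + ennreal (C * C' * y ^ ?d)"
        using 1 2 3 C(1) by (intro add_mono T ennreal_leI mult_left_mono) auto
      also have "\<dots> = ennreal (?C * y ^ ?d)" using C C' y1 by (subst ennreal_plus[symmetric]) (auto simp: algebra_simps)
      finally show ?thesis unfolding y_def .
    qed
    moreover have "?C \<ge> 0" using C C' by simp
    ultimately show ?thesis by blast
  qed
qed

section \<open>The main estimate\<close>

text \<open>The constant \<kappa> is fixed before any function is introduced, hence is uniform in
  time and in \<phi>; this is what allows \<gamma> and \<eta> to be chosen in advance. The lemma
  translates the hypotheses at one time \<open>t\<close> into \<open>admissible\<close>.\<close>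

lemma admissible_slice:
  assumes s: "s > 1" and \<theta>: "\<theta> > 1/2"
  obtains \<kappa> where "\<kappa> \<ge> 0" "\<And>k \<phi> d\<phi> \<Phi> A G t. k \<ge> 1 \<Longrightarrow> is_FT (\<lambda>(t, x). \<phi> t x) \<Phi> \<Longrightarrow> calH_mem s \<theta> (LamFT (real k) \<Phi>) \<Longrightarrow>
     L2_time_deriv \<phi> d\<phi> \<Longrightarrow> Hdot1 A G \<Longrightarrow> weak_A0_eq A (\<phi> t) (d\<phi> t) \<Longrightarrow>
     \<exists>P Q. admissible s \<kappa> k P Q G (\<lambda>j. calH_norm s \<theta> (LamFT (real j) \<Phi>))"
proof -
  obtain K where K: "K < \<infinity>" "\<And>a U. U \<in> borel_measurable (lborel \<Otimes>\<^sub>M lborel) \<Longrightarrow>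
     (\<integral>\<^sup>+\<xi>. (ennreal (symL a \<xi>) * (\<integral>\<^sup>+\<tau>. nm U (\<tau>, \<xi>) \<partial>lborel))\<^sup>2 \<partial>lborel) \<le> K * nn2 (nm (Hw a \<theta> U))"
    using slice_bound[OF \<theta>] by blast
  obtain K' where K': "K = ennreal K'" "K' \<ge> 0" using K(1) by (cases K) auto
  let ?c = "fconst TYPE(real)"
  \<comment> \<open>The constant of the trace bound, times the normalisation of the inverse
    transform in time, squared because \<open>wn\<close> is a squared norm.\<close>
  define \<kappa> where "\<kappa> = ?c\<^sup>2 * K'"
  have \<kappa>0: "\<kappa> \<ge> 0" using K' by (simp add: \<kappa>_def)
  have main: "\<exists>P Q. admissible s \<kappa> k P Q G (\<lambda>j. calH_norm s \<theta> (LamFT (real j) \<Phi>))"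
    if k: "k \<ge> 1" and FT: "is_FT (\<lambda>(t, x). \<phi> t x) \<Phi>" and mem: "calH_mem s \<theta> (LamFT (real k) \<Phi>)"
      and D: "L2_time_deriv \<phi> d\<phi>" and H: "Hdot1 A G" and W: "weak_A0_eq A (\<phi> t) (d\<phi> t)" for k \<phi> d\<phi> \<Phi> A G t
  proof -
    let ?N = "\<lambda>j. calH_norm s \<theta> (LamFT (real j) \<Phi>)"
    have \<Phi>m[measurable]: "\<Phi> \<in> borel_measurable (lborel \<Otimes>\<^sub>M lborel)" using FT by (auto simp: is_FT_def sq_int_def lborel_prod)
    have dm[measurable]: "dtFT \<Phi> \<in> borel_measurable (lborel \<Otimes>\<^sub>M lborel)" unfolding dtFT_def by measurable
    have sqk: "sq_int (Hw (s + real k) \<theta> \<Phi>)" "sq_int (Hw (s - 1 + real k) \<theta> (dtFT \<Phi>))"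
      using mem by (simp_all add: calH_mem_def Hw_LamFT Hw_dtFT_LamFT)
    have sqa: "sq_int (Hw a \<theta> U)" if "a \<le> b" "sq_int (Hw b \<theta> U)" "U \<in> borel_measurable (lborel \<Otimes>\<^sub>M lborel)" for a b U
      using le_less_trans[OF nn2_Hw_mono[OF that(1), of \<theta> U]] that(2) measurable_Hw[OF that(3), of a \<theta>]
      by (simp add: sq_int_nm_iff nn2_def lborel_prod)
    have sqj: "sq_int (Hw (s + real j) \<theta> \<Phi>)" "sq_int (Hw (s - 1 + real j) \<theta> (dtFT \<Phi>))" if "j \<le> k" for j
      using that by (auto intro: sqa[OF _ sqk(1) \<Phi>m] sqa[OF _ sqk(2) dm])
    have N_eq: "?N j = L2norm (Hw (s + real j) \<theta> \<Phi>) + L2norm (Hw (s - 1 + real j) \<theta> (dtFT \<Phi>))" for j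
      by (simp add: calH_norm_def Hw_LamFT Hw_dtFT_LamFT)
    have N0: "0 \<le> ?N j" for j unfolding N_eq by simp
    have L2mono: "L2norm (Hw a \<theta> U) \<le> L2norm (Hw b \<theta> U)" if "a \<le> b" "sq_int (Hw a \<theta> U)" "sq_int (Hw b \<theta> U)" for a b U
    proof -
      have "(L2norm (Hw a \<theta> U))\<^sup>2 \<le> (L2norm (Hw b \<theta> U))\<^sup>2"
        using nn2_Hw_mono[OF that(1), of \<theta> U] by (simp add: nn2_L2norm that ennreal_le_iff)
      then show ?thesis by (rule power2_le_imp_le) simp
    qed
    have Nmono: "?N i \<le> ?N j" if "i \<le> j" "j \<le> k" for i j
      unfolding N_eq using that by (intro add_mono L2mono sqj) auto
    \<comment> \<open>The trace bound at index 0 gives the finiteness that \<open>time_slice\<close>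
      asks for. It is available for the time derivative as well, because s - 1 + k is
      nonnegative.\<close>
    have f0: "(\<integral>\<^sup>+\<xi>. (\<integral>\<^sup>+\<tau>. nm \<Phi> (\<tau>, \<xi>) \<partial>lborel)\<^sup>2 \<partial>lborel) < \<infinity>"
    proof -
      have "sq_int (Hw 0 \<theta> \<Phi>)" using s by (intro sqa[OF _ sqk(1) \<Phi>m]) auto
      then have "K * nn2 (nm (Hw 0 \<theta> \<Phi>)) < \<infinity>" using K(1) by (simp add: sq_int_nm_iff nn2_def ennreal_mult_less_top)
      with K(2)[OF \<Phi>m, of 0] show ?thesis by (simp add: le_less_trans)
    qed
    have f1: "(\<integral>\<^sup>+\<xi>. (\<integral>\<^sup>+\<tau>. nm (dtFT \<Phi>) (\<tau>, \<xi>) \<partial>lborel)\<^sup>2 \<partial>lborel) < \<infinity>"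
    proof -
      have "sq_int (Hw 0 \<theta> (dtFT \<Phi>))" using s by (intro sqa[OF _ sqk(2) dm]) auto
      then have "K * nn2 (nm (Hw 0 \<theta> (dtFT \<Phi>))) < \<infinity>" using K(1) by (simp add: sq_int_nm_iff nn2_def ennreal_mult_less_top)
      with K(2)[OF dm, of 0] show ?thesis by (simp add: le_less_trans)
    qed
    define P where "P \<xi> = ifourier (\<lambda>\<tau>. \<Phi> (\<tau>, \<xi>)) t" for \<xi>
    define Q where "Q \<xi> = ifourier (\<lambda>\<tau>. dtFT \<Phi> (\<tau>, \<xi>)) t" for \<xi>
    have FTP: "is_FT (\<phi> t) P" and FTQ: "is_FT (d\<phi> t) Q"
      using time_slice[OF FT D f0 f1, of t] by (simp_all add: P_def[abs_def] Q_def[abs_def])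
    have sqQ: "sq_int Q" and sqP: "sq_int P" using FTQ FTP by (auto simp: is_FT_def)
    then have [measurable]: "P \<in> borel_measurable borel" "Q \<in> borel_measurable borel" by (auto simp: sq_int_def)
    have wb: "wn a (nm (\<lambda>\<xi>. ifourier (\<lambda>\<tau>. U (\<tau>, \<xi>)) t)) \<le> ennreal \<kappa> * nn2 (nm (Hw a \<theta> U))"
      if Um[measurable]: "U \<in> borel_measurable (lborel \<Otimes>\<^sub>M lborel)" for a U
    proof -
      let ?I = "\<lambda>\<xi>. \<integral>\<^sup>+\<tau>. nm U (\<tau>, \<xi>) \<partial>lborel"
      have "wn a (nm (\<lambda>\<xi>. ifourier (\<lambda>\<tau>. U (\<tau>, \<xi>)) t)) \<le> (\<integral>\<^sup>+\<xi>. (ennreal (symL a \<xi>) * (ennreal ?c * ?I \<xi>))\<^sup>2 \<partial>lborel)"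
        unfolding wn_def nn2_def by (intro nn_integral_mono power_mono mult_left_mono nm_partial_ifourier_le) auto
      also have "\<dots> = (\<integral>\<^sup>+\<xi>. (ennreal ?c)\<^sup>2 * (ennreal (symL a \<xi>) * ?I \<xi>)\<^sup>2 \<partial>lborel)"
        by (simp only: power_mult_distrib mult_ac)
      also have "\<dots> = (ennreal ?c)\<^sup>2 * (\<integral>\<^sup>+\<xi>. (ennreal (symL a \<xi>) * ?I \<xi>)\<^sup>2 \<partial>lborel)"
        by (rule nn_integral_cmult) measurable
      also have "\<dots> \<le> (ennreal ?c)\<^sup>2 * (K * nn2 (nm (Hw a \<theta> U)))" by (intro mult_left_mono K(2) Um) simp
      also have "\<dots> = ennreal \<kappa> * nn2 (nm (Hw a \<theta> U))"
        using K' by (simp add: \<kappa>_def ennreal_mult ennreal_power mult.assoc)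
      finally show ?thesis .
    qed
    have bP: "wn (s + real j) (nm P) \<le> ennreal (\<kappa> * (?N j)\<^sup>2)" if "j \<le> k" for j
    proof -
      have "wn (s + real j) (nm P) \<le> ennreal \<kappa> * ennreal ((L2norm (Hw (s + real j) \<theta> \<Phi>))\<^sup>2)"
        using wb[OF \<Phi>m, of "s + real j"] nn2_L2norm[OF sqj(1)[OF that]] by (simp add: P_def[abs_def])
      also have "\<dots> \<le> ennreal \<kappa> * ennreal ((?N j)\<^sup>2)" unfolding N_eq by (intro mult_left_mono ennreal_leI power_mono) auto
      finally show ?thesis using \<kappa>0 by (simp add: ennreal_mult)
    qed
    have bQ: "wn (s - 1 + real j) (nm Q) \<le> ennreal (\<kappa> * (?N j)\<^sup>2)" if "j \<le> k" for j
    proof -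
      have "wn (s - 1 + real j) (nm Q) \<le> ennreal \<kappa> * ennreal ((L2norm (Hw (s - 1 + real j) \<theta> (dtFT \<Phi>)))\<^sup>2)"
        using wb[OF dm, of "s - 1 + real j"] nn2_L2norm[OF sqj(2)[OF that]] by (simp add: Q_def[abs_def])
      also have "\<dots> \<le> ennreal \<kappa> * ennreal ((?N j)\<^sup>2)" unfolding N_eq by (intro mult_left_mono ennreal_leI power_mono) auto
      finally show ?thesis using \<kappa>0 by (simp add: ennreal_mult)
    qed
    \<comment> \<open>Here k \<ge> 1 is used: the norm of index 1 controls \<open>P\<close> at
      regularity s + 1 > 2.\<close>
    have Pint: "integrable lborel P"
    proof -
      have "s + 1 > 2" using s by simp
      then obtain K3 where K3: "K3 < \<infinity>" "\<And>f. f \<in> borel_measurable borel \<Longrightarrow> (\<integral>\<^sup>+\<xi>. f \<xi> \<partial>lborel)\<^sup>2 \<le> K3 * wn (s + 1) f"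
        using L1_bound by blast
      have "(\<integral>\<^sup>+\<xi>. nm P \<xi> \<partial>lborel)\<^sup>2 \<le> K3 * wn (s + 1) (nm P)" by (rule K3(2)) measurable
      also have "\<dots> < \<infinity>" using K3(1) le_less_trans[OF bP[of 1]] k by (simp add: ennreal_mult_less_top)
      finally show ?thesis by (simp add: integrable_nm_iff power_less_top_ennreal)
    qed
    have Gm[measurable]: "G \<in> borel_measurable borel" using H by (simp add: Hdot1_def)
    have hG: "hn (nm G) < \<infinity>"
      using H by (simp add: Hdot1_def sq_int_nm_iff hn_def nn2_def norm_mult ennreal_mult)
    have fin: "(\<integral>\<^sup>+\<xi>. (nconv (nm P) (nm G) \<xi>)\<^sup>2 \<partial>lborel) < \<infinity>"
    proof -
      obtain K2 where K2: "K2 < \<infinity>" "\<And>f g. f \<in> borel_measurable borel \<Longrightarrow> g \<in> borel_measurable borel \<Longrightarrow> nn2 (nconv f g) \<le> K2 * (wn s f * hn g)"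
        using nconv_bilinear_sh[OF s] by blast
      have "nn2 (nconv (nm P) (nm G)) \<le> K2 * (wn s (nm P) * hn (nm G))" by (rule K2(2)) measurable
      also have "\<dots> < \<infinity>" using K2(1) hG le_less_trans[OF bP[of 0]] by (simp add: ennreal_mult_less_top)
      finally show ?thesis by (simp add: nn2_def)
    qed
    have sq: "sq_int (\<phi> t)" "sq_int (d\<phi> t)" using D by (auto simp: L2_time_deriv_def)
    have "elliptic_rel P Q G"
      unfolding elliptic_rel_def
      by (rule elliptic_identity[OF FTP FTQ Pint sq H W local_L1_bound[OF Gm hG] fin])
    then have "admissible s \<kappa> k P Q G ?N"
      unfolding admissible_def using Pint sqQ Gm hG N0 Nmono bP bQ by blast
    then show ?thesis by blast
  qed
  show ?thesis using \<kappa>0 main by (rule that)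
qed

lemma mi_pow_le: "\<bar>mi_pow \<xi> \<alpha>\<bar> \<le> norm \<xi> ^ mi_abs \<alpha>"
proof -
  have "\<bar>mi_pow \<xi> \<alpha>\<bar> = (\<Prod>i\<in>UNIV. \<bar>\<xi> $ i\<bar> ^ \<alpha> i)" by (simp add: mi_pow_def abs_prod power_abs)
  also have "\<dots> \<le> (\<Prod>i\<in>UNIV. norm \<xi> ^ \<alpha> i)"
    by (intro prod_mono conjI power_mono component_le_norm_cart) auto
  also have "\<dots> = norm \<xi> ^ mi_abs \<alpha>" by (simp add: mi_abs_def power_sum)
  finally show ?thesis .
qed

lemma measurable_mi_pow [measurable]: "(\<lambda>\<xi>. mi_pow \<xi> \<alpha>) \<in> borel_measurable borel"
  unfolding mi_pow_def by (intro borel_measurable_continuous_onI continuous_intros)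

text \<open>Every power |\<xi>|^j with j \<le> k is at most 1 + |\<xi>|^k, so the energy and the top
  order together control all multi-indices.\<close>

lemma nn2_Hdot1w_dxFT_le:
  assumes [measurable]: "G \<in> borel_measurable borel" and \<alpha>: "mi_abs \<alpha> \<le> k"
  shows "nn2 (nm (Hdot1w (dxFT \<alpha> G))) \<le> 2 * (nn2 (pw 1 (nm G)) + nn2 (pw (Suc k) (nm G)))"
proof -
  have "nn2 (nm (Hdot1w (dxFT \<alpha> G))) \<le> nn2 (\<lambda>\<xi>. pw 1 (nm G) \<xi> + pw (Suc k) (nm G) \<xi>)"
    unfolding nn2_def
  proof (intro nn_integral_mono power_mono)
    fix \<xi> :: "real^4"
    have "norm \<xi> ^ mi_abs \<alpha> \<le> 1 + norm \<xi> ^ k"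
    proof (cases "norm \<xi> \<le> 1")
      case True
      then have "norm \<xi> ^ mi_abs \<alpha> \<le> 1" by (intro power_le_one) auto
      then show ?thesis by (simp add: add_increasing2)
    next
      case False
      then have "norm \<xi> ^ mi_abs \<alpha> \<le> norm \<xi> ^ k" using \<alpha> by (intro power_increasing) auto
      then show ?thesis by simp
    qed
    then have m: "\<bar>mi_pow \<xi> \<alpha>\<bar> \<le> 1 + norm \<xi> ^ k" using mi_pow_le[of \<xi> \<alpha>] by linarith
    have "norm (Hdot1w (dxFT \<alpha> G) \<xi>) = norm \<xi> * norm (G \<xi>) * \<bar>mi_pow \<xi> \<alpha>\<bar>"
      by (simp add: Hdot1w_def dxFT_def norm_mult norm_power)
    also have "\<dots> \<le> norm \<xi> * norm (G \<xi>) * (1 + norm \<xi> ^ k)" by (intro mult_left_mono m) auto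
    also have "\<dots> = norm \<xi> ^ 1 * norm (G \<xi>) + norm \<xi> ^ Suc k * norm (G \<xi>)" by (simp add: algebra_simps)
    finally have "nm (Hdot1w (dxFT \<alpha> G)) \<xi> \<le> ennreal (norm \<xi> ^ 1 * norm (G \<xi>) + norm \<xi> ^ Suc k * norm (G \<xi>))" by (rule ennreal_leI)
    also have "\<dots> = pw 1 (nm G) \<xi> + pw (Suc k) (nm G) \<xi>"
      unfolding pw_def by (subst ennreal_plus) (auto simp: ennreal_mult)
    finally show "nm (Hdot1w (dxFT \<alpha> G)) \<xi> \<le> pw 1 (nm G) \<xi> + pw (Suc k) (nm G) \<xi>" .
  qed simp
  also have "\<dots> \<le> 2 * (nn2 (pw 1 (nm G)) + nn2 (pw (Suc k) (nm G)))" by (rule nn2_add_le) measurable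
  finally show ?thesis .
qed

theorem mainTheorem7:
  fixes s \<theta> :: real and k :: nat
  assumes "s > 1" and "\<theta> > 1 / 2" and "k \<ge> 1"
  shows "\<exists>\<gamma> \<eta> :: real \<Rightarrow> real. continuous_on UNIV \<gamma> \<and> continuous_on UNIV \<eta> \<and>
    (\<forall>(\<phi> :: real \<Rightarrow> real ^ 4 \<Rightarrow> complex) d\<phi> \<Phi> (A0 :: real \<Rightarrow> real ^ 4 \<Rightarrow> real) G.
       is_FT (\<lambda>(t, x). \<phi> t x) \<Phi> \<and>
       calH_mem s \<theta> (LamFT (real k) \<Phi>) \<and>
       L2_time_deriv \<phi> d\<phi> \<and>
       (\<forall>t. Hdot1 (A0 t) (G t) \<and> weak_A0_eq (A0 t) (\<phi> t) (d\<phi> t))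
       \<longrightarrow>
       (\<forall>\<alpha>. mi_abs \<alpha> \<le> k \<longrightarrow> (\<forall>t.
          sq_int (Hdot1w (dxFT \<alpha> (G t))) \<and>
          L2norm (Hdot1w (dxFT \<alpha> (G t)))
            \<le> \<gamma> (calH_norm s \<theta> \<Phi>) * calH_norm s \<theta> (LamFT (real k) \<Phi>)
              + \<eta> (calH_norm s \<theta> (LamFT (real k - 1) \<Phi>)))))"
proof -
  obtain m where k: "k = Suc m" using assms(3) by (cases k) auto
  obtain \<kappa> where \<kappa>: "\<kappa> \<ge> 0" "\<And>k \<phi> d\<phi> \<Phi> A G t. k \<ge> 1 \<Longrightarrow> is_FT (\<lambda>(t, x). \<phi> t x) \<Phi> \<Longrightarrow> calH_mem s \<theta> (LamFT (real k) \<Phi>) \<Longrightarrow>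
     L2_time_deriv \<phi> d\<phi> \<Longrightarrow> Hdot1 A G \<Longrightarrow> weak_A0_eq A (\<phi> t) (d\<phi> t) \<Longrightarrow>
     \<exists>P Q. admissible s \<kappa> k P Q G (\<lambda>j. calH_norm s \<theta> (LamFT (real j) \<Phi>))"
    using admissible_slice[OF assms(1,2)] by blast
  obtain C0 where C0: "C0 \<ge> 0" "\<And>k P Q G N. admissible s \<kappa> k P Q G N \<Longrightarrow> nn2 (pw 1 (nm G)) \<le> ennreal (C0 * N 0 ^ 4)"
    using admissible_energy[OF assms(1) \<kappa>(1)] by blast
  obtain C where C: "C \<ge> 0" "\<And>k P Q G N. admissible s \<kappa> k P Q G N \<Longrightarrow> Suc m \<le> k \<Longrightarrow>
     nn2 (pw (m + 2) (nm G)) \<le> ennreal (C * ((N m)\<^sup>2 * (N 1)\<^sup>2 + (N 0)\<^sup>2 * (N (Suc m))\<^sup>2 + (N 1)\<^sup>2 * (N m)\<^sup>2 * N 0 ^ 4))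
        + (if m = 0 then 0 else ennreal (C * N 1 ^ 4) * nn2 (pw m (nm G)))"
    using admissible_step[OF assms(1) \<kappa>(1), of m] by blast
  \<comment> \<open>\<open>Suc (m - 1)\<close> equals \<open>m\<close> only for m > 0, and the bound
    is applied in that case only.\<close>
  obtain C' d where C': "C' \<ge> 0" "\<And>k P Q G N. admissible s \<kappa> k P Q G N \<Longrightarrow> m - 1 \<le> k \<Longrightarrow> nn2 (pw (Suc (m - 1)) (nm G)) \<le> ennreal (C' * (1 + N (m - 1)) ^ d)"
    using admissible_poly_bound[OF assms(1) \<kappa>(1), of "m - 1"] by blast
  \<comment> \<open>\<open>g\<close> collects the coefficients of the squared top norm. The outer 2
    comes from \<open>nn2_Hdot1w_dxFT_le\<close> and C0 from the energy. The rest is dictated by m =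
    0, where \<open>N 1\<close> is the top norm and \<open>N m\<close> is \<open>N 0\<close>: both
    source terms give x^2, the cubic term x^6.\<close>
  define g where "g x = 2 * (C0 * x\<^sup>2 + C * (2 * x\<^sup>2 + x ^ 6))" for x :: real
  \<comment> \<open>For m > 0 one has N 1 \<le> N m, so everything except \<open>N (Suc m)\<close>
    is of lower order and goes into \<open>f\<close>; for m = 0 nothing is left. The absolute value
    keeps \<open>f\<close> nonnegative on the whole line, as needed for its square root.\<close>
  define f where "f y = (if m = 0 then 0 else 2 * (C * (y ^ 4 + y ^ 8) + C * y ^ 4 * (C' * (1 + \<bar>y\<bar>) ^ d)))" for y :: real
  have g0: "g x \<ge> 0" for x unfolding g_def using C0(1) C(1) by (intro mult_nonneg_nonneg add_nonneg_nonneg) auto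
  have f0: "f x \<ge> 0" for x unfolding f_def using C(1) C'(1) by (auto intro!: mult_nonneg_nonneg add_nonneg_nonneg)
  have cont: "continuous_on UNIV (\<lambda>x. sqrt (g x))" "continuous_on UNIV (\<lambda>x. sqrt (f x))"
    unfolding g_def f_def by (cases "m = 0"; auto intro!: continuous_intros)+
  have main: "sq_int (Hdot1w (dxFT \<alpha> G)) \<and> L2norm (Hdot1w (dxFT \<alpha> G)) \<le> sqrt (g (N 0)) * N k + sqrt (f (N m))"
    if a: "admissible s \<kappa> k P Q G N" and \<alpha>: "mi_abs \<alpha> \<le> k" for P Q G N \<alpha>
  proof -
    have Gm[measurable]: "G \<in> borel_measurable borel" using a by (simp add: admissible_def)
    have N0: "N j \<ge> 0" for j using a by (simp add: admissible_def)
    have Nm: "N i \<le> N j" if "i \<le> j" "j \<le> k" for i j using a that unfolding admissible_def by blast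
    define y where "y = N m"
    define R where "R = (N k)\<^sup>2 * (2 * C * (N 0)\<^sup>2 + C * N 0 ^ 6) + (if m = 0 then 0 else C * (y ^ 4 + y ^ 8) + C * y ^ 4 * (C' * (1 + y) ^ d))"
    have y0: "y \<ge> 0" using N0 by (simp add: y_def)
    have Ek: "nn2 (pw (Suc k) (nm G)) \<le> ennreal R"
    proof -
      let ?X = "(N m)\<^sup>2 * (N 1)\<^sup>2 + (N 0)\<^sup>2 * (N (Suc m))\<^sup>2 + (N 1)\<^sup>2 * (N m)\<^sup>2 * N 0 ^ 4"
      have e: "nn2 (pw (Suc k) (nm G)) \<le> ennreal (C * ?X) + (if m = 0 then 0 else ennreal (C * N 1 ^ 4) * nn2 (pw m (nm G)))"
        using C(2)[OF a] k by simp
      show ?thesis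
      proof (cases "m = 0")
        case True
        have "C * ?X = R" using True k by (simp add: R_def algebra_simps flip: power_add)
        then show ?thesis using e True by simp
      next
        case False
        have N1y: "N 1 \<le> y" "N 0 \<le> y" "N (m - 1) \<le> y" unfolding y_def using False k by (auto intro!: Nm)
        have T: "ennreal (C * N 1 ^ 4) * nn2 (pw m (nm G)) \<le> ennreal (C * y ^ 4 * (C' * (1 + y) ^ d))"
        proof -
          have "nn2 (pw m (nm G)) \<le> ennreal (C' * (1 + N (m - 1)) ^ d)" using C'(2)[OF a] False k by simp
          also have "\<dots> \<le> ennreal (C' * (1 + y) ^ d)" using C'(1) N1y N0 by (intro ennreal_leI mult_left_mono power_mono) auto
          finally have "ennreal (C * N 1 ^ 4) * nn2 (pw m (nm G)) \<le> ennreal (C * y ^ 4) * ennreal (C' * (1 + y) ^ d)"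
            using C(1) N1y N0 by (intro mult_mono ennreal_leI mult_left_mono power_mono) auto
          then show ?thesis using C(1) C'(1) y0 by (simp add: ennreal_mult)
        qed
        have "C * ?X \<le> (N k)\<^sup>2 * (2 * C * (N 0)\<^sup>2 + C * N 0 ^ 6) + C * (y ^ 4 + y ^ 8)"
        proof -
          have a1: "(N m)\<^sup>2 * (N 1)\<^sup>2 \<le> y ^ 4"
          proof -
            have "(N m)\<^sup>2 * (N 1)\<^sup>2 \<le> y\<^sup>2 * y\<^sup>2" using N1y N0 by (intro mult_mono power_mono) (auto simp: y_def)
            then show ?thesis by (simp flip: power_add)
          qed
          have a2: "(N 1)\<^sup>2 * (N m)\<^sup>2 * N 0 ^ 4 \<le> y ^ 8"
          proof -
            have "(N 1)\<^sup>2 * (N m)\<^sup>2 * N 0 ^ 4 \<le> y\<^sup>2 * y\<^sup>2 * y ^ 4" using N1y N0 by (intro mult_mono power_mono) (auto simp: y_def)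
            then show ?thesis by (simp flip: power_add)
          qed
          have "C * ?X \<le> C * (y ^ 4 + (N 0)\<^sup>2 * (N k)\<^sup>2 + y ^ 8)" using a1 a2 C(1) k by (intro mult_left_mono add_mono) auto
          also have "\<dots> = C * ((N 0)\<^sup>2 * (N k)\<^sup>2) + C * (y ^ 4 + y ^ 8)" by (simp add: algebra_simps)
          also have "C * ((N 0)\<^sup>2 * (N k)\<^sup>2) \<le> (N k)\<^sup>2 * (2 * C * (N 0)\<^sup>2 + C * N 0 ^ 6)"
          proof -
            have "C * (N 0)\<^sup>2 \<le> 2 * C * (N 0)\<^sup>2 + C * N 0 ^ 6" using C(1) N0 by (simp add: mult_nonneg_nonneg)
            from mult_left_mono[OF this, of "(N k)\<^sup>2"] show ?thesis by (simp add: mult_ac)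
          qed
          finally show ?thesis by simp
        qed
        then have "ennreal (C * ?X) \<le> ennreal ((N k)\<^sup>2 * (2 * C * (N 0)\<^sup>2 + C * N 0 ^ 6) + C * (y ^ 4 + y ^ 8))" by (rule ennreal_leI)
        with e T False have "nn2 (pw (Suc k) (nm G)) \<le> ennreal ((N k)\<^sup>2 * (2 * C * (N 0)\<^sup>2 + C * N 0 ^ 6) + C * (y ^ 4 + y ^ 8)) + ennreal (C * y ^ 4 * (C' * (1 + y) ^ d))"
          by (auto intro: order_trans add_mono)
        also have "\<dots> = ennreal R"
          using False C(1) C'(1) y0 N0 by (subst ennreal_plus[symmetric]) (auto simp: R_def intro!: add_nonneg_nonneg mult_nonneg_nonneg)
        finally show ?thesis .
      qed
    qed
    have R0: "R \<ge> 0" unfolding R_def using C(1) C'(1) y0 N0 by (auto intro!: add_nonneg_nonneg mult_nonneg_nonneg)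
    \<comment> \<open>N 0 \<le> N k trades two of the four powers for the top norm, so the energy
      contributes to \<gamma> and not to \<eta>.\<close>
    have E0: "nn2 (pw 1 (nm G)) \<le> ennreal (C0 * (N 0)\<^sup>2 * (N k)\<^sup>2)"
    proof -
      have "N 0 ^ 4 = (N 0)\<^sup>2 * (N 0)\<^sup>2" by (simp flip: power_add)
      also have "\<dots> \<le> (N 0)\<^sup>2 * (N k)\<^sup>2" using Nm[of 0 k] N0 by (intro mult_left_mono power_mono) auto
      finally have "C0 * N 0 ^ 4 \<le> C0 * ((N 0)\<^sup>2 * (N k)\<^sup>2)" using C0(1) by (rule mult_left_mono)
      then show ?thesis using order_trans[OF C0(2)[OF a] ennreal_leI] by (simp add: mult.assoc)
    qed
    have "nn2 (nm (Hdot1w (dxFT \<alpha> G))) \<le> 2 * (ennreal (C0 * (N 0)\<^sup>2 * (N k)\<^sup>2) + ennreal R)"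
      by (rule order_trans[OF nn2_Hdot1w_dxFT_le[OF Gm \<alpha>]]) (intro mult_left_mono add_mono E0 Ek, simp)
    also have "\<dots> = ennreal (2 * (C0 * (N 0)\<^sup>2 * (N k)\<^sup>2 + R))"
      using C0(1) R0 by (subst ennreal_plus[symmetric]) (auto simp: ennreal_mult)
    also have "2 * (C0 * (N 0)\<^sup>2 * (N k)\<^sup>2 + R) = (N k)\<^sup>2 * g (N 0) + f y"
      using y0 by (simp add: R_def g_def f_def algebra_simps)
    finally have L: "nn2 (nm (Hdot1w (dxFT \<alpha> G))) \<le> ennreal ((N k)\<^sup>2 * g (N 0) + f y)" .
    have Hm: "Hdot1w (dxFT \<alpha> G) \<in> borel_measurable borel" unfolding Hdot1w_def dxFT_def by measurable
    have sq: "sq_int (Hdot1w (dxFT \<alpha> G))"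
      using Hm le_less_trans[OF L] by (simp add: sq_int_nm_iff nn2_def)
    have "(L2norm (Hdot1w (dxFT \<alpha> G)))\<^sup>2 \<le> (N k)\<^sup>2 * g (N 0) + f y"
      using L g0 f0 unfolding nn2_L2norm[OF sq] by (subst (asm) ennreal_le_iff) auto
    then have "L2norm (Hdot1w (dxFT \<alpha> G)) \<le> sqrt ((N k)\<^sup>2 * g (N 0) + f y)" by (rule real_le_rsqrt)
    \<comment> \<open>Subadditivity of the square root separates the two parts and makes the top
      norm enter linearly.\<close>
    also have "\<dots> \<le> sqrt ((N k)\<^sup>2 * g (N 0)) + sqrt (f y)" using g0 f0 by (intro sqrt_add_le_add_sqrt) auto
    also have "\<dots> = sqrt (g (N 0)) * N k + sqrt (f y)" using N0 by (simp add: real_sqrt_mult)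
    finally show ?thesis using sq by (simp add: y_def)
  qed
  have Lam0: "LamFT 0 \<Phi> = \<Phi>" for \<Phi> by (rule ext) (auto simp: LamFT_def)
  show ?thesis
  proof (rule exI[of _ "\<lambda>x. sqrt (g x)"], rule exI[of _ "\<lambda>x. sqrt (f x)"], intro conjI cont allI impI)
    fix \<phi> :: "real \<Rightarrow> real ^ 4 \<Rightarrow> complex" and d\<phi> \<Phi> and A0 :: "real \<Rightarrow> real ^ 4 \<Rightarrow> real" and G and \<alpha> :: "4 \<Rightarrow> nat" and t
    assume h: "is_FT (\<lambda>(t, x). \<phi> t x) \<Phi> \<and> calH_mem s \<theta> (LamFT (real k) \<Phi>) \<and> L2_time_deriv \<phi> d\<phi> \<and>
       (\<forall>t. Hdot1 (A0 t) (G t) \<and> weak_A0_eq (A0 t) (\<phi> t) (d\<phi> t))" and \<alpha>: "mi_abs \<alpha> \<le> k"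
    obtain P Q where a: "admissible s \<kappa> k P Q (G t) (\<lambda>j. calH_norm s \<theta> (LamFT (real j) \<Phi>))"
      using \<kappa>(2)[OF assms(3), of \<phi> \<Phi> d\<phi> "A0 t" "G t" t] h by blast
    have km: "real k - 1 = real m" by (simp add: k)
    show "sq_int (Hdot1w (dxFT \<alpha> (G t)))" using main[OF a \<alpha>] by blast
    show "L2norm (Hdot1w (dxFT \<alpha> (G t))) \<le> sqrt (g (calH_norm s \<theta> \<Phi>)) * calH_norm s \<theta> (LamFT (real k) \<Phi>) + sqrt (f (calH_norm s \<theta> (LamFT (real k - 1) \<Phi>)))"
      using main[OF a \<alpha>] unfolding km by (simp add: Lam0)
  qed
qed

end
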